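(* Let $K$ be a field, $\Gamma$ a finite graph, $L=L_\Gamma$ the associated right angled Artin Lie algebra over $K$, $n\ge 0$ an integer, and $M$ an ideal of $L$ of codimension $k$ with $[L,L]\subseteq M$. Let $X$ be the set of all (possibly empty) subsets of $V(\Gamma)$ which generate complete subgraphs and let $Y\subseteq X$ be the set of those $A\in X$ such that $M\cap L_A$ has codimension $k$ in $L_A$. Assume that $\mathrm{lk}_{|Y|}(Z)$ is $(n-i-1)$-acyclic over $K$ for every $Z\in X\setminus Y$, where $i=|Z|$. Then $M$ is of type $FP_n$.
   Context: Graphs have no loops and no multiple edges. $L_\Gamma$ is the Lie algebra over $K$ with generators the vertices $V(\Gamma)$ and relations $[v,w]=0$ whenever $v,w$ are joined by an edge (it is isomorphic to $\mathrm{gr}(G_\Gamma)\otimes_{\mathbb Z}K$, with $G_\Gamma$ the right angled Artin group). For $A\subseteq V(\Gamma)$, $L_A$ is the Lie subalgebra of $L_\Gamma$ generated by $A$. $X$ and $Y$ are posets under inclusion; for such a poset $H$ of subsets, $|H|$ is its simplicial realization, whose $k$-simplices are the chains $A_0\subset A_1\subset\dots\subset A_k$ of elements of $H$ (strict inclusions). For $Z\in X\setminus Y$, $\mathrm{lk}_{|Y|}(Z)$ is the subcomplex of $|Y|$ consisting of the chains $A_0\subset\dots\subset A_k$ in $Y$ such that $Z\subset A_0$. A complex $W$ is $m$-acyclic over $K$ if its reduced homology $\tilde H_i(W,K)$ vanishes for all $i\le m$; here $\tilde H_{-1}(W,K)=0$ iff $W\ne\emptyset$, and for $m\le-2$ the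 condition is vacuous. A Lie algebra $N$ over $K$ is of type $FP_n$ if the trivial $U(N)$-module $K$ has a projective resolution in which all projectives in dimensions $\le n$ are finitely generated. *)

theory Defs
  imports
    "HOL-Library.Poly_Mapping"
    "HOL-Library.FuncSet"
    "Graph_Theory.Pair_Digraph"
    "HOL-Algebra.QuotRing"
    "HOL-Algebra.Module"
begin

section \<open>Lie algebras over a field\<close>

text \<open>The bracket is alternating, which is stronger than antisymmetric in characteristic 2.\<close>

locale lie_algebra = vector_space scale
  for scale :: "'k::field \<Rightarrow> 'l::ab_group_add \<Rightarrow> 'l" +
  fixes bracket :: "'l \<Rightarrow> 'l \<Rightarrow> 'l"
  assumes bracket_add_left: "bracket (x + y) z = bracket x z + bracket y z"
    and bracket_add_right: "bracket x (y + z) = bracket x y + bracket x z"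
    and bracket_scale_left: "bracket (scale c x) y = scale c (bracket x y)"
    and bracket_scale_right: "bracket x (scale c y) = scale c (bracket x y)"
    and bracket_self: "bracket x x = 0"
    and jacobi: "bracket x (bracket y z) + bracket y (bracket z x) + bracket z (bracket x y) = 0"
begin

definition lie_subalgebra :: "'l set \<Rightarrow> bool" where
  "lie_subalgebra N \<longleftrightarrow> subspace N \<and> (\<forall>x\<in>N. \<forall>y\<in>N. bracket x y \<in> N)"

definition lie_ideal :: "'l set \<Rightarrow> bool" where
  "lie_ideal N \<longleftrightarrow> subspace N \<and> (\<forall>x. \<forall>y\<in>N. bracket x y \<in> N)"

definition generated_subalgebra :: "'l set \<Rightarrow> 'l set" where
  "generated_subalgebra S = \<Inter>{N. lie_subalgebra N \<and> S \<subseteq> N}"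

definition derived_subalgebra :: "'l set" where
  "derived_subalgebra = span {bracket x y | x y. True}"

text \<open>The dimension of \<open>N / W\<close> is \<open>d\<close>: the classes modulo \<open>W\<close> of some \<open>d\<close> elements of \<open>N\<close>
  form a basis of \<open>N / W\<close>.\<close>

definition has_codim :: "'l set \<Rightarrow> 'l set \<Rightarrow> nat \<Rightarrow> bool" where
  "has_codim N W d \<longleftrightarrow> W \<subseteq> N \<and>
     (\<exists>B. finite B \<and> card B = d \<and> B \<subseteq> N \<and>
       (\<forall>x\<in>N. \<exists>!c. c \<in> B \<rightarrow>\<^sub>E (UNIV :: 'k set) \<and> x - (\<Sum>b\<in>B. scale (c b) b) \<in> W))"

end


section \<open>The right angled Artin Lie algebra of a graph\<close>

text \<open>The bilinear extension of a binary operation on basis elements.\<close>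

definition bilinear_ext ::
    "('a \<Rightarrow> 'a \<Rightarrow> 'a) \<Rightarrow> ('a \<Rightarrow>\<^sub>0 'k::comm_ring_1) \<Rightarrow> ('a \<Rightarrow>\<^sub>0 'k) \<Rightarrow> ('a \<Rightarrow>\<^sub>0 'k)" where
  "bilinear_ext f p q =
     (\<Sum>s\<in>Poly_Mapping.keys p. \<Sum>t\<in>Poly_Mapping.keys q. Poly_Mapping.single (f s t) (Poly_Mapping.lookup p s * Poly_Mapping.lookup q t))"

datatype (letters: 'v) lie_word = Gen 'v | Br "'v lie_word" "'v lie_word"

text \<open>The free non-associative algebra on \<open>V\<close>; its multiplication is \<open>bilinear_ext Br\<close>.\<close>

definition free_nonassoc :: "'v set \<Rightarrow> ('v lie_word \<Rightarrow>\<^sub>0 'k::comm_ring_1) set" where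
  "free_nonassoc V = {p. \<forall>t\<in>Poly_Mapping.keys p. letters t \<subseteq> V}"

text \<open>The two-sided ideal of the free non-associative algebra on the vertices that is generated by
  the axioms of a Lie algebra and the defining relations \<open>[v,w] = 0\<close> for adjacent \<open>v\<close>, \<open>w\<close>.\<close>

inductive_set raag_relations :: "'v pair_pre_digraph \<Rightarrow> ('v lie_word \<Rightarrow>\<^sub>0 'k::comm_ring_1) set"
  for G :: "'v pair_pre_digraph" where
  alternating: "p \<in> free_nonassoc (pverts G) \<Longrightarrow> bilinear_ext Br p p \<in> raag_relations G"
| jacobi: "\<lbrakk>p \<in> free_nonassoc (pverts G); q \<in> free_nonassoc (pverts G); r \<in> free_nonassoc (pverts G)\<rbrakk>
    \<Longrightarrow> bilinear_ext Br p (bilinear_ext Br q r) + bilinear_ext Br q (bilinear_ext Br r p)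
        + bilinear_ext Br r (bilinear_ext Br p q) \<in> raag_relations G"
| edge: "(v, w) \<in> parcs G \<Longrightarrow> Poly_Mapping.single (Br (Gen v) (Gen w)) 1 \<in> raag_relations G"
| zero: "0 \<in> raag_relations G"
| add: "\<lbrakk>p \<in> raag_relations G; q \<in> raag_relations G\<rbrakk> \<Longrightarrow> p + q \<in> raag_relations G"
| scale: "p \<in> raag_relations G \<Longrightarrow> Poly_Mapping.map ((*) c) p \<in> raag_relations G"
| left: "\<lbrakk>p \<in> free_nonassoc (pverts G); q \<in> raag_relations G\<rbrakk>
    \<Longrightarrow> bilinear_ext Br p q \<in> raag_relations G"
| right: "\<lbrakk>p \<in> raag_relations G; q \<in> free_nonassoc (pverts G)\<rbrakk>
    \<Longrightarrow> bilinear_ext Br p q \<in> raag_relations G"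

primrec eval_word :: "('l \<Rightarrow> 'l \<Rightarrow> 'l) \<Rightarrow> ('v \<Rightarrow> 'l) \<Rightarrow> 'v lie_word \<Rightarrow> 'l" where
  "eval_word br \<iota> (Gen v) = \<iota> v"
| "eval_word br \<iota> (Br s t) = br (eval_word br \<iota> s) (eval_word br \<iota> t)"

definition eval_nonassoc ::
    "('k::field \<Rightarrow> 'l::ab_group_add \<Rightarrow> 'l) \<Rightarrow> ('l \<Rightarrow> 'l \<Rightarrow> 'l) \<Rightarrow> ('v \<Rightarrow> 'l) \<Rightarrow>
     ('v lie_word \<Rightarrow>\<^sub>0 'k) \<Rightarrow> 'l" where
  "eval_nonassoc scale br \<iota> p = (\<Sum>t\<in>Poly_Mapping.keys p. scale (Poly_Mapping.lookup p t) (eval_word br \<iota> t))"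

text \<open>The Lie algebra presented by generators \<open>\<iota> v\<close>, for \<open>v\<close> a vertex of \<open>G\<close>, and relations
  \<open>[\<iota> v, \<iota> w] = 0\<close> for adjacent \<open>v\<close>, \<open>w\<close>: the evaluation homomorphism from the free non-associative
  algebra on the vertices is onto and its kernel is the ideal of relations, i.e. it induces an
  isomorphism from the quotient by that ideal.\<close>

locale raag_lie_algebra = lie_algebra scale bracket + pair_graph G
  for scale :: "'k::field \<Rightarrow> 'l::ab_group_add \<Rightarrow> 'l"
    and bracket :: "'l \<Rightarrow> 'l \<Rightarrow> 'l"
    and G :: "'v pair_pre_digraph" +
  fixes \<iota> :: "'v \<Rightarrow> 'l"
  assumes presentation_onto:
      "eval_nonassoc scale bracket \<iota> ` free_nonassoc (pverts G) = UNIV"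
    and presentation_kernel:
      "{p \<in> free_nonassoc (pverts G). eval_nonassoc scale bracket \<iota> p = 0} = raag_relations G"


section \<open>The universal enveloping algebra\<close>

definition free_assoc :: "'l set \<Rightarrow> ('l list \<Rightarrow>\<^sub>0 'k::comm_ring_1) ring" where
  "free_assoc N = \<lparr>carrier = {p. Poly_Mapping.keys p \<subseteq> lists N}, mult = bilinear_ext (@),
     one = Poly_Mapping.single [] 1, zero = 0, add = (+)\<rparr>"

text \<open>The first two families of relations make \<open>x \<mapsto> [x]\<close> linear on \<open>N\<close> and turn the free associative
  algebra on the set \<open>N\<close> into the tensor algebra of the vector space \<open>N\<close>.\<close>

definition enveloping_relations ::
    "('k::field \<Rightarrow> 'l::ab_group_add \<Rightarrow> 'l) \<Rightarrow> ('l \<Rightarrow> 'l \<Rightarrow> 'l) \<Rightarrow> 'l set \<Rightarrow> ('l list \<Rightarrow>\<^sub>0 'k) set" where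
  "enveloping_relations scale br N =
     {Poly_Mapping.single [x + y] 1 - Poly_Mapping.single [x] 1 - Poly_Mapping.single [y] 1
        | x y. x \<in> N \<and> y \<in> N} \<union>
     {Poly_Mapping.single [scale c x] 1 - Poly_Mapping.single [x] c | c x. x \<in> N} \<union>
     {Poly_Mapping.single [x, y] 1 - Poly_Mapping.single [y, x] 1 - Poly_Mapping.single [br x y] 1
        | x y. x \<in> N \<and> y \<in> N}"

definition enveloping_algebra ::
    "('k::field \<Rightarrow> 'l::ab_group_add \<Rightarrow> 'l) \<Rightarrow> ('l \<Rightarrow> 'l \<Rightarrow> 'l) \<Rightarrow> 'l set \<Rightarrow> ('l list \<Rightarrow>\<^sub>0 'k) set ring" where
  "enveloping_algebra scale br N =
     free_assoc N Quot (genideal (free_assoc N) (enveloping_relations scale br N))"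

text \<open>The trivial module \<open>K\<close> over the enveloping algebra. A residue class acts as multiplication by
  the common constant coefficient of its representatives, so \<open>N\<close> acts as zero and the unit as the
  identity. The record fields \<open>mult\<close> and \<open>one\<close> play no role for modules.\<close>

definition trivial_module :: "(('l list \<Rightarrow>\<^sub>0 'k::field) set, 'k) module" where
  "trivial_module = \<lparr>carrier = UNIV, mult = undefined, one = undefined, zero = 0, add = (+),
     smult = (\<lambda>u a. the_elem ((\<lambda>p. Poly_Mapping.lookup p []) ` u) * a)\<rparr>"


section \<open>Left modules over a ring and finiteness type\<close>

text \<open>The library locale \<open>module\<close> is restricted to commutative rings.\<close>

locale left_module = R?: ring R + M?: abelian_group M
  for R :: "('r, 's) ring_scheme" (structure) and M :: "('r, 'm, 't) module_scheme" (structure) +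
  assumes smult_closed: "\<lbrakk>a \<in> carrier R; x \<in> carrier M\<rbrakk> \<Longrightarrow> a \<odot>\<^bsub>M\<^esub> x \<in> carrier M"
    and smult_l_distr: "\<lbrakk>a \<in> carrier R; b \<in> carrier R; x \<in> carrier M\<rbrakk>
      \<Longrightarrow> (a \<oplus>\<^bsub>R\<^esub> b) \<odot>\<^bsub>M\<^esub> x = a \<odot>\<^bsub>M\<^esub> x \<oplus>\<^bsub>M\<^esub> b \<odot>\<^bsub>M\<^esub> x"
    and smult_r_distr: "\<lbrakk>a \<in> carrier R; x \<in> carrier M; y \<in> carrier M\<rbrakk>
      \<Longrightarrow> a \<odot>\<^bsub>M\<^esub> (x \<oplus>\<^bsub>M\<^esub> y) = a \<odot>\<^bsub>M\<^esub> x \<oplus>\<^bsub>M\<^esub> a \<odot>\<^bsub>M\<^esub> y"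
    and smult_assoc: "\<lbrakk>a \<in> carrier R; b \<in> carrier R; x \<in> carrier M\<rbrakk>
      \<Longrightarrow> (a \<otimes>\<^bsub>R\<^esub> b) \<odot>\<^bsub>M\<^esub> x = a \<odot>\<^bsub>M\<^esub> (b \<odot>\<^bsub>M\<^esub> x)"
    and smult_one: "x \<in> carrier M \<Longrightarrow> \<one>\<^bsub>R\<^esub> \<odot>\<^bsub>M\<^esub> x = x"

definition lmod_hom ::
    "('r, 's) ring_scheme \<Rightarrow> ('r, 'a, 't) module_scheme \<Rightarrow> ('r, 'b, 'u) module_scheme \<Rightarrow> ('a \<Rightarrow> 'b) set" where
  "lmod_hom R M N = {f \<in> carrier M \<rightarrow> carrier N.
     (\<forall>x\<in>carrier M. \<forall>y\<in>carrier M. f (x \<oplus>\<^bsub>M\<^esub> y) = f x \<oplus>\<^bsub>N\<^esub> f y) \<and>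
     (\<forall>a\<in>carrier R. \<forall>x\<in>carrier M. f (a \<odot>\<^bsub>M\<^esub> x) = a \<odot>\<^bsub>N\<^esub> f x)}"

definition lmod_kernel ::
    "('r, 'a, 't) module_scheme \<Rightarrow> ('r, 'b, 'u) module_scheme \<Rightarrow> ('a \<Rightarrow> 'b) \<Rightarrow> 'a set" where
  "lmod_kernel M N f = {x \<in> carrier M. f x = \<zero>\<^bsub>N\<^esub>}"

definition finitely_generated :: "('r, 's) ring_scheme \<Rightarrow> ('r, 'm, 't) module_scheme \<Rightarrow> bool" where
  "finitely_generated R M \<longleftrightarrow> (\<exists>S. finite S \<and> S \<subseteq> carrier M \<and>
     (\<forall>x\<in>carrier M. \<exists>c\<in>S \<rightarrow> carrier R. x = (\<Oplus>\<^bsub>M\<^esub>s\<in>S. c s \<odot>\<^bsub>M\<^esub> s)))"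

text \<open>The free left module with basis indexed by \<open>S\<close>: finitely supported functions on \<open>S\<close>.\<close>

definition free_lmod :: "('r, 's) ring_scheme \<Rightarrow> 'i set \<Rightarrow> ('r, 'i \<Rightarrow> 'r) module" where
  "free_lmod R S =
    \<lparr>carrier = {f. (\<forall>i\<in>S. f i \<in> carrier R) \<and> (\<forall>i. i \<notin> S \<longrightarrow> f i = \<zero>\<^bsub>R\<^esub>) \<and> finite {i. f i \<noteq> \<zero>\<^bsub>R\<^esub>}},
     mult = undefined, one = undefined, zero = (\<lambda>_. \<zero>\<^bsub>R\<^esub>), add = (\<lambda>f g i. f i \<oplus>\<^bsub>R\<^esub> g i),
     smult = (\<lambda>a f i. a \<otimes>\<^bsub>R\<^esub> f i)\<rparr>"

text \<open>Projective means isomorphic to a direct summand of a free module, i.e. a retract of one. Index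
  sets of the type of \<open>P\<close> suffice: a projective \<open>P\<close> is a retract of the free module on
  \<open>carrier P\<close>.\<close>

definition projective :: "('r, 's) ring_scheme \<Rightarrow> ('r, 'm, 't) module_scheme \<Rightarrow> bool" where
  "projective R P \<longleftrightarrow> left_module R P \<and>
     (\<exists>(S :: 'm set) i r. i \<in> lmod_hom R P (free_lmod R S) \<and> r \<in> lmod_hom R (free_lmod R S) P \<and>
        (\<forall>x\<in>carrier P. r (i x) = x))"

text \<open>\<open>\<cdots> \<rightarrow> P 1 \<rightarrow> P 0 \<rightarrow> A \<rightarrow> 0\<close> is exact, with \<open>d i : P (i + 1) \<rightarrow> P i\<close> and \<open>e : P 0 \<rightarrow> A\<close>.\<close>

definition projective_resolution ::
    "('r, 's) ring_scheme \<Rightarrow> ('r, 'a, 't) module_scheme \<Rightarrow> (nat \<Rightarrow> ('r, 'm, 'u) module_scheme) \<Rightarrow>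
     (nat \<Rightarrow> 'm \<Rightarrow> 'm) \<Rightarrow> ('m \<Rightarrow> 'a) \<Rightarrow> bool" where
  "projective_resolution R A P d e \<longleftrightarrow>
     (\<forall>i. projective R (P i)) \<and>
     e \<in> lmod_hom R (P 0) A \<and> (\<forall>i. d i \<in> lmod_hom R (P (Suc i)) (P i)) \<and>
     e ` carrier (P 0) = carrier A \<and>
     d 0 ` carrier (P 1) = lmod_kernel (P 0) A e \<and>
     (\<forall>i. d (Suc i) ` carrier (P (Suc (Suc i))) = lmod_kernel (P (Suc i)) (P i) (d i))"

text \<open>The modules of the resolution have carriers in the type of lists over \<open>R\<close>. This is no
  restriction: if any resolution as required exists, then there is one by free modules, of finite
  rank up to dimension \<open>n\<close> and of rank at most \<open>max |R| \<aleph>\<^sub>0\<close> beyond, and a module of that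
  cardinality can be transported to a set of lists over \<open>R\<close>.\<close>

definition module_type_FP :: "('r, 's) ring_scheme \<Rightarrow> ('r, 'a, 't) module_scheme \<Rightarrow> nat \<Rightarrow> bool" where
  "module_type_FP R A n \<longleftrightarrow>
     (\<exists>(P :: nat \<Rightarrow> ('r, 'r list) module) d e.
        projective_resolution R A P d e \<and> (\<forall>i\<le>n. finitely_generated R (P i)))"

definition lie_type_FP ::
    "('k::field \<Rightarrow> 'l::ab_group_add \<Rightarrow> 'l) \<Rightarrow> ('l \<Rightarrow> 'l \<Rightarrow> 'l) \<Rightarrow> 'l set \<Rightarrow> nat \<Rightarrow> bool" where
  "lie_type_FP scale br N n \<longleftrightarrow>
     module_type_FP (enveloping_algebra scale br N)
       (trivial_module :: (('l list \<Rightarrow>\<^sub>0 'k) set, 'k) module) n"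


section \<open>Simplicial realizations of posets of sets and acyclicity\<close>

text \<open>The simplex \<open>A\<^sub>0 \<subset> \<dots> \<subset> A\<^sub>k\<close> is represented by the list \<open>[A\<^sub>0, \<dots>, A\<^sub>k]\<close>.\<close>

definition realization :: "'v set set \<Rightarrow> 'v set list set" where
  "realization H = {xs. xs \<noteq> [] \<and> sorted_wrt (\<subset>) xs \<and> set xs \<subseteq> H}"

definition lk :: "'v set set \<Rightarrow> 'v set \<Rightarrow> 'v set list set" where
  "lk H Z = {xs \<in> realization H. Z \<subset> hd xs}"

text \<open>The augmented simplicial chain complex of a complex with ordered simplices. The empty list is
  the generator of the chains in degree \<open>-1\<close>, and a simplex of dimension \<open>i\<close> has \<open>i + 1\<close> vertices.\<close>

definition reduced_chains :: "'a list set \<Rightarrow> int \<Rightarrow> ('a list \<Rightarrow>\<^sub>0 'k::comm_ring_1) set" where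
  "reduced_chains W i = {c. Poly_Mapping.keys c \<subseteq> {xs \<in> insert [] W. int (length xs) = i + 1}}"

definition boundary :: "('a list \<Rightarrow>\<^sub>0 'k::comm_ring_1) \<Rightarrow> ('a list \<Rightarrow>\<^sub>0 'k)" where
  "boundary c = (\<Sum>xs\<in>Poly_Mapping.keys c. \<Sum>j<length xs.
     Poly_Mapping.single (take j xs @ drop (Suc j) xs) ((-1) ^ j * Poly_Mapping.lookup c xs))"

definition reduced_homology_vanishes :: "'k::comm_ring_1 itself \<Rightarrow> 'a list set \<Rightarrow> int \<Rightarrow> bool" where
  "reduced_homology_vanishes _ W i \<longleftrightarrow>
     {c \<in> (reduced_chains W i :: ('a list \<Rightarrow>\<^sub>0 'k) set). boundary c = 0}
       = boundary ` reduced_chains W (i + 1)"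

definition acyclic_over :: "'k::comm_ring_1 itself \<Rightarrow> int \<Rightarrow> 'a list set \<Rightarrow> bool" where
  "acyclic_over K m W \<longleftrightarrow> (\<forall>i\<le>m. reduced_homology_vanishes K W i)"


section \<open>The posets attached to an ideal\<close>

definition complete_vertex_sets :: "'v pair_pre_digraph \<Rightarrow> 'v set set" where
  "complete_vertex_sets G =
     {A. A \<subseteq> pverts G \<and> (\<forall>v\<in>A. \<forall>w\<in>A. v \<noteq> w \<longrightarrow> (v, w) \<in> parcs G)}"

context raag_lie_algebra
begin

definition L_on :: "'v set \<Rightarrow> 'l set" where
  "L_on A = generated_subalgebra (\<iota> ` A)"

definition codim_preserving_sets :: "'l set \<Rightarrow> nat \<Rightarrow> 'v set set" where
  "codim_preserving_sets M k = {A \<in> complete_vertex_sets G. has_codim (L_on A) (M \<inter> L_on A) k}"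

end

end

theory Submission imports Defs "HOL-Library.Function_Algebras"
begin

text \<open>Let \<open>R\<close> be the algebra of the trace monoid of \<open>G\<close> (words in the vertices, where adjacent vertices
  commute); it is the enveloping algebra of \<open>L\<close>. The pairs \<open>(B, \<sigma>)\<close>, where \<open>B\<close> is a clique and
  \<open>\<sigma>\<close> a simplex of \<open>|Y|\<close> all of whose vertices contain \<open>B\<close>, index a free \<open>R\<close>-complex that combines
  the Koszul differential in \<open>B\<close> with the simplicial boundary in \<open>\<sigma>\<close>. Augmented by the empty simplex
  and filtered by \<open>|B|\<close>, its layers are the chain complexes of the sets of simplices above \<open>B\<close>,
  which are cones if \<open>B \<in> Y\<close> and links otherwise. So the hypothesis allows one to compare it, in the
  relevant degrees, with the Koszul resolution of \<open>K\<close> over \<open>R\<close>, and it is exact below degree \<open>n\<close>.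

  As \<open>[L, L] \<subseteq> M\<close>, the ideal \<open>M\<close> is the common kernel of \<open>k\<close> functionals \<open>\<xi>\<^sub>b\<close> that
  vanish on brackets. Impose them one at a time: if \<open>M' = N \<inter> ker \<xi>\<^sub>b\<close> and \<open>\<xi>\<^sub>b y = 1\<close> with \<open>y \<in> N\<close>, then
  the powers of \<open>y\<close> are a basis of \<open>U(N)\<close> over \<open>U(M')\<close>. For \<open>A \<in> Y\<close> such a \<open>y\<close> exists in \<open>L\<^sub>A\<close>, where
  it is a combination of commuting generators, and wedging with it is a homotopy for the contraction
  with \<open>\<xi>\<^sub>b\<close>. Hence the chains with values in \<open>U(M')\<close> that are killed by this contraction form a subcomplex
  with acyclic quotient. In the end one has a complex of free \<open>U(M)\<close>-modules of finite rank.\<close>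


section \<open>Resolutions by free modules\<close>

text \<open>The condition that defines Y says that L = M + L_A for every A in Y. Hence the module
  induced to U(L) from K over U(L_A), restricted to U(M), is induced from K over U(M \<inter> L_A).
  As L_A is abelian of finite dimension, that module has a Koszul resolution of finite rank over
  U(M), although U(L) itself has infinite rank over U(M) as soon as k > 0. This is what makes a
  finite complex possible. The restriction goes through a chain of subalgebras because one
  functional at a time needs only polynomials in one element, and no Poincare-Birkhoff-Witt theorem.
  All enveloping algebras are realised inside the trace algebra, as the subalgebras generated by the
  images of the Lie subalgebras. That nothing is lost is shown for L by rewriting words, and it is
  inherited with each functional. The layer of a clique B is shifted by |B| in degree, which is why
  its link has to be acyclic only up to degree n - |B| - 1. Above degree n the resolution is
  continued by arbitrary free covers.\<close>

text \<open>The modules of a resolution have lists of ring elements as elements, and so have the index sets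
  of free modules. A finitely supported function \<open>f\<close> on lists is coded by the list of the
  \<open>f s # s\<close>, which a prefix code turns into a single list.\<close>

fun prefix_code :: "'a \<Rightarrow> 'a \<Rightarrow> 'a list \<Rightarrow> 'a list" where
  "prefix_code a b [] = [b]"
| "prefix_code a b (x # xs) = a # x # prefix_code a b xs"

text \<open>Before each entry \<open>a\<close> announces that one follows, and \<open>b\<close>
  announces the end. So a code tells where it stops, even if the entries themselves equal
  \<open>a\<close> or \<open>b\<close>.\<close>

lemma prefix_code_append_cancel:
  assumes "a \<noteq> b"
  shows "prefix_code a b xs @ us = prefix_code a b ys @ vs \<Longrightarrow> xs = ys \<and> us = vs"
proof (induction xs arbitrary: ys)
  case Nil
  then show ?case using assms by (cases ys) auto
next
  case (Cons x xs)
  then show ?case using assms by (cases ys) auto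
qed

lemma concat_prefix_code_inject:
  assumes "a \<noteq> b"
  shows "concat (map (prefix_code a b) xss) = concat (map (prefix_code a b) yss) \<Longrightarrow> xss = yss"
proof (induction xss arbitrary: yss)
  case Nil
  have "prefix_code a b x \<noteq> []" for x by (cases x) auto
  then show ?case using Nil by (cases yss) auto
next
  case (Cons x xss)
  have *: "prefix_code a b x \<noteq> []" for x by (cases x) auto
  show ?case
  proof (cases yss)
    case Nil
    then show ?thesis using Cons * by auto
  next
    case c: (Cons y ys)
    have "x = y \<and> concat (map (prefix_code a b) xss) = concat (map (prefix_code a b) ys)"
      by (rule prefix_code_append_cancel[OF assms]) (use Cons.prems c in simp)
    then show ?thesis using Cons.IH c by simp
  qed
qed

lemma finitely_supported_inj_list:
  fixes a b z :: 'r
  assumes "a \<noteq> b"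
  shows "\<exists>enc :: ('r list \<Rightarrow> 'r) \<Rightarrow> 'r list. inj_on enc {f. finite {i. f i \<noteq> z}}"
proof -
  define l where "l f = (SOME xs. set xs = {i. f i \<noteq> z})" for f :: "'r list \<Rightarrow> 'r"
  have l: "set (l f) = {i. f i \<noteq> z}" if "finite {i. f i \<noteq> z}" for f
    unfolding l_def using finite_list[OF that] by (rule someI_ex)
  define enc where "enc f = concat (map (prefix_code a b) (map (\<lambda>s. f s # s) (l f)))" for f
  have "f = g" if f: "finite {i. f i \<noteq> z}" and g: "finite {i. g i \<noteq> z}" and e: "enc f = enc g" for f g
  proof -
    have m: "map (\<lambda>s. f s # s) (l f) = map (\<lambda>s. g s # s) (l g)"
      by (rule concat_prefix_code_inject[OF assms]) (use e in \<open>simp add: enc_def\<close>)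
    \<comment> \<open>Dropping the heads leaves the enumerated support; the heads are then the
      values on it.\<close>
    from arg_cong[OF m, of "map tl"] have ll: "l f = l g" by (simp add: comp_def)
    show "f = g"
    proof
      fix i
      show "f i = g i"
      proof (cases "i \<in> set (l f)")
        case True
        then show ?thesis using m ll by auto
      next
        case False
        then show ?thesis using ll l[OF f] l[OF g] by auto
      qed
    qed
  qed
  then have "inj_on enc {f. finite {i. f i \<noteq> z}}" by (auto simp: inj_on_def)
  then show ?thesis by blast
qed

lemma free_lmod_simps [simp]:
  "add (free_lmod R S) = (\<lambda>f g i. f i \<oplus>\<^bsub>R\<^esub> g i)"
  "zero (free_lmod R S) = (\<lambda>_. \<zero>\<^bsub>R\<^esub>)"
  "smult (free_lmod R S) = (\<lambda>a f i. a \<otimes>\<^bsub>R\<^esub> f i)"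
  by (auto simp: free_lmod_def)

lemma carrier_free_lmod:
  "f \<in> carrier (free_lmod R S) \<longleftrightarrow>
    (\<forall>i\<in>S. f i \<in> carrier R) \<and> (\<forall>i. i \<notin> S \<longrightarrow> f i = \<zero>\<^bsub>R\<^esub>) \<and> finite {i. f i \<noteq> \<zero>\<^bsub>R\<^esub>}"
  by (auto simp: free_lmod_def)

text \<open>Transport of structure along an injection. It is needed because the elements of a free
  module are functions, while \<open>module_type_FP\<close> wants modules whose elements are lists
  over the ring.\<close>

definition image_module ::
    "('m \<Rightarrow> 'b) \<Rightarrow> ('r, 'm, 't) module_scheme \<Rightarrow> ('r, 'b) module" where
  "image_module enc M = \<lparr>carrier = enc ` carrier M, mult = undefined, one = undefined,
     zero = enc \<zero>\<^bsub>M\<^esub>,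
     add = (\<lambda>x y. enc (inv_into (carrier M) enc x \<oplus>\<^bsub>M\<^esub> inv_into (carrier M) enc y)),
     smult = (\<lambda>a x. enc (a \<odot>\<^bsub>M\<^esub> inv_into (carrier M) enc x))\<rparr>"

lemma image_module_simps [simp]:
  "carrier (image_module enc M) = enc ` carrier M"
  "zero (image_module enc M) = enc \<zero>\<^bsub>M\<^esub>"
  "inj_on enc (carrier M) \<Longrightarrow> x \<in> carrier M \<Longrightarrow> y \<in> carrier M \<Longrightarrow>
     enc x \<oplus>\<^bsub>image_module enc M\<^esub> enc y = enc (x \<oplus>\<^bsub>M\<^esub> y)"
  "inj_on enc (carrier M) \<Longrightarrow> x \<in> carrier M \<Longrightarrow>
     a \<odot>\<^bsub>image_module enc M\<^esub> enc x = enc (a \<odot>\<^bsub>M\<^esub> x)"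
  by (auto simp: image_module_def)

lemma left_module_image_module:
  assumes M: "left_module R M" and inj: "inj_on enc (carrier M)"
  shows "left_module R (image_module enc M)"
proof -
  interpret left_module R M by fact
  have "abelian_group (image_module enc M)"
  proof (rule abelian_groupI)
    fix x assume "x \<in> carrier (image_module enc M)"
    then obtain u where u: "u \<in> carrier M" "x = enc u" by auto
    show "\<exists>y\<in>carrier (image_module enc M). y \<oplus>\<^bsub>image_module enc M\<^esub> x = \<zero>\<^bsub>image_module enc M\<^esub>"
      by (rule bexI[of _ "enc (\<ominus>\<^bsub>M\<^esub> u)"]) (use u inj M.l_neg in auto)
  qed (use inj in \<open>auto simp: M.a_assoc M.a_comm M.a_lcomm\<close>)
  then interpret N: abelian_group "image_module enc M" .
  show ?thesis
    by unfold_locales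
      (use inj in \<open>auto simp: smult_closed smult_l_distr smult_r_distr smult_assoc smult_one\<close>)
qed

context ring
begin

lemma left_module_free_lmod:
  fixes S :: "'i set"
  shows "left_module R (free_lmod R S)"
proof -
  have fin: "finite {i. f i \<oplus> g i \<noteq> \<zero>}" if "finite {i. f i \<noteq> \<zero>}" "finite {i. g i \<noteq> \<zero>}" for f g :: "'i \<Rightarrow> 'a"
    by (rule finite_subset[of _ "{i. f i \<noteq> \<zero>} \<union> {i. g i \<noteq> \<zero>}"]) (use that in auto)
  have fin2: "finite {i. r \<otimes> f i \<noteq> \<zero>}" if "finite {i. f i \<noteq> \<zero>}" "r \<in> carrier R" for f :: "'i \<Rightarrow> 'a" and r
    by (rule finite_subset[of _ "{i. f i \<noteq> \<zero>}"]) (use that in auto)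
  have cl: "f \<in> carrier (free_lmod R S) \<Longrightarrow> f i \<in> carrier R" for f :: "'i \<Rightarrow> 'a" and i
    by (cases "i \<in> S") (auto simp: carrier_free_lmod)
  have "abelian_group (free_lmod R S)"
  proof (rule abelian_groupI)
    fix x assume x: "x \<in> carrier (free_lmod R S)"
    have s: "{i. \<ominus> x i \<noteq> \<zero>} \<subseteq> {i. x i \<noteq> \<zero>}" by auto
    show "\<exists>y\<in>carrier (free_lmod R S). y \<oplus>\<^bsub>free_lmod R S\<^esub> x = \<zero>\<^bsub>free_lmod R S\<^esub>"
      apply (rule bexI[of _ "\<lambda>i. \<ominus> x i"])
      using cl[OF x] x finite_subset[OF s] by (auto simp: carrier_free_lmod l_neg)
  next
    fix x y z assume "x \<in> carrier (free_lmod R S)" "y \<in> carrier (free_lmod R S)" "z \<in> carrier (free_lmod R S)"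
    note c = this[THEN cl]
    show "x \<oplus>\<^bsub>free_lmod R S\<^esub> y \<oplus>\<^bsub>free_lmod R S\<^esub> z = x \<oplus>\<^bsub>free_lmod R S\<^esub> (y \<oplus>\<^bsub>free_lmod R S\<^esub> z)"
      using c by (simp add: a_assoc)
  next
    fix x y assume "x \<in> carrier (free_lmod R S)" "y \<in> carrier (free_lmod R S)"
    note c = this[THEN cl]
    show "x \<oplus>\<^bsub>free_lmod R S\<^esub> y = y \<oplus>\<^bsub>free_lmod R S\<^esub> x"
      using c by (simp add: a_comm)
  next
    fix x assume "x \<in> carrier (free_lmod R S)"
    note c = this[THEN cl]
    show "\<zero>\<^bsub>free_lmod R S\<^esub> \<oplus>\<^bsub>free_lmod R S\<^esub> x = x" using c by simp
  qed (auto simp: carrier_free_lmod fin)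
  then interpret M: abelian_group "free_lmod R S" .
  show ?thesis
  proof unfold_locales
    fix a b x assume "a \<in> carrier R" "b \<in> carrier R" and x: "x \<in> carrier (free_lmod R S)"
    then show "(a \<oplus> b) \<odot>\<^bsub>free_lmod R S\<^esub> x = a \<odot>\<^bsub>free_lmod R S\<^esub> x \<oplus>\<^bsub>free_lmod R S\<^esub> b \<odot>\<^bsub>free_lmod R S\<^esub> x"
      "a \<otimes> b \<odot>\<^bsub>free_lmod R S\<^esub> x = a \<odot>\<^bsub>free_lmod R S\<^esub> (b \<odot>\<^bsub>free_lmod R S\<^esub> x)"
      using cl[OF x] by (auto simp: l_distr m_assoc)
  next
    fix a x y assume "a \<in> carrier R" and x: "x \<in> carrier (free_lmod R S)" "y \<in> carrier (free_lmod R S)"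
    then show "a \<odot>\<^bsub>free_lmod R S\<^esub> (x \<oplus>\<^bsub>free_lmod R S\<^esub> y) = a \<odot>\<^bsub>free_lmod R S\<^esub> x \<oplus>\<^bsub>free_lmod R S\<^esub> a \<odot>\<^bsub>free_lmod R S\<^esub> y"
      using x[THEN cl] by (auto simp: r_distr)
  next
    fix x assume x: "x \<in> carrier (free_lmod R S)"
    then show "\<one> \<odot>\<^bsub>free_lmod R S\<^esub> x = x" using cl[OF x] by auto
  qed (auto simp: carrier_free_lmod fin2)
qed

lemma free_lmod_closed:
  fixes S :: "'i set"
  shows "f \<in> carrier (free_lmod R S) \<Longrightarrow> f i \<in> carrier R"
  by (cases "i \<in> S") (auto simp: carrier_free_lmod)

text \<open>The unit vectors generate. \<open>\<one> \<noteq> \<zero>\<close> keeps them distinct,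
  so that a sum over the set of their codes has one term for each index.\<close>

lemma finitely_generated_image_free_lmod:
  fixes S :: "'i set"
  assumes inj: "inj_on enc (carrier (free_lmod R S))" and S: "finite S" and nz: "\<one> \<noteq> \<zero>"
  shows "finitely_generated R (image_module enc (free_lmod R S))"
proof -
  let ?M = "free_lmod R S" and ?N = "image_module enc (free_lmod R S)"
  define \<delta> where "\<delta> = (\<lambda>(s::'i) i. if i = s then \<one> else \<zero>)"
  interpret N: left_module R ?N
    by (intro left_module_image_module left_module_free_lmod inj)
  have \<delta>: "\<delta> s \<in> carrier ?M" if "s \<in> S" for s
    using that by (auto simp: \<delta>_def carrier_free_lmod)
  have inj\<delta>: "inj \<delta>" using nz by (auto simp: inj_on_def \<delta>_def fun_eq_iff split: if_splits)
  have inj2: "inj_on (\<lambda>s. enc (\<delta> s)) S"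
    using inj inj\<delta> \<delta> by (auto simp: inj_on_def)
  show ?thesis unfolding finitely_generated_def
  proof (intro exI[of _ "(\<lambda>s. enc (\<delta> s)) ` S"] conjI ballI)
    fix x assume "x \<in> carrier ?N"
    then obtain f where f: "f \<in> carrier ?M" "x = enc f" by auto
    define c where "c = (\<lambda>t. f (inv_into S (\<lambda>s. enc (\<delta> s)) t))"
    have c: "c (enc (\<delta> s)) = f s" if "s \<in> S" for s
      using inv_into_f_f[OF inj2 that] by (simp add: c_def)
    have cr: "f s \<in> carrier R" for s using f(1) by (rule free_lmod_closed)
    have rs: "(\<lambda>i. if i \<in> F then f i else \<zero>) \<in> carrier ?M" for F
    proof -
      have "finite {i. (if i \<in> F then f i else \<zero>) \<noteq> \<zero>}"
        by (rule finite_subset[of _ "{i. f i \<noteq> \<zero>}"]) (use f(1) in \<open>auto simp: carrier_free_lmod\<close>)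
      then show ?thesis using f(1) by (auto simp: carrier_free_lmod)
    qed
    have "F \<subseteq> S \<Longrightarrow> (\<Oplus>\<^bsub>?N\<^esub>t\<in>(\<lambda>s. enc (\<delta> s)) ` F. c t \<odot>\<^bsub>?N\<^esub> t) = enc (\<lambda>i. if i \<in> F then f i else \<zero>)"
      if "finite F" for F using that
    proof induction
      case empty
      then show ?case by simp
    next
      case (insert s F)
      have s: "s \<in> S" "F \<subseteq> S" using insert by auto
      have sm: "c (enc (\<delta> t)) \<odot>\<^bsub>?N\<^esub> enc (\<delta> t) = enc (\<lambda>i. if i = t then f t else \<zero>)" if "t \<in> S" for t
      proof -
        have "(\<lambda>i. f t \<otimes> \<delta> t i) = (\<lambda>i. if i = t then f t else \<zero>)" using cr by (auto simp: \<delta>_def)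
        then show ?thesis using that inj \<delta> c by simp
      qed
      have cl: "enc (\<lambda>i. if i = t then f t else \<zero>) \<in> carrier ?N" if "t \<in> S" for t
        using that rs[of "{t}"] by (auto intro!: imageI simp: if_distrib cong: if_cong)
      have "(\<Oplus>\<^bsub>?N\<^esub>t\<in>(\<lambda>s. enc (\<delta> s)) ` insert s F. c t \<odot>\<^bsub>?N\<^esub> t)
         = (c (enc (\<delta> s)) \<odot>\<^bsub>?N\<^esub> enc (\<delta> s)) \<oplus>\<^bsub>?N\<^esub> (\<Oplus>\<^bsub>?N\<^esub>t\<in>(\<lambda>s. enc (\<delta> s)) ` F. c t \<odot>\<^bsub>?N\<^esub> t)"
        unfolding image_insert
      proof (rule N.finsum_insert)
        show "enc (\<delta> s) \<notin> (\<lambda>s. enc (\<delta> s)) ` F"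
          using insert s inj2 by (auto simp: inj_on_def)
      qed (use insert s sm cl in auto)
      also have "\<dots> = enc (\<lambda>i. if i = s then f s else \<zero>) \<oplus>\<^bsub>?N\<^esub> enc (\<lambda>i. if i \<in> F then f i else \<zero>)"
        using insert s sm by simp
      also have "\<dots> = enc ((\<lambda>i. if i = s then f s else \<zero>) \<oplus>\<^bsub>?M\<^esub> (\<lambda>i. if i \<in> F then f i else \<zero>))"
        using inj rs[of "{s}"] rs[of F] by (intro image_module_simps) (auto cong: if_cong)
      also have "(\<lambda>i. if i = s then f s else \<zero>) \<oplus>\<^bsub>?M\<^esub> (\<lambda>i. if i \<in> F then f i else \<zero>)
         = (\<lambda>i. if i \<in> insert s F then f i else \<zero>)"
        using insert cr by auto
      finally show ?case .
    qed
    from this[OF S] have "(\<Oplus>\<^bsub>?N\<^esub>t\<in>(\<lambda>s. enc (\<delta> s)) ` S. c t \<odot>\<^bsub>?N\<^esub> t) = enc (\<lambda>i. if i \<in> S then f i else \<zero>)"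
      by simp
    also have "(\<lambda>i. if i \<in> S then f i else \<zero>) = f" using f(1) by (auto simp: carrier_free_lmod)
    finally show "\<exists>c\<in>(\<lambda>s. enc (\<delta> s)) ` S \<rightarrow> carrier R. x = (\<Oplus>\<^bsub>?N\<^esub>s\<in>(\<lambda>s. enc (\<delta> s)) ` S. c s \<odot>\<^bsub>?N\<^esub> s)"
      using f(2) c cr by (intro bexI[of _ c]) auto
  qed (use S \<delta> in auto)
qed

text \<open>The retraction is \<open>enc\<close> itself and its section is the inverse. As
  \<open>projective\<close> takes index sets from the element type of the module, \<open>enc\<close>
  has to map into the index type.\<close>

lemma projective_image_free_lmod:
  fixes S :: "'i set" and enc :: "('i \<Rightarrow> 'a) \<Rightarrow> 'i"
  assumes inj: "inj_on enc (carrier (free_lmod R S))"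
  shows "projective R (image_module enc (free_lmod R S))"
proof -
  have "inv_into (carrier (free_lmod R S)) enc \<in> lmod_hom R (image_module enc (free_lmod R S)) (free_lmod R S)"
  proof -
    interpret M: left_module R "free_lmod R S" by (rule left_module_free_lmod)
    show ?thesis using inj M.smult_closed M.a_closed
      by (auto simp: lmod_hom_def simp del: free_lmod_simps)
  qed
  moreover have "enc \<in> lmod_hom R (free_lmod R S) (image_module enc (free_lmod R S))"
    using inj by (auto simp: lmod_hom_def simp del: free_lmod_simps)
  ultimately show ?thesis unfolding projective_def
    using left_module_image_module[OF left_module_free_lmod inj] inj
    by (auto intro!: exI[of _ S] exI[of _ "inv_into (carrier (free_lmod R S)) enc"] exI[of _ enc])
qed

text \<open>The free module on the elements of a submodule \<open>Z\<close>, which \<open>enc\<close> encodes in the index type, maps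
  onto \<open>Z\<close>.\<close>

definition free_cover :: "(('i \<Rightarrow> 'a) \<Rightarrow> 'i) \<Rightarrow> ('i \<Rightarrow> 'a) \<Rightarrow> 'i \<Rightarrow> 'a" where
  "free_cover enc f = (\<lambda>s. \<Oplus>z\<in>{z. f z \<noteq> \<zero>}. f z \<otimes> inv_into {f. finite {i. f i \<noteq> \<zero>}} enc z s)"

definition submodule_of_free :: "'i set \<Rightarrow> ('i \<Rightarrow> 'a) set \<Rightarrow> bool" where
  "submodule_of_free T Z \<longleftrightarrow> Z \<subseteq> carrier (free_lmod R T) \<and> (\<lambda>_. \<zero>) \<in> Z \<and>
     (\<forall>f\<in>Z. \<forall>g\<in>Z. (\<lambda>i. f i \<oplus> g i) \<in> Z) \<and> (\<forall>a\<in>carrier R. \<forall>f\<in>Z. (\<lambda>i. a \<otimes> f i) \<in> Z)"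

lemma free_cover_hom:
  fixes T :: "'i set" and enc :: "('i \<Rightarrow> 'a) \<Rightarrow> 'i"
  assumes inj: "inj_on enc {f. finite {i. f i \<noteq> \<zero>}}" and Z: "submodule_of_free T Z"
  shows "free_cover enc \<in> lmod_hom R (free_lmod R (enc ` Z)) (free_lmod R T)"
    and "free_cover enc ` carrier (free_lmod R (enc ` Z)) = Z"
proof -
  define dec where "dec = inv_into {f. finite {i. f i \<noteq> \<zero>}} enc"
  have Zc: "Z \<subseteq> carrier (free_lmod R T)" using Z by (auto simp: submodule_of_free_def)
  have dec: "dec (enc f) = f" if "f \<in> Z" for f
    unfolding dec_def using that Zc by (intro inv_into_f_f inj) (auto simp: carrier_free_lmod)
  \<comment> \<open>Summing over any finite \<open>F\<close> that contains the support allows the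
    sums for \<open>f\<close>, \<open>g\<close> and their sum to be compared term by term.\<close>
  have cov: "free_cover enc f = (\<lambda>s. \<Oplus>z\<in>F. f z \<otimes> dec z s)"
    if f: "f \<in> carrier (free_lmod R (enc ` Z))" and F: "finite F" "{z. f z \<noteq> \<zero>} \<subseteq> F" "F \<subseteq> enc ` Z" for f F
  proof
    fix s
    have c: "f z \<in> carrier R" "dec z s \<in> carrier R" if "z \<in> F" for z
      using subsetD[OF F(3) that] free_lmod_closed[OF f] dec Zc free_lmod_closed[of _ T] by auto
    show "free_cover enc f s = (\<Oplus>z\<in>F. f z \<otimes> dec z s)"
      unfolding free_cover_def dec_def[symmetric]
      by (rule add.finprod_mono_neutral_cong_left) (use F c in auto)
  qed
  have supp: "finite {z. f z \<noteq> \<zero>}" "{z. f z \<noteq> \<zero>} \<subseteq> enc ` Z"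
    if "f \<in> carrier (free_lmod R (enc ` Z))" for f
    using that by (auto simp: carrier_free_lmod)
  have cl: "dec z s \<in> carrier R" if "z \<in> enc ` Z" for z s
    using that dec Zc free_lmod_closed[of _ T] by auto
  have inZ: "(\<lambda>s. \<Oplus>z\<in>F. f z \<otimes> dec z s) \<in> Z"
    if "finite F" and f: "\<And>z. f z \<in> carrier R" and "F \<subseteq> enc ` Z" for f F
    using that(1,3)
  proof induction
    case empty
    then show ?case using Z by (simp add: submodule_of_free_def)
  next
    case (insert z F)
    have "(\<lambda>s. \<Oplus>z\<in>insert z F. f z \<otimes> dec z s) = (\<lambda>s. (f z \<otimes> dec z s) \<oplus> (\<Oplus>z\<in>F. f z \<otimes> dec z s))"
      using insert f cl by (intro ext finsum_insert) auto
    then show ?case using insert f Z dec by (auto simp: submodule_of_free_def)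
  qed
  have mem: "free_cover enc f \<in> Z" if "f \<in> carrier (free_lmod R (enc ` Z))" for f
    using cov[OF that _ order_refl] supp[OF that] inZ free_lmod_closed[OF that] by auto
  show hom: "free_cover enc \<in> lmod_hom R (free_lmod R (enc ` Z)) (free_lmod R T)"
    unfolding lmod_hom_def
  proof (intro CollectI conjI ballI)
    show "free_cover enc \<in> carrier (free_lmod R (enc ` Z)) \<rightarrow> carrier (free_lmod R T)"
      using mem Zc by auto
  next
    fix f g assume fg: "f \<in> carrier (free_lmod R (enc ` Z))" "g \<in> carrier (free_lmod R (enc ` Z))"
    interpret M: left_module R "free_lmod R (enc ` Z)" by (rule left_module_free_lmod)
    let ?F = "{z. f z \<noteq> \<zero>} \<union> {z. g z \<noteq> \<zero>}"
    have F: "finite ?F" "?F \<subseteq> enc ` Z" using supp fg by auto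
    have h: "(\<lambda>i. f i \<oplus> g i) \<in> carrier (free_lmod R (enc ` Z))" using M.a_closed[OF fg] by simp
    show "free_cover enc (f \<oplus>\<^bsub>free_lmod R (enc ` Z)\<^esub> g) = free_cover enc f \<oplus>\<^bsub>free_lmod R T\<^esub> free_cover enc g"
    proof -
      have "(\<lambda>s. \<Oplus>z\<in>?F. (f z \<oplus> g z) \<otimes> dec z s)
         = (\<lambda>s. (\<Oplus>z\<in>?F. f z \<otimes> dec z s) \<oplus> (\<Oplus>z\<in>?F. g z \<otimes> dec z s))"
      proof
        fix s
        have "(\<Oplus>z\<in>?F. (f z \<oplus> g z) \<otimes> dec z s) = (\<Oplus>z\<in>?F. f z \<otimes> dec z s \<oplus> g z \<otimes> dec z s)"
          by (rule finsum_cong')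
            (use F cl free_lmod_closed[OF fg(1)] free_lmod_closed[OF fg(2)] in \<open>auto simp: l_distr\<close>)
        also have "\<dots> = (\<Oplus>z\<in>?F. f z \<otimes> dec z s) \<oplus> (\<Oplus>z\<in>?F. g z \<otimes> dec z s)"
          by (rule finsum_addf) (use F cl free_lmod_closed[OF fg(1)] free_lmod_closed[OF fg(2)] in auto)
        finally show "(\<Oplus>z\<in>?F. (f z \<oplus> g z) \<otimes> dec z s)
          = (\<Oplus>z\<in>?F. f z \<otimes> dec z s) \<oplus> (\<Oplus>z\<in>?F. g z \<otimes> dec z s)" .
      qed
      moreover have "{z. f z \<oplus> g z \<noteq> \<zero>} \<subseteq> ?F" by auto
      ultimately show ?thesis
        using cov[OF fg(1) F(1) _ F(2)] cov[OF fg(2) F(1) _ F(2)] cov[OF h F(1) _ F(2)] by simp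
    qed
  next
    fix a f assume a: "a \<in> carrier R" and f: "f \<in> carrier (free_lmod R (enc ` Z))"
    interpret M: left_module R "free_lmod R (enc ` Z)" by (rule left_module_free_lmod)
    let ?F = "{z. f z \<noteq> \<zero>}"
    have h: "(\<lambda>i. a \<otimes> f i) \<in> carrier (free_lmod R (enc ` Z))" using M.smult_closed[OF a f] by simp
    have "(\<lambda>s. \<Oplus>z\<in>?F. (a \<otimes> f z) \<otimes> dec z s) = (\<lambda>s. a \<otimes> (\<Oplus>z\<in>?F. f z \<otimes> dec z s))"
    proof
      fix s
      have "(\<Oplus>z\<in>?F. (a \<otimes> f z) \<otimes> dec z s) = (\<Oplus>z\<in>?F. a \<otimes> (f z \<otimes> dec z s))"
        by (rule finsum_cong') (use supp[OF f] a cl free_lmod_closed[OF f] in \<open>auto simp: m_assoc\<close>)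
      also have "\<dots> = a \<otimes> (\<Oplus>z\<in>?F. f z \<otimes> dec z s)"
        by (rule finsum_rdistr[symmetric]) (use supp[OF f] a cl free_lmod_closed[OF f] in auto)
      finally show "(\<Oplus>z\<in>?F. (a \<otimes> f z) \<otimes> dec z s) = a \<otimes> (\<Oplus>z\<in>?F. f z \<otimes> dec z s)" .
    qed
    moreover have "{z. a \<otimes> f z \<noteq> \<zero>} \<subseteq> ?F" using a by auto
    ultimately show "free_cover enc (a \<odot>\<^bsub>free_lmod R (enc ` Z)\<^esub> f) = a \<odot>\<^bsub>free_lmod R T\<^esub> free_cover enc f"
      using cov[OF f supp(1)[OF f] order_refl supp(2)[OF f]] cov[OF h supp(1)[OF f] _ supp(2)[OF f]] by simp
  qed
  show "free_cover enc ` carrier (free_lmod R (enc ` Z)) = Z"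
  proof
    show "free_cover enc ` carrier (free_lmod R (enc ` Z)) \<subseteq> Z" using mem by auto
  next
    show "Z \<subseteq> free_cover enc ` carrier (free_lmod R (enc ` Z))"
    proof
      fix g assume g: "g \<in> Z"
      let ?f = "\<lambda>i. if i = enc g then \<one> else \<zero>"
      have f: "?f \<in> carrier (free_lmod R (enc ` Z))"
        using g by (auto simp: carrier_free_lmod)
      have "free_cover enc ?f = (\<lambda>s. \<Oplus>z\<in>{enc g}. ?f z \<otimes> dec z s)"
        by (rule cov[OF f]) (use g in auto)
      also have "\<dots> = g" using g dec cl[of "enc g"] by (auto simp: finsum_insert)
      finally show "g \<in> free_cover enc ` carrier (free_lmod R (enc ` Z))" using f by force
    qed
  qed
qed

lemma submodule_of_free_kernel:
  fixes S :: "'i set"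
  assumes f: "f \<in> lmod_hom R (free_lmod R S) N" and N: "left_module R N"
  shows "submodule_of_free S (lmod_kernel (free_lmod R S) N f)"
proof -
  interpret M: left_module R "free_lmod R S" by (rule left_module_free_lmod)
  interpret N: left_module R N by fact
  have ad: "f (x \<oplus>\<^bsub>free_lmod R S\<^esub> y) = f x \<oplus>\<^bsub>N\<^esub> f y"
    "a \<in> carrier R \<Longrightarrow> f (a \<odot>\<^bsub>free_lmod R S\<^esub> x) = a \<odot>\<^bsub>N\<^esub> f x"
    "f x \<in> carrier N"
    if "x \<in> carrier (free_lmod R S)" "y \<in> carrier (free_lmod R S)" for x y a
    using f that by (auto simp: lmod_hom_def simp del: free_lmod_simps)
  have "f \<zero>\<^bsub>free_lmod R S\<^esub> \<oplus>\<^bsub>N\<^esub> f \<zero>\<^bsub>free_lmod R S\<^esub> = f \<zero>\<^bsub>free_lmod R S\<^esub>"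
    using ad(1)[OF M.zero_closed M.zero_closed] M.l_zero[OF M.zero_closed] by metis
  then have z: "f \<zero>\<^bsub>free_lmod R S\<^esub> = \<zero>\<^bsub>N\<^esub>"
    using ad(3)[OF M.zero_closed M.zero_closed] N.add.l_cancel_one by blast
  have sz: "a \<odot>\<^bsub>N\<^esub> \<zero>\<^bsub>N\<^esub> = \<zero>\<^bsub>N\<^esub>" if a: "a \<in> carrier R" for a
  proof -
    have "a \<odot>\<^bsub>N\<^esub> \<zero>\<^bsub>N\<^esub> \<oplus>\<^bsub>N\<^esub> a \<odot>\<^bsub>N\<^esub> \<zero>\<^bsub>N\<^esub> = a \<odot>\<^bsub>N\<^esub> \<zero>\<^bsub>N\<^esub>"
      using N.smult_r_distr[OF a N.M.zero_closed N.M.zero_closed] N.M.l_zero[OF N.M.zero_closed] by metis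
    then show ?thesis using N.smult_closed[OF a N.M.zero_closed] N.M.add.l_cancel_one by blast
  qed
  show ?thesis
    unfolding submodule_of_free_def lmod_kernel_def
  proof (intro conjI ballI)
    show "(\<lambda>_. \<zero>) \<in> {x \<in> carrier (free_lmod R S). f x = \<zero>\<^bsub>N\<^esub>}"
      using z M.zero_closed by simp
  next
    fix x y assume "x \<in> {x \<in> carrier (free_lmod R S). f x = \<zero>\<^bsub>N\<^esub>}"
      "y \<in> {x \<in> carrier (free_lmod R S). f x = \<zero>\<^bsub>N\<^esub>}"
    then show "(\<lambda>i. x i \<oplus> y i) \<in> {x \<in> carrier (free_lmod R S). f x = \<zero>\<^bsub>N\<^esub>}"
      using ad(1)[of x y] M.a_closed[of x y] by simp
  next
    fix a x assume "a \<in> carrier R" "x \<in> {x \<in> carrier (free_lmod R S). f x = \<zero>\<^bsub>N\<^esub>}"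
    then show "(\<lambda>i. a \<otimes> x i) \<in> {x \<in> carrier (free_lmod R S). f x = \<zero>\<^bsub>N\<^esub>}"
      using ad(2)[of x x a] sz M.smult_closed[of a x] by simp
  qed auto
qed

lemma lmod_hom_image_module:
  assumes f: "f \<in> lmod_hom R M N" and M: "left_module R M" and N: "left_module R N"
    and inj: "inj_on enc (carrier M)" "inj_on enc' (carrier N)"
  shows "(\<lambda>x. enc' (f (inv_into (carrier M) enc x))) \<in> lmod_hom R (image_module enc M) (image_module enc' N)"
proof -
  interpret M: left_module R M by fact
  interpret N: left_module R N by fact
  show ?thesis
    using f inj M.smult_closed M.a_closed N.smult_closed N.a_closed
    by (auto simp: lmod_hom_def Pi_iff)
qed

text \<open>A finite free complex that is exact below degree \<open>n\<close> is enough: from there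
  on, each kernel is covered by the free module on all of its elements, and no finiteness is asked
  of those modules. The coding by lists is done here once and for all.\<close>

lemma module_type_FP_free:
  fixes S :: "nat \<Rightarrow> 'a list set" and A :: "('a, 'c, 't) module_scheme"
  assumes A: "left_module R A" and nz: "\<one> \<noteq> \<zero>"
    and S: "\<And>i. i \<le> n \<Longrightarrow> finite (S i)"
    and d: "\<And>i. i < n \<Longrightarrow> d i \<in> lmod_hom R (free_lmod R (S (Suc i))) (free_lmod R (S i))"
    and e: "e \<in> lmod_hom R (free_lmod R (S 0)) A"
    and e_onto: "e ` carrier (free_lmod R (S 0)) = carrier A"
    and exact0: "0 < n \<Longrightarrow> d 0 ` carrier (free_lmod R (S 1)) = lmod_kernel (free_lmod R (S 0)) A e"
    and exact: "\<And>i. Suc i < n \<Longrightarrow> d (Suc i) ` carrier (free_lmod R (S (Suc (Suc i))))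
      = lmod_kernel (free_lmod R (S (Suc i))) (free_lmod R (S i)) (d i)"
  shows "module_type_FP R A n"
proof -
  obtain enc :: "('a list \<Rightarrow> 'a) \<Rightarrow> 'a list" where inj: "inj_on enc {f. finite {i. f i \<noteq> \<zero>}}"
    using finitely_supported_inj_list[OF nz] by metis
  have injS: "inj_on enc (carrier (free_lmod R T))" for T
    by (rule inj_on_subset[OF inj]) (auto simp: carrier_free_lmod)
  define cov where "cov = free_cover enc"
  \<comment> \<open>The cycles in degree \<open>n\<close>; for \<open>n = 0\<close> these are the
    kernel of the augmentation.\<close>
  define Z0 where "Z0 = (if n = 0 then lmod_kernel (free_lmod R (S 0)) A e
    else lmod_kernel (free_lmod R (S n)) (free_lmod R (S (n - 1))) (d (n - 1)))"
  have Z0: "submodule_of_free (S n) Z0"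
    using submodule_of_free_kernel[OF e A]
      submodule_of_free_kernel[OF d[of "n - 1"] left_module_free_lmod] by (auto simp: Z0_def)
  \<comment> \<open>\<open>Z j\<close> consists of the cycles in degree \<open>n + j\<close>, and
    the free module in the next degree has a basis vector for each of them.\<close>
  define Z where "Z = rec_nat Z0 (\<lambda>_ Z. {f \<in> carrier (free_lmod R (enc ` Z)). cov f = (\<lambda>_. \<zero>)})"
  have Z_0: "Z 0 = Z0" and Z_Suc: "Z (Suc j) = {f \<in> carrier (free_lmod R (enc ` Z j)). cov f = (\<lambda>_. \<zero>)}" for j
    by (auto simp: Z_def)
  define S' where "S' i = (if i \<le> n then S i else enc ` Z (i - Suc n))" for i
  define d' where "d' i = (if i < n then d i else cov)" for i
  have sub: "submodule_of_free (S' (n + j)) (Z j)" for j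
  proof (induction j)
    case 0
    then show ?case using Z0 by (simp add: S'_def Z_0)
  next
    case (Suc j)
    have "submodule_of_free (enc ` Z j) (lmod_kernel (free_lmod R (enc ` Z j)) (free_lmod R (S' (n + j))) cov)"
      unfolding cov_def
      by (intro submodule_of_free_kernel left_module_free_lmod free_cover_hom[OF inj Suc])
    then show ?case by (simp add: S'_def Z_Suc lmod_kernel_def)
  qed
  have S'n: "S' (Suc (n + j)) = enc ` Z j" for j by (simp add: S'_def)
  have d'hom: "d' i \<in> lmod_hom R (free_lmod R (S' (Suc i))) (free_lmod R (S' i))" for i
  proof (cases "i < n")
    case True
    then show ?thesis using d[OF True] by (simp add: d'_def S'_def)
  next
    case False
    then obtain j where j: "i = n + j" by (metis le_Suc_ex not_less)
    show ?thesis using free_cover_hom(1)[OF inj sub[of j]] by (simp add: j S'n d'_def cov_def)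
  qed
  have imcov: "d' (n + j) ` carrier (free_lmod R (S' (Suc (n + j)))) = Z j" for j
    using free_cover_hom(2)[OF inj sub[of j]] by (simp add: S'n d'_def cov_def)
  have ex0: "d' 0 ` carrier (free_lmod R (S' 1)) = lmod_kernel (free_lmod R (S' 0)) A e"
  proof (cases "n = 0")
    case True
    then show ?thesis using imcov[of 0] by (simp add: Z_0 Z0_def S'_def)
  next
    case False
    then show ?thesis using exact0 by (auto simp: d'_def S'_def)
  qed
  have ex: "d' (Suc i) ` carrier (free_lmod R (S' (Suc (Suc i))))
      = lmod_kernel (free_lmod R (S' (Suc i))) (free_lmod R (S' i)) (d' i)" for i
  proof (cases "Suc i < n")
    case True
    then show ?thesis using exact[OF True] by (simp add: d'_def S'_def)
  next
    case False
    show ?thesis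
    proof (cases "Suc i = n")
      case True
      then show ?thesis using imcov[of 0] by (auto simp: Z_0 Z0_def S'_def d'_def)
    next
      case F2: False
      then obtain j where j: "i = n + j" using False by (metis le_Suc_ex not_less not_less_eq nat_neq_iff)
      show ?thesis using imcov[of "Suc j"]
        by (simp add: j Z_Suc S'n d'_def lmod_kernel_def)
    qed
  qed
  let ?F = "\<lambda>i. free_lmod R (S' i)"
  let ?dec = "\<lambda>i. inv_into (carrier (?F i)) enc"
  define P where "P = (\<lambda>i. image_module enc (?F i))"
  have decF: "?dec i (enc f) = f" if "f \<in> carrier (?F i)" for i f
    using injS that by (rule inv_into_f_f)
  have d'c: "d' i f \<in> carrier (?F i)" if "f \<in> carrier (?F (Suc i))" for i f
    using d'hom[of i] that by (auto simp: lmod_hom_def)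
  have zc: "(\<lambda>_. \<zero>) \<in> carrier (free_lmod R T)" for T :: "'a list set" by (auto simp: carrier_free_lmod)
  define D where "D = (\<lambda>i x. enc (d' i (?dec (Suc i) x)))"
  define E where "E = (\<lambda>x. e (?dec 0 x))"
  have imD: "D i ` carrier (P (Suc i)) = enc ` (d' i ` carrier (?F (Suc i)))" for i
    by (auto simp: D_def P_def decF image_image)
  have kerD: "lmod_kernel (P (Suc i)) (P i) (D i) = enc ` lmod_kernel (?F (Suc i)) (?F i) (d' i)" for i
  proof -
    have "enc (d' i x) = enc (\<lambda>_. \<zero>) \<longleftrightarrow> d' i x = (\<lambda>_. \<zero>)" if "x \<in> carrier (?F (Suc i))" for x
      using inj_on_eq_iff[OF injS d'c[OF that] zc] .
    then show ?thesis by (auto simp: lmod_kernel_def D_def P_def decF)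
  qed
  have "projective_resolution R A P D E"
    unfolding projective_resolution_def
  proof (intro conjI allI)
    show "projective R (P i)" for i
      unfolding P_def by (rule projective_image_free_lmod[OF injS])
    show "D i \<in> lmod_hom R (P (Suc i)) (P i)" for i
      unfolding D_def P_def by (intro lmod_hom_image_module left_module_free_lmod d'hom injS)
    show "E \<in> lmod_hom R (P 0) A"
    proof -
      interpret M: left_module R "?F 0" by (rule left_module_free_lmod)
      have "e \<in> lmod_hom R (?F 0) A" using e by (simp add: S'_def)
      then show ?thesis
        using injS[of "S' 0"] M.smult_closed M.a_closed
        by (auto simp: lmod_hom_def E_def P_def simp del: free_lmod_simps)
    qed
    show "E ` carrier (P 0) = carrier A"
    proof -
      have "E ` carrier (P 0) = e ` carrier (?F 0)" by (auto simp: E_def P_def decF image_image)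
      then show ?thesis using e_onto by (simp add: S'_def)
    qed
    show "D 0 ` carrier (P 1) = lmod_kernel (P 0) A E"
      using imD[of 0] ex0 by (auto simp: lmod_kernel_def E_def P_def decF)
    show "D (Suc i) ` carrier (P (Suc (Suc i))) = lmod_kernel (P (Suc i)) (P i) (D i)" for i
      unfolding imD kerD ex ..
  qed
  moreover have "finitely_generated R (P i)" if "i \<le> n" for i
    unfolding P_def by (rule finitely_generated_image_free_lmod[OF injS _ nz]) (use that S in \<open>simp add: S'_def\<close>)
  ultimately show ?thesis unfolding module_type_FP_def by blast
qed

end


section \<open>Enveloping algebras\<close>

text \<open>With concatenation as the addition of lists, \<open>'l list \<Rightarrow>\<^sub>0 'k\<close> is the free associative algebra.\<close>

instantiation list :: (type) monoid_add
begin
definition zero_list :: "'a list" where "zero_list = []"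
definition plus_list :: "'a list \<Rightarrow> 'a list \<Rightarrow> 'a list" where "plus_list = (@)"
instance by standard (auto simp: zero_list_def plus_list_def)
end

abbreviation "lookup \<equiv> Poly_Mapping.lookup"
abbreviation "keys \<equiv> Poly_Mapping.keys"
abbreviation "single \<equiv> Poly_Mapping.single"

abbreviation cst :: "'k \<Rightarrow> ('m::zero \<Rightarrow>\<^sub>0 'k::zero)" where
  "cst c \<equiv> single 0 c"

lemma lookup_cst_mult [simp]:
  "lookup (cst c * p) t = c * lookup (p :: 'm::monoid_add \<Rightarrow>\<^sub>0 'k::comm_ring_1) t"
  by (simp add: mult_map_scale_conv_mult[symmetric] map.rep_eq when_def)

lemma poly_mapping_sum_singles:
  "p = (\<Sum>t\<in>keys p. single t (lookup p t :: 'b::comm_monoid_add))"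
  by (rule poly_mapping_eqI) (simp add: lookup_sum lookup_single when_def in_keys_iff)

lemma poly_mapping_keys_induct [consumes 1, case_names zero single add]:
  assumes "keys (p :: 't \<Rightarrow>\<^sub>0 'b::comm_monoid_add) \<subseteq> A" and "P 0" and "\<And>t c. t \<in> A \<Longrightarrow> P (single t c)"
    and "\<And>p q. P p \<Longrightarrow> P q \<Longrightarrow> P (p + q)"
  shows "P p"
proof -
  have "finite F \<Longrightarrow> F \<subseteq> A \<Longrightarrow> P (\<Sum>t\<in>F. single t (lookup p t))" for F
    by (induction F rule: finite_induct) (use assms in auto)
  from this[of "keys p"] show ?thesis
    using assms(1) poly_mapping_sum_singles[of p] by simp
qed

lemma poly_mapping_induct [case_names zero single add]:
  assumes "P 0" and "\<And>t c. P (single t c)" and "\<And>p q. P p \<Longrightarrow> P q \<Longrightarrow> P (p + q)"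
  shows "P (p :: 't \<Rightarrow>\<^sub>0 'b::comm_monoid_add)"
  using poly_mapping_keys_induct[of p UNIV P] assms by auto

lemma cst_central: "p * cst c = cst c * (p :: 'm::monoid_add \<Rightarrow>\<^sub>0 'k::comm_ring_1)"
  by (induction p rule: poly_mapping_induct)
    (auto simp: mult_single algebra_simps)

lemma cst_left_commute: "p * (cst c * q) = cst c * (p * (q :: 'm::monoid_add \<Rightarrow>\<^sub>0 'k::comm_ring_1))"
  by (simp add: mult.assoc[symmetric] cst_central)

lemma cst_add: "cst (a + b) = cst a + (cst b :: 'm::monoid_add \<Rightarrow>\<^sub>0 'k::comm_ring_1)"
  by (simp add: single_add)

lemma cst_mult: "cst (a * b) = cst a * (cst b :: 'm::monoid_add \<Rightarrow>\<^sub>0 'k::comm_ring_1)"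
  by (simp add: mult_single)

lemma keys_cst_mult: "keys (cst c * p) \<subseteq> keys (p :: 'm::monoid_add \<Rightarrow>\<^sub>0 'k::comm_ring_1)"
  by (auto simp: in_keys_iff)

interpretation pm: vector_space "\<lambda>c (p :: 'm::monoid_add \<Rightarrow>\<^sub>0 'k::field). cst c * p"
  by unfold_locales (auto simp: algebra_simps cst_add cst_mult)

lemma bilinear_ext_add_left: "bilinear_ext f (p + q) r = bilinear_ext f p r + bilinear_ext f q r"
  unfolding bilinear_ext_def
  by (rule setsum_keys_plus_distrib) (auto simp: distrib_right single_add sum.distrib)

lemma bilinear_ext_add_right: "bilinear_ext f p (q + r) = bilinear_ext f p q + bilinear_ext f p r"
  unfolding bilinear_ext_def sum.distrib[symmetric]
  by (rule sum.cong[OF refl], rule setsum_keys_plus_distrib) (auto simp: distrib_left single_add)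

lemma bilinear_ext_0 [simp]: "bilinear_ext f 0 q = 0" "bilinear_ext f p 0 = 0"
  by (auto simp: bilinear_ext_def)

lemma bilinear_ext_single: "bilinear_ext f (single s a) (single t b) = single (f s t) (a * b)"
  by (auto simp: bilinear_ext_def)

lemma times_eq_bilinear_ext: "p * q = bilinear_ext (+) p (q :: 'm::monoid_add \<Rightarrow>\<^sub>0 'k::comm_ring_1)"
proof (induction p rule: poly_mapping_induct)
  case (single s a)
  show ?case
    by (induction q rule: poly_mapping_induct)
      (auto simp: bilinear_ext_single mult_single bilinear_ext_add_right distrib_left)
qed (auto simp: bilinear_ext_add_left distrib_right)

lemma bilinear_ext_append: "bilinear_ext (@) = ((*) :: ('a list \<Rightarrow>\<^sub>0 'k::comm_ring_1) \<Rightarrow> _)"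
  by (intro ext) (simp add: times_eq_bilinear_ext plus_list_def)

text \<open>The scalar multiplication is an argument because the targets are the Lie algebra, monoid
  algebras and sequences in a monoid algebra.\<close>

definition lin_ext :: "('k \<Rightarrow> 'b \<Rightarrow> 'b) \<Rightarrow> ('t \<Rightarrow> 'b::comm_monoid_add) \<Rightarrow> ('t \<Rightarrow>\<^sub>0 'k::zero) \<Rightarrow> 'b" where
  "lin_ext scale f p = (\<Sum>t\<in>keys p. scale (lookup p t) (f t))"

context
  fixes scale :: "'k::field \<Rightarrow> 'b::ab_group_add \<Rightarrow> 'b"
  assumes vs: "vector_space scale"
begin

interpretation vs: vector_space scale by (rule vs)

lemma lin_ext_single: "lin_ext scale f (single t c) = scale c (f t)"
  by (auto simp: lin_ext_def)

lemma lin_ext_0: "lin_ext scale f 0 = 0"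
  by (auto simp: lin_ext_def)

lemma lin_ext_add: "lin_ext scale f (p + q) = lin_ext scale f p + lin_ext scale f q"
  unfolding lin_ext_def by (rule setsum_keys_plus_distrib) (auto simp: vs.scale_left_distrib)

lemma lin_ext_scale: "lin_ext scale f (Poly_Mapping.map ((*) c) p) = scale c (lin_ext scale f p)"
proof -
  have "lin_ext scale f (Poly_Mapping.map ((*) c) p) = (\<Sum>t\<in>keys p. scale (c * lookup p t) (f t))"
    unfolding lin_ext_def
    by (rule sum.mono_neutral_cong_left) (auto simp: in_keys_iff map.rep_eq when_def)
  also have "\<dots> = scale c (lin_ext scale f p)"
    by (simp add: lin_ext_def vs.scale_sum_right)
  finally show ?thesis .
qed

lemma lin_ext_minus: "lin_ext scale f (- p) = - lin_ext scale f p"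
  using lin_ext_add[of f p "- p"] by (simp add: eq_neg_iff_add_eq_0 add.commute lin_ext_0)

lemma lin_ext_diff: "lin_ext scale f (p - q) = lin_ext scale f p - lin_ext scale f q"
  using lin_ext_add[of f p "- q"] by (simp add: lin_ext_minus)

lemma lin_ext_cst_mult:
  "lin_ext scale f (cst c * p) = scale c (lin_ext scale f (p :: 'm::monoid_add \<Rightarrow>\<^sub>0 'k))"
  using lin_ext_scale[of f c p] by (simp add: mult_map_scale_conv_mult)

end

abbreviation plin :: "('t \<Rightarrow> ('m::monoid_add \<Rightarrow>\<^sub>0 'k::field)) \<Rightarrow> ('t \<Rightarrow>\<^sub>0 'k) \<Rightarrow> ('m \<Rightarrow>\<^sub>0 'k)" where
  "plin \<equiv> lin_ext (\<lambda>c p. cst c * p)"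

lemmas plin_single [simp] = lin_ext_single[OF pm.vector_space_axioms]
  and plin_0 [simp] = lin_ext_0[OF pm.vector_space_axioms]
  and plin_add = lin_ext_add[OF pm.vector_space_axioms]
  and plin_minus = lin_ext_minus[OF pm.vector_space_axioms]
  and plin_diff = lin_ext_diff[OF pm.vector_space_axioms]
  and plin_cst_mult = lin_ext_cst_mult[OF pm.vector_space_axioms]

lemma plin_mult:
  fixes f :: "'t::monoid_add \<Rightarrow> ('m::monoid_add \<Rightarrow>\<^sub>0 'k::field)"
  assumes "\<And>s t. f (s + t) = f s * f t"
  shows "plin f (p * q) = plin f p * plin f q"
proof (induction p rule: poly_mapping_induct)
  case (single s a)
  show ?case
  proof (induction q rule: poly_mapping_induct)
    case (single t b)
    have "cst (a * b) * (f s * f t) = cst a * (cst b * (f s * f t))"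
      by (simp only: cst_mult mult.assoc)
    also have "cst b * (f s * f t) = f s * (cst b * f t)"
      by (rule cst_left_commute[symmetric])
    finally show ?case by (simp only: mult_single assms plin_single mult.assoc)
  qed (simp_all add: plin_add distrib_left)
qed (simp_all add: plin_add distrib_right)

definition free_words :: "'l set \<Rightarrow> ('l list \<Rightarrow>\<^sub>0 'k::comm_ring_1) set" where
  "free_words N = {p. keys p \<subseteq> lists N}"

lemma free_words_closed:
  "0 \<in> free_words N" "1 \<in> free_words N"
  "p \<in> free_words N \<Longrightarrow> q \<in> free_words N \<Longrightarrow> p + q \<in> free_words N"
  "p \<in> free_words N \<Longrightarrow> - p \<in> free_words N"
  "p \<in> free_words N \<Longrightarrow> q \<in> free_words N \<Longrightarrow> p - q \<in> free_words N"
  "p \<in> free_words N \<Longrightarrow> q \<in> free_words N \<Longrightarrow> p * q \<in> free_words N"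
  "p \<in> free_words N \<Longrightarrow> cst c * p \<in> free_words N"
  "xs \<in> lists N \<Longrightarrow> single xs c \<in> free_words N"
proof -
  assume *: "p \<in> free_words N" "q \<in> free_words N"
  show "p + q \<in> free_words N" using * keys_add[of p q] by (force simp: free_words_def)
  show "p - q \<in> free_words N" using * keys_diff[of p q] by (force simp: free_words_def)
  show "p * q \<in> free_words N" using * keys_mult[of p q] by (force simp: free_words_def plus_list_def)
next
  assume "p \<in> free_words N"
  then show "cst c * p \<in> free_words N" using keys_cst_mult[of c p] by (force simp: free_words_def)
qed (auto simp: free_words_def zero_list_def single_one[symmetric] simp del: single_one)

lemma single_Nil: "single [] 1 = (1 :: 'l list \<Rightarrow>\<^sub>0 'k::zero_neq_one)"
  by (simp add: zero_list_def[symmetric])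

lemma free_words_induct [consumes 1, case_names zero one Cons scale add]:
  assumes "p \<in> free_words N" and "P 0" and "P 1"
    and "\<And>x q. x \<in> N \<Longrightarrow> q \<in> free_words N \<Longrightarrow> P q \<Longrightarrow> P (single [x] 1 * q)"
    and "\<And>c q. q \<in> free_words N \<Longrightarrow> P q \<Longrightarrow> P (cst c * q)"
    and "\<And>p q. P p \<Longrightarrow> P q \<Longrightarrow> P (p + q)"
  shows "P p"
proof -
  have w: "P (single xs 1)" if "xs \<in> lists N" for xs
    using that
  proof (induction xs)
    case Nil
    then show ?case using assms(3) by (simp add: single_one[symmetric] zero_list_def del: single_one)
  next
    case (Cons x xs)
    then show ?case using assms(4)[of x "single xs 1"]
      by (auto simp: mult_single plus_list_def free_words_closed)
  qed
  have "keys p \<subseteq> lists N" using assms(1) by (simp add: free_words_def)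
  then show ?thesis
  proof (induction p rule: poly_mapping_keys_induct)
    case (single t c)
    then show ?case using w[of t] assms(5)[of "single t 1" c] by (simp add: mult_single free_words_closed)
  qed (use assms in auto)
qed

lemma free_assoc_simps [simp]:
  "carrier (free_assoc N) = free_words N"
  "mult (free_assoc N) = (*)" "one (free_assoc N) = 1"
  "zero (free_assoc N) = 0" "add (free_assoc N) = (+)"
  by (auto simp: free_assoc_def free_words_def bilinear_ext_append single_one[symmetric] zero_list_def
      simp del: single_one)

lemma ring_free_assoc: "ring (free_assoc N :: ('l list \<Rightarrow>\<^sub>0 'k::comm_ring_1) ring)"
proof (rule ringI)
  show "abelian_group (free_assoc N :: ('l list \<Rightarrow>\<^sub>0 'k) ring)"
  proof (rule abelian_groupI)
    fix x assume "x \<in> carrier (free_assoc N :: ('l list \<Rightarrow>\<^sub>0 'k) ring)"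
    then show "\<exists>y\<in>carrier (free_assoc N). y \<oplus>\<^bsub>free_assoc N\<^esub> x = \<zero>\<^bsub>free_assoc N\<^esub>"
      by (intro bexI[of _ "- x"]) (auto simp: free_words_closed)
  qed (simp_all add: free_words_closed add.assoc add.commute)
  show "Group.monoid (free_assoc N :: ('l list \<Rightarrow>\<^sub>0 'k) ring)"
    by (rule monoidI) (simp_all add: free_words_closed mult.assoc)
qed (simp_all add: distrib_left distrib_right)

section \<open>The ideal of enveloping relations\<close>

context lie_algebra
begin

text \<open>The ideal by which \<open>enveloping_algebra\<close> divides. Computations are done as
  congruences modulo it in the free algebra, not with residue classes.\<close>

definition env :: "'l set \<Rightarrow> ('l list \<Rightarrow>\<^sub>0 'k) set" where
  "env N = genideal (free_assoc N) (enveloping_relations scale bracket N)"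

lemma bracket_0 [simp]: "bracket 0 x = 0" "bracket x 0 = 0"
  using bracket_add_left[of 0 0 x] bracket_add_right[of x 0 0] by auto

lemma bracket_minus: "bracket (- x) y = - bracket x y" "bracket x (- y) = - bracket x y"
  using bracket_add_left[of x "- x" y] bracket_add_right[of x y "- y"]
  by (auto simp: eq_neg_iff_add_eq_0 add.commute)

lemma bracket_flip: "bracket x y = - bracket y x"
proof -
  have "bracket x y + bracket y x = 0"
    using bracket_self[of "x + y", unfolded bracket_add_left bracket_add_right] by (simp add: bracket_self add.commute)
  then show ?thesis by (simp add: eq_neg_iff_add_eq_0)
qed

lemma bracket_derivation: "bracket y (bracket x z) = bracket (bracket y x) z + bracket x (bracket y z)"
proof -
  have "bracket x (bracket z y) = - bracket x (bracket y z)" "bracket z (bracket y x) = - bracket (bracket y x) z"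
    using bracket_flip[of z y] bracket_flip[of z "bracket y x"] by (simp_all add: bracket_minus)
  then show ?thesis
    using jacobi[of y x z] by (simp only: add_eq_0_iff2 minus_add_distrib minus_minus add.commute add.assoc)
      (simp add: algebra_simps)
qed

lemma subalgebra_closed:
  assumes "lie_subalgebra N"
  shows "0 \<in> N" "x \<in> N \<Longrightarrow> y \<in> N \<Longrightarrow> x + y \<in> N" "x \<in> N \<Longrightarrow> y \<in> N \<Longrightarrow> x - y \<in> N"
    "x \<in> N \<Longrightarrow> scale c x \<in> N" "x \<in> N \<Longrightarrow> y \<in> N \<Longrightarrow> bracket x y \<in> N"
  using assms by (auto simp: lie_subalgebra_def subspace_0 subspace_add subspace_diff subspace_scale)

lemma enveloping_relations_free_words:
  assumes "lie_subalgebra N"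
  shows "enveloping_relations scale bracket N \<subseteq> free_words N"
  using subalgebra_closed[OF assms]
  by (auto simp: enveloping_relations_def intro!: free_words_closed)

context
  fixes N assumes N: "lie_subalgebra N"
begin

lemma ideal_env: "ideal (env N) (free_assoc N)"
  unfolding env_def
  by (rule ring.genideal_ideal[OF ring_free_assoc]) (use enveloping_relations_free_words[OF N] in simp)

lemma env_subset: "p \<in> env N \<Longrightarrow> p \<in> free_words N"
  using ideal.Icarr[OF ideal_env] by simp

lemma env_0: "0 \<in> env N"
  using additive_subgroup.zero_closed[OF ideal.axioms(1)[OF ideal_env]] by simp

lemma env_add: "p \<in> env N \<Longrightarrow> q \<in> env N \<Longrightarrow> p + q \<in> env N"
  using additive_subgroup.a_closed[OF ideal.axioms(1)[OF ideal_env], of p q] by simp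

lemma env_lmult: "p \<in> env N \<Longrightarrow> a \<in> free_words N \<Longrightarrow> a * p \<in> env N"
  using ideal.I_l_closed[OF ideal_env, of p a] by simp

lemma env_rmult: "p \<in> env N \<Longrightarrow> a \<in> free_words N \<Longrightarrow> p * a \<in> env N"
  using ideal.I_r_closed[OF ideal_env, of p a] by simp

lemma env_minus: "p \<in> env N \<Longrightarrow> - p \<in> env N"
proof -
  assume "p \<in> env N"
  moreover have "- 1 \<in> (free_words N :: ('l list \<Rightarrow>\<^sub>0 'k) set)" by (intro free_words_closed)
  ultimately show "- p \<in> env N" using env_lmult[of p "- 1"] by simp
qed

lemma env_diff: "p \<in> env N \<Longrightarrow> q \<in> env N \<Longrightarrow> p - q \<in> env N"
  using env_add[of p "- q"] env_minus[of q] by simp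

lemma env_cst_mult: "p \<in> env N \<Longrightarrow> cst c * p \<in> env N"
  by (rule env_lmult) (auto intro: free_words_closed simp: zero_list_def)

lemma env_relation: "r \<in> enveloping_relations scale bracket N \<Longrightarrow> r \<in> env N"
  unfolding env_def
  using ring.genideal_self[OF ring_free_assoc, of "enveloping_relations scale bracket N" N]
    enveloping_relations_free_words[OF N] by auto

lemma env_relation_add:
  "x \<in> N \<Longrightarrow> z \<in> N \<Longrightarrow> single [x + z] 1 - single [x] 1 - single [z] 1 \<in> env N"
  by (rule env_relation) (auto simp: enveloping_relations_def)

lemma env_relation_scale: "x \<in> N \<Longrightarrow> single [scale c x] 1 - cst c * single [x] 1 \<in> env N"
  by (rule env_relation) (auto simp: enveloping_relations_def mult_single zero_list_def plus_list_def)

lemma env_relation_bracket: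
  "x \<in> N \<Longrightarrow> z \<in> N \<Longrightarrow>
    single [x] 1 * single [z] 1 - single [z] 1 * single [x] 1 - single [bracket x z] 1 \<in> env N"
proof -
  assume *: "x \<in> N" "z \<in> N"
  have "single [x] 1 * single [z] 1 - single [z] 1 * single [x] 1 - single [bracket x z] 1
    = single [x, z] 1 - single [z, x] 1 - single [bracket x z] (1 :: 'k)"
    by (simp add: mult_single plus_list_def)
  then show ?thesis using * env_relation[of "single [x, z] 1 - single [z, x] 1 - single [bracket x z] 1"]
    unfolding enveloping_relations_def by auto
qed

text \<open>The elements of \<open>env N\<close> that satisfy \<open>P\<close> form a two-sided
  ideal that contains the relations; negatives come from left multiplication by -1.\<close>

lemma env_induct [consumes 1, case_names relation add lmult rmult]:
  assumes p: "p \<in> env N"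
    and rel: "\<And>r. r \<in> enveloping_relations scale bracket N \<Longrightarrow> P r"
    and add: "\<And>p q. P p \<Longrightarrow> P q \<Longrightarrow> P (p + q)"
    and lm: "\<And>a p. a \<in> free_words N \<Longrightarrow> P p \<Longrightarrow> P (a * p)"
    and rm: "\<And>a p. a \<in> free_words N \<Longrightarrow> P p \<Longrightarrow> P (p * a)"
  shows "P p"
proof -
  \<comment> \<open>Some relation is needed, since \<open>P 0\<close> comes from multiplying it by
    0.\<close>
  have "single [0 + 0] 1 - single [0] 1 - single [0] 1 \<in> enveloping_relations scale bracket N"
    using subalgebra_closed(1)[OF N] unfolding enveloping_relations_def by blast
  from lm[of 0, OF free_words_closed(1) rel[OF this]] have P0: "P 0" by simp
  have neg: "P (- p)" if "P p" for p
  proof -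
    have "- 1 \<in> (free_words N :: ('l list \<Rightarrow>\<^sub>0 'k) set)" by (intro free_words_closed)
    then show ?thesis using lm[of "- 1" p] that by simp
  qed
  have id: "ideal {p \<in> env N. P p} (free_assoc N)"
  proof (rule idealI[OF ring_free_assoc])
    show "subgroup {p \<in> env N. P p} (add_monoid (free_assoc N))"
    proof (rule group.subgroupI)
      show grp: "group (add_monoid (free_assoc N :: ('l list \<Rightarrow>\<^sub>0 'k) ring))"
        using ring_free_assoc abelian_group.a_group ring.is_abelian_group by blast
      show "{p \<in> env N. P p} \<noteq> {}" using P0 env_0 by auto
      fix a assume a: "a \<in> {p \<in> env N. P p}"
      have "inv\<^bsub>add_monoid (free_assoc N)\<^esub> a = - a"
        using a env_subset[of a] free_words_closed(4)[of a N] by (intro group.inv_equality[OF grp]) auto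
      then show "inv\<^bsub>add_monoid (free_assoc N)\<^esub> a \<in> {p \<in> env N. P p}"
        using a env_minus neg by auto
    qed (use env_subset add env_add in auto)
  qed (use lm rm env_lmult env_rmult in auto)
  have "env N \<subseteq> {p \<in> env N. P p}"
    unfolding env_def[of N]
    by (rule ring.genideal_minimal[OF ring_free_assoc id[unfolded env_def[of N]]])
      (use env_relation rel in \<open>auto simp: env_def[symmetric]\<close>)
  then show ?thesis using p by auto
qed

end

end

text \<open>A Lie homomorphism into a monoid algebra under the commutator. It induces
  \<open>\<Phi>\<close> on the free algebra, and \<open>U N\<close>, the associative subalgebra
  generated by the image of \<open>N\<close>, serves as a concrete candidate for the enveloping
  algebra of \<open>N\<close>.\<close>

locale lie_rep = lie_algebra scale bracket
  for scale :: "'k::field \<Rightarrow> 'l::ab_group_add \<Rightarrow> 'l" and bracket +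
  fixes \<theta> :: "'l \<Rightarrow> ('m::monoid_add \<Rightarrow>\<^sub>0 'k)"
  assumes \<theta>_add: "\<theta> (x + y) = \<theta> x + \<theta> y"
    and \<theta>_scale: "\<theta> (scale c x) = cst c * \<theta> x"
    and \<theta>_bracket: "\<theta> (bracket x y) = \<theta> x * \<theta> y - \<theta> y * \<theta> x"
begin

definition \<Phi> :: "('l list \<Rightarrow>\<^sub>0 'k) \<Rightarrow> ('m \<Rightarrow>\<^sub>0 'k)" where
  "\<Phi> = plin (\<lambda>xs. prod_list (map \<theta> xs))"

lemma \<Phi>_simps:
  "\<Phi> 0 = 0" "\<Phi> 1 = 1" "\<Phi> (p + q) = \<Phi> p + \<Phi> q" "\<Phi> (p - q) = \<Phi> p - \<Phi> q" "\<Phi> (- p) = - \<Phi> p"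
  "\<Phi> (p * q) = \<Phi> p * \<Phi> q" "\<Phi> (cst c) = cst c" "\<Phi> (single [x] c) = cst c * \<theta> x"
  "\<Phi> (single [x, y] c) = cst c * (\<theta> x * \<theta> y)"
proof -
  show c: "\<Phi> (cst c) = cst c" for c by (simp add: \<Phi>_def zero_list_def)
  show "\<Phi> 1 = 1" using c[of 1] by simp
  show "\<Phi> (p * q) = \<Phi> p * \<Phi> q" unfolding \<Phi>_def by (rule plin_mult) (simp add: plus_list_def)
qed (simp_all add: \<Phi>_def plin_add plin_diff plin_minus)

lemma \<Phi>_env:
  assumes N: "lie_subalgebra N" and p: "p \<in> env N"
  shows "\<Phi> p = 0"
  using p
proof (induction rule: env_induct[OF N, consumes 1, case_names relation add lmult rmult])
  case (relation r)
  then show ?case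
    by (auto simp: enveloping_relations_def \<Phi>_simps \<theta>_add \<theta>_scale \<theta>_bracket)
qed (auto simp: \<Phi>_simps)

definition U :: "'l set \<Rightarrow> ('m \<Rightarrow>\<^sub>0 'k) set" where
  "U N = \<Phi> ` free_words N"

lemma U_closed:
  "0 \<in> U N" "1 \<in> U N" "p \<in> U N \<Longrightarrow> q \<in> U N \<Longrightarrow> p + q \<in> U N" "p \<in> U N \<Longrightarrow> - p \<in> U N"
  "p \<in> U N \<Longrightarrow> q \<in> U N \<Longrightarrow> p - q \<in> U N" "p \<in> U N \<Longrightarrow> q \<in> U N \<Longrightarrow> p * q \<in> U N"
  "p \<in> U N \<Longrightarrow> cst c * p \<in> U N" "x \<in> N \<Longrightarrow> \<theta> x \<in> U N"
proof -
  show "0 \<in> U N" unfolding U_def by (rule image_eqI[of _ _ 0]) (simp_all add: \<Phi>_simps free_words_closed)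
  show "1 \<in> U N" unfolding U_def by (rule image_eqI[of _ _ 1]) (simp_all add: \<Phi>_simps free_words_closed)
  show "x \<in> N \<Longrightarrow> \<theta> x \<in> U N"
    unfolding U_def by (rule image_eqI[of _ _ "single [x] 1"]) (auto simp: \<Phi>_simps intro: free_words_closed)
  assume "p \<in> U N"
  then obtain a where a: "p = \<Phi> a" "a \<in> free_words N" by (auto simp: U_def)
  show "- p \<in> U N" "cst c * p \<in> U N"
    unfolding U_def
    by (rule image_eqI[of _ _ "- a"], use a in \<open>simp_all add: \<Phi>_simps free_words_closed\<close>)
      (rule image_eqI[of _ _ "cst c * a"], use a in \<open>simp_all add: \<Phi>_simps free_words_closed\<close>)
  assume "q \<in> U N"
  then obtain b where b: "q = \<Phi> b" "b \<in> free_words N" by (auto simp: U_def)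
  show "p + q \<in> U N" "p - q \<in> U N" "p * q \<in> U N"
    unfolding U_def
    by (rule image_eqI[of _ _ "a + b"], use a b in \<open>simp_all add: \<Phi>_simps free_words_closed\<close>)
      ((rule image_eqI[of _ _ "a - b"], use a b in \<open>simp_all add: \<Phi>_simps free_words_closed\<close>),
       (rule image_eqI[of _ _ "a * b"], use a b in \<open>simp_all add: \<Phi>_simps free_words_closed\<close>))
qed

lemma U_induct [consumes 1, case_names zero one mult scale add]:
  assumes "u \<in> U N" and "P 0" and "P 1"
    and "\<And>x q. x \<in> N \<Longrightarrow> q \<in> U N \<Longrightarrow> P q \<Longrightarrow> P (\<theta> x * q)"
    and "\<And>c q. q \<in> U N \<Longrightarrow> P q \<Longrightarrow> P (cst c * q)"
    and "\<And>p q. P p \<Longrightarrow> P q \<Longrightarrow> P (p + q)"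
  shows "P u"
proof -
  obtain a where a: "u = \<Phi> a" "a \<in> free_words N" using assms(1) by (auto simp: U_def)
  from a(2) have "P (\<Phi> a)"
    by (induction a rule: free_words_induct) (use assms in \<open>auto simp: \<Phi>_simps U_def\<close>)
  then show ?thesis by (simp add: a)
qed

end


section \<open>Subalgebras of codimension one\<close>

text \<open>As \<open>\<xi>\<close> vanishes on brackets, \<open>N\<close> is the semidirect product
  of the ideal \<open>ker\<close> and the line of \<open>y\<close>. Its enveloping algebra is
  therefore a skew polynomial ring in \<open>y\<close> over that of \<open>ker\<close>, twisted by
  the derivation that bracketing with \<open>y\<close> induces.\<close>

locale codim_one_subalgebra = lie_algebra scale bracket
  for scale :: "'k::field \<Rightarrow> 'l::ab_group_add \<Rightarrow> 'l" and bracket +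
  fixes N :: "'l set" and \<xi> :: "'l \<Rightarrow> 'k" and y :: 'l
  assumes N: "lie_subalgebra N"
    and \<xi>_add: "\<xi> (x + z) = \<xi> x + \<xi> z"
    and \<xi>_scale: "\<xi> (scale c x) = c * \<xi> x"
    and \<xi>_bracket: "\<xi> (bracket x z) = 0"
    and y: "y \<in> N" "\<xi> y = 1"
begin

abbreviation ker :: "'l set" where "ker \<equiv> {x \<in> N. \<xi> x = 0}"

lemma \<xi>_0: "\<xi> 0 = 0"
  using \<xi>_scale[of 0 0] by simp

lemma \<xi>_diff: "\<xi> (x - z) = \<xi> x - \<xi> z"
  using \<xi>_add[of "x - z" z] by simp

lemma lie_subalgebra_ker: "lie_subalgebra ker"
  using N unfolding lie_subalgebra_def subspace_def
  by (auto simp: \<xi>_0 \<xi>_add \<xi>_scale \<xi>_bracket)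

definition proj :: "'l \<Rightarrow> 'l" where
  "proj x = x - scale (\<xi> x) y"

lemma proj_ker: "x \<in> N \<Longrightarrow> proj x \<in> ker"
  using subalgebra_closed[OF N] y by (auto simp: proj_def \<xi>_diff \<xi>_scale)

lemma proj_add: "proj (x + z) = proj x + proj z"
  by (simp add: proj_def \<xi>_add scale_left_distrib)

lemma proj_scale: "proj (scale c x) = scale c (proj x)"
  by (simp add: proj_def \<xi>_scale scale_right_diff_distrib)

lemma bracket_y_ker: "x \<in> ker \<Longrightarrow> bracket y x \<in> ker"
  using subalgebra_closed[OF N] y by (auto simp: \<xi>_bracket)

text \<open>The derivation of the free algebra that is \<open>bracket y\<close> on letters, here on
  single words.\<close>

primrec word_deriv :: "'l list \<Rightarrow> ('l list \<Rightarrow>\<^sub>0 'k)" where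
  "word_deriv [] = 0"
| "word_deriv (x # xs) = single (bracket y x # xs) 1 + single [x] 1 * word_deriv xs"

definition deriv :: "('l list \<Rightarrow>\<^sub>0 'k) \<Rightarrow> ('l list \<Rightarrow>\<^sub>0 'k)" where
  "deriv = plin word_deriv"

lemma deriv_simps:
  "deriv 0 = 0" "deriv (p + q) = deriv p + deriv q" "deriv (p - q) = deriv p - deriv q"
  "deriv (cst c * p) = cst c * deriv p" "deriv (single xs c) = cst c * word_deriv xs"
  "deriv 1 = 0"
proof -
  show s: "deriv (single xs c) = cst c * word_deriv xs" for xs c by (simp add: deriv_def)
  show "deriv 1 = 0" using s[of "[]" 1] by (simp add: single_Nil)
qed (simp_all add: deriv_def plin_add plin_diff plin_cst_mult)

lemma word_deriv_append:
  "word_deriv (xs @ ys) = word_deriv xs * single ys 1 + single xs 1 * word_deriv ys"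
proof (induction xs)
  case Nil
  show ?case by (simp add: single_Nil)
next
  case (Cons x xs)
  have "single (x # xs) 1 = (single [x] 1 * single xs 1 :: 'l list \<Rightarrow>\<^sub>0 'k)"
    "single (bracket y x # xs @ ys) 1 = (single (bracket y x # xs) 1 * single ys 1 :: 'l list \<Rightarrow>\<^sub>0 'k)"
    by (simp_all add: mult_single plus_list_def)
  then show ?case using Cons by (simp add: distrib_left distrib_right mult.assoc)
qed

lemma deriv_mult: "deriv (p * q) = deriv p * q + p * deriv q"
proof (induction p rule: poly_mapping_induct)
  case (single s a)
  show ?case
  proof (induction q rule: poly_mapping_induct)
    case (single t b)
    have "deriv (single s a * single t b)
        = cst (a * b) * (word_deriv s * single t 1) + cst (a * b) * (single s 1 * word_deriv t)"
      by (simp add: mult_single deriv_simps plus_list_def word_deriv_append distrib_left)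
    also have "cst (a * b) * (word_deriv s * single t 1) = cst a * (word_deriv s * (cst b * single t 1))"
      by (simp only: cst_mult mult.assoc cst_left_commute[of "word_deriv s"])
    also have "\<dots> = deriv (single s a) * single t b"
      by (simp add: deriv_simps mult.assoc mult_single)
    also have "cst (a * b) * (single s 1 * word_deriv t) = (cst a * single s 1) * (cst b * word_deriv t)"
      by (simp only: cst_mult mult.assoc cst_left_commute[of "single s 1"])
    also have "\<dots> = single s a * deriv (single t b)"
      by (simp add: deriv_simps mult_single)
    finally show ?case .
  qed (simp_all add: deriv_simps algebra_simps)
qed (simp_all add: deriv_simps algebra_simps)

lemma deriv_single_mult: "deriv (single [x] 1 * p) = single [bracket y x] 1 * p + single [x] 1 * deriv p"
  by (simp add: deriv_mult deriv_simps)

lemma deriv_free_words: "p \<in> free_words ker \<Longrightarrow> deriv p \<in> free_words ker"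
proof (induction rule: free_words_induct)
  case (Cons x q)
  then show ?case using bracket_y_ker[of x]
    unfolding deriv_single_mult by (intro free_words_closed) auto
qed (auto simp: deriv_simps free_words_closed)

lemmas env_ker_0 = env_0[OF lie_subalgebra_ker] and env_ker_add = env_add[OF lie_subalgebra_ker]
  and env_ker_diff = env_diff[OF lie_subalgebra_ker] and env_ker_lmult = env_lmult[OF lie_subalgebra_ker]
  and env_ker_rmult = env_rmult[OF lie_subalgebra_ker] and env_ker_cst = env_cst_mult[OF lie_subalgebra_ker]

text \<open>By the Leibniz rule it is enough to look at the relations, where the one for brackets is
  mapped to a combination of relations by the Jacobi identity. The induction also carries
  \<open>p \<in> env ker\<close>, because \<open>deriv (a * p)\<close> contains the term
  \<open>deriv a * p\<close>.\<close>

lemma deriv_env: "p \<in> env ker \<Longrightarrow> deriv p \<in> env ker"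
proof -
  assume "p \<in> env ker"
  then have "p \<in> env ker \<and> deriv p \<in> env ker"
  proof (induction rule: env_induct[OF lie_subalgebra_ker, consumes 1, case_names relation add lmult rmult])
    case (relation r)
    have "deriv r \<in> env ker"
      using relation unfolding enveloping_relations_def
    proof (elim UnE CollectE exE conjE)
      fix x z assume r: "r = single [x + z] 1 - single [x] 1 - single [z] 1" and xz: "x \<in> N" "\<xi> x = 0" "z \<in> N" "\<xi> z = 0"
      show ?thesis
        using env_relation_add[OF lie_subalgebra_ker, of "bracket y x" "bracket y z"] bracket_y_ker xz
        by (simp add: r deriv_simps bracket_add_right)
    next
      fix c x assume r: "r = single [scale c x] 1 - single [x] c" and x: "x \<in> N" "\<xi> x = 0"
      show ?thesis
        using env_relation_scale[OF lie_subalgebra_ker, of "bracket y x" c] bracket_y_ker x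
        by (simp add: r deriv_simps bracket_scale_right)
    next
      fix x z assume r: "r = single [x, z] 1 - single [z, x] 1 - single [bracket x z] 1"
        and xz: "x \<in> N" "\<xi> x = 0" "z \<in> N" "\<xi> z = 0"
      let ?s = "\<lambda>x. single [x] (1 :: 'k)"
      let ?A = "bracket y x" and ?B = "bracket y z"
      have AB: "?A \<in> ker" "?B \<in> ker" using bracket_y_ker xz by auto
      have "deriv r = ?s ?A * ?s z + ?s x * ?s ?B - (?s ?B * ?s x + ?s z * ?s ?A) - ?s (bracket ?A z + bracket x ?B)"
        by (simp add: r deriv_simps bracket_derivation[of y x z] mult_single plus_list_def)
      also have "\<dots> = (?s ?A * ?s z - ?s z * ?s ?A - ?s (bracket ?A z))
          + (?s x * ?s ?B - ?s ?B * ?s x - ?s (bracket x ?B))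
          - (?s (bracket ?A z + bracket x ?B) - ?s (bracket ?A z) - ?s (bracket x ?B))"
        by (simp add: algebra_simps)
      also have "\<dots> \<in> env ker"
      proof (rule env_ker_diff[OF env_ker_add])
        have xz': "x \<in> ker" "z \<in> ker" using xz by auto
        show "?s ?A * ?s z - ?s z * ?s ?A - ?s (bracket ?A z) \<in> env ker"
          "?s x * ?s ?B - ?s ?B * ?s x - ?s (bracket x ?B) \<in> env ker"
          using env_relation_bracket[OF lie_subalgebra_ker] AB xz' by blast+
        show "?s (bracket ?A z + bracket x ?B) - ?s (bracket ?A z) - ?s (bracket x ?B) \<in> env ker"
          by (rule env_relation_add[OF lie_subalgebra_ker]) (use AB xz' subalgebra_closed(5)[OF lie_subalgebra_ker] in blast)+
      qed
      finally show ?thesis .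
    qed
    then show ?case using relation env_relation[OF lie_subalgebra_ker] by auto
  next
    case (add p q)
    then show ?case by (auto simp: deriv_simps intro: env_ker_add)
  next
    case (lmult a p)
    then show ?case
      by (auto simp: deriv_mult intro!: env_ker_add env_ker_lmult deriv_free_words)
  next
    case (rmult a p)
    then show ?case
      by (auto simp: deriv_mult intro!: env_ker_add env_ker_rmult deriv_free_words)
  qed
  then show "deriv p \<in> env ker" ..
qed

text \<open>The action of the free algebra on polynomials in a variable for \<open>y\<close> with coefficients
  in the free algebra on the kernel of \<open>\<xi>\<close>.\<close>

definition y_op :: "(nat \<Rightarrow> ('l list \<Rightarrow>\<^sub>0 'k)) \<Rightarrow> nat \<Rightarrow> ('l list \<Rightarrow>\<^sub>0 'k)" where
  "y_op f = (\<lambda>j. deriv (f j) + (if j = 0 then 0 else f (j - 1)))"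

text \<open>If \<open>f\<close> stands for the polynomial with the terms \<open>f j * y ^ j\<close>,
  this is left multiplication by \<open>x\<close>, split as \<open>proj x\<close> plus a multiple of
  \<open>y\<close>. Moving \<open>y\<close> past a coefficient \<open>a\<close> produces
  \<open>a * y + deriv a\<close>, which is \<open>y_op\<close>.\<close>

definition op :: "'l \<Rightarrow> (nat \<Rightarrow> ('l list \<Rightarrow>\<^sub>0 'k)) \<Rightarrow> nat \<Rightarrow> ('l list \<Rightarrow>\<^sub>0 'k)" where
  "op x f = (\<lambda>j. single [proj x] 1 * f j + cst (\<xi> x) * y_op f j)"

definition act :: "('l list \<Rightarrow>\<^sub>0 'k) \<Rightarrow> (nat \<Rightarrow> ('l list \<Rightarrow>\<^sub>0 'k)) \<Rightarrow> nat \<Rightarrow> ('l list \<Rightarrow>\<^sub>0 'k)" where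
  "act p f = lin_ext (\<lambda>c g j. cst c * g j) (\<lambda>xs. foldr op xs f) p"

lemma vs_fun: "vector_space (\<lambda>c (g :: nat \<Rightarrow> ('l list \<Rightarrow>\<^sub>0 'k)) j. cst c * g j)"
proof unfold_locales
  show "(\<lambda>j. cst a * (cst b * g j)) = (\<lambda>j. cst (a * b) * g j)" for a b and g :: "nat \<Rightarrow> ('l list \<Rightarrow>\<^sub>0 'k)"
    by (simp only: cst_mult mult.assoc)
qed (simp_all add: fun_eq_iff distrib_left distrib_right cst_add)

lemma op_add: "op x (\<lambda>j. f j + g j) = (\<lambda>j. op x f j + op x g j)"
  by (auto simp: op_def y_op_def fun_eq_iff deriv_simps algebra_simps)

lemma op_cst: "op x (\<lambda>j. cst c * f j) = (\<lambda>j. cst c * op x f j)"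
proof
  fix j
  have "y_op (\<lambda>j. cst c * f j) j = cst c * y_op f j"
    by (auto simp: y_op_def deriv_simps distrib_left)
  then show "op x (\<lambda>j. cst c * f j) j = cst c * op x f j"
    by (simp add: op_def distrib_left cst_left_commute[of "single [proj x] 1"] cst_left_commute[of "cst (\<xi> x)"])
qed

lemma foldr_op_add: "foldr op xs (\<lambda>j. f j + g j) = (\<lambda>j. foldr op xs f j + foldr op xs g j)"
  by (induction xs) (auto simp: op_add)

lemma foldr_op_cst: "foldr op xs (\<lambda>j. cst c * f j) = (\<lambda>j. cst c * foldr op xs f j)"
  by (induction xs) (auto simp: op_cst)

lemma act_simps:
  "act 0 f = (\<lambda>j. 0)" "act (p + q) f = (\<lambda>j. act p f j + act q f j)"
  "act (p - q) f = (\<lambda>j. act p f j - act q f j)"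
  "act (single xs c) f = (\<lambda>j. cst c * foldr op xs f j)" "act 1 f = f"
proof -
  show s: "act (single xs c) f = (\<lambda>j. cst c * foldr op xs f j)" for xs c
    by (simp add: act_def lin_ext_single[OF vs_fun])
  show "act 1 f = f" using s[of "[]" 1] by (simp add: single_Nil)
qed (simp_all add: act_def lin_ext_0[OF vs_fun] lin_ext_add[OF vs_fun] lin_ext_diff[OF vs_fun] fun_eq_iff)

lemma act_right:
  "act p (\<lambda>j. f j + g j) = (\<lambda>j. act p f j + act p g j)" "act p (\<lambda>j. cst c * f j) = (\<lambda>j. cst c * act p f j)"
proof -
  show "act p (\<lambda>j. f j + g j) = (\<lambda>j. act p f j + act p g j)"
    by (induction p rule: poly_mapping_induct) (simp_all add: act_simps foldr_op_add algebra_simps)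
  show "act p (\<lambda>j. cst c * f j) = (\<lambda>j. cst c * act p f j)"
  proof (induction p rule: poly_mapping_induct)
    case (single t a)
    show ?case
      by (simp only: act_simps foldr_op_cst mult.assoc[symmetric] cst_central[of "cst a" c])
  qed (simp_all add: act_simps distrib_left)
qed

lemma act_right_0: "act p (\<lambda>j. 0) = (\<lambda>j. 0)"
  using act_right(2)[of p 0 "\<lambda>j. 0"] by simp

lemma act_mult: "act (p * q) f = act p (act q f)"
proof (induction p rule: poly_mapping_induct)
  case (single s a)
  show ?case
  proof (induction q rule: poly_mapping_induct)
    case (single t b)
    show ?case
      by (simp add: mult_single act_simps plus_list_def foldr_op_cst cst_mult mult.assoc)
  qed (simp_all add: act_simps act_right act_right_0 distrib_left foldr_op_add)
qed (simp_all add: act_simps distrib_right)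

lemma act_Cons: "act (single [x] 1 * p) f = op x (act p f)"
  by (simp add: act_mult act_simps)

definition coeffs_in :: "('l list \<Rightarrow>\<^sub>0 'k) set \<Rightarrow> (nat \<Rightarrow> ('l list \<Rightarrow>\<^sub>0 'k)) set" where
  "coeffs_in S = {f. \<forall>j. f j \<in> S}"

lemma proj_ker_free: "x \<in> N \<Longrightarrow> single [proj x] c \<in> free_words ker"
  using proj_ker[of x] by (intro free_words_closed) auto

lemma op_coeffs_in:
  "x \<in> N \<Longrightarrow> f \<in> coeffs_in (free_words ker) \<Longrightarrow> op x f \<in> coeffs_in (free_words ker)"
  "x \<in> N \<Longrightarrow> f \<in> coeffs_in (env ker) \<Longrightarrow> op x f \<in> coeffs_in (env ker)"
proof -
  assume x: "x \<in> N"
  show "f \<in> coeffs_in (free_words ker) \<Longrightarrow> op x f \<in> coeffs_in (free_words ker)"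
    by (auto simp: coeffs_in_def op_def y_op_def intro!: free_words_closed(1,3,6,7) proj_ker_free deriv_free_words x)
  show "f \<in> coeffs_in (env ker) \<Longrightarrow> op x f \<in> coeffs_in (env ker)"
    by (auto simp: coeffs_in_def op_def y_op_def
        intro!: env_ker_0 env_ker_add env_ker_cst env_ker_lmult proj_ker_free deriv_env x)
qed

lemma act_cst: "act (cst c * q) f = (\<lambda>j. cst c * act q f j)"
  by (simp add: act_mult act_simps zero_list_def)

lemma act_coeffs_in_free:
  "p \<in> free_words N \<Longrightarrow> f \<in> coeffs_in (free_words ker) \<Longrightarrow> act p f \<in> coeffs_in (free_words ker)"
proof (induction p rule: free_words_induct)
  case (scale c q)
  then show ?case unfolding act_cst by (auto simp: coeffs_in_def intro: free_words_closed(7))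
next
  case (Cons x q)
  then show ?case unfolding act_Cons by (intro op_coeffs_in)
qed (auto simp: act_simps coeffs_in_def intro: free_words_closed)

lemma act_coeffs_in_env:
  "p \<in> free_words N \<Longrightarrow> f \<in> coeffs_in (env ker) \<Longrightarrow> act p f \<in> coeffs_in (env ker)"
proof (induction p rule: free_words_induct)
  case (scale c q)
  then show ?case unfolding act_cst by (auto simp: coeffs_in_def intro: env_ker_cst)
next
  case (Cons x q)
  then show ?case unfolding act_Cons by (intro op_coeffs_in)
qed (auto simp: act_simps coeffs_in_def intro: env_ker_0 env_ker_add)

lemma y_op_single_mult:
  "y_op (\<lambda>j. single [m] 1 * f j) j = single [bracket y m] 1 * f j + single [m] 1 * y_op f j"
  by (auto simp: y_op_def deriv_single_mult algebra_simps)

lemma y_op_add: "y_op (\<lambda>j. f j + g j) j = y_op f j + y_op g j"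
  by (auto simp: y_op_def deriv_simps algebra_simps)

lemma y_op_cst: "y_op (\<lambda>j. cst c * f j) j = cst c * y_op f j"
  by (auto simp: y_op_def deriv_simps distrib_left)

lemma op_op:
  "op x (op z f) j = single [proj x] 1 * single [proj z] 1 * f j
    + cst (\<xi> z) * (single [proj x] 1 * y_op f j)
    + cst (\<xi> x) * (single [bracket y (proj z)] 1 * f j + single [proj z] 1 * y_op f j)
    + cst (\<xi> x * \<xi> z) * y_op (y_op f) j"
proof -
  have "y_op (op z f) j = single [bracket y (proj z)] 1 * f j + single [proj z] 1 * y_op f j
      + cst (\<xi> z) * y_op (y_op f) j"
    by (simp only: op_def[of z] y_op_add y_op_cst y_op_single_mult)
  moreover have "op z f j = single [proj z] 1 * f j + cst (\<xi> z) * y_op f j"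
    by (simp add: op_def)
  ultimately show ?thesis
    by (simp only: op_def[of x] distrib_left mult.assoc cst_mult add.assoc cst_left_commute[of "single [proj x] 1"])
qed

lemma bracket_proj:
  "bracket x z = bracket (proj x) (proj z) + scale (\<xi> x) (bracket y (proj z)) - scale (\<xi> z) (bracket y (proj x))"
proof -
  have x: "x = proj x + scale (\<xi> x) y" and z: "z = proj z + scale (\<xi> z) y"
    by (simp_all add: proj_def)
  have "bracket x z = bracket (proj x + scale (\<xi> x) y) (proj z + scale (\<xi> z) y)"
    using x z by simp
  also have "\<dots> = bracket (proj x) (proj z) + scale (\<xi> x) (bracket y (proj z)) + scale (\<xi> z) (bracket (proj x) y)"
    by (simp add: bracket_add_left bracket_add_right bracket_scale_left bracket_scale_right bracket_self)
  also have "bracket (proj x) y = - bracket y (proj x)" by (rule bracket_flip)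
  finally show ?thesis by simp
qed

lemma env_ker_linear:
  assumes "u \<in> ker" "v \<in> ker" "w \<in> ker"
  shows "single [u] 1 + cst c * single [v] 1 - cst d * single [w] 1 - single [u + scale c v - scale d w] 1 \<in> env ker"
proof -
  let ?s = "\<lambda>x. single [x] (1 :: 'k)"
  note cl = subalgebra_closed[OF lie_subalgebra_ker]
  have cv: "scale c v \<in> ker" and dw: "scale d w \<in> ker"
    by (rule cl(4)[OF assms(2)], rule cl(4)[OF assms(3)])
  have 1: "?s (u + scale c v) - ?s u - ?s (scale c v) \<in> env ker"
    by (rule env_relation_add[OF lie_subalgebra_ker assms(1) cv])
  have 2: "?s (scale c v) - cst c * ?s v \<in> env ker" "?s (scale d w) - cst d * ?s w \<in> env ker"
    by (rule env_relation_scale[OF lie_subalgebra_ker assms(2)], rule env_relation_scale[OF lie_subalgebra_ker assms(3)])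
  have 3: "?s ((u + scale c v - scale d w) + scale d w) - ?s (u + scale c v - scale d w) - ?s (scale d w) \<in> env ker"
    by (rule env_relation_add[OF lie_subalgebra_ker cl(3)[OF cl(2)[OF assms(1) cv] dw] dw])
  have "?s u + cst c * ?s v - cst d * ?s w - ?s (u + scale c v - scale d w)
    = (?s ((u + scale c v - scale d w) + scale d w) - ?s (u + scale c v - scale d w) - ?s (scale d w))
      + (?s (scale d w) - cst d * ?s w) - (?s (scale c v) - cst c * ?s v)
      - (?s (u + scale c v) - ?s u - ?s (scale c v))"
  proof -
    have "B + V - W - E = (A - E - D) + (D - W) - (C - V) - (A - B - C)"
      for A B C D E V W :: "'l list \<Rightarrow>\<^sub>0 'k" by simp
    then show ?thesis by (simp only: diff_add_cancel)
  qed
  also have "\<dots> \<in> env ker"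
    by (rule env_ker_diff[OF env_ker_diff[OF env_ker_add[OF 3 2(2)] 2(1)] 1])
  finally show ?thesis .
qed

text \<open>Only the bracket relation needs an argument. In the difference of the two orders of
  \<open>op_op\<close> all terms with \<open>y_op\<close> cancel. What remains is the bracket
  relation of \<open>proj x\<close> and \<open>proj z\<close>, plus the linearity relation for the
  decomposition of \<open>bracket x z\<close> in \<open>bracket_proj\<close>, both relations of
  \<open>ker\<close>.\<close>

lemma act_relation:
  assumes r: "r \<in> enveloping_relations scale bracket N" and f: "f \<in> coeffs_in (free_words ker)"
  shows "act r f \<in> coeffs_in (env ker)"
  using r unfolding enveloping_relations_def
proof (elim UnE CollectE exE conjE)
  note f' = f[unfolded coeffs_in_def, simplified, rule_format]
  let ?s = "\<lambda>x. single [x] (1 :: 'k)"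
  {
    fix x z assume r: "r = ?s (x + z) - ?s x - ?s z" and xz: "x \<in> N" "z \<in> N"
    have "act r f j = (?s (proj x + proj z) - ?s (proj x) - ?s (proj z)) * f j" for j
    proof -
      have "S * F + (a + b) * Y - (P * F + a * Y) - (Q * F + b * Y) = (S - P - Q) * F"
        for S F a b Y P Q :: "'l list \<Rightarrow>\<^sub>0 'k" by (simp add: algebra_simps)
      then show ?thesis by (simp add: r act_simps op_def proj_add \<xi>_add cst_add)
    qed
    then show ?thesis
      using env_relation_add[OF lie_subalgebra_ker proj_ker[OF xz(1)] proj_ker[OF xz(2)]] f'
      by (auto simp: coeffs_in_def intro: env_ker_rmult)
  next
    fix c x assume r: "r = ?s (scale c x) - single [x] c" and x: "x \<in> N"
    have "act r f j = (?s (scale c (proj x)) - cst c * ?s (proj x)) * f j" for j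
    proof -
      have "S * F + (a * b) * Y - a * (P * F + b * Y) = (S - a * P) * F"
        for S F a b Y P :: "'l list \<Rightarrow>\<^sub>0 'k" by (simp add: algebra_simps)
      moreover have "act r f j = op (scale c x) f j - cst c * op x f j" by (simp add: r act_simps)
      ultimately show ?thesis by (simp only: op_def proj_scale \<xi>_scale cst_mult)
    qed
    then show ?thesis
      using env_relation_scale[OF lie_subalgebra_ker proj_ker[OF x], of c] f'
      by (auto simp: coeffs_in_def intro: env_ker_rmult)
  next
    fix x z assume r: "r = single [x, z] 1 - single [z, x] 1 - ?s (bracket x z)" and xz: "x \<in> N" "z \<in> N"
    let ?m = "proj x" and ?n = "proj z" and ?a = "\<xi> x" and ?b = "\<xi> z"
    have m: "?m \<in> ker" "?n \<in> ker" using proj_ker xz by auto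
    have br: "proj (bracket x z) = bracket x z" by (simp add: proj_def \<xi>_bracket)
    have "act r f j = op x (op z f) j - op z (op x f) j - ?s (bracket x z) * f j" for j
      by (simp add: r act_simps) (simp add: op_def[of "bracket x z"] br \<xi>_bracket)
    moreover have "P * Q * F + b * (P * Y) + a * (B * F + Q * Y) + c * YY
        - (Q * P * F + a * (Q * Y) + b * (A * F + P * Y) + c * YY) - Z * F
        = (P * Q - Q * P - W) * F + (W + a * B - b * A - Z) * F"
      for P Q F a b c Y YY A B Z W :: "'l list \<Rightarrow>\<^sub>0 'k" by (simp add: algebra_simps)
    ultimately have eq: "act r f j = (?s ?m * ?s ?n - ?s ?n * ?s ?m - ?s (bracket ?m ?n)) * f j
        + (?s (bracket ?m ?n) + cst ?a * ?s (bracket y ?n) - cst ?b * ?s (bracket y ?m) - ?s (bracket x z)) * f j" for j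
      by (simp only: op_op mult.commute[of ?b ?a])
    have 1: "?s ?m * ?s ?n - ?s ?n * ?s ?m - ?s (bracket ?m ?n) \<in> env ker"
      by (rule env_relation_bracket[OF lie_subalgebra_ker m])
    have 2: "?s (bracket ?m ?n) + cst ?a * ?s (bracket y ?n) - cst ?b * ?s (bracket y ?m) - ?s (bracket x z) \<in> env ker"
      unfolding bracket_proj[of x z]
      by (rule env_ker_linear[OF subalgebra_closed(5)[OF lie_subalgebra_ker m] bracket_y_ker[OF m(2)] bracket_y_ker[OF m(1)]])
    show ?thesis
      unfolding coeffs_in_def by (auto simp: eq intro!: env_ker_add env_ker_rmult[OF 1] env_ker_rmult[OF 2] f')
  }
qed

lemma act_env:
  assumes p: "p \<in> env N"
  shows "f \<in> coeffs_in (free_words ker) \<Longrightarrow> act p f \<in> coeffs_in (env ker)"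
  using p
proof (induction arbitrary: f rule: env_induct[OF N, consumes 1, case_names relation add lmult rmult])
  case (relation r)
  then show ?case by (intro act_relation)
next
  case (add p q)
  then show ?case by (auto simp: act_simps coeffs_in_def intro: env_ker_add)
next
  case (lmult a p)
  then show ?case by (simp add: act_mult act_coeffs_in_env)
next
  case (rmult a p)
  then show ?case by (simp add: act_mult act_coeffs_in_free)
qed

lemma act_ker: "p \<in> free_words ker \<Longrightarrow> act p f = (\<lambda>j. p * f j)"
proof (induction rule: free_words_induct)
  case (Cons x q)
  then show ?case unfolding act_Cons by (simp add: op_def proj_def mult.assoc)
next
  case (scale c q)
  then show ?case unfolding act_cst by (simp add: mult.assoc)
qed (simp_all add: act_simps distrib_right)

lemma act_y_power:
  "(\<lambda>j. act (single [y] 1 ^ i) (\<lambda>j. if j = 0 then 1 else 0) j - (if j = i then 1 else 0)) \<in> coeffs_in (env ker)"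
proof (induction i)
  case 0
  then show ?case by (auto simp: act_simps coeffs_in_def intro: env_ker_0)
next
  case (Suc i)
  let ?e = "\<lambda>i j. if j = i then 1 else 0 :: 'l list \<Rightarrow>\<^sub>0 'k"
  let ?g = "act (single [y] 1 ^ i) (?e 0)"
  \<comment> \<open>\<open>proj y\<close> is the zero vector, but its letter is not zero in the free
    algebra. It vanishes only modulo \<open>env ker\<close>, so powers of \<open>y\<close> act as
    shifts only up to such terms.\<close>
  have s0: "single [0] 1 \<in> env ker"
    using env_relation_scale[OF lie_subalgebra_ker, of 0 0] env_0[OF lie_subalgebra_ker] \<xi>_0 subalgebra_closed(1)[OF N] by simp
  have ei: "op y (?e i) j - ?e (Suc i) j = single [0] 1 * ?e i j" for j
    by (auto simp: op_def y_op_def proj_def y deriv_simps)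
  have "act (single [y] 1 ^ Suc i) (?e 0) j - ?e (Suc i) j
      = op y (\<lambda>j. ?g j - ?e i j) j + single [0] 1 * ?e i j" for j
  proof -
    have "act (single [y] 1 ^ Suc i) (?e 0) j - ?e (Suc i) j = op y ?g j - op y (?e i) j + (op y (?e i) j - ?e (Suc i) j)"
      by (simp only: power_Suc act_Cons) simp
    also have "op y ?g j - op y (?e i) j = op y (\<lambda>j. ?g j - ?e i j) j"
      using fun_cong[OF op_add[of y "\<lambda>j. ?g j - ?e i j" "?e i"], of j] by (simp add: algebra_simps)
    finally show ?thesis by (simp only: ei)
  qed
  then show ?case
    using op_coeffs_in(2)[OF y(1) Suc] s0
    by (auto simp: coeffs_in_def intro!: env_ker_add env_ker_rmult free_words_closed)
qed

text \<open>The sum is applied to the constant polynomial 1. A relation of \<open>N\<close> acts as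
  zero modulo \<open>env ker\<close>, whereas coefficient \<open>i\<close> of the result is
  congruent to \<open>p i\<close>.\<close>

lemma free_over_ker:
  assumes p: "\<And>i. i < m \<Longrightarrow> p i \<in> free_words ker"
    and s: "(\<Sum>i<m. p i * single [y] 1 ^ i) \<in> env N" and i: "i < m"
  shows "p i \<in> env ker"
proof -
  let ?e = "\<lambda>i j. if j = i then 1 else 0 :: 'l list \<Rightarrow>\<^sub>0 'k"
  have act_sum: "act (\<Sum>i\<in>I. q i) f = (\<lambda>j. \<Sum>i\<in>I. act (q i) f j)" for I :: "nat set" and q f
    by (induction I rule: infinite_finite_induct) (simp_all add: act_simps)
  define g where "g i = act (single [y] 1 ^ i) (?e 0)" for i
  have "act (\<Sum>i<m. p i * single [y] 1 ^ i) (?e 0) \<in> coeffs_in (env ker)"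
    by (rule act_env[OF s]) (auto simp: coeffs_in_def intro: free_words_closed)
  moreover have "act (\<Sum>i<m. p i * single [y] 1 ^ i) (?e 0) = (\<lambda>j. \<Sum>i<m. p i * g i j)"
    by (simp add: act_sum act_mult act_ker p g_def)
  ultimately have 1: "(\<Sum>k<m. p k * g k i) \<in> env ker" by (auto simp: coeffs_in_def)
  have sum_env: "(\<Sum>k\<in>I. q k) \<in> env ker" if "\<And>k. k \<in> I \<Longrightarrow> q k \<in> env ker" for I :: "nat set" and q
    using that by (induction I rule: infinite_finite_induct) (auto intro: env_ker_0 env_ker_add)
  have 2: "(\<Sum>k<m. p k * (g k i - ?e k i)) \<in> env ker"
  proof (rule sum_env)
    fix k assume "k \<in> {..<m}"
    then show "p k * (g k i - ?e k i) \<in> env ker"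
      using act_y_power[of k] by (intro env_ker_lmult p) (simp_all add: g_def coeffs_in_def)
  qed
  have "(\<Sum>k<m. p k * g k i) - (\<Sum>k<m. p k * (g k i - ?e k i)) = (\<Sum>k<m. p k * ?e k i)"
    unfolding sum_subtractf[symmetric] by (rule sum.cong[OF refl]) (simp only: right_diff_distrib diff_diff_eq2, simp)
  also have "\<dots> = (\<Sum>k<m. if k = i then p k else 0)" by (rule sum.cong) auto
  also have "\<dots> = p i" using i by simp
  finally show ?thesis using env_ker_diff[OF 1 2] by simp
qed

end

section \<open>Faithful representations and division by an element outside the kernel\<close>

context lie_rep
begin

text \<open>The kernel of \<open>\<Phi>\<close> on words in \<open>N\<close> contains
  \<open>env N\<close> anyway; equality means that \<open>U N\<close> is the enveloping algebra of
  \<open>N\<close>.\<close>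

definition faithful_on :: "'l set \<Rightarrow> bool" where
  "faithful_on N \<longleftrightarrow> (\<forall>p\<in>free_words N. \<Phi> p = 0 \<longrightarrow> p \<in> env N)"

lemma free_words_mono: "A \<subseteq> B \<Longrightarrow> free_words A \<subseteq> free_words B"
  unfolding free_words_def using lists_mono by blast

lemma U_mono: "A \<subseteq> B \<Longrightarrow> U A \<subseteq> U B"
  unfolding U_def using free_words_mono by blast

lemma \<Phi>_sum: "\<Phi> (\<Sum>i\<in>I. p i) = (\<Sum>i\<in>I. \<Phi> (p i))"
  by (induction I rule: infinite_finite_induct) (auto simp: \<Phi>_simps)

lemma \<Phi>_power: "\<Phi> (p ^ i) = \<Phi> p ^ i"
  by (induction i) (auto simp: \<Phi>_simps)

lemma U_sum: "(\<And>i. i \<in> I \<Longrightarrow> p i \<in> U N) \<Longrightarrow> (\<Sum>i\<in>I. p i) \<in> U N"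
  by (induction I rule: infinite_finite_induct) (auto intro: U_closed)

end

locale codim_one_rep = lie_rep scale bracket \<theta> + codim_one_subalgebra scale bracket N \<xi> y
  for scale :: "'k::field \<Rightarrow> 'l::ab_group_add \<Rightarrow> 'l" and bracket
    and \<theta> :: "'l \<Rightarrow> ('m::monoid_add \<Rightarrow>\<^sub>0 'k)" and N \<xi> y +
  assumes faithful: "faithful_on N"
begin

text \<open>A polynomial of degree 0 in \<open>y\<close>: a relation of \<open>N\<close> among words
  in \<open>ker\<close> is already a relation of \<open>ker\<close>.\<close>

lemma faithful_ker: "faithful_on ker"
  unfolding faithful_on_def
proof (intro ballI impI)
  fix p assume p: "p \<in> free_words ker" "\<Phi> p = 0"
  then have "p \<in> env N"
    using faithful free_words_mono[of ker N] by (auto simp: faithful_on_def)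
  then show "p \<in> env ker" using free_over_ker[of 1 "\<lambda>_. p" 0] p by simp
qed

lemma U_independent:
  assumes p: "\<And>i. i < m \<Longrightarrow> p i \<in> U ker" and s: "(\<Sum>i<m. p i * \<theta> y ^ i) = 0" and i: "i < m"
  shows "p i = 0"
proof -
  have "\<exists>q. q \<in> free_words ker \<and> p i = \<Phi> q" if "i < m" for i
    using p[OF that] by (auto simp: U_def)
  then obtain q where q: "\<And>i. i < m \<Longrightarrow> q i \<in> free_words ker" "\<And>i. i < m \<Longrightarrow> p i = \<Phi> (q i)"
    by metis
  let ?s = "\<Sum>i<m. q i * single [y] 1 ^ i"
  have pw: "single [y] 1 ^ i \<in> free_words N" for i
    by (induction i) (use y in \<open>auto intro!: free_words_closed(2,6,8)\<close>)
  have fs: "(\<Sum>i\<in>I. f i) \<in> free_words N" if "\<And>i. i \<in> I \<Longrightarrow> f i \<in> free_words N" for I :: "nat set" and f :: "nat \<Rightarrow> _ \<Rightarrow>\<^sub>0 'k"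
    using that by (induction I rule: infinite_finite_induct) (auto intro: free_words_closed)
  have "\<Phi> ?s = 0" using s q(2) by (simp add: \<Phi>_sum \<Phi>_simps \<Phi>_power)
  moreover have "?s \<in> free_words N"
    using q(1) free_words_mono[of ker N] by (intro fs free_words_closed(6) pw) auto
  ultimately have "?s \<in> env N" using faithful by (auto simp: faithful_on_def)
  from free_over_ker[OF q(1) this i] have "q i \<in> env ker" by auto
  then show ?thesis using \<Phi>_env[OF lie_subalgebra_ker] q(2)[OF i] by simp
qed

text \<open>The commutator with \<open>\<theta> y\<close> is a derivation which preserves the
  generators coming from the ideal \<open>ker\<close>. It serves to move \<open>\<theta> y\<close>
  to the right of coefficients.\<close>

lemma U_ker_commutator: "u \<in> U ker \<Longrightarrow> \<theta> y * u - u * \<theta> y \<in> U ker"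
proof (induction rule: U_induct)
  case (mult x q)
  have "\<theta> y * (\<theta> x * q) - \<theta> x * q * \<theta> y = \<theta> (bracket y x) * q + \<theta> x * (\<theta> y * q - q * \<theta> y)"
    by (simp add: \<theta>_bracket algebra_simps)
  also have "\<dots> \<in> U ker"
    using mult bracket_y_ker[OF mult.hyps(1)] by (intro U_closed(3,6) U_closed(8)) auto
  finally show ?case .
next
  case (scale c q)
  have "\<theta> y * (cst c * q) - cst c * q * \<theta> y = cst c * (\<theta> y * q - q * \<theta> y)"
    by (simp only: right_diff_distrib cst_left_commute[of "\<theta> y"] mult.assoc)
  then show ?case using scale by (simp add: U_closed(7))
next
  case (add p q)
  have "\<theta> y * (p + q) - (p + q) * \<theta> y = (\<theta> y * p - p * \<theta> y) + (\<theta> y * q - q * \<theta> y)"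
    by (simp add: algebra_simps)
  then show ?case using U_closed(3)[OF add] by simp
qed (auto intro: U_closed)

text \<open>Polynomials in \<open>\<theta> y\<close> with their coefficients in \<open>U ker\<close>
  on the left. The rules only append \<open>\<theta> y\<close> on the right, and stability under
  left multiplication by \<open>U ker\<close> and by \<open>\<theta> y\<close> makes them exhaust
  \<open>U N\<close>.\<close>

inductive_set y_polys :: "('m \<Rightarrow>\<^sub>0 'k) set" where
  base: "a \<in> U ker \<Longrightarrow> a \<in> y_polys"
| add: "p \<in> y_polys \<Longrightarrow> q \<in> y_polys \<Longrightarrow> p + q \<in> y_polys"
| times: "p \<in> y_polys \<Longrightarrow> p * \<theta> y \<in> y_polys"

lemma y_polys_left: "p \<in> y_polys \<Longrightarrow> a \<in> U ker \<Longrightarrow> a * p \<in> y_polys"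
proof (induction rule: y_polys.induct)
  case (times p)
  then show ?case using y_polys.times[of "a * p"] by (simp add: mult.assoc)
qed (auto simp: distrib_left intro: y_polys.intros U_closed)

lemma y_polys_y: "p \<in> y_polys \<Longrightarrow> \<theta> y * p \<in> y_polys"
proof (induction rule: y_polys.induct)
  case (base a)
  have "\<theta> y * a = (\<theta> y * a - a * \<theta> y) + a * \<theta> y" by simp
  then show ?case using U_ker_commutator[OF base] base y_polys.intros by metis
next
  case (times p)
  then show ?case using y_polys.times[of "\<theta> y * p"] by (simp add: mult.assoc)
qed (auto simp: distrib_left intro: y_polys.intros)

lemma U_y_polys: "U N \<subseteq> y_polys"
proof
  fix u assume "u \<in> U N"
  then show "u \<in> y_polys"
  proof (induction rule: U_induct)
    case (mult x q)
    have "x = proj x + scale (\<xi> x) y" by (simp add: proj_def)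
    then have "\<theta> x = \<theta> (proj x) + cst (\<xi> x) * \<theta> y" by (metis \<theta>_add \<theta>_scale)
    then have "\<theta> x * q = \<theta> (proj x) * q + cst (\<xi> x) * (\<theta> y * q)"
      by (simp add: distrib_right mult.assoc)
    moreover have "cst (\<xi> x) \<in> U ker" using U_closed(7)[OF U_closed(2), of "\<xi> x"] by simp
    ultimately show ?case
      using mult proj_ker[OF mult.hyps(1)] by (auto intro!: y_polys.add y_polys_left y_polys_y U_closed(8))
  next
    case (scale c q)
    moreover have "cst c \<in> U ker" using U_closed(7)[OF U_closed(2), of c] by simp
    ultimately show ?case by (auto intro: y_polys_left)
  qed (auto intro: y_polys.intros U_closed)
qed

lemma y_polys_U: "p \<in> y_polys \<Longrightarrow> p \<in> U N"
  by (induction rule: y_polys.induct) (use U_mono[of ker N] y in \<open>auto intro: U_closed\<close>)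

text \<open>Division by \<open>\<theta> y\<close> with remainder: all terms of positive degree end
  with \<open>\<theta> y\<close>.\<close>

lemma U_decompose:
  assumes "u \<in> U N"
  shows "\<exists>a\<in>U ker. \<exists>b\<in>U N. u = a + b * \<theta> y"
proof -
  have "u \<in> y_polys" using assms U_y_polys by auto
  then show ?thesis
  proof (induction rule: y_polys.induct)
    case (base a)
    then show ?case using U_closed(1) by (intro bexI[of _ a] bexI[of _ 0]) auto
  next
    case (add p q)
    then obtain a b a' b' where "a \<in> U ker" "b \<in> U N" "p = a + b * \<theta> y" "a' \<in> U ker" "b' \<in> U N" "q = a' + b' * \<theta> y"
      by blast
    then show ?case by (intro bexI[of _ "a + a'"] bexI[of _ "b + b'"]) (auto simp: distrib_right add_ac intro: U_closed(3))
  next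
    case (times p)
    then show ?case using y_polys_U U_closed(1) by (intro bexI[of _ 0] bexI[of _ p]) auto
  qed
qed

lemma y_polys_sum:
  "p \<in> y_polys \<Longrightarrow> \<exists>m f. (\<forall>i. f i \<in> U ker) \<and> (\<forall>i\<ge>m. f i = 0) \<and> p = (\<Sum>i<m. f i * \<theta> y ^ i)"
proof (induction rule: y_polys.induct)
  case (base a)
  show ?case
    by (rule exI[of _ 1], rule exI[of _ "\<lambda>i. if i = 0 then a else 0"]) (use base in \<open>auto intro: U_closed\<close>)
next
  case (add p q)
  then obtain m f m' f' where f: "\<forall>i. f i \<in> U ker" "\<forall>i\<ge>m. f i = 0" "p = (\<Sum>i<m. f i * \<theta> y ^ i)"
    and f': "\<forall>i. f' i \<in> U ker" "\<forall>i\<ge>m'. f' i = 0" "q = (\<Sum>i<m'. f' i * \<theta> y ^ i)" by blast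
  have "p = (\<Sum>i<max m m'. f i * \<theta> y ^ i)" unfolding f(3)
    by (rule sum.mono_neutral_left) (use f(2) in auto)
  moreover have "q = (\<Sum>i<max m m'. f' i * \<theta> y ^ i)" unfolding f'(3)
    by (rule sum.mono_neutral_left) (use f'(2) in auto)
  ultimately have "p + q = (\<Sum>i<max m m'. (f i + f' i) * \<theta> y ^ i)"
    by (simp add: sum.distrib distrib_right)
  then show ?case using f f' U_closed(3)
    by (intro exI[of _ "max m m'"] exI[of _ "\<lambda>i. f i + f' i"]) auto
next
  case (times p)
  then obtain m f where f: "\<forall>i. f i \<in> U ker" "\<forall>i\<ge>m. f i = 0" "p = (\<Sum>i<m. f i * \<theta> y ^ i)" by blast
  have "p * \<theta> y = (\<Sum>i<Suc m. (case i of 0 \<Rightarrow> 0 | Suc j \<Rightarrow> f j) * \<theta> y ^ i)"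
    unfolding sum.lessThan_Suc_shift by (simp add: f(3) sum_distrib_right mult.assoc power_commutes)
  moreover have "(case i of 0 \<Rightarrow> 0 | Suc j \<Rightarrow> f j) \<in> U ker" for i
    using f(1) U_closed(1) by (auto split: nat.split)
  moreover have "\<forall>i\<ge>Suc m. (case i of 0 \<Rightarrow> 0 | Suc j \<Rightarrow> f j) = 0" using f(2) by (auto split: nat.split)
  ultimately show ?case by (intro exI[of _ "Suc m"] exI[of _ "\<lambda>i. case i of 0 \<Rightarrow> 0 | Suc j \<Rightarrow> f j"]) auto
qed

text \<open>The equation is a polynomial relation in \<open>\<theta> y\<close>, with constant term
  \<open>- a\<close> and the coefficients of \<open>b\<close> moved up by one degree, so
  \<open>U_independent\<close> makes all of them vanish.\<close>

lemma U_unique: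
  assumes a: "a \<in> U ker" and b: "b \<in> U N" and eq: "a = b * \<theta> y"
  shows "a = 0" "b = 0"
proof -
  obtain m f where f: "\<forall>i. f i \<in> U ker" "\<forall>i\<ge>m. f i = 0" "b = (\<Sum>i<m. f i * \<theta> y ^ i)"
    using y_polys_sum U_y_polys b by blast
  define g where "g i = (case i of 0 \<Rightarrow> - a | Suc j \<Rightarrow> f j)" for i
  have g: "g i \<in> U ker" for i using f(1) U_closed(4)[OF a] by (auto simp: g_def split: nat.split)
  have "(\<Sum>i<Suc m. g i * \<theta> y ^ i) = 0"
    unfolding sum.lessThan_Suc_shift using eq
    by (simp add: f(3) sum_distrib_right mult.assoc power_commutes g_def)
  from U_independent[OF g this] have z: "i < Suc m \<Longrightarrow> g i = 0" for i .
  show "a = 0" using z[of 0] by (simp add: g_def)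
  have "f i = 0" if "i < m" for i using z[of "Suc i"] that by (simp add: g_def)
  then show "b = 0" by (simp add: f(3))
qed

end


section \<open>A finiteness criterion\<close>

text \<open>The augmentation of \<open>U M\<close> is the coefficient at the neutral element. It is
  multiplicative on traces, since a product of traces is neutral only if both factors are.\<close>

locale augmented_lie_rep = lie_rep scale bracket \<theta>
  for scale :: "'k::field \<Rightarrow> 'l::ab_group_add \<Rightarrow> 'l" and bracket
    and \<theta> :: "'l \<Rightarrow> ('m::monoid_add \<Rightarrow>\<^sub>0 'k)" +
  fixes M :: "'l set"
  assumes M: "lie_subalgebra M"
    and faithful: "faithful_on M"
    and lookup_mult_0: "lookup (p * q) 0 = lookup p 0 * lookup (q :: 'm \<Rightarrow>\<^sub>0 'k) 0"
    and lookup_\<theta>_0: "lookup (\<theta> x) 0 = 0"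
begin

definition U_ring :: "('m \<Rightarrow>\<^sub>0 'k) ring" where
  "U_ring = \<lparr>carrier = U M, mult = (*), one = 1, zero = 0, add = (+)\<rparr>"

lemma U_ring_simps [simp]:
  "carrier U_ring = U M" "mult U_ring = (*)" "one U_ring = 1" "zero U_ring = 0" "add U_ring = (+)"
  by (auto simp: U_ring_def)

lemma ring_U_ring: "ring U_ring"
proof (rule ringI)
  show "abelian_group U_ring"
  proof (rule abelian_groupI)
    fix x assume "x \<in> carrier U_ring"
    then show "\<exists>y\<in>carrier U_ring. y \<oplus>\<^bsub>U_ring\<^esub> x = \<zero>\<^bsub>U_ring\<^esub>"
      by (intro bexI[of _ "- x"]) (auto simp: U_closed)
  qed (simp_all add: U_closed add.assoc add.commute)
  show "Group.monoid U_ring"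
    by (rule monoidI) (simp_all add: U_closed mult.assoc)
qed (simp_all add: distrib_left distrib_right)

abbreviation "R \<equiv> enveloping_algebra scale bracket M"

definition \<Psi> :: "('l list \<Rightarrow>\<^sub>0 'k) set \<Rightarrow> ('m \<Rightarrow>\<^sub>0 'k)" where
  "\<Psi> X = the_elem (\<Phi> ` X)"

lemma \<Phi>_ring_hom: "ring_hom_ring (free_assoc M) U_ring \<Phi>"
  by (intro ring_hom_ringI ring_free_assoc ring_U_ring) (auto simp: \<Phi>_simps U_def)

lemma kernel_\<Phi>: "a_kernel (free_assoc M) U_ring \<Phi> = env M"
  using faithful \<Phi>_env[OF M] env_subset[OF M]
  by (auto simp: a_kernel_def' faithful_on_def)

lemma R_eq: "R = free_assoc M Quot a_kernel (free_assoc M) U_ring \<Phi>"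
  by (simp add: kernel_\<Phi> env_def enveloping_algebra_def)

lemma \<Psi>_iso: "\<Psi> \<in> ring_iso R U_ring"
proof -
  interpret ring_hom_ring "free_assoc M" U_ring \<Phi> by (rule \<Phi>_ring_hom)
  have "(\<lambda>X. the_elem (\<Phi> ` X)) \<in> ring_iso R U_ring"
    unfolding R_eq by (rule FactRing_iso_set) (auto simp: U_def)
  then show ?thesis by (simp add: \<Psi>_def[abs_def])
qed

lemma ring_R: "ring R"
proof -
  interpret ideal "env M" "free_assoc M" by (rule ideal_env[OF M])
  show ?thesis using quotient_is_ring by (simp add: enveloping_algebra_def env_def)
qed

lemma \<Psi>_simps:
  "x \<in> carrier R \<Longrightarrow> \<Psi> x \<in> U M"
  "x \<in> carrier R \<Longrightarrow> y \<in> carrier R \<Longrightarrow> \<Psi> (x \<otimes>\<^bsub>R\<^esub> y) = \<Psi> x * \<Psi> y"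
  "x \<in> carrier R \<Longrightarrow> y \<in> carrier R \<Longrightarrow> \<Psi> (x \<oplus>\<^bsub>R\<^esub> y) = \<Psi> x + \<Psi> y"
  "\<Psi> \<one>\<^bsub>R\<^esub> = 1" "\<Psi> \<zero>\<^bsub>R\<^esub> = 0"
proof -
  have h: "\<Psi> \<in> ring_hom R U_ring" using \<Psi>_iso by (simp add: ring_iso_def)
  show "x \<in> carrier R \<Longrightarrow> \<Psi> x \<in> U M"
    "x \<in> carrier R \<Longrightarrow> y \<in> carrier R \<Longrightarrow> \<Psi> (x \<otimes>\<^bsub>R\<^esub> y) = \<Psi> x * \<Psi> y"
    "x \<in> carrier R \<Longrightarrow> y \<in> carrier R \<Longrightarrow> \<Psi> (x \<oplus>\<^bsub>R\<^esub> y) = \<Psi> x + \<Psi> y"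
    "\<Psi> \<one>\<^bsub>R\<^esub> = 1"
    using ring_hom_closed[OF h] ring_hom_mult[OF h] ring_hom_add[OF h] ring_hom_one[OF h] by simp_all
  show "\<Psi> \<zero>\<^bsub>R\<^esub> = 0" using ring_hom_zero[OF h ring_R ring_U_ring] by simp
qed

lemma \<Psi>_bij: "bij_betw \<Psi> (carrier R) (U M)"
  using \<Psi>_iso by (simp add: ring_iso_def)

lemma lookup_\<Phi>_0: "lookup (\<Phi> p) 0 = lookup p []"
proof (induction p rule: poly_mapping_induct)
  case (single t c)
  have "lookup (prod_list (map \<theta> t)) 0 = (if t = [] then 1 else 0)"
    by (cases t) (auto simp: lookup_mult_0 lookup_\<theta>_0 lookup_one)
  then show ?case by (auto simp: \<Phi>_def lookup_single)
qed (auto simp: \<Phi>_simps lookup_add)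

text \<open>The action was defined by the constant coefficient of representatives. By
  \<open>lookup_\<Phi>_0\<close> this becomes the augmentation of \<open>U M\<close>, which is the
  form in which the complexes see it.\<close>

lemma trivial_smult:
  assumes "u \<in> carrier R"
  shows "u \<odot>\<^bsub>trivial_module\<^esub> a = lookup (\<Psi> u) 0 * a"
proof -
  obtain p where p: "p \<in> free_words M" "u = env M +>\<^bsub>free_assoc M\<^esub> p"
    using assms by (auto simp: enveloping_algebra_def FactRing_def A_RCOSETS_def' env_def)
  then have u: "u = (\<lambda>h. h + p) ` env M" by (auto simp: a_r_coset_def')
  have "\<Phi> ` u = {\<Phi> p}"
    using \<Phi>_env[OF M] env_0[OF M] by (force simp: u \<Phi>_simps image_image)
  moreover have "(\<lambda>p. lookup p []) ` u = {lookup (\<Phi> p) 0}"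
    using \<Phi>_env[OF M] env_0[OF M] lookup_\<Phi>_0[symmetric] by (force simp: u \<Phi>_simps image_image)
  ultimately show ?thesis by (simp add: \<Psi>_def trivial_module_def)
qed

lemma left_module_trivial: "left_module R (trivial_module :: (('l list \<Rightarrow>\<^sub>0 'k) set, 'k) module)"
proof -
  let ?T = "trivial_module :: (('l list \<Rightarrow>\<^sub>0 'k) set, 'k) module"
  have s: "carrier ?T = UNIV" "add ?T = (+)" "zero ?T = 0" by (auto simp: trivial_module_def)
  have "abelian_group ?T"
  proof (rule abelian_groupI)
    show "\<exists>y\<in>carrier ?T. y \<oplus>\<^bsub>?T\<^esub> x = \<zero>\<^bsub>?T\<^esub>" for x
      by (intro bexI[of _ "- x"]) (auto simp: s)
  qed (auto simp: s)
  then interpret T: abelian_group ?T .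
  interpret R: ring R by (rule ring_R)
  show ?thesis
    by unfold_locales (auto simp: s trivial_smult \<Psi>_simps lookup_add lookup_mult_0 lookup_one algebra_simps)
qed

text \<open>Lets everything that follows take place among functions with values in the monoid
  algebra. \<open>C i\<close> is free over \<open>U M\<close> with one basis element for each point
  of \<open>B i\<close>: the values on \<open>B i\<close> are arbitrary and the matrix
  \<open>c\<close>, which is the identity on \<open>B i\<close>, determines all others.\<close>

theorem lie_type_FP_criterion:
  fixes C :: "nat \<Rightarrow> ('i \<Rightarrow> ('m \<Rightarrow>\<^sub>0 'k)) set" and B :: "nat \<Rightarrow> 'i set" and c :: "nat \<Rightarrow> 'i \<Rightarrow> 'i \<Rightarrow> 'k"
    and D :: "nat \<Rightarrow> ('i \<Rightarrow> ('m \<Rightarrow>\<^sub>0 'k)) \<Rightarrow> 'i \<Rightarrow> ('m \<Rightarrow>\<^sub>0 'k)" and \<epsilon> :: "('i \<Rightarrow> ('m \<Rightarrow>\<^sub>0 'k)) \<Rightarrow> 'k"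
  assumes B: "\<And>i. i \<le> n \<Longrightarrow> finite (B i)"
    and c: "\<And>i s t. i \<le> n \<Longrightarrow> s \<in> B i \<Longrightarrow> t \<in> B i \<Longrightarrow> c i t s = (if s = t then 1 else 0)"
    and C: "\<And>i f. i \<le> n \<Longrightarrow> f \<in> C i \<longleftrightarrow> (\<exists>g. (\<forall>t\<in>B i. g t \<in> U M) \<and> f = (\<lambda>s. \<Sum>t\<in>B i. cst (c i t s) * g t))"
    and D_closed: "\<And>i f. i < n \<Longrightarrow> f \<in> C (Suc i) \<Longrightarrow> D i f \<in> C i"
    and D_add: "\<And>i f g. D i (\<lambda>s. f s + g s) = (\<lambda>s. D i f s + D i g s)"
    and D_mult: "\<And>i a f. D i (\<lambda>s. a * f s) = (\<lambda>s. a * D i f s)"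
    and \<epsilon>_add: "\<And>f g. \<epsilon> (\<lambda>s. f s + g s) = \<epsilon> f + \<epsilon> g"
    and \<epsilon>_mult: "\<And>a f. \<epsilon> (\<lambda>s. a * f s) = lookup a 0 * \<epsilon> f"
    and onto: "f1 \<in> C 0" "\<epsilon> f1 = 1"
    and cycles: "\<And>f. f \<in> C 1 \<Longrightarrow> \<epsilon> (D 0 f) = 0" "\<And>i f. Suc i < n \<Longrightarrow> f \<in> C (Suc (Suc i)) \<Longrightarrow> D i (D (Suc i) f) = (\<lambda>_. 0)"
    and exact: "\<And>f. 0 < n \<Longrightarrow> f \<in> C 0 \<Longrightarrow> \<epsilon> f = 0 \<Longrightarrow> \<exists>h\<in>C 1. D 0 h = f"
      "\<And>i f. Suc i < n \<Longrightarrow> f \<in> C (Suc i) \<Longrightarrow> D i f = (\<lambda>_. 0) \<Longrightarrow> \<exists>h\<in>C (Suc (Suc i)). D (Suc i) h = f"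
  shows "lie_type_FP scale bracket M n"
proof -
  interpret R: ring R by (rule ring_R)
  let ?T = "trivial_module :: (('l list \<Rightarrow>\<^sub>0 'k) set, 'k) module"
  have "\<exists>\<rho> :: 'i \<Rightarrow> ('l list \<Rightarrow>\<^sub>0 'k) set list. inj_on \<rho> (B i)" if i: "i \<le> n" for i
  proof -
    obtain r :: "'i \<Rightarrow> nat" where r: "inj_on r (B i)"
      using finite_imp_inj_to_nat_seg[OF B[OF i]] by blast
    \<comment> \<open>Basis elements must be indexed by lists over the ring; lists that differ in
      length do.\<close>
    have "inj_on (\<lambda>b. replicate (r b) {}) (B i)"
      using r by (auto simp: inj_on_def replicate_eq_replicate)
    then show ?thesis by blast
  qed
  then obtain \<rho> :: "nat \<Rightarrow> 'i \<Rightarrow> ('l list \<Rightarrow>\<^sub>0 'k) set list" where \<rho>: "\<And>i. i \<le> n \<Longrightarrow> inj_on (\<rho> i) (B i)"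
    by metis
  define S where "S i = \<rho> i ` B i" for i
  let ?F = "\<lambda>i. free_lmod R (S i)"
  \<comment> \<open>The isomorphism from the free module over the quotient ring onto
    \<open>C i\<close>: coordinates are carried over by \<open>\<Psi>\<close> and spread over all
    indices by \<open>c\<close>.\<close>
  define \<phi> where "\<phi> i f = (\<lambda>s. \<Sum>t\<in>B i. cst (c i t s) * \<Psi> (f (\<rho> i t)))" for i and f :: "('l list \<Rightarrow>\<^sub>0 'k) set list \<Rightarrow> ('l list \<Rightarrow>\<^sub>0 'k) set"
  have Fc: "f r \<in> carrier R" if "f \<in> carrier (?F i)" for f i r
    using that by (rule R.free_lmod_closed)
  have \<phi>_at: "\<phi> i f s = \<Psi> (f (\<rho> i s))" if "i \<le> n" "s \<in> B i" for i f s
  proof -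
    have "\<phi> i f s = (\<Sum>t\<in>B i. if t = s then \<Psi> (f (\<rho> i t)) else 0)"
      unfolding \<phi>_def by (rule sum.cong) (use that c in auto)
    then show ?thesis using that B by simp
  qed
  have \<phi>_bij: "bij_betw (\<phi> i) (carrier (?F i)) (C i)" if i: "i \<le> n" for i
  proof (rule bij_betwI')
    fix f g assume fg: "f \<in> carrier (?F i)" "g \<in> carrier (?F i)"
    show "\<phi> i f = \<phi> i g \<longleftrightarrow> f = g"
    proof
      assume e: "\<phi> i f = \<phi> i g"
      show "f = g"
      proof
        fix r
        show "f r = g r"
        proof (cases "r \<in> S i")
          case True
          then obtain s where s: "s \<in> B i" "r = \<rho> i s" by (auto simp: S_def)
          have "\<Psi> (f r) = \<Psi> (g r)" using e \<phi>_at[OF i s(1)] s(2) by metis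
          then show ?thesis using \<Psi>_bij Fc[OF fg(1)] Fc[OF fg(2)] by (auto simp: bij_betw_def inj_on_def)
        next
          case False
          then show ?thesis using fg by (auto simp: carrier_free_lmod)
        qed
      qed
    qed simp
  next
    fix f assume f: "f \<in> carrier (?F i)"
    show "\<phi> i f \<in> C i"
      unfolding C[OF i] \<phi>_def using \<Psi>_simps(1)[OF Fc[OF f]] by (intro exI[of _ "\<lambda>t. \<Psi> (f (\<rho> i t))"]) auto
  next
    fix h assume "h \<in> C i"
    then obtain g where g: "\<forall>t\<in>B i. g t \<in> U M" "h = (\<lambda>s. \<Sum>t\<in>B i. cst (c i t s) * g t)"
      using C[OF i] by auto
    define f where "f r = (if r \<in> S i then inv_into (carrier R) \<Psi> (g (inv_into (B i) (\<rho> i) r)) else \<zero>\<^bsub>R\<^esub>)" for r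
    have fr: "f (\<rho> i t) \<in> carrier R \<and> \<Psi> (f (\<rho> i t)) = g t" if t: "t \<in> B i" for t
    proof -
      have "f (\<rho> i t) = inv_into (carrier R) \<Psi> (g t)"
        using t \<rho>[OF i] by (simp add: f_def S_def)
      moreover have "g t \<in> \<Psi> ` carrier R" using g(1) t \<Psi>_bij by (simp add: bij_betw_def)
      ultimately show ?thesis by (simp add: inv_into_into f_inv_into_f)
    qed
    have "finite {r. f r \<noteq> \<zero>\<^bsub>R\<^esub>}"
      by (rule finite_subset[of _ "S i"]) (auto simp: f_def S_def B[OF i])
    then have "f \<in> carrier (?F i)" using fr by (auto simp: carrier_free_lmod S_def f_def)
    moreover have "h = \<phi> i f" unfolding g(2) \<phi>_def using fr by auto
    ultimately show "\<exists>f\<in>carrier (?F i). h = \<phi> i f" by blast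
  qed
  have \<phi>_add: "\<phi> i (f \<oplus>\<^bsub>?F i\<^esub> g) = (\<lambda>s. \<phi> i f s + \<phi> i g s)"
    if "f \<in> carrier (?F i)" "g \<in> carrier (?F i)" for i f g
    using Fc[OF that(1)] Fc[OF that(2)] by (auto simp: \<phi>_def \<Psi>_simps distrib_left sum.distrib)
  have \<phi>_smult: "\<phi> i (a \<odot>\<^bsub>?F i\<^esub> f) = (\<lambda>s. \<Psi> a * \<phi> i f s)"
    if "a \<in> carrier R" "f \<in> carrier (?F i)" for i f a
    using that(1) Fc[OF that(2)]
    by (auto simp: \<phi>_def \<Psi>_simps sum_distrib_left cst_left_commute[of "\<Psi> a"])
  have \<phi>_inv: "inv_into (carrier (?F i)) (\<phi> i) h \<in> carrier (?F i)" "\<phi> i (inv_into (carrier (?F i)) (\<phi> i) h) = h"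
    if "i \<le> n" "h \<in> C i" for i h
    using \<phi>_bij[OF that(1)] that(2) by (auto simp: bij_betw_def inv_into_into f_inv_into_f)
  have \<phi>C: "\<phi> i f \<in> C i" if "i \<le> n" "f \<in> carrier (?F i)" for i f
    using \<phi>_bij[OF that(1)] that(2) by (auto simp: bij_betw_def)
  have \<phi>_eq: "f = g" if "i \<le> n" "f \<in> carrier (?F i)" "g \<in> carrier (?F i)" "\<phi> i f = \<phi> i g" for i f g
    using \<phi>_bij[OF that(1)] that by (auto simp: bij_betw_def inj_on_def)
  define d where "d i f = inv_into (carrier (?F i)) (\<phi> i) (D i (\<phi> (Suc i) f))" for i f
  have d: "d i f \<in> carrier (?F i)" "\<phi> i (d i f) = D i (\<phi> (Suc i) f)" if "i < n" "f \<in> carrier (?F (Suc i))" for i f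
    unfolding d_def using that by (intro \<phi>_inv D_closed \<phi>C; simp)+
  define e where "e f = \<epsilon> (\<phi> 0 f)" for f
  have \<phi>0: "\<phi> i \<zero>\<^bsub>?F i\<^esub> = (\<lambda>_. 0)" for i by (simp add: \<phi>_def \<Psi>_simps)
  have mod: "left_module R (?F i)" for i by (rule R.left_module_free_lmod)
  have zF: "\<zero>\<^bsub>?F i\<^esub> \<in> carrier (?F i)" for i by (auto simp: carrier_free_lmod)
  have d_zero: "d i f = \<zero>\<^bsub>?F i\<^esub> \<longleftrightarrow> D i (\<phi> (Suc i) f) = (\<lambda>_. 0)" if "i < n" "f \<in> carrier (?F (Suc i))" for i f
    using d[OF that] \<phi>0[of i] \<phi>_eq[of i "d i f" "\<zero>\<^bsub>?F i\<^esub>"] zF that(1) by force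
  have T: "carrier ?T = UNIV" "add ?T = (+)" "zero ?T = 0" by (auto simp: trivial_module_def)
  have "module_type_FP R ?T n"
  proof (rule R.module_type_FP_free[where S = S and d = d and e = e])
    show "left_module R ?T" by (rule left_module_trivial)
    show "\<one>\<^bsub>R\<^esub> \<noteq> \<zero>\<^bsub>R\<^esub>" using \<Psi>_simps(4,5) by (metis one_neq_zero)
    show "finite (S i)" if "i \<le> n" for i using B[OF that] by (simp add: S_def)
    show "d i \<in> lmod_hom R (?F (Suc i)) (?F i)" if i: "i < n" for i
    proof -
      interpret F: left_module R "?F i" by (rule mod)
      interpret F': left_module R "?F (Suc i)" by (rule mod)
      have "d i (f \<oplus>\<^bsub>?F (Suc i)\<^esub> g) = d i f \<oplus>\<^bsub>?F i\<^esub> d i g"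
        if fg: "f \<in> carrier (?F (Suc i))" "g \<in> carrier (?F (Suc i))" for f g
        by (rule \<phi>_eq[of i]) (use i d[OF i] fg F.a_closed F'.a_closed in \<open>simp_all only: \<phi>_add D_add less_imp_le\<close>)
      moreover have "d i (a \<odot>\<^bsub>?F (Suc i)\<^esub> f) = a \<odot>\<^bsub>?F i\<^esub> d i f"
        if "a \<in> carrier R" "f \<in> carrier (?F (Suc i))" for f a
        by (rule \<phi>_eq[of i]) (use i d[OF i] that F.smult_closed F'.smult_closed in \<open>simp_all only: \<phi>_smult D_mult less_imp_le\<close>)
      ultimately show ?thesis using d(1)[OF i] by (simp add: lmod_hom_def del: free_lmod_simps)
    qed
    show "e \<in> lmod_hom R (?F 0) ?T"
      by (simp add: lmod_hom_def e_def \<phi>_add \<phi>_smult \<epsilon>_add \<epsilon>_mult T trivial_smult del: free_lmod_simps)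
    show "e ` carrier (?F 0) = carrier ?T"
    proof -
      have "a \<in> e ` carrier (?F 0)" for a
      proof -
        obtain f where f: "f \<in> carrier (?F 0)" "\<phi> 0 f = f1" using \<phi>_inv[OF _ onto(1)] by blast
        obtain u where u: "u \<in> carrier R" "\<Psi> u = cst a"
        proof -
          have "cst a \<in> \<Psi> ` carrier R"
            using \<Psi>_bij U_closed(7)[OF U_closed(2), of a] by (simp add: bij_betw_def)
          then show ?thesis using that by auto
        qed
        interpret F: left_module R "?F 0" by (rule mod)
        have "e (u \<odot>\<^bsub>?F 0\<^esub> f) = a"
          unfolding e_def \<phi>_smult[OF u(1) f(1)] \<epsilon>_mult by (simp add: f(2) onto u)
        then show ?thesis using F.smult_closed[OF u(1) f(1)] by blast
      qed
      then show ?thesis by (auto simp: T)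
    qed
    show "d 0 ` carrier (?F 1) = lmod_kernel (?F 0) ?T e" if n: "0 < n"
    proof
      show "d 0 ` carrier (?F 1) \<subseteq> lmod_kernel (?F 0) ?T e"
        using d[OF n] cycles(1) \<phi>C[of 1] n by (auto simp: lmod_kernel_def e_def T)
      show "lmod_kernel (?F 0) ?T e \<subseteq> d 0 ` carrier (?F 1)"
      proof
        fix f assume "f \<in> lmod_kernel (?F 0) ?T e"
        then have f: "f \<in> carrier (?F 0)" "\<epsilon> (\<phi> 0 f) = 0" by (auto simp: lmod_kernel_def e_def T)
        obtain h where h: "h \<in> C 1" "D 0 h = \<phi> 0 f" using exact(1)[OF n \<phi>C[OF _ f(1)] f(2)] by auto
        obtain g where g: "g \<in> carrier (?F 1)" "\<phi> 1 g = h" using \<phi>_inv[of 1 h] h n by auto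
        have "d 0 g = f" by (rule \<phi>_eq[of 0]) (use d[OF n] g h f in auto)
        then show "f \<in> d 0 ` carrier (?F 1)" using g by blast
      qed
    qed
    show "d (Suc i) ` carrier (?F (Suc (Suc i))) = lmod_kernel (?F (Suc i)) (?F i) (d i)" if i: "Suc i < n" for i
    proof
      have i': "i < n" using i by simp
      show "d (Suc i) ` carrier (?F (Suc (Suc i))) \<subseteq> lmod_kernel (?F (Suc i)) (?F i) (d i)"
        using d[OF i] cycles(2)[OF i] \<phi>C[of "Suc (Suc i)"] i d_zero[OF i']
        by (auto simp: lmod_kernel_def simp del: free_lmod_simps)
      show "lmod_kernel (?F (Suc i)) (?F i) (d i) \<subseteq> d (Suc i) ` carrier (?F (Suc (Suc i)))"
      proof
        fix f assume "f \<in> lmod_kernel (?F (Suc i)) (?F i) (d i)"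
        then have f: "f \<in> carrier (?F (Suc i))" "D i (\<phi> (Suc i) f) = (\<lambda>_. 0)"
          using d_zero[OF i'] by (auto simp: lmod_kernel_def simp del: free_lmod_simps)
        obtain h where h: "h \<in> C (Suc (Suc i))" "D (Suc i) h = \<phi> (Suc i) f"
          using exact(2)[OF i \<phi>C[OF _ f(1)] f(2)] i by auto
        obtain g where g: "g \<in> carrier (?F (Suc (Suc i)))" "\<phi> (Suc (Suc i)) g = h"
          using \<phi>_inv[of "Suc (Suc i)" h] h i by auto
        have "d (Suc i) g = f" by (rule \<phi>_eq[of "Suc i"]) (use d[OF i] g h f i in auto)
        then show "f \<in> d (Suc i) ` carrier (?F (Suc (Suc i)))" using g by blast
      qed
    qed
  qed
  then show ?thesis by (simp add: lie_type_FP_def)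
qed

end


section \<open>The trace algebra of a graph\<close>

text \<open>The class of a word in the trace monoid of a graph (adjacent letters commute) is determined by
  its projections to the pairs of letters that do not commute, so the trace monoid embeds into a
  power of the free monoid.\<close>

datatype 'a projections = Projections (pair_proj: "'a \<times> 'a \<Rightarrow> 'a list")

lemma projections_eq_iff: "a = b \<longleftrightarrow> (\<forall>u v. pair_proj a (u, v) = pair_proj b (u, v))"
  by (cases a, cases b) (auto simp: fun_eq_iff)

instantiation projections :: (type) monoid_add
begin
definition "0 = Projections (\<lambda>_. [])"
definition "a + b = Projections (\<lambda>p. pair_proj a p @ pair_proj b p)"
instance by standard (auto simp: zero_projections_def plus_projections_def)
end

lemma pair_proj_simps [simp]:
  "pair_proj 0 p = []" "pair_proj (a + b) p = pair_proj a p @ pair_proj b p"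
  by (auto simp: zero_projections_def plus_projections_def)

lemma projections_add_cancel_right: "a + s = b + s \<longleftrightarrow> a = (b :: 'a projections)"
  by (auto simp: projections_eq_iff)

lemma projections_add_eq_0: "a + b = 0 \<longleftrightarrow> a = 0 \<and> b = (0 :: 'a projections)"
  by (auto simp: projections_eq_iff)

lemma lookup_mult_0_projections:
  "lookup (p * q) 0 = lookup p 0 * lookup (q :: 'a projections \<Rightarrow>\<^sub>0 'k::comm_ring_1) 0"
proof (induction p rule: poly_mapping_induct)
  case (single s a)
  show ?case
    by (induction q rule: poly_mapping_induct)
      (auto simp: mult_single lookup_single projections_add_eq_0 distrib_left lookup_add when_def)
qed (auto simp: distrib_right lookup_add)

text \<open>Valid for any bilinear product, so that it covers both the bracket of the Lie algebra
  and the commutator of the trace algebra.\<close>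

lemma eval_word_bilinear_ext:
  fixes scale :: "'k::field \<Rightarrow> 'b::ab_group_add \<Rightarrow> 'b"
  assumes vs: "vector_space scale"
    and add: "\<And>x y z. br (x + y) z = br x z + br y z" "\<And>x y z. br x (y + z) = br x y + br x z"
    and scale: "\<And>c x y. br (scale c x) y = scale c (br x y)" "\<And>c x y. br x (scale c y) = scale c (br x y)"
  shows "lin_ext scale (eval_word br g) (bilinear_ext Br p q)
    = br (lin_ext scale (eval_word br g) p) (lin_ext scale (eval_word br g) q)"
proof -
  interpret vector_space scale by (rule vs)
  have z: "br 0 x = 0" "br x 0 = 0" for x
    using add(1)[of 0 0 x] add(2)[of x 0 0] by auto
  show ?thesis
  proof (induction p rule: poly_mapping_induct)
    case (single s a)
    show ?case
      by (induction q rule: poly_mapping_induct)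
        (auto simp: bilinear_ext_single lin_ext_single[OF vs] scale scale_scale lin_ext_0[OF vs] z
          bilinear_ext_add_right lin_ext_add[OF vs] add)
  qed (auto simp: lin_ext_0[OF vs] z bilinear_ext_add_left lin_ext_add[OF vs] add)
qed

section \<open>Words up to commutation of adjacent letters\<close>

context pair_graph
begin

abbreviation adj :: "'a \<Rightarrow> 'a \<Rightarrow> bool" where "adj u v \<equiv> (u, v) \<in> parcs G"

lemma adj_sym: "adj u v \<Longrightarrow> adj v u"
  by (rule arcs_symmetric)

lemma adj_irrefl: "\<not> adj u u"
  using no_loops'[of u u] by auto

text \<open>No vertex is adjacent to itself, so the pair \<open>(u, u)\<close> is among the recorded
  ones and counts the occurrences of \<open>u\<close>.\<close>

definition tr :: "'a list \<Rightarrow> 'a projections" where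
  "tr w = Projections (\<lambda>(u, v). if adj u v then [] else filter (\<lambda>x. x = u \<or> x = v) w)"

lemma pair_proj_tr: "pair_proj (tr w) (u, v) = (if adj u v then [] else filter (\<lambda>x. x = u \<or> x = v) w)"
  by (simp add: tr_def)

lemma tr_append: "tr (xs @ ys) = tr xs + tr ys"
  by (auto simp: pair_proj_tr projections_eq_iff)

lemma tr_Cons: "tr (x # ys) = tr [x] + tr ys"
  using tr_append[of "[x]" ys] by simp

lemma tr_Nil: "tr [] = 0"
  by (auto simp: pair_proj_tr projections_eq_iff)

lemma tr_single_nonzero: "tr [v] \<noteq> 0"
  using adj_irrefl[of v] by (auto simp: pair_proj_tr projections_eq_iff)

lemma tr_commute: "adj u v \<Longrightarrow> tr [u] + tr [v] = tr [v] + tr [u]"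
  using adj_sym adj_irrefl by (auto simp: pair_proj_tr projections_eq_iff)

lemma tr_commute_list: "(\<And>x. x \<in> set w \<Longrightarrow> adj u x) \<Longrightarrow> tr [u] + tr w = tr w + tr [u]"
proof (induction w)
  case (Cons x w)
  have "tr [u] + tr (x # w) = (tr [u] + tr [x]) + tr w"
    by (simp add: tr_Cons[of x w] add.assoc)
  also have "\<dots> = tr [x] + (tr [u] + tr w)"
    using Cons.prems[of x] tr_commute[of u x] by (simp add: add.assoc)
  also have "\<dots> = tr (x # w) + tr [u]"
    using Cons by (simp add: tr_Cons[of x w] add.assoc)
  finally show ?case .
qed (simp add: tr_Nil)

text \<open>The letter is the last occurrence of \<open>u\<close> in \<open>ws\<close>. A later
  letter not adjacent to \<open>u\<close> would be visible in the projection to that pair, which has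
  to end with \<open>u\<close>. Hence \<open>u\<close> can be moved to the end and
  cancelled.\<close>

lemma tr_eq_snoc:
  assumes "tr ws = tr us + tr [u]"
  obtains w1 w2 where "ws = w1 @ u # w2" "\<And>x. x \<in> set w2 \<Longrightarrow> adj u x" "tr (w1 @ w2) = tr us"
proof -
  have f: "filter (\<lambda>x. x = u \<or> x = v) ws = filter (\<lambda>x. x = u \<or> x = v) us @ [u]" if "\<not> adj u v" for v
    using arg_cong[OF assms, of "\<lambda>t. pair_proj t (u, v)"] that by (simp add: pair_proj_tr)
  have "u \<in> set (filter (\<lambda>x. x = u \<or> x = u) ws)"
    unfolding f[OF adj_irrefl] by simp
  then have "u \<in> set ws" by simp
  then obtain w1 w2 where w: "ws = w1 @ u # w2" "u \<notin> set w2" by (metis split_list_last)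
  have adj: "adj u x" if x: "x \<in> set w2" for x
  proof (rule ccontr)
    assume na: "\<not> adj u x"
    let ?f = "filter (\<lambda>z. z = u \<or> z = x)"
    have e: "?f w2 \<noteq> []" using x by (auto simp: filter_empty_conv)
    have "last (?f ws) = last (?f w2)" using e w by simp
    moreover have "last (?f w2) \<in> set w2" using last_in_set[OF e] by auto
    moreover have "last (?f ws) = u" unfolding f[OF na] by simp
    ultimately show False using w(2) by simp
  qed
  have "tr (w1 @ w2) + tr [u] = tr us + tr [u]"
    using assms tr_commute_list[of w2 u] adj by (simp add: w tr_append tr_Cons[of u w2] add.assoc)
  then have "tr (w1 @ w2) = tr us" by (simp only: projections_add_cancel_right)
  with w adj show thesis by (intro that) auto
qed

definition traces :: "'a projections set" where
  "traces = tr ` lists (pverts G)"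

lemma traces_0: "0 \<in> traces"
  unfolding traces_def by (rule image_eqI[of _ _ "[]"]) (auto simp: tr_Nil)

lemma traces_add: "s \<in> traces \<Longrightarrow> t \<in> traces \<Longrightarrow> s + t \<in> traces"
  unfolding traces_def
proof (elim imageE)
  fix xs ys assume "s = tr xs" "xs \<in> lists (pverts G)" "t = tr ys" "ys \<in> lists (pverts G)"
  then show "s + t \<in> tr ` lists (pverts G)"
    by (intro image_eqI[of _ _ "xs @ ys"]) (auto simp: tr_append)
qed

lemma traces_single: "v \<in> pverts G \<Longrightarrow> tr [v] \<in> traces"
  unfolding traces_def by auto

end

lemma free_nonassoc_closed:
  fixes p q :: "'v lie_word \<Rightarrow>\<^sub>0 'k::comm_ring_1"
  shows "(0 :: 'v lie_word \<Rightarrow>\<^sub>0 'k) \<in> free_nonassoc V" "p \<in> free_nonassoc V \<Longrightarrow> q \<in> free_nonassoc V \<Longrightarrow> p + q \<in> free_nonassoc V"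
  "p \<in> free_nonassoc V \<Longrightarrow> q \<in> free_nonassoc V \<Longrightarrow> p - q \<in> free_nonassoc V"
  "p \<in> free_nonassoc V \<Longrightarrow> Poly_Mapping.map ((*) c) p \<in> free_nonassoc V"
  "p \<in> free_nonassoc V \<Longrightarrow> q \<in> free_nonassoc V \<Longrightarrow> bilinear_ext Br p q \<in> free_nonassoc V"
  "letters t \<subseteq> V \<Longrightarrow> single t (c :: 'k) \<in> free_nonassoc V"
proof -
  show add: "p + q \<in> free_nonassoc V" if "p \<in> free_nonassoc V" "q \<in> free_nonassoc V"
    for p q :: "'v lie_word \<Rightarrow>\<^sub>0 'k"
    using that keys_add[of p q] unfolding free_nonassoc_def by blast
  show "p - q \<in> free_nonassoc V" if "p \<in> free_nonassoc V" "q \<in> free_nonassoc V"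
    for p q :: "'v lie_word \<Rightarrow>\<^sub>0 'k"
    using that keys_diff[of p q] unfolding free_nonassoc_def by blast
  show z: "0 \<in> (free_nonassoc V :: ('v lie_word \<Rightarrow>\<^sub>0 'k) set)" by (simp add: free_nonassoc_def)
  show "Poly_Mapping.map ((*) c) p \<in> free_nonassoc V" if "p \<in> free_nonassoc V"
    using that by (auto simp: free_nonassoc_def in_keys_iff map.rep_eq when_def split: if_splits)
  show s: "single t c \<in> free_nonassoc V" if "letters t \<subseteq> V" for t and c :: 'k
    using that by (simp add: free_nonassoc_def)
  show "bilinear_ext Br p q \<in> free_nonassoc V" if "p \<in> free_nonassoc V" "q \<in> free_nonassoc V"
  proof -
    have sum: "(\<Sum>i\<in>I. f i) \<in> free_nonassoc V" if "\<And>i. i \<in> I \<Longrightarrow> f i \<in> free_nonassoc V"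
      for I :: "'v lie_word set" and f :: "_ \<Rightarrow> 'v lie_word \<Rightarrow>\<^sub>0 'k"
      using that by (induction I rule: infinite_finite_induct) (simp_all add: z add)
    show ?thesis unfolding bilinear_ext_def
      by (intro sum s) (use that in \<open>auto simp: free_nonassoc_def\<close>)
  qed
qed

section \<open>The Lie algebra inside the trace algebra, and its enveloping algebra\<close>

context raag_lie_algebra
begin

abbreviation eval_L :: "('v lie_word \<Rightarrow>\<^sub>0 'k) \<Rightarrow> 'l" where
  "eval_L \<equiv> eval_nonassoc scale bracket \<iota>"

definition commutator :: "('v projections \<Rightarrow>\<^sub>0 'k) \<Rightarrow> ('v projections \<Rightarrow>\<^sub>0 'k) \<Rightarrow> ('v projections \<Rightarrow>\<^sub>0 'k)" where
  "commutator p q = p * q - q * p"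

definition eval_R :: "('v lie_word \<Rightarrow>\<^sub>0 'k) \<Rightarrow> ('v projections \<Rightarrow>\<^sub>0 'k)" where
  "eval_R = plin (eval_word commutator (\<lambda>v. single (tr [v]) 1))"

lemma eval_L_lin_ext: "eval_L = lin_ext scale (eval_word bracket \<iota>)"
  by (simp add: fun_eq_iff eval_nonassoc_def lin_ext_def)

lemma eval_L_simps:
  "eval_L 0 = 0" "eval_L (p + q) = eval_L p + eval_L q" "eval_L (p - q) = eval_L p - eval_L q"
  "eval_L (Poly_Mapping.map ((*) c) p) = scale c (eval_L p)"
  "eval_L (bilinear_ext Br p q) = bracket (eval_L p) (eval_L q)"
  "eval_L (single t c) = scale c (eval_word bracket \<iota> t)"
  unfolding eval_L_lin_ext
  by (rule lin_ext_0[OF vector_space_axioms] lin_ext_add[OF vector_space_axioms]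
      lin_ext_diff[OF vector_space_axioms] lin_ext_scale[OF vector_space_axioms]
      eval_word_bilinear_ext[OF vector_space_axioms] lin_ext_single[OF vector_space_axioms]
      bracket_add_left bracket_add_right bracket_scale_left bracket_scale_right)+

lemma eval_R_simps:
  "eval_R 0 = 0" "eval_R (p + q) = eval_R p + eval_R q" "eval_R (p - q) = eval_R p - eval_R q"
  "eval_R (Poly_Mapping.map ((*) c) p) = cst c * eval_R p"
  "eval_R (bilinear_ext Br p q) = commutator (eval_R p) (eval_R q)"
  "eval_R (single t c) = cst c * eval_word commutator (\<lambda>v. single (tr [v]) 1) t"
proof -
  show "eval_R (bilinear_ext Br p q) = commutator (eval_R p) (eval_R q)"
    unfolding eval_R_def
  proof (rule eval_word_bilinear_ext[OF pm.vector_space_axioms])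
    show "commutator (cst c * x) y = cst c * commutator x y" for c x y
      by (simp add: commutator_def right_diff_distrib mult.assoc cst_left_commute[of y])
    show "commutator x (cst c * y) = cst c * commutator x y" for c x y
      by (simp add: commutator_def right_diff_distrib mult.assoc cst_left_commute[of x])
  qed (simp_all add: commutator_def algebra_simps)
qed (simp_all add: eval_R_def plin_add plin_diff lin_ext_scale[OF pm.vector_space_axioms])

lemma eval_R_relations: "p \<in> raag_relations G \<Longrightarrow> eval_R p = 0"
proof (induction rule: raag_relations.induct)
  case (jacobi p q r)
  show ?case
    by (simp add: eval_R_simps commutator_def) (simp add: algebra_simps)
next
  case (edge v w)
  show ?case
    using tr_commute[OF edge] by (simp add: eval_R_simps commutator_def mult_single)
qed (simp_all add: eval_R_simps commutator_def)

text \<open>The choice of the preimage is immaterial: the kernel of \<open>eval_L\<close> is the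
  ideal of relations, on which \<open>eval_R\<close> vanishes.\<close>

definition \<theta> :: "'l \<Rightarrow> ('v projections \<Rightarrow>\<^sub>0 'k)" where
  "\<theta> x = eval_R (SOME p. p \<in> free_nonassoc (pverts G) \<and> eval_L p = x)"

lemma \<theta>_eval: "p \<in> free_nonassoc (pverts G) \<Longrightarrow> \<theta> (eval_L p) = eval_R p"
proof -
  assume p: "p \<in> free_nonassoc (pverts G)"
  let ?q = "SOME q. q \<in> free_nonassoc (pverts G) \<and> eval_L q = eval_L p"
  have q: "?q \<in> free_nonassoc (pverts G) \<and> eval_L ?q = eval_L p"
    by (rule someI[of "\<lambda>q. q \<in> free_nonassoc (pverts G) \<and> eval_L q = eval_L p" p]) (simp add: p)
  have "?q - p \<in> {p \<in> free_nonassoc (pverts G). eval_L p = 0}"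
    using p q by (simp add: free_nonassoc_closed eval_L_simps)
  then have "eval_R (?q - p) = 0"
    unfolding presentation_kernel by (rule eval_R_relations)
  then show ?thesis by (simp add: \<theta>_def eval_R_simps)
qed

lemma eval_L_onto: obtains p where "p \<in> free_nonassoc (pverts G)" "x = eval_L p"
  using presentation_onto by (metis UNIV_I image_iff)

sublocale lie_rep scale bracket \<theta>
proof
  fix x y :: 'l and c :: 'k
  obtain p where p: "p \<in> free_nonassoc (pverts G)" "x = eval_L p" by (rule eval_L_onto)
  obtain q where q: "q \<in> free_nonassoc (pverts G)" "y = eval_L q" by (rule eval_L_onto)
  show "\<theta> (x + y) = \<theta> x + \<theta> y"
    using \<theta>_eval[OF free_nonassoc_closed(2)[OF p(1) q(1)]] p q by (simp add: \<theta>_eval eval_L_simps eval_R_simps)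
  show "\<theta> (scale c x) = cst c * \<theta> x"
    using \<theta>_eval[OF free_nonassoc_closed(4)[OF p(1), of c]] p by (simp add: \<theta>_eval eval_L_simps eval_R_simps)
  show "\<theta> (bracket x y) = \<theta> x * \<theta> y - \<theta> y * \<theta> x"
    using \<theta>_eval[OF free_nonassoc_closed(5)[OF p(1) q(1)]] p q
    by (simp add: \<theta>_eval eval_L_simps eval_R_simps commutator_def)
qed

lemma \<theta>_generator: "v \<in> pverts G \<Longrightarrow> \<theta> (\<iota> v) = single (tr [v]) 1"
  using \<theta>_eval[OF free_nonassoc_closed(6)[of "Gen v" "pverts G" 1]]
  by (simp add: eval_L_simps eval_R_simps)

lemma lie_induct [case_names generator zero add scale bracket]:
  assumes "\<And>v. v \<in> pverts G \<Longrightarrow> P (\<iota> v)" and "P 0" and add: "\<And>x y. P x \<Longrightarrow> P y \<Longrightarrow> P (x + y)"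
    and sc: "\<And>c x. P x \<Longrightarrow> P (scale c x)" and br: "\<And>x y. P x \<Longrightarrow> P y \<Longrightarrow> P (bracket x y)"
  shows "P x"
proof -
  obtain p where p: "p \<in> free_nonassoc (pverts G)" "x = eval_L p" by (rule eval_L_onto)
  have w: "letters t \<subseteq> pverts G \<Longrightarrow> P (eval_word bracket \<iota> t)" for t
    by (induction t) (use assms in auto)
  have "keys p \<subseteq> {t. letters t \<subseteq> pverts G}" using p(1) by (auto simp: free_nonassoc_def)
  then have "P (eval_L p)"
    by (induction p rule: poly_mapping_keys_induct) (use assms w in \<open>auto simp: eval_L_simps\<close>)
  then show ?thesis by (simp add: p)
qed

definition trace_algebra :: "('v projections \<Rightarrow>\<^sub>0 'k) set" where
  "trace_algebra = {p. keys p \<subseteq> traces}"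

lemma trace_algebra_closed:
  "0 \<in> trace_algebra" "p \<in> trace_algebra \<Longrightarrow> q \<in> trace_algebra \<Longrightarrow> p + q \<in> trace_algebra"
  "p \<in> trace_algebra \<Longrightarrow> q \<in> trace_algebra \<Longrightarrow> p - q \<in> trace_algebra"
  "p \<in> trace_algebra \<Longrightarrow> q \<in> trace_algebra \<Longrightarrow> p * q \<in> trace_algebra"
  "p \<in> trace_algebra \<Longrightarrow> cst c * p \<in> trace_algebra"
  "t \<in> traces \<Longrightarrow> single t c \<in> trace_algebra" "1 \<in> trace_algebra"
proof -
  assume p: "p \<in> trace_algebra"
  show "cst c * p \<in> trace_algebra" using p keys_cst_mult[of c p] by (auto simp: trace_algebra_def)
  assume q: "q \<in> trace_algebra"
  show "p + q \<in> trace_algebra" "p - q \<in> trace_algebra"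
    using p q keys_add[of p q] keys_diff[of p q] unfolding trace_algebra_def by blast+
  show "p * q \<in> trace_algebra"
    using p q keys_mult[of p q] traces_add unfolding trace_algebra_def by blast
qed (auto simp: trace_algebra_def traces_0)

lemma \<theta>_trace_algebra: "\<theta> x \<in> trace_algebra \<and> lookup (\<theta> x) 0 = 0"
proof (induction x rule: lie_induct)
  case (generator v)
  then show ?case using tr_single_nonzero
    by (auto simp: \<theta>_generator lookup_single traces_single trace_algebra_closed)
next
  case zero
  have "\<theta> 0 = 0" using \<theta>_add[of 0 0] by simp
  then show ?case by (simp add: trace_algebra_closed)
qed (auto simp: \<theta>_add \<theta>_scale \<theta>_bracket lookup_add lookup_minus lookup_mult_0_projections trace_algebra_closed)

lemma single_tr_U: "ws \<in> lists (pverts G) \<Longrightarrow> single (tr ws) 1 \<in> U UNIV"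
proof (induction ws)
  case Nil
  then show ?case using U_closed(2) by (simp add: tr_Nil)
next
  case (Cons w ws)
  have "single (tr (w # ws)) 1 = \<theta> (\<iota> w) * single (tr ws) 1"
    using Cons by (simp add: \<theta>_generator mult_single tr_Cons[of w ws])
  then show ?case using Cons by (auto intro: U_closed)
qed

lemma U_UNIV: "U UNIV = trace_algebra"
proof
  show "U UNIV \<subseteq> trace_algebra"
  proof
    fix u assume "u \<in> U UNIV"
    then show "u \<in> trace_algebra"
      by (induction rule: U_induct) (auto intro: trace_algebra_closed conjunct1[OF \<theta>_trace_algebra])
  qed
  show "trace_algebra \<subseteq> U UNIV"
  proof
    fix p assume "p \<in> trace_algebra"
    then have "keys p \<subseteq> traces" by (simp add: trace_algebra_def)
    then show "p \<in> U UNIV"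
    proof (induction p rule: poly_mapping_keys_induct)
      case (single t c)
      then show ?case
        using U_closed(7)[OF single_tr_U, of _ c] by (auto simp: traces_def mult_single)
    qed (auto intro: U_closed)
  qed
qed

lemma lie_subalgebra_UNIV: "lie_subalgebra UNIV"
  by (simp add: lie_subalgebra_def)

lemma free_words_UNIV: "p \<in> free_words UNIV"
  by (simp add: free_words_def)

lemmas env_U_0 = env_0[OF lie_subalgebra_UNIV] and env_U_add = env_add[OF lie_subalgebra_UNIV]
  and env_U_diff = env_diff[OF lie_subalgebra_UNIV] and env_U_minus = env_minus[OF lie_subalgebra_UNIV]
  and env_U_lmult = env_lmult[OF lie_subalgebra_UNIV _ free_words_UNIV]
  and env_U_rmult = env_rmult[OF lie_subalgebra_UNIV _ free_words_UNIV]
  and env_U_cst = env_cst_mult[OF lie_subalgebra_UNIV]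

definition word :: "'v list \<Rightarrow> ('l list \<Rightarrow>\<^sub>0 'k)" where
  "word ws = single (map \<iota> ws) 1"

lemma word_append: "word (xs @ ys) = word xs * word ys"
  by (simp add: word_def mult_single plus_list_def)

lemma word_Nil: "word [] = 1"
  by (simp add: word_def single_Nil)

lemma bracket_adj: "adj u v \<Longrightarrow> bracket (\<iota> u) (\<iota> v) = 0"
proof -
  assume a: "adj u v"
  have "single (Br (Gen u) (Gen v)) 1 \<in> {p \<in> free_nonassoc (pverts G). eval_L p = 0}"
    unfolding presentation_kernel using a by (rule raag_relations.edge)
  then show ?thesis by (simp add: eval_L_simps)
qed

lemma env_single_0: "single [0] 1 \<in> env UNIV"
  using env_relation_scale[OF lie_subalgebra_UNIV, of 0 0] by simp

lemma word_commute: "adj u v \<Longrightarrow> word [u] * word [v] - word [v] * word [u] \<in> env UNIV"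
  using env_U_add[OF env_relation_bracket[OF lie_subalgebra_UNIV, of "\<iota> u" "\<iota> v"] env_single_0]
  by (simp add: word_def bracket_adj)

lemma word_commute_list:
  "(\<And>x. x \<in> set w \<Longrightarrow> adj u x) \<Longrightarrow> word [u] * word w - word w * word [u] \<in> env UNIV"
proof (induction w)
  case Nil
  then show ?case by (simp add: word_Nil env_U_0)
next
  case (Cons x w)
  have w: "word (x # w) = word [x] * word w" using word_append[of "[x]" w] by simp
  have "word [u] * word (x # w) - word (x # w) * word [u]
      = (word [u] * word [x] - word [x] * word [u]) * word w + word [x] * (word [u] * word w - word w * word [u])"
    by (simp only: w) (simp add: algebra_simps)
  moreover have "word [u] * word [x] - word [x] * word [u] \<in> env UNIV"
    "word [u] * word w - word w * word [u] \<in> env UNIV"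
    using Cons by (auto intro: word_commute)
  ultimately show ?case using env_U_add[OF env_U_rmult env_U_lmult] by metis
qed

text \<open>The enveloping relations allow adjacent letters to be exchanged. By
  \<open>tr_eq_snoc\<close> the last letter of \<open>us\<close> can be moved to the end of
  \<open>vs\<close> by such exchanges, and induction handles the rest.\<close>

lemma word_cong: "tr us = tr vs \<Longrightarrow> word us - word vs \<in> env UNIV"
proof (induction us arbitrary: vs rule: rev_induct)
  case Nil
  have "vs = []"
  proof (cases vs)
    case (Cons v vs')
    then have "tr [v] = 0"
      using Nil tr_Cons[of v vs'] projections_add_eq_0 by (metis tr_Nil)
    then show ?thesis using tr_single_nonzero by blast
  qed
  then show ?case by (simp add: env_U_0)
next
  case (snoc u us)
  have "tr vs = tr us + tr [u]" using snoc.prems by (simp add: tr_append)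
  then obtain w1 w2 where w: "vs = w1 @ u # w2" "\<And>x. x \<in> set w2 \<Longrightarrow> adj u x" "tr (w1 @ w2) = tr us"
    by (rule tr_eq_snoc) blast
  have vs: "word vs = word w1 * (word [u] * word w2)"
    using word_append[of w1 "u # w2"] word_append[of "[u]" w2] by (simp add: w(1))
  have "word (us @ [u]) - word vs
    = (word us - word (w1 @ w2)) * word [u] - word w1 * (word [u] * word w2 - word w2 * word [u])"
    unfolding word_append vs by (simp add: algebra_simps)
  moreover have "word us - word (w1 @ w2) \<in> env UNIV" using snoc.IH[of "w1 @ w2"] w(3) by simp
  moreover have "word [u] * word w2 - word w2 * word [u] \<in> env UNIV" by (rule word_commute_list) (rule w(2))
  ultimately show ?case using env_U_diff[OF env_U_rmult env_U_lmult] by metis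
qed

text \<open>A linear section of \<open>\<Phi>\<close> over the trace algebra, multiplicative modulo the relations.\<close>

definition lift :: "('v projections \<Rightarrow>\<^sub>0 'k) \<Rightarrow> ('l list \<Rightarrow>\<^sub>0 'k)" where
  "lift = plin (\<lambda>t. word (SOME ws. ws \<in> lists (pverts G) \<and> tr ws = t))"

lemma lift_simps: "lift 0 = 0" "lift (p + q) = lift p + lift q" "lift (p - q) = lift p - lift q"
  "lift (cst c * p) = cst c * lift p"
  by (simp_all add: lift_def plin_add plin_diff plin_cst_mult)

lemma lift_tr: "ws \<in> lists (pverts G) \<Longrightarrow> word ws - lift (single (tr ws) 1) \<in> env UNIV"
proof -
  assume ws: "ws \<in> lists (pverts G)"
  let ?v = "SOME vs. vs \<in> lists (pverts G) \<and> tr vs = tr ws"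
  have "tr ?v = tr ws" using someI[of "\<lambda>vs. vs \<in> lists (pverts G) \<and> tr vs = tr ws" ws] ws by blast
  then have "word ws - word ?v \<in> env UNIV" by (intro word_cong) simp
  then show ?thesis by (simp add: lift_def)
qed

lemma lift_mult:
  assumes "keys p \<subseteq> traces" "keys q \<subseteq> traces"
  shows "lift p * lift q - lift (p * q) \<in> env UNIV"
  using assms(1)
proof (induction p rule: poly_mapping_keys_induct)
  case (single s a)
  then obtain xs where xs: "xs \<in> lists (pverts G)" "s = tr xs" by (auto simp: traces_def)
  show ?case
    using assms(2)
  proof (induction q rule: poly_mapping_keys_induct)
    case (single t b)
    then obtain ys where ys: "ys \<in> lists (pverts G)" "t = tr ys" by (auto simp: traces_def)
    let ?l = "\<lambda>t. lift (single t 1)"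
    have l: "lift (single t c) = cst c * ?l t" for t c
      using lift_simps(4)[of c "single t 1"] by (simp add: mult_single)
    have e: "xs @ ys \<in> lists (pverts G)" using xs ys by simp
    have "?l s * ?l t - ?l (s + t)
      = (word (xs @ ys) - ?l (tr (xs @ ys))) - (word xs - ?l s) * word ys - ?l s * (word ys - ?l t)"
      by (simp add: xs(2) ys(2) tr_append word_append algebra_simps)
    also have "\<dots> \<in> env UNIV"
      unfolding xs(2) ys(2)
      by (intro env_U_diff env_U_rmult env_U_lmult lift_tr e xs ys)
    finally have "cst (a * b) * (?l s * ?l t - ?l (s + t)) \<in> env UNIV" by (rule env_U_cst)
    moreover have "lift (single s a) * lift (single t b) - lift (single s a * single t b)
      = cst (a * b) * (?l s * ?l t - ?l (s + t))"
      by (simp only: mult_single[of s a t b] l[of _ a] l[of _ b] l[of _ "a * b"] cst_mult mult.assoc right_diff_distrib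
          cst_left_commute[of "?l s"])
    ultimately show ?case by simp
  next
    case (add p' q')
    then show ?case using env_U_add[OF add] by (simp add: lift_simps algebra_simps)
  qed (simp add: lift_simps env_U_0)
next
  case (add p' q')
  then show ?case using env_U_add[OF add] by (simp add: lift_simps algebra_simps)
qed (simp add: lift_simps env_U_0)

text \<open>The elements with this property contain \<open>env UNIV\<close> and are closed under
  linear combinations and products. As the letters are arbitrary vectors, the enveloping relations
  reduce them to the generators, for which it is \<open>lift_tr\<close>.\<close>

lemma lift_\<Phi>: "p - lift (\<Phi> p) \<in> env UNIV"
proof -
  define S where "S = {p. p - lift (\<Phi> p) \<in> env UNIV}"
  have S_add: "p + q \<in> S" if "p \<in> S" "q \<in> S" for p q
    using env_U_add[of "p - lift (\<Phi> p)" "q - lift (\<Phi> q)"] that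
    by (simp add: S_def \<Phi>_simps lift_simps algebra_simps)
  have S_cst: "cst c * p \<in> S" if "p \<in> S" for p c
    using env_U_cst[of "p - lift (\<Phi> p)" c] that by (simp add: S_def \<Phi>_simps lift_simps right_diff_distrib)
  have \<Phi>_traces: "keys (\<Phi> p) \<subseteq> traces" for p
    using U_UNIV free_words_UNIV[of p] by (auto simp: U_def trace_algebra_def)
  have S_mult: "p * q \<in> S" if "p \<in> S" "q \<in> S" for p q
  proof -
    have "p * q - lift (\<Phi> (p * q)) = (p - lift (\<Phi> p)) * q + lift (\<Phi> p) * (q - lift (\<Phi> q))
        + (lift (\<Phi> p) * lift (\<Phi> q) - lift (\<Phi> p * \<Phi> q))"
      by (simp add: \<Phi>_simps algebra_simps)
    also have "\<dots> \<in> env UNIV"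
      using that by (intro env_U_add env_U_rmult env_U_lmult lift_mult \<Phi>_traces) (auto simp: S_def)
    finally show ?thesis by (simp add: S_def)
  qed
  have S_env: "p \<in> S" if "p \<in> env UNIV" for p
    using \<Phi>_env[OF lie_subalgebra_UNIV that] that by (simp add: S_def lift_simps)
  have S_diff: "p - q \<in> S" if "p \<in> S" "q \<in> S" for p q
    using S_add[OF that(1) S_cst[OF that(2), of "- 1"]]
    by (simp add: single_uminus)
  have S_word: "word ws \<in> S" if "ws \<in> lists (pverts G)" for ws
  proof -
    have "\<Phi> (word ws) = single (tr ws) 1" using that
    proof (induction ws)
      case Nil
      then show ?case by (simp add: word_Nil tr_Nil \<Phi>_simps)
    next
      case (Cons w ws)
      have "word (w # ws) = word [w] * word ws" using word_append[of "[w]" ws] by simp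
      then show ?case
        using Cons by (simp add: \<Phi>_simps tr_Cons[of w ws] mult_single[symmetric])
          (simp add: word_def \<Phi>_simps \<theta>_generator mult_single)
    qed
    then show ?thesis using lift_tr[OF that] by (simp add: S_def)
  qed
  have S_single: "single [x] 1 \<in> S" for x
  proof (induction x rule: lie_induct)
    case (generator v)
    then show ?case using S_word[of "[v]"] by (simp add: word_def)
  next
    case zero
    then show ?case by (rule S_env[OF env_single_0])
  next
    case (add x y)
    then show ?case
      using S_add[OF S_add[OF S_env[OF env_relation_add[OF lie_subalgebra_UNIV, of x y]] add(1)] add(2)] by simp
  next
    case (scale c x)
    then show ?case
      using S_add[OF S_env[OF env_relation_scale[OF lie_subalgebra_UNIV, of x c]] S_cst[OF scale, of c]] by simp
  next
    case (bracket x y)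
    have "single [bracket x y] 1 = single [x] 1 * single [y] 1 - single [y] 1 * single [x] 1
      - (single [x] 1 * single [y] 1 - single [y] 1 * single [x] 1 - single [bracket x y] (1 :: 'k))" by simp
    then show ?case
      using S_diff[OF S_diff[OF S_mult[OF bracket] S_mult[OF bracket(2,1)]]
          S_env[OF env_relation_bracket[OF lie_subalgebra_UNIV, of x y]]] by simp
  qed
  have "p \<in> S"
    using free_words_UNIV[of p]
  proof (induction p rule: free_words_induct)
    case one
    then show ?case using S_word[of "[]"] by (simp add: word_Nil)
  qed (auto intro: S_env env_U_0 S_mult S_single S_cst S_add)
  then show ?thesis by (simp add: S_def)
qed

lemma faithful_UNIV: "faithful_on UNIV"
  unfolding faithful_on_def
proof (intro ballI impI)
  fix p assume "\<Phi> p = 0"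
  then show "p \<in> env UNIV" using lift_\<Phi>[of p] by (simp add: lift_simps)
qed

text \<open>The generators of a clique commute, so all brackets in their span vanish and the span is
  a subalgebra already.\<close>

lemma L_on_complete:
  assumes A: "A \<in> complete_vertex_sets G"
  shows "L_on A \<subseteq> {\<Sum>v\<in>A. scale (a v) (\<iota> v) | a. True}"
proof -
  let ?S = "{\<Sum>v\<in>A. scale (a v) (\<iota> v) | a. True}"
  have fin: "finite A" using A finite_subset[OF _ finite_verts] by (auto simp: complete_vertex_sets_def)
  have br: "bracket (\<iota> v) (\<iota> w) = 0" if "v \<in> A" "w \<in> A" for v w
    using A that bracket_adj[of v w] bracket_self by (cases "v = w") (auto simp: complete_vertex_sets_def)
  have br_sum: "bracket (\<Sum>i\<in>I. f i) x = (\<Sum>i\<in>I. bracket (f i) x)" "bracket x (\<Sum>i\<in>I. f i) = (\<Sum>i\<in>I. bracket x (f i))"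
    for I :: "'v set" and f x
    by (induction I rule: infinite_finite_induct) (auto simp: bracket_add_left bracket_add_right)
  have sub: "subspace ?S"
    unfolding subspace_def
  proof (intro conjI ballI allI)
    show "0 \<in> ?S" by (rule CollectI, rule exI[of _ "\<lambda>_. 0"]) simp
  next
    fix x y assume "x \<in> ?S" "y \<in> ?S"
    then obtain a b where "x = (\<Sum>v\<in>A. scale (a v) (\<iota> v))" "y = (\<Sum>v\<in>A. scale (b v) (\<iota> v))" by auto
    then have "x + y = (\<Sum>v\<in>A. scale (a v + b v) (\<iota> v))" by (simp add: scale_left_distrib sum.distrib)
    then show "x + y \<in> ?S" by (intro CollectI exI[of _ "\<lambda>v. a v + b v"]) simp
  next
    fix c x assume "x \<in> ?S"
    then obtain a where "x = (\<Sum>v\<in>A. scale (a v) (\<iota> v))" by auto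
    then have "scale c x = (\<Sum>v\<in>A. scale (c * a v) (\<iota> v))" by (simp add: scale_sum_right)
    then show "scale c x \<in> ?S" by (intro CollectI exI[of _ "\<lambda>v. c * a v"]) simp
  qed
  have brS: "bracket x y \<in> ?S" if xy: "x \<in> ?S" "y \<in> ?S" for x y
  proof -
    have "bracket x y = 0"
      using xy br by (auto simp: br_sum bracket_scale_left bracket_scale_right intro!: sum.neutral)
    then show ?thesis by (intro CollectI exI[of _ "\<lambda>_. 0"]) simp
  qed
  have gen: "\<iota> v \<in> ?S" if v: "v \<in> A" for v
  proof -
    have "(\<Sum>u\<in>A. scale (if u = v then 1 else 0) (\<iota> u)) = (\<Sum>u\<in>A. if u = v then \<iota> u else 0)"
      by (rule sum.cong) auto
    also have "\<dots> = \<iota> v" using fin v by simp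
    finally show ?thesis by (intro CollectI exI[of _ "\<lambda>u. if u = v then 1 else 0"]) simp
  qed
  have "lie_subalgebra ?S" unfolding lie_subalgebra_def by (intro conjI ballI sub brS)
  moreover have "\<iota> ` A \<subseteq> ?S" by (intro image_subsetI gen)
  ultimately have "?S \<in> {N. lie_subalgebra N \<and> \<iota> ` A \<subseteq> N}" by (intro CollectI conjI)
  then show ?thesis unfolding L_on_def generated_subalgebra_def by (rule Inter_lower)
qed

end


section \<open>The complex of cliques and simplices\<close>

lemma sum_antisymmetric_pairs:
  fixes a :: "'v \<Rightarrow> 'v \<Rightarrow> 'r::ab_group_add" and pos :: "'v \<Rightarrow> nat"
  assumes S: "finite S" and pos: "inj_on pos S"
    and a: "\<And>u v. u \<in> S \<Longrightarrow> v \<in> S \<Longrightarrow> u \<noteq> v \<Longrightarrow> a u v = - a v u"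
  shows "(\<Sum>v\<in>S. \<Sum>u\<in>S - {v}. a v u) = 0"
proof -
  \<comment> \<open>Antisymmetry alone shows that twice the sum vanishes, which is worthless in
    characteristic 2. So the ordered pairs are separated by \<open>pos\<close> and each is matched
    with its opposite.\<close>
  have split: "(\<Sum>u\<in>S - {v}. a v u)
      = (\<Sum>u\<in>S. if pos u < pos v then a v u else 0) + (\<Sum>u\<in>S. if pos v < pos u then a v u else 0)"
    if v: "v \<in> S" for v
  proof -
    have "(\<Sum>u\<in>S - {v}. a v u) = (\<Sum>u\<in>S - {v}. (if pos u < pos v then a v u else 0) + (if pos v < pos u then a v u else 0))"
    proof (rule sum.cong[OF refl])
      fix u assume "u \<in> S - {v}"
      then have "pos u < pos v \<or> pos v < pos u"
        using inj_onD[OF pos, of u v] v by (metis DiffE insertI1 nat_neq_iff)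
      then show "a v u = (if pos u < pos v then a v u else 0) + (if pos v < pos u then a v u else 0)" by auto
    qed
    also have "\<dots> = (\<Sum>u\<in>S. (if pos u < pos v then a v u else 0) + (if pos v < pos u then a v u else 0))"
      by (rule sum.mono_neutral_left) (use S in auto)
    finally show ?thesis by (simp add: sum.distrib)
  qed
  have "(\<Sum>v\<in>S. \<Sum>u\<in>S. if pos v < pos u then a v u else 0) = (\<Sum>u\<in>S. \<Sum>v\<in>S. if pos v < pos u then a v u else 0)"
    by (rule sum.swap)
  also have "\<dots> = (\<Sum>u\<in>S. \<Sum>v\<in>S. - (if pos v < pos u then a u v else 0))"
  proof (intro sum.cong refl)
    fix u v assume "u \<in> S" "v \<in> S"
    then show "(if pos v < pos u then a v u else 0) = - (if pos v < pos u then a u v else 0)"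
      using a[of v u] by (cases "u = v") auto
  qed
  finally show ?thesis by (simp add: split sum.distrib sum_negf)
qed

text \<open>The sign of moving \<open>v\<close> from the front to its place in the product of the
  elements of \<open>B\<close>, ordered by \<open>pos\<close>.\<close>

definition sg :: "('v \<Rightarrow> nat) \<Rightarrow> 'v \<Rightarrow> 'v set \<Rightarrow> 'r::ring_1" where
  "sg pos v B = (- 1) ^ card {u \<in> B. pos u < pos v}"

lemma minus_one_power_commute: "(- 1) ^ n * x = x * (- 1 :: 'r::ring_1) ^ n"
  by (cases "even n") auto

lemma sg_commute: "sg pos v B * x = x * (sg pos v B :: 'r::ring_1)"
  unfolding sg_def by (rule minus_one_power_commute)

lemma sg_square: "sg pos v B * (sg pos v B * x) = (x :: 'r::ring_1)"
  by (cases "even (card {u \<in> B. pos u < pos v})") (auto simp: sg_def)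

lemma sg_insert:
  assumes "finite B" "u \<notin> B"
  shows "sg pos v (insert u B) = (if pos u < pos v then - sg pos v B else (sg pos v B :: 'r::ring_1))"
proof (cases "pos u < pos v")
  case True
  then have "{w \<in> insert u B. pos w < pos v} = insert u {w \<in> B. pos w < pos v}" by auto
  then show ?thesis using assms True by (simp add: sg_def)
next
  case False
  then have "{w \<in> insert u B. pos w < pos v} = {w \<in> B. pos w < pos v}" by auto
  then show ?thesis using False by (simp add: sg_def)
qed

lemma sg_swap:
  assumes "finite B" "u \<notin> B" "v \<notin> B" "pos u \<noteq> pos v"
  shows "sg pos v B * sg pos u (insert v B) = - (sg pos u B * sg pos v (insert u B) :: 'r::ring_1)"
  using assms by (simp add: sg_insert sg_commute[of pos u B])

text \<open>The sign behind the anticommutation of \<open>contract\<close> with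
  \<open>wedge\<close>: on the left, \<open>v\<close> is inserted while \<open>u\<close> is present
  and \<open>u\<close> is treated while \<open>v\<close> is present; on the right, each is without
  the other.\<close>

lemma sg_swap2:
  assumes "finite B" "u \<notin> B" "v \<notin> B" "pos u \<noteq> pos v"
  shows "sg pos v (insert u B) * sg pos u (insert v B) = - (sg pos u B * sg pos v B :: 'r::ring_1)"
  using assms by (simp add: sg_insert sg_commute[of pos u B])

text \<open>The interior product, with \<open>f B\<close> as the left coefficient of the basis
  vector of \<open>B\<close> in the exterior algebra. The weight multiplies from the right, so the
  map is left linear. For the weight given by the generators it is the Koszul differential, for
  scalar weights the contraction with a functional.\<close>

definition contract :: "'v set \<Rightarrow> ('v \<Rightarrow> nat) \<Rightarrow> ('v \<Rightarrow> 'r) \<Rightarrow> ('v set \<Rightarrow> 'r) \<Rightarrow> 'v set \<Rightarrow> 'r::ring_1" where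
  "contract V pos \<xi> f B = (\<Sum>v\<in>V - B. sg pos v B * (f (insert v B) * \<xi> v))"

text \<open>The exterior product with the vector whose coordinates are \<open>y v\<close>.\<close>

definition wedge :: "'v set \<Rightarrow> ('v \<Rightarrow> nat) \<Rightarrow> ('v \<Rightarrow> 'r) \<Rightarrow> ('v set \<Rightarrow> 'r) \<Rightarrow> 'v set \<Rightarrow> 'r::ring_1" where
  "wedge V pos y f B = (\<Sum>v\<in>V \<inter> B. sg pos v (B - {v}) * (f (B - {v}) * y v))"

lemma contract_add: "contract V pos \<xi> (\<lambda>B. f B + g B) B = contract V pos \<xi> f B + contract V pos \<xi> g B"
  by (simp add: contract_def distrib_left distrib_right sum.distrib)

lemma contract_diff: "contract V pos \<xi> (\<lambda>B. f B - g B) B = contract V pos \<xi> f B - contract V pos \<xi> g B"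
  by (simp add: contract_def left_diff_distrib right_diff_distrib sum_subtractf)

lemma contract_zero: "contract V pos \<xi> (\<lambda>B. 0) B = 0"
  by (simp add: contract_def)

lemma contract_lmult: "contract V pos \<xi> (\<lambda>B. a * f B) B = a * contract V pos \<xi> f B"
  unfolding contract_def sum_distrib_left
proof (rule sum.cong[OF refl])
  fix v
  show "sg pos v B * (a * f (insert v B) * \<xi> v) = a * (sg pos v B * (f (insert v B) * \<xi> v))"
    using sg_commute[of pos v B a] by (simp add: mult.assoc[symmetric])
qed

lemma contract_rmult:
  assumes "\<And>v. v \<in> V \<Longrightarrow> a * \<xi> v = \<xi> v * a"
  shows "contract V pos \<xi> (\<lambda>B. f B * a) B = contract V pos \<xi> f B * a"
  unfolding contract_def sum_distrib_right
  by (rule sum.cong[OF refl]) (use assms in \<open>simp add: mult.assoc\<close>)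

lemma contract_rmult_sum:
  "contract V pos (\<lambda>v. \<xi> v * a) f B = contract V pos \<xi> f B * a"
  by (simp add: contract_def sum_distrib_right mult.assoc)

lemma contract_weight_sum:
  "contract V pos (\<lambda>v. \<Sum>i\<in>I. \<xi> i v) f B = (\<Sum>i\<in>I. contract V pos (\<xi> i) f B)"
  unfolding contract_def by (subst sum.swap) (simp add: sum_distrib_left)

lemma contract_weight_diff:
  "contract V pos (\<lambda>v. \<xi> v - \<eta> v) f B = contract V pos \<xi> f B - contract V pos \<eta> f B"
  by (simp add: contract_def right_diff_distrib sum_subtractf)

lemma wedge_zero: "wedge V pos y (\<lambda>B. 0) B = 0"
  by (simp add: wedge_def)

context
  fixes V :: "'v set" and pos :: "'v \<Rightarrow> nat"
  assumes V: "finite V" and pos: "inj_on pos V"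
begin

lemma contract_contract:
  assumes B: "B \<subseteq> V"
  shows "contract V pos \<xi> (contract V pos \<eta> f) B
    = (\<Sum>v\<in>V - B. \<Sum>u\<in>(V - B) - {v}. sg pos v B * sg pos u (insert v B) * (f (insert u (insert v B)) * (\<eta> u * \<xi> v)))"
  unfolding contract_def[of _ _ \<xi>]
proof (rule sum.cong[OF refl])
  fix v assume v: "v \<in> V - B"
  have "V - insert v B = (V - B) - {v}" by auto
  then show "sg pos v B * (contract V pos \<eta> f (insert v B) * \<xi> v)
    = (\<Sum>u\<in>(V - B) - {v}. sg pos v B * sg pos u (insert v B) * (f (insert u (insert v B)) * (\<eta> u * \<xi> v)))"
    by (simp add: contract_def sum_distrib_left sum_distrib_right mult.assoc)
qed

lemma contract_anticommute:
  assumes B: "B \<subseteq> V"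
    and comm: "\<And>u v. u \<in> V - B \<Longrightarrow> v \<in> V - B \<Longrightarrow> u \<noteq> v \<Longrightarrow>
      f (insert u (insert v B)) * (\<eta> u * \<xi> v) = f (insert u (insert v B)) * (\<xi> v * \<eta> u)"
  shows "contract V pos \<xi> (contract V pos \<eta> f) B = - contract V pos \<eta> (contract V pos \<xi> f) B"
proof -
  have fB: "finite B" using B V by (rule finite_subset)
  let ?t = "\<lambda>v u. sg pos v B * sg pos u (insert v B) * (f (insert u (insert v B)) * (\<eta> u * \<xi> v))"
  let ?t' = "\<lambda>v u. sg pos v B * sg pos u (insert v B) * (f (insert u (insert v B)) * (\<xi> u * \<eta> v))"
  have "(\<Sum>v\<in>V - B. \<Sum>u\<in>(V - B) - {v}. ?t v u) = (\<Sum>(v, u)\<in>(SIGMA v:V - B. (V - B) - {v}). ?t v u)"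
    using V by (intro sum.Sigma) auto
  also have "\<dots> = (\<Sum>(u, v)\<in>(SIGMA v:V - B. (V - B) - {v}). ?t v u)"
    by (rule sum.reindex_bij_witness[where i = "\<lambda>(u, v). (v, u)" and j = "\<lambda>(u, v). (v, u)"]) auto
  also have "\<dots> = (\<Sum>u\<in>V - B. \<Sum>v\<in>(V - B) - {u}. ?t v u)"
    using V by (intro sum.Sigma[symmetric]) auto
  also have "\<dots> = (\<Sum>u\<in>V - B. \<Sum>v\<in>(V - B) - {u}. - ?t' u v)"
  proof (intro sum.cong refl)
    fix u v assume uv: "u \<in> V - B" "v \<in> V - B - {u}"
    have "pos u \<noteq> pos v" using inj_onD[OF pos, of u v] uv by auto
    then have "sg pos v B * sg pos u (insert v B) = - (sg pos u B * sg pos v (insert u B) :: 'a)"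
      using uv fB by (intro sg_swap) auto
    moreover have "f (insert u (insert v B)) * (\<eta> u * \<xi> v) = f (insert u (insert v B)) * (\<xi> v * \<eta> u)"
      using comm[of u v] uv by auto
    ultimately show "?t v u = - ?t' u v" by (simp add: insert_commute[of u v])
  qed
  finally show ?thesis by (simp add: contract_contract[OF B] sum_negf)
qed

text \<open>Commutation is required only behind a coefficient: the images of \<open>u\<close> and
  \<open>v\<close> commute if both lie in one clique, and the coefficient is zero otherwise.\<close>

lemma contract_square:
  assumes B: "B \<subseteq> V"
    and comm: "\<And>u v. u \<in> V - B \<Longrightarrow> v \<in> V - B \<Longrightarrow> u \<noteq> v \<Longrightarrow>
      f (insert u (insert v B)) * (\<xi> u * \<xi> v) = f (insert u (insert v B)) * (\<xi> v * \<xi> u)"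
  shows "contract V pos \<xi> (contract V pos \<xi> f) B = 0"
  unfolding contract_contract[OF B]
proof (rule sum_antisymmetric_pairs[of _ pos])
  have fB: "finite B" using B V by (rule finite_subset)
  fix u v assume uv: "u \<in> V - B" "v \<in> V - B" "u \<noteq> v"
  have "pos u \<noteq> pos v" using inj_onD[OF pos, of u v] uv by auto
  then have "sg pos u B * sg pos v (insert u B) = - (sg pos v B * sg pos u (insert v B) :: 'a)"
    using uv fB by (intro sg_swap) auto
  then show "sg pos u B * sg pos v (insert u B) * (f (insert v (insert u B)) * (\<xi> v * \<xi> u))
    = - (sg pos v B * sg pos u (insert v B) * (f (insert u (insert v B)) * (\<xi> u * \<xi> v)))"
    using comm[OF uv] by (simp add: insert_commute[of v u])
qed (use V pos in \<open>auto intro: inj_on_subset\<close>)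

text \<open>Contraction is an antiderivation, so the anticommutator with the exterior product by
  \<open>y\<close> is multiplication by the pairing of \<open>y\<close> with \<open>\<xi>\<close>.
  All contracting homotopies on cliques below come from this formula.\<close>

lemma contract_wedge:
  assumes B: "B \<subseteq> V" and y: "\<And>v a. v \<in> V \<Longrightarrow> y v * a = a * y v"
  shows "contract V pos \<xi> (wedge V pos y f) B + wedge V pos y (contract V pos \<xi> f) B = f B * (\<Sum>v\<in>V. y v * \<xi> v)"
proof -
  have fB: "finite B" using B V by (rule finite_subset)
  let ?c = "\<lambda>v u. sg pos v B * (sg pos u (insert v B - {u}) * (f (insert v B - {u}) * (y u * \<xi> v)))"
  let ?w = "\<lambda>v u. sg pos u (B - {u}) * (sg pos v (B - {u}) * (f (insert v (B - {u})) * (\<xi> v * y u)))"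
  have 1: "contract V pos \<xi> (wedge V pos y f) B
    = (\<Sum>v\<in>V - B. f B * (y v * \<xi> v)) + (\<Sum>v\<in>V - B. \<Sum>u\<in>B. ?c v u)"
    unfolding sum.distrib[symmetric] contract_def
  proof (rule sum.cong[OF refl])
    fix v assume v: "v \<in> V - B"
    have VB: "V \<inter> insert v B = insert v B" using v B by auto
    have "sg pos v B * (wedge V pos y f (insert v B) * \<xi> v) = (\<Sum>u\<in>insert v B. ?c v u)"
      by (simp add: wedge_def VB sum_distrib_left sum_distrib_right mult.assoc)
    also have "\<dots> = ?c v v + (\<Sum>u\<in>B. ?c v u)" using v fB by simp
    also have "?c v v = f B * (y v * \<xi> v)" using v by (simp add: sg_square)
    finally show "sg pos v B * (wedge V pos y f (insert v B) * \<xi> v) = f B * (y v * \<xi> v) + (\<Sum>u\<in>B. ?c v u)" .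
  qed
  have 2: "wedge V pos y (contract V pos \<xi> f) B
    = (\<Sum>u\<in>B. f B * (y u * \<xi> u)) + (\<Sum>u\<in>B. \<Sum>v\<in>V - B. ?w v u)"
  proof -
    have VB: "V \<inter> B = B" using B by auto
    show ?thesis
      unfolding sum.distrib[symmetric] wedge_def VB
    proof (rule sum.cong[OF refl])
      fix u assume u: "u \<in> B"
      have VBu: "V - (B - {u}) = insert u (V - B)" using u B by auto
      have "sg pos u (B - {u}) * (contract V pos \<xi> f (B - {u}) * y u) = (\<Sum>v\<in>insert u (V - B). ?w v u)"
        by (simp add: contract_def VBu sum_distrib_left sum_distrib_right mult.assoc)
      also have "\<dots> = ?w u u + (\<Sum>v\<in>V - B. ?w v u)" using u V by simp
      also have "?w u u = f B * (y u * \<xi> u)"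
        using u B y[of u "\<xi> u"] by (auto simp: sg_square insert_absorb)
      finally show "sg pos u (B - {u}) * (contract V pos \<xi> f (B - {u}) * y u)
        = f B * (y u * \<xi> u) + (\<Sum>v\<in>V - B. ?w v u)" .
    qed
  qed
  \<comment> \<open>The terms that insert \<open>v\<close> and remove a different \<open>u\<close>
    cancel; those with \<open>u = v\<close> make up the pairing.\<close>
  have 3: "(\<Sum>u\<in>B. \<Sum>v\<in>V - B. ?w v u) = - (\<Sum>v\<in>V - B. \<Sum>u\<in>B. ?c v u)"
    unfolding sum_negf[symmetric]
  proof (subst sum.swap, intro sum.cong refl)
    fix v u assume uv: "v \<in> V - B" "u \<in> B"
    let ?C = "B - {u}"
    have ins: "insert v B - {u} = insert v ?C" "B = insert u ?C" using uv by auto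
    have "pos u \<noteq> pos v" using inj_onD[OF pos, of u v] uv B by auto
    then have s: "sg pos v (insert u ?C) * sg pos u (insert v ?C) = - (sg pos u ?C * sg pos v ?C :: 'a)"
      using uv fB by (intro sg_swap2) auto
    have "?c v u = sg pos v (insert u ?C) * sg pos u (insert v ?C) * (f (insert v ?C) * (y u * \<xi> v))"
      using ins by (simp add: mult.assoc)
    also have "\<dots> = - ?w v u"
      unfolding s using y[of u "\<xi> v"] uv B by (auto simp: mult.assoc)
    finally show "?w v u = - ?c v u" by simp
  qed
  have "(\<Sum>v\<in>V - B. f B * (y v * \<xi> v)) + (\<Sum>u\<in>B. f B * (y u * \<xi> u)) = (\<Sum>v\<in>V. f B * (y v * \<xi> v))"
    using sum.subset_diff[OF B V, of "\<lambda>v. f B * (y v * \<xi> v)"] by simp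
  then show ?thesis unfolding 1 2 3 by (simp add: sum_distrib_left)
qed

end

text \<open>The simplicial boundary on coefficient functions: the coefficient at \<open>s\<close>
  collects those of all lists that arise from \<open>s\<close> by inserting an element of
  \<open>Y\<close>, with the sign of its position. Lists that are no simplices take part with
  coefficient zero.\<close>

fun insum :: "'c set \<Rightarrow> ('c list \<Rightarrow> 'r) \<Rightarrow> 'c list \<Rightarrow> 'r::ab_group_add" where
  "insum Y f [] = (\<Sum>A\<in>Y. f [A])"
| "insum Y f (x # xs) = (\<Sum>A\<in>Y. f (A # x # xs)) - insum Y (\<lambda>l. f (x # l)) xs"

lemma insum_add: "insum Y (\<lambda>l. f l + g l) s = insum Y f s + insum Y g s"
  by (induction s arbitrary: f g) (auto simp: sum.distrib)

lemma insum_zero: "insum Y (\<lambda>l. 0) s = 0"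
  by (induction s) auto

lemma insum_diff: "insum Y (\<lambda>l. f l - g l) s = insum Y f s - insum Y g s"
  using insum_add[of Y "\<lambda>l. f l - g l" g s] by simp

lemma insum_sum: "insum Y (\<lambda>l. \<Sum>i\<in>I. f i l) s = (\<Sum>i\<in>I. insum Y (f i) s)"
  by (induction I rule: infinite_finite_induct) (auto simp: insum_zero insum_add)

lemma insum_lmult: "insum Y (\<lambda>l. a * f l) s = (a :: 'r::ring) * insum Y f s"
  by (induction s arbitrary: f) (auto simp: sum_distrib_left right_diff_distrib)

lemma insum_rmult: "insum Y (\<lambda>l. f l * a) s = insum Y f s * (a :: 'r::ring)"
  by (induction s arbitrary: f) (auto simp: sum_distrib_right left_diff_distrib)

text \<open>A pair of elements can be inserted in two orders, and these come with opposite
  signs.\<close>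

lemma insum_insum: "insum Y (insum Y f) s = 0"
proof (induction s arbitrary: f)
  case Nil
  have "(\<Sum>A\<in>Y. \<Sum>B\<in>Y. f [B, A]) = (\<Sum>B\<in>Y. \<Sum>A\<in>Y. f [B, A])" by (rule sum.swap)
  then show ?case by (simp add: sum_subtractf)
next
  case (Cons x s)
  have "(\<Sum>A\<in>Y. \<Sum>B\<in>Y. f (B # A # x # s)) = (\<Sum>B\<in>Y. \<Sum>A\<in>Y. f (B # A # x # s))" by (rule sum.swap)
  moreover have "insum Y (\<lambda>l. \<Sum>A\<in>Y. f (A # x # l)) s = (\<Sum>A\<in>Y. insum Y (\<lambda>l. f (A # x # l)) s)"
    by (rule insum_sum)
  moreover have "insum Y (\<lambda>l. insum Y (\<lambda>l'. f (x # l')) l) s = 0" using Cons.IH[of "\<lambda>l'. f (x # l')"] by simp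
  ultimately show ?case by (simp add: sum_subtractf insum_diff)
qed

lemma insum_nonzero:
  "insum Y f s \<noteq> 0 \<Longrightarrow> \<exists>A\<in>Y. \<exists>xs ys. s = xs @ ys \<and> f (xs @ A # ys) \<noteq> 0"
proof (induction s arbitrary: f)
  case Nil
  then obtain A where "A \<in> Y" "f [A] \<noteq> 0" by (auto elim: sum.not_neutral_contains_not_neutral)
  then show ?case by (intro bexI[of _ A] exI[of _ "[]"]) auto
next
  case (Cons x s)
  then have "(\<Sum>A\<in>Y. f (A # x # s)) \<noteq> 0 \<or> insum Y (\<lambda>l. f (x # l)) s \<noteq> 0" by auto
  then show ?case
  proof
    assume "(\<Sum>A\<in>Y. f (A # x # s)) \<noteq> 0"
    then obtain A where "A \<in> Y" "f (A # x # s) \<noteq> 0" by (auto elim: sum.not_neutral_contains_not_neutral)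
    then show ?thesis by (intro bexI[of _ A] exI[of _ "[]"] exI[of _ "x # s"]) auto
  next
    assume "insum Y (\<lambda>l. f (x # l)) s \<noteq> 0"
    from Cons.IH[OF this] obtain A xs ys where "A \<in> Y" "s = xs @ ys" "f (x # xs @ A # ys) \<noteq> 0" by auto
    then show ?thesis by (intro bexI[of _ A] exI[of _ "x # xs"] exI[of _ ys]) auto
  qed
qed

lemma boundary_add: "boundary (c + d) = boundary c + boundary (d :: 'a list \<Rightarrow>\<^sub>0 'k::comm_ring_1)"
  unfolding boundary_def
  by (rule setsum_keys_plus_distrib) (auto simp: distrib_left single_add sum.distrib)

text \<open>By linearity a single list \<open>t\<close> is enough: deleting its entry at position
  \<open>j\<close> gives \<open>s\<close> exactly if inserting that entry into \<open>s\<close> at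
  position \<open>j\<close> gives \<open>t\<close>. Induction on \<open>t\<close> follows the
  recursion of \<open>insum\<close>.\<close>

lemma lookup_boundary:
  fixes c :: "'a list \<Rightarrow>\<^sub>0 'k::comm_ring_1"
  assumes "keys c \<subseteq> lists Y" and Y: "finite Y"
  shows "lookup (boundary c) s = insum Y (lookup c) s"
  using assms(1)
proof (induction c rule: poly_mapping_keys_induct)
  case zero
  then show ?case by (simp add: boundary_def insum_zero)
next
  case (add p q)
  have "lookup (p + q) = (\<lambda>l. lookup p l + lookup q l)" by (simp add: fun_eq_iff lookup_add)
  then show ?case using add by (simp only: boundary_add lookup_add insum_add)
next
  case (single t a)
  have b: "lookup (boundary (single t a)) s
    = (\<Sum>j<length t. (-1) ^ j * a when take j t @ drop (Suc j) t = s)" for s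
    by (cases "a = 0") (auto simp: boundary_def lookup_sum lookup_single)
  have "lookup (single t a) = (\<lambda>l. a when t = l)"
    by (simp add: fun_eq_iff lookup_single)
  moreover have "(\<Sum>j<length t. (-1) ^ j * a when take j t @ drop (Suc j) t = s) = insum Y (\<lambda>l. a when t = l) s"
    using single
  proof (induction t arbitrary: s)
    case Nil
    have "insum Y (\<lambda>l. a when [] = l) s = 0"
      using insum_nonzero[of Y "\<lambda>l. a when [] = l" s] by auto
    then show ?case by simp
  next
    case (Cons x xs)
    have xY: "x \<in> Y" "xs \<in> lists Y" by fact+
    have "(\<Sum>j<length (x # xs). (-1) ^ j * a when take j (x # xs) @ drop (Suc j) (x # xs) = s)
      = (a when xs = s) + (\<Sum>j<length xs. - ((-1) ^ j * a when x # take j xs @ drop (Suc j) xs = s))"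
      unfolding length_Cons sum.lessThan_Suc_shift
      by (intro arg_cong2[where f = "(+)"] sum.cong) (auto simp: when_def)
    also have "\<dots> = (a when xs = s) - (\<Sum>j<length xs. (-1) ^ j * a when x # take j xs @ drop (Suc j) xs = s)"
      by (simp add: sum_negf)
    also have "\<dots> = insum Y (\<lambda>l. a when x # xs = l) s"
    proof (cases s)
      case Nil
      have "(\<Sum>A\<in>Y. a when x # xs = [A]) = (\<Sum>A\<in>Y. if A = x then a when xs = [] else 0)"
        by (rule sum.cong) (auto simp: when_def)
      then show ?thesis using xY Y Nil by (simp add: when_def)
    next
      case s: (Cons z zs)
      have 1: "(\<Sum>A\<in>Y. a when x # xs = A # z # zs) = (a when xs = s)"
      proof (cases "xs = s")
        case True
        then have "(\<Sum>A\<in>Y. a when x # xs = A # z # zs) = (\<Sum>A\<in>Y. if A = x then a else 0)"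
          by (intro sum.cong) (auto simp: s when_def)
        then show ?thesis using True xY Y by simp
      qed (simp add: s)
      have 2: "insum Y (\<lambda>l. a when x # xs = z # l) zs
        = (\<Sum>j<length xs. (-1) ^ j * a when x # take j xs @ drop (Suc j) xs = s)"
      proof (cases "x = z")
        case True
        then show ?thesis using Cons.IH[of zs] xY by (simp add: s)
      qed (simp add: s insum_zero)
      show ?thesis using 1 2 by (simp add: s)
    qed
    finally show ?case .
  qed
  ultimately show ?case by (simp add: b)
qed

lemma insum_cong_length:
  "(\<And>l. length l = Suc (length s) \<Longrightarrow> f l = g l) \<Longrightarrow> insum Y f s = insum Y g s"
proof (induction s arbitrary: f g)
  case (Cons x s)
  have "insum Y (\<lambda>l. f (x # l)) s = insum Y (\<lambda>l. g (x # l)) s"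
    by (rule Cons.IH) (use Cons.prems in simp)
  then show ?case using Cons.prems by simp
qed simp

definition diff_closed :: "'r::ab_group_add set \<Rightarrow> bool" where
  "diff_closed U \<longleftrightarrow> 0 \<in> U \<and> (\<forall>a\<in>U. \<forall>b\<in>U. a - b \<in> U)"

lemma diff_closedD:
  assumes "diff_closed U"
  shows "0 \<in> U" "a \<in> U \<Longrightarrow> b \<in> U \<Longrightarrow> a - b \<in> U" "a \<in> U \<Longrightarrow> - a \<in> U"
    "a \<in> U \<Longrightarrow> b \<in> U \<Longrightarrow> a + b \<in> U" "(\<And>i. i \<in> I \<Longrightarrow> f i \<in> U) \<Longrightarrow> (\<Sum>i\<in>I. f i) \<in> U"
proof -
  have c: "0 \<in> U" "\<And>a b. a \<in> U \<Longrightarrow> b \<in> U \<Longrightarrow> a - b \<in> U" using assms by (auto simp: diff_closed_def)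
  then show "0 \<in> U" "a \<in> U \<Longrightarrow> b \<in> U \<Longrightarrow> a - b \<in> U" by auto
  have neg: "- a \<in> U" if "a \<in> U" for a using c(2)[OF c(1) that] by simp
  then show "a \<in> U \<Longrightarrow> - a \<in> U" .
  have add: "a + b \<in> U" if "a \<in> U" "b \<in> U" for a b using c(2)[OF that(1) neg[OF that(2)]] by simp
  then show "a \<in> U \<Longrightarrow> b \<in> U \<Longrightarrow> a + b \<in> U" .
  show "(\<And>i. i \<in> I \<Longrightarrow> f i \<in> U) \<Longrightarrow> (\<Sum>i\<in>I. f i) \<in> U"
    by (induction I rule: infinite_finite_induct) (auto intro: c add)
qed

lemma diff_closed_sign:
  assumes "diff_closed U" "a \<in> (U :: 'r::ring_1 set)"
  shows "(- 1) ^ n * a \<in> U" "sg pos v B * a \<in> U"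
proof -
  show s: "(- 1) ^ n * a \<in> U" for n using assms diff_closedD(3)[OF assms(1)] by (cases "even n") auto
  show "sg pos v B * a \<in> U" unfolding sg_def by (rule s)
qed

lemma insum_in:
  assumes U: "diff_closed U"
  shows "(\<And>l. length l = Suc (length s) \<Longrightarrow> f l \<in> U) \<Longrightarrow> insum Y f s \<in> U"
proof (induction s arbitrary: f)
  case Nil
  then show ?case by (auto intro!: diff_closedD(5)[OF U])
next
  case (Cons x s)
  have "insum Y (\<lambda>l. f (x # l)) s \<in> U" by (rule Cons.IH) (use Cons.prems in simp)
  then show ?case using Cons.prems by (auto intro!: diff_closedD(2,5)[OF U])
qed

lemma contract_nonzero:
  assumes "contract V pos \<xi> f B \<noteq> 0"
  shows "\<exists>v\<in>V - B. f (insert v B) \<noteq> 0"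
proof (rule ccontr)
  assume "\<not> ?thesis"
  then have "contract V pos \<xi> f B = 0" by (auto simp: contract_def intro!: sum.neutral)
  then show False using assms by simp
qed

lemma wedge_nonzero:
  assumes "wedge V pos y f B \<noteq> 0"
  shows "\<exists>v\<in>V \<inter> B. f (B - {v}) \<noteq> 0 \<and> y v \<noteq> 0"
proof (rule ccontr)
  assume "\<not> ?thesis"
  then have "f (B - {v}) * y v = 0" if "v \<in> V \<inter> B" for v
    using that by (cases "f (B - {v}) = 0") auto
  then have "wedge V pos y f B = 0" unfolding wedge_def by (intro sum.neutral) simp
  then show False using assms by simp
qed

lemma contract_in:
  assumes U: "diff_closed U" and "\<And>v. v \<in> V \<Longrightarrow> f (insert v B) * \<xi> v \<in> U"
  shows "contract V pos \<xi> f B \<in> U"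
  unfolding contract_def using assms by (auto intro!: diff_closedD(5)[OF U] diff_closed_sign)

lemma wedge_in:
  assumes U: "diff_closed U" and "\<And>v. v \<in> V \<Longrightarrow> f (B - {v}) * y v \<in> U"
  shows "wedge V pos y f B \<in> U"
  unfolding wedge_def using assms by (auto intro!: diff_closedD(5)[OF U] diff_closed_sign)

section \<open>The total complex of cliques and simplices\<close>

locale clique_complex =
  fixes V :: "'v set" and pos :: "'v \<Rightarrow> nat" and X Y :: "'v set set" and \<theta> :: "'v \<Rightarrow> 'r::ring_1"
  assumes finite_V: "finite V" and pos: "inj_on pos V"
    and X_subset: "B \<in> X \<Longrightarrow> B \<subseteq> V" and X_down: "B \<in> X \<Longrightarrow> B' \<subseteq> B \<Longrightarrow> B' \<in> X" and YX: "Y \<subseteq> X"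
    and commute: "B \<in> X \<Longrightarrow> u \<in> B \<Longrightarrow> v \<in> B \<Longrightarrow> \<theta> u * \<theta> v = \<theta> v * \<theta> u"
begin

text \<open>A chain is a function on pairs \<open>(B, \<sigma>)\<close>, where \<open>B\<close> is a clique (a basis element of the
  exterior algebra) and \<open>\<sigma>\<close> is a simplex of \<open>Y\<close> all of whose vertices contain \<open>B\<close>. In the
  extended complex \<open>\<sigma>\<close> may also be the empty simplex. Degrees are \<open>|B| + dim \<sigma>\<close>.\<close>

definition ext_index :: "nat \<Rightarrow> ('v set \<times> 'v set list) set" where
  "ext_index i = {(B, \<sigma>). B \<in> X \<and> (\<sigma> = [] \<or> \<sigma> \<in> realization Y \<and> B \<subseteq> hd \<sigma>) \<and> card B + length \<sigma> = Suc i}"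

definition index :: "nat \<Rightarrow> ('v set \<times> 'v set list) set" where
  "index i = {(B, \<sigma>) \<in> ext_index i. \<sigma> \<noteq> []}"

definition supp_in :: "('v set \<times> 'v set list \<Rightarrow> 'r) \<Rightarrow> ('v set \<times> 'v set list) set \<Rightarrow> bool" where
  "supp_in \<omega> I \<longleftrightarrow> (\<forall>s. s \<notin> I \<longrightarrow> \<omega> s = 0)"

text \<open>The power of -1 makes the simplicial boundary anticommute with the contraction, which
  lowers \<open>card B\<close> by one.\<close>

definition dtot :: "('v set \<times> 'v set list \<Rightarrow> 'r) \<Rightarrow> 'v set \<times> 'v set list \<Rightarrow> 'r" where
  "dtot \<omega> = (\<lambda>(B, \<sigma>). contract V pos \<theta> (\<lambda>B. \<omega> (B, \<sigma>)) B + (- 1) ^ card B * insum Y (\<lambda>\<sigma>. \<omega> (B, \<sigma>)) \<sigma>)"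

text \<open>The chains on the empty simplex form a subcomplex of the extended complex; this is the
  differential of the quotient.\<close>

definition dres :: "('v set \<times> 'v set list \<Rightarrow> 'r) \<Rightarrow> 'v set \<times> 'v set list \<Rightarrow> 'r" where
  "dres \<omega> = (\<lambda>(B, \<sigma>). if \<sigma> = [] then 0 else dtot \<omega> (B, \<sigma>))"

lemma supp_inD: "supp_in \<omega> I \<Longrightarrow> \<omega> s \<noteq> 0 \<Longrightarrow> s \<in> I"
  unfolding supp_in_def by blast

lemma supp_in_mono: "supp_in \<omega> I \<Longrightarrow> I \<subseteq> I' \<Longrightarrow> supp_in \<omega> I'"
  by (auto simp: supp_in_def)

lemma index_ext: "index i \<subseteq> ext_index i"
  by (auto simp: index_def)

lemma finite_realization: "finite (realization Y)"
proof -
  have "finite Y" using YX X_subset finite_V by (meson Pow_iff finite_Pow_iff finite_subset subsetI subset_iff)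
  have "distinct xs" if "xs \<in> realization Y" for xs
    using that by (auto simp: realization_def distinct_conv_nth sorted_wrt_iff_nth_less)
      (metis nat_neq_iff psubset_eq)
  then have "realization Y \<subseteq> {xs. set xs \<subseteq> Y \<and> length xs \<le> card Y}"
    using \<open>finite Y\<close> by (auto simp: realization_def) (metis card_mono distinct_card)
  then show ?thesis using finite_lists_length_le[OF \<open>finite Y\<close>] finite_subset by blast
qed

lemma finite_Y: "finite Y"
proof -
  have "Y \<subseteq> Pow V" using YX X_subset by auto
  then show ?thesis using finite_V finite_subset by auto
qed

lemma finite_index: "finite (index i)"
proof (rule finite_subset)
  show "index i \<subseteq> Pow V \<times> realization Y" using X_subset by (auto simp: index_def ext_index_def)
  show "finite (Pow V \<times> realization Y)" using finite_V finite_realization by auto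
qed

lemma realization_remove:
  assumes "xs @ A # ys \<in> realization Y" "xs @ ys \<noteq> []"
  shows "xs @ ys \<in> realization Y" "hd (xs @ A # ys) \<subseteq> hd (xs @ ys)"
proof -
  show "xs @ ys \<in> realization Y" using assms by (auto simp: realization_def sorted_wrt_append)
  show "hd (xs @ A # ys) \<subseteq> hd (xs @ ys)"
    using assms by (cases xs; cases ys) (auto simp: realization_def)
qed

lemma supp_dtot: "supp_in \<omega> (ext_index (Suc i)) \<Longrightarrow> supp_in (dtot \<omega>) (ext_index i)"
  unfolding supp_in_def[of "dtot \<omega>"]
proof (intro allI impI, rule ccontr)
  fix s assume \<omega>: "supp_in \<omega> (ext_index (Suc i))" and s: "s \<notin> ext_index i" "dtot \<omega> s \<noteq> 0"
  obtain B \<sigma> where s': "s = (B, \<sigma>)" by (cases s)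
  have "contract V pos \<theta> (\<lambda>B. \<omega> (B, \<sigma>)) B \<noteq> 0 \<or> insum Y (\<lambda>\<sigma>. \<omega> (B, \<sigma>)) \<sigma> \<noteq> 0"
  proof (rule ccontr)
    assume "\<not> ?thesis"
    then have "dtot \<omega> s = 0" by (simp add: dtot_def s')
    then show False using s(2) by simp
  qed
  then consider "contract V pos \<theta> (\<lambda>B. \<omega> (B, \<sigma>)) B \<noteq> 0" | "insum Y (\<lambda>\<sigma>. \<omega> (B, \<sigma>)) \<sigma> \<noteq> 0"
    by blast
  then show False
  proof cases
    case 1
    from contract_nonzero[OF this] obtain v where v: "v \<in> V - B" "\<omega> (insert v B, \<sigma>) \<noteq> 0" by blast
    then have m: "(insert v B, \<sigma>) \<in> ext_index (Suc i)" using supp_inD[OF \<omega>] by blast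
    then have "B \<in> X" using X_down[of "insert v B" B] by (auto simp: ext_index_def)
    moreover have "finite B" using X_subset[OF \<open>B \<in> X\<close>] finite_V finite_subset by blast
    ultimately show False using m s(1) v by (auto simp: ext_index_def s')
  next
    case 2
    from insum_nonzero[OF this] obtain A xs ys where x: "A \<in> Y" "\<sigma> = xs @ ys" "\<omega> (B, xs @ A # ys) \<noteq> 0" by auto
    then have m: "(B, xs @ A # ys) \<in> ext_index (Suc i)" using supp_inD[OF \<omega>] by blast
    then have "xs @ A # ys \<in> realization Y" "B \<subseteq> hd (xs @ A # ys)" by (auto simp: ext_index_def)
    then show False using m s(1) realization_remove[of xs A ys] by (auto simp: ext_index_def s' x)
  qed
qed

lemma supp_dres: "supp_in \<omega> (index (Suc i)) \<Longrightarrow> supp_in (dres \<omega>) (index i)"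
  using supp_dtot[OF supp_in_mono[OF _ index_ext]] by (auto simp: supp_in_def dres_def index_def)

lemma dtot_add: "dtot (\<lambda>s. f s + g s) = (\<lambda>s. dtot f s + dtot g s)"
  by (auto simp: dtot_def fun_eq_iff contract_add insum_add distrib_left)

lemma dtot_diff: "dtot (\<lambda>s. f s - g s) = (\<lambda>s. dtot f s - dtot g s)"
  by (auto simp: dtot_def fun_eq_iff contract_diff insum_diff right_diff_distrib)

lemma dtot_lmult: "dtot (\<lambda>s. a * f s) = (\<lambda>s. a * dtot f s)"
proof (rule ext, clarify)
  fix B :: "'v set" and \<sigma>
  have "(- 1) ^ card B * (a * x) = a * ((- 1) ^ card B * x)" for x
    using minus_one_power_commute[of "card B" a] by (simp add: mult.assoc[symmetric])
  then show "dtot (\<lambda>s. a * f s) (B, \<sigma>) = a * dtot f (B, \<sigma>)"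
    by (simp add: dtot_def contract_lmult insum_lmult distrib_left)
qed

lemma dres_add: "dres (\<lambda>s. f s + g s) = (\<lambda>s. dres f s + dres g s)"
  by (auto simp: dres_def dtot_add fun_eq_iff)

lemma dres_diff: "dres (\<lambda>s. f s - g s) = (\<lambda>s. dres f s - dres g s)"
  by (auto simp: dres_def dtot_diff fun_eq_iff)

lemma dres_lmult: "dres (\<lambda>s. a * f s) = (\<lambda>s. a * dres f s)"
  by (auto simp: dres_def dtot_lmult fun_eq_iff)

lemma contract_sign_insum:
  assumes "finite B"
  shows "contract V pos \<xi> (\<lambda>B. (- 1) ^ card B * insum Y (\<lambda>\<sigma>. \<omega> (B, \<sigma>)) \<sigma>) B
    = - ((- 1) ^ card B * insum Y (\<lambda>\<sigma>. contract V pos \<xi> (\<lambda>B. \<omega> (B, \<sigma>)) B) \<sigma>)"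
proof -
  have "insum Y (\<lambda>\<sigma>. contract V pos \<xi> (\<lambda>B. \<omega> (B, \<sigma>)) B) \<sigma>
    = (\<Sum>v\<in>V - B. sg pos v B * (insum Y (\<lambda>\<sigma>. \<omega> (insert v B, \<sigma>)) \<sigma> * \<xi> v))"
    unfolding contract_def by (simp add: insum_sum insum_lmult insum_rmult)
  moreover have "contract V pos \<xi> (\<lambda>B. (- 1) ^ card B * insum Y (\<lambda>\<sigma>. \<omega> (B, \<sigma>)) \<sigma>) B
    = (\<Sum>v\<in>V - B. - ((- 1) ^ card B * (sg pos v B * (insum Y (\<lambda>\<sigma>. \<omega> (insert v B, \<sigma>)) \<sigma> * \<xi> v))))"
    unfolding contract_def
  proof (rule sum.cong[OF refl])
    fix v assume "v \<in> V - B"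
    then show "sg pos v B * ((- 1) ^ card (insert v B) * insum Y (\<lambda>\<sigma>. \<omega> (insert v B, \<sigma>)) \<sigma> * \<xi> v)
      = - ((- 1) ^ card B * (sg pos v B * (insum Y (\<lambda>\<sigma>. \<omega> (insert v B, \<sigma>)) \<sigma> * \<xi> v)))"
      using assms by (simp add: mult.assoc[symmetric] minus_one_power_commute[of "card B" "sg pos v B"])
  qed
  ultimately show ?thesis by (simp add: sum_negf sum_distrib_left)
qed

lemma supp_X: "supp_in \<omega> (ext_index i) \<Longrightarrow> \<omega> (B, \<sigma>) \<noteq> 0 \<Longrightarrow> B \<in> X"
  using supp_inD by (force simp: ext_index_def)

lemma dtot_dtot:
  assumes \<omega>: "supp_in \<omega> (ext_index i)"
  shows "dtot (dtot \<omega>) s = 0"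
proof -
  obtain B \<sigma> where s: "s = (B, \<sigma>)" by (cases s)
  show ?thesis
  proof (cases "B \<subseteq> V")
    case B: True
    have fB: "finite B" using B finite_V by (rule finite_subset)
    have "contract V pos \<theta> (contract V pos \<theta> (\<lambda>B. \<omega> (B, \<sigma>))) B = 0"
    proof (rule contract_square[OF finite_V pos B])
      fix u v
      show "\<omega> (insert u (insert v B), \<sigma>) * (\<theta> u * \<theta> v) = \<omega> (insert u (insert v B), \<sigma>) * (\<theta> v * \<theta> u)"
        using supp_X[OF \<omega>, of "insert u (insert v B)" \<sigma>] commute[of "insert u (insert v B)" u v]
        by (cases "\<omega> (insert u (insert v B), \<sigma>) = 0") auto
    qed
    moreover have "insum Y (\<lambda>\<sigma>. insum Y (\<lambda>\<sigma>. \<omega> (B, \<sigma>)) \<sigma>) \<sigma> = 0"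
      using insum_insum[of Y "\<lambda>\<sigma>. \<omega> (B, \<sigma>)" \<sigma>] by simp
    ultimately show ?thesis
      using contract_sign_insum[OF fB, of \<theta> \<omega> \<sigma>]
      by (simp add: s dtot_def contract_add insum_add insum_lmult distrib_left)
  next
    case False
    have z: "\<omega> (B', \<sigma>) = 0" if "B \<subseteq> B'" for B' \<sigma>
      using supp_X[OF \<omega>, of B' \<sigma>] X_subset[of B'] that False by blast
    have "dtot \<omega> (B', \<sigma>) = 0" if "B \<subseteq> B'" for B' \<sigma>
      using z that by (simp add: dtot_def contract_def insum_zero subset_insertI2)
    then show ?thesis by (simp add: s dtot_def[of "dtot \<omega>"] contract_def insum_zero subset_insertI)
  qed
qed

text \<open>At a nonempty list both parts of the differential only read nonempty lists, so the
  discarded component never enters.\<close>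

lemma dres_dres:
  assumes "supp_in \<omega> (index i)"
  shows "dres (dres \<omega>) = (\<lambda>_. 0)"
proof (rule ext, clarify)
  fix B \<sigma>
  have "insum Y (\<lambda>\<sigma>. dres \<omega> (B, \<sigma>)) \<sigma> = insum Y (\<lambda>\<sigma>. dtot \<omega> (B, \<sigma>)) \<sigma>"
    by (rule insum_cong_length) (auto simp: dres_def)
  then have "\<sigma> \<noteq> [] \<Longrightarrow> dtot (dres \<omega>) (B, \<sigma>) = dtot (dtot \<omega>) (B, \<sigma>)"
    by (simp add: dtot_def[of "dres \<omega>"] dtot_def[of "dtot \<omega>"]) (simp add: dres_def)
  then show "dres (dres \<omega>) (B, \<sigma>) = 0"
    using dtot_dtot[OF supp_in_mono[OF assms index_ext]] by (simp add: dres_def[of "dres \<omega>"])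
qed

text \<open>The Koszul part consists of right multiples of the \<open>\<theta> v\<close> and is
  killed by \<open>aug\<close>; summing the rest over \<open>Y\<close> gives a double simplicial
  boundary at the empty list.\<close>

lemma augmentation_dres:
  fixes aug :: "'r \<Rightarrow> 'k::ab_group_add"
  assumes \<omega>: "supp_in \<omega> (index (Suc 0))"
    and aug_add: "\<And>a b. aug (a + b) = aug a + aug b" and aug_\<theta>: "\<And>a v. v \<in> V \<Longrightarrow> aug (a * \<theta> v) = 0"
  shows "(\<Sum>A\<in>Y. aug (dres \<omega> ({}, [A]))) = 0"
proof -
  have aug_0: "aug 0 = 0" using aug_add[of 0 0] by simp
  have aug_sum: "aug (\<Sum>i\<in>I. f i) = (\<Sum>i\<in>I. aug (f i))" for I :: "'c set" and f
    by (induction I rule: infinite_finite_induct) (auto simp: aug_0 aug_add)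
  have "aug (contract V pos \<theta> f B) = 0" for f B
    unfolding contract_def aug_sum by (rule sum.neutral) (use aug_\<theta> in \<open>simp add: mult.assoc[symmetric]\<close>)
  then have "(\<Sum>A\<in>Y. aug (dres \<omega> ({}, [A]))) = (\<Sum>A\<in>Y. aug (insum Y (\<lambda>\<sigma>. \<omega> ({}, \<sigma>)) [A]))"
    by (simp add: dres_def dtot_def aug_add)
  also have "\<dots> = aug (insum Y (insum Y (\<lambda>\<sigma>. \<omega> ({}, \<sigma>))) [])"
    by (simp only: insum.simps(1) aug_sum)
  finally show ?thesis by (simp only: insum_insum aug_0)
qed

section \<open>Chains with restricted values that all contractions kill\<close>

definition chains :: "'r set \<Rightarrow> ('j \<Rightarrow> 'v \<Rightarrow> 'r) \<Rightarrow> 'j set \<Rightarrow> nat \<Rightarrow> ('v set \<times> 'v set list \<Rightarrow> 'r) set" where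
  "chains U \<xi> J i = {\<omega>. supp_in \<omega> (index i) \<and> (\<forall>s. \<omega> s \<in> U) \<and>
     (\<forall>j\<in>J. \<forall>B \<sigma>. contract V pos (\<xi> j) (\<lambda>B. \<omega> (B, \<sigma>)) B = 0)}"

text \<open>In the application the \<open>\<xi> j\<close> are functionals with common kernel
  \<open>N\<close> and \<open>U\<close> is the enveloping algebra of \<open>N\<close>. The forms on
  \<open>A\<close> killed by their contractions are then those built from the vectors of
  \<open>N\<close> in the span of \<open>A\<close>, and this is the Koszul complex of the abelian
  algebra \<open>N \<inter> L_on A\<close> with coefficients in \<open>U\<close>.\<close>

definition koszul :: "'r set \<Rightarrow> ('j \<Rightarrow> 'v \<Rightarrow> 'r) \<Rightarrow> 'j set \<Rightarrow> 'v set \<Rightarrow> nat \<Rightarrow> ('v set \<Rightarrow> 'r) set" where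
  "koszul U \<xi> J A p = {f. (\<forall>B. f B \<noteq> 0 \<longrightarrow> B \<subseteq> A \<and> card B = p) \<and> (\<forall>B. f B \<in> U) \<and>
     (\<forall>j\<in>J. \<forall>B. contract V pos (\<xi> j) f B = 0)}"

lemma contract_outside:
  assumes "A \<in> Y" "\<And>B. f B \<noteq> 0 \<Longrightarrow> B \<subseteq> A" "\<not> B \<subseteq> V"
  shows "contract V pos \<xi> f B = 0"
proof -
  have "f (insert v B) = 0" for v using assms X_subset[of A] YX by blast
  then show ?thesis by (simp add: contract_def)
qed

end

text \<open>The generators \<open>\<theta> v\<close> need not lie in \<open>RN\<close>. The
  assumption \<open>d_RN\<close> says that the Koszul differential stays in \<open>RN\<close>
  nevertheless on forms killed by the contractions.\<close>

locale stable_chains = clique_complex V pos X Y \<theta>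
  for V :: "'v set" and pos X Y and \<theta> :: "'v \<Rightarrow> 'r::ring_1" +
  fixes RN :: "'r set" and \<xi> :: "'j \<Rightarrow> 'v \<Rightarrow> 'r" and J :: "'j set"
  assumes RN: "diff_closed RN"
    and \<xi>_central: "j \<in> J \<Longrightarrow> \<xi> j v * a = a * \<xi> j v"
    and d_RN: "A \<in> Y \<Longrightarrow> f \<in> koszul RN \<xi> J A p \<Longrightarrow> contract V pos \<theta> f B \<in> RN"
begin

lemma contract_dres_\<xi>:
  assumes \<omega>: "supp_in \<omega> (index i)" and j: "j \<in> J"
    and z: "\<And>B \<sigma>. contract V pos (\<xi> j) (\<lambda>B. \<omega> (B, \<sigma>)) B = 0"
  shows "contract V pos (\<xi> j) (\<lambda>B. dres \<omega> (B, \<sigma>)) B = 0"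
proof (cases "\<sigma> = [] \<or> \<not> B \<subseteq> V")
  case True
  have "dres \<omega> (insert v B, \<sigma>) = 0" for v
  proof (cases "\<sigma> = []")
    case False
    then have nB: "\<not> B \<subseteq> V" using True by simp
    have zero: "\<omega> (B', \<sigma>) = 0" if "B \<subseteq> B'" for B' \<sigma>
      using supp_X[OF supp_in_mono[OF \<omega> index_ext], of B' \<sigma>] X_subset[of B'] that nB by blast
    show ?thesis using zero by (simp add: dres_def dtot_def contract_def insum_zero subset_insertI subset_insertI2)
  qed (simp add: dres_def)
  then show ?thesis by (simp add: contract_def)
next
  case False
  then have B: "B \<subseteq> V" and \<sigma>: "\<sigma> \<noteq> []" by auto
  have fB: "finite B" using B finite_V by (rule finite_subset)
  have "contract V pos (\<xi> j) (contract V pos \<theta> (\<lambda>B. \<omega> (B, \<sigma>))) B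
      = - contract V pos \<theta> (contract V pos (\<xi> j) (\<lambda>B. \<omega> (B, \<sigma>))) B"
    by (rule contract_anticommute[OF finite_V pos B]) (rule arg_cong[OF \<xi>_central[OF j, symmetric]])
  moreover have "contract V pos (\<xi> j) (\<lambda>B. \<omega> (B, \<sigma>)) = (\<lambda>B. 0)" using z by (simp add: fun_eq_iff)
  ultimately have "contract V pos (\<xi> j) (\<lambda>B. contract V pos \<theta> (\<lambda>B. \<omega> (B, \<sigma>)) B) B = 0"
    by (simp add: contract_zero)
  then show ?thesis
    using \<sigma> contract_sign_insum[OF fB, of "\<xi> j" \<omega> \<sigma>] z
    by (simp add: dres_def dtot_def contract_add insum_zero)
qed

lemma slice_koszul:
  assumes \<omega>: "\<omega> \<in> chains RN \<xi> J i" and \<sigma>: "\<sigma> \<in> realization Y"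
  shows "(\<lambda>B. \<omega> (B, \<sigma>)) \<in> koszul RN \<xi> J (hd \<sigma>) (Suc i - length \<sigma>)" "hd \<sigma> \<in> Y"
proof -
  show "hd \<sigma> \<in> Y" using \<sigma> by (cases \<sigma>) (auto simp: realization_def)
  have "B \<subseteq> hd \<sigma> \<and> card B = Suc i - length \<sigma>" if "\<omega> (B, \<sigma>) \<noteq> 0" for B
  proof -
    have "(B, \<sigma>) \<in> index i" using \<omega> that supp_inD unfolding chains_def by blast
    then show ?thesis by (auto simp: index_def ext_index_def)
  qed
  then show "(\<lambda>B. \<omega> (B, \<sigma>)) \<in> koszul RN \<xi> J (hd \<sigma>) (Suc i - length \<sigma>)"
    using \<omega> by (auto simp: koszul_def chains_def)
qed

lemma dres_chains:
  assumes \<omega>: "\<omega> \<in> chains RN \<xi> J (Suc i)"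
  shows "dres \<omega> \<in> chains RN \<xi> J i"
proof -
  have s: "supp_in \<omega> (index (Suc i))" using \<omega> by (simp add: chains_def)
  have s': "supp_in (dres \<omega>) (index i)" by (rule supp_dres[OF s])
  have "dres \<omega> (B, \<sigma>) \<in> RN" for B \<sigma>
  proof (cases "\<sigma> \<in> realization Y")
    case True
    have "contract V pos \<theta> (\<lambda>B. \<omega> (B, \<sigma>)) B \<in> RN"
      by (rule d_RN[OF slice_koszul(2)[OF \<omega> True] slice_koszul(1)[OF \<omega> True]])
    moreover have "insum Y (\<lambda>\<sigma>. \<omega> (B, \<sigma>)) \<sigma> \<in> RN"
      by (rule insum_in[OF RN]) (use \<omega> in \<open>auto simp: chains_def\<close>)
    ultimately show ?thesis
      by (auto simp: dres_def dtot_def intro!: diff_closedD(1,4)[OF RN] diff_closed_sign[OF RN])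
  next
    case False
    then have "dres \<omega> (B, \<sigma>) = 0" using s' by (auto simp: supp_in_def index_def ext_index_def)
    then show ?thesis using diff_closedD(1)[OF RN] by simp
  qed
  moreover have "contract V pos (\<xi> j) (\<lambda>B. dres \<omega> (B, \<sigma>)) B = 0" if "j \<in> J" for j B \<sigma>
    by (rule contract_dres_\<xi>[OF s]) (use \<omega> that in \<open>auto simp: chains_def\<close>)
  ultimately show ?thesis using s' by (auto simp: chains_def)
qed

lemma chains_diff:
  assumes "f \<in> chains RN \<xi> J i" "g \<in> chains RN \<xi> J i"
  shows "(\<lambda>s. f s - g s) \<in> chains RN \<xi> J i" "(\<lambda>s. f s + g s) \<in> chains RN \<xi> J i"
  using assms diff_closedD(2,4)[OF RN]
  by (auto simp: chains_def supp_in_def contract_diff contract_add)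

end

text \<open>The passage from \<open>RN\<close> to \<open>RM\<close> imposes the further functional
  \<open>\<xi> b\<close>. \<open>y A\<close> lists the coordinates of a vector in the span of
  \<open>A\<close> on which \<open>\<xi> b\<close> is 1 and the earlier functionals vanish;
  \<open>decompose\<close> and \<open>unique\<close> express division by its image.\<close>

locale codim_one_step = stable_chains V pos X Y \<theta> RN \<xi> J
  for V :: "'v set" and pos X Y and \<theta> :: "'v \<Rightarrow> 'r::ring_1"
    and RN :: "'r set" and \<xi> :: "'j \<Rightarrow> 'v \<Rightarrow> 'r" and J :: "'j set" +
  fixes RM :: "'r set" and b :: 'j and y :: "'v set \<Rightarrow> 'v \<Rightarrow> 'r"
  assumes RM: "diff_closed RM" "RM \<subseteq> RN"
    and \<xi>_b_central: "\<xi> b v * a = a * \<xi> b v" and y_central: "y A v * a = a * y A v"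
    and RN_\<xi>: "j \<in> insert b J \<Longrightarrow> u \<in> RN \<Longrightarrow> u * \<xi> j v \<in> RN"
    and RM_\<xi>: "j \<in> insert b J \<Longrightarrow> u \<in> RM \<Longrightarrow> u * \<xi> j v \<in> RM"
    and RN_y: "u \<in> RN \<Longrightarrow> u * y A v \<in> RN"
    and y_supp: "A \<in> Y \<Longrightarrow> v \<notin> A \<Longrightarrow> y A v = 0"
    and y_b: "A \<in> Y \<Longrightarrow> (\<Sum>v\<in>V. y A v * \<xi> b v) = 1"
    and y_J: "A \<in> Y \<Longrightarrow> j \<in> J \<Longrightarrow> (\<Sum>v\<in>V. y A v * \<xi> j v) = 0"
    and decompose: "A \<in> Y \<Longrightarrow> u \<in> RN \<Longrightarrow> \<exists>a0\<in>RM. \<exists>a1\<in>RN. u = a0 + a1 * (\<Sum>v\<in>V. y A v * \<theta> v)"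
    and unique: "A \<in> Y \<Longrightarrow> a0 \<in> RM \<Longrightarrow> a1 \<in> RN \<Longrightarrow> a0 = a1 * (\<Sum>v\<in>V. y A v * \<theta> v) \<Longrightarrow> a0 = 0 \<and> a1 = 0"
    and d_RM: "A \<in> Y \<Longrightarrow> f \<in> koszul RM \<xi> (insert b J) A p \<Longrightarrow> contract V pos \<theta> f B \<in> RM"
begin

lemma \<xi>_central': "j \<in> insert b J \<Longrightarrow> \<xi> j v * a = a * \<xi> j v"
  using \<xi>_central \<xi>_b_central by blast

lemma decompose_zero:
  assumes "A \<in> Y" "a0 \<in> RM" "a1 \<in> RN" "a0 + a1 * (\<Sum>v\<in>V. y A v * \<theta> v) = 0"
  shows "a0 = 0" "a1 = 0"
proof -
  have "a0 = (- a1) * (\<Sum>v\<in>V. y A v * \<theta> v)" using assms(4) by (simp add: eq_neg_iff_add_eq_0)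
  from unique[OF assms(1,2) diff_closedD(3)[OF RN assms(3)] this] show "a0 = 0" "a1 = 0" by auto
qed

lemma \<theta>_y_central:
  assumes "j \<in> insert b J"
  shows "(\<Sum>v\<in>V. y A v * \<theta> v) * \<xi> j v = \<xi> j v * (\<Sum>v\<in>V. y A v * \<theta> v)"
  using \<xi>_central'[OF assms, of v "\<Sum>v\<in>V. y A v * \<theta> v"] by simp

text \<open>The hypotheses say that \<open>x\<close> is a cycle of the quotient by the smaller
  Koszul complex. With \<open>\<beta>\<close> the contraction of \<open>x\<close> by
  \<open>\<xi> b\<close>, the form \<open>x - ?w \<beta>\<close> is killed by all contractions and
  can be divided by \<open>?t\<close>, with remainder \<open>a0\<close> in \<open>RM\<close> and
  quotient \<open>a1\<close>. Subtracting the differential of \<open>?w a1\<close> removes the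
  multiple of \<open>?t\<close> at the cost of a term \<open>?w \<beta>'\<close>, and
  \<open>\<beta>'\<close> turns out to be zero.\<close>

lemma koszul_quotient_acyclic:
  assumes A: "A \<in> Y" and x: "x \<in> koszul RN \<xi> J A p"
    and dx_RM: "\<And>B. contract V pos \<theta> x B \<in> RM"
    and dx_\<xi>: "\<And>B. contract V pos (\<xi> b) (contract V pos \<theta> x) B = 0"
  shows "\<exists>z\<in>koszul RN \<xi> J A (Suc p). (\<lambda>B. x B - contract V pos \<theta> z B) \<in> koszul RM \<xi> (insert b J) A p"
proof -
  let ?d = "contract V pos \<theta>" and ?i = "\<lambda>j. contract V pos (\<xi> j)" and ?w = "wedge V pos (y A)"
  let ?t = "\<Sum>v\<in>V. y A v * \<theta> v"
  have AV: "A \<subseteq> V" using A YX X_subset by blast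
  have xs: "B \<subseteq> A \<and> card B = p" if "x B \<noteq> 0" for B using x that by (auto simp: koszul_def)
  have xU: "x B \<in> RN" for B using x by (auto simp: koszul_def)
  have xJ: "?i j x B = 0" if "j \<in> J" for j B using x that by (auto simp: koszul_def)
  have acomm: "?i j (?i k f) B = - ?i k (?i j f) B" if "j \<in> insert b J" "B \<subseteq> V" for j k f B
    by (rule contract_anticommute[OF finite_V pos that(2)]) (rule arg_cong[OF \<xi>_central'[OF that(1), symmetric]])
  have acomm\<theta>: "?i j (?d f) B = - ?d (?i j f) B" if "j \<in> insert b J" "B \<subseteq> V" for j f B
    by (rule contract_anticommute[OF finite_V pos that(2)]) (rule arg_cong[OF \<xi>_central'[OF that(1), symmetric]])
  have sq: "?i b (?i b f) B = 0" if "B \<subseteq> V" for f B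
    by (rule contract_square[OF finite_V pos that]) (rule arg_cong[OF \<xi>_central'], simp)
  have w: "?i j (?w f) B = f B * (\<Sum>v\<in>V. y A v * \<xi> j v) - ?w (?i j f) B" if "B \<subseteq> V" for j f B
    using contract_wedge[OF finite_V pos that, of "y A" "\<xi> j" f] y_central by (simp add: eq_diff_eq)
  have wd: "?d (?w f) B = f B * ?t - ?w (?d f) B" if "B \<subseteq> V" for f B
    using contract_wedge[OF finite_V pos that, of "y A" \<theta> f] y_central by (simp add: eq_diff_eq)
  have out: "contract V pos \<eta> f B = 0" if "\<And>B. f B \<noteq> 0 \<Longrightarrow> B \<subseteq> A" "\<not> B \<subseteq> V" for \<eta> f B
    using contract_outside[OF A that] .
  define \<beta> where "\<beta> = ?i b x"
  have csupp: "B \<subseteq> A \<and> Suc (card B) = q" if "contract V pos \<eta> f B \<noteq> 0" "\<And>B. f B \<noteq> 0 \<Longrightarrow> B \<subseteq> A \<and> card B = q" for \<eta> f B q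
  proof -
    from contract_nonzero[OF that(1)] obtain v where v: "v \<in> V - B" "f (insert v B) \<noteq> 0" by blast
    have "finite B" using that(2)[OF v(2)] AV finite_V by (meson finite_insert finite_subset)
    then show ?thesis using that(2)[OF v(2)] v(1) by auto
  qed
  have wsupp: "B \<subseteq> A \<and> card B = Suc q" if "?w f B \<noteq> 0" "\<And>B. f B \<noteq> 0 \<Longrightarrow> B \<subseteq> A \<and> card B = q" for f B q
  proof -
    from wedge_nonzero[OF that(1)] obtain v where v: "v \<in> V \<inter> B" "f (B - {v}) \<noteq> 0" "y A v \<noteq> 0" by blast
    have "v \<in> A" using y_supp[OF A] v(3) by blast
    moreover have "finite (B - {v})" using that(2)[OF v(2)] AV finite_V by (meson finite_subset)
    moreover from this have "Suc (card (B - {v})) = card B" using v(1) by (intro card_Suc_Diff1) auto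
    ultimately show ?thesis using that(2)[OF v(2)] v(1) by auto
  qed
  have \<beta>s: "B \<subseteq> A \<and> Suc (card B) = p" if "\<beta> B \<noteq> 0" for B
    using csupp[of "\<xi> b" x B p] that xs unfolding \<beta>_def by blast
  have \<beta>U: "\<beta> B \<in> RN" for B
    unfolding \<beta>_def by (rule contract_in[OF RN]) (use RN_\<xi> xU in auto)
  define \<alpha> where "\<alpha> B = x B - ?w \<beta> B" for B
  have w\<beta>s: "B \<subseteq> A \<and> card B = p" if "?w \<beta> B \<noteq> 0" for B
  proof (cases p)
    case 0
    then have "\<beta> = (\<lambda>B. 0)" using \<beta>s by fastforce
    then show ?thesis using that by (simp add: wedge_zero)
  next
    case (Suc q)
    then show ?thesis using wsupp[of \<beta> B q] that \<beta>s by auto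
  qed
  have \<alpha>s: "B \<subseteq> A \<and> card B = p" if "\<alpha> B \<noteq> 0" for B
  proof (cases "x B = 0")
    case True
    then have "?w \<beta> B \<noteq> 0" using that by (simp add: \<alpha>_def)
    then show ?thesis by (rule w\<beta>s)
  next
    case False
    then show ?thesis by (rule xs)
  qed
  have \<alpha>U: "\<alpha> B \<in> RN" for B
    unfolding \<alpha>_def
    by (intro diff_closedD(2)[OF RN] xU wedge_in[OF RN] RN_y \<beta>U)
  have "\<exists>a0 a1. a0 \<in> RM \<and> a1 \<in> RN \<and> \<alpha> B = a0 + a1 * ?t" for B using decompose[OF A \<alpha>U[of B]] by blast
  then obtain a0 a1 where a: "\<And>B. a0 B \<in> RM" "\<And>B. a1 B \<in> RN" "\<And>B. \<alpha> B = a0 B + a1 B * ?t" by metis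
  have as: "B \<subseteq> A \<and> card B = p" if "a0 B \<noteq> 0 \<or> a1 B \<noteq> 0" for B
    using \<alpha>s[of B] decompose_zero[OF A a(1) a(2), of B B] a(3)[of B] that by metis
  have \<xi>a: "?i j a0 B = 0 \<and> ?i j a1 B = 0" if j: "j \<in> insert b J" and z: "?i j \<alpha> B = 0" and ins: "?i j a0 B \<in> RM" "?i j a1 B \<in> RN" for j B
  proof -
    have "?i j \<alpha> B = ?i j a0 B + ?i j (\<lambda>B. a1 B * ?t) B"
      by (simp add: contract_add[symmetric] a(3)[abs_def])
    also have "?i j (\<lambda>B. a1 B * ?t) B = ?i j a1 B * ?t"
      by (rule contract_rmult) (rule \<theta>_y_central[OF j])
    finally show ?thesis using decompose_zero[OF A ins] z by simp
  qed
  have Q: "B \<subseteq> V" if "B \<subseteq> A" for B using that AV by blast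
  have i\<beta>: "?i b \<beta> B = 0" for B
  proof (cases "B \<subseteq> V")
    case True
    then show ?thesis unfolding \<beta>_def by (rule sq)
  next
    case False
    show ?thesis by (rule out[OF _ False]) (use \<beta>s in blast)
  qed
  have iJ\<beta>: "?i j \<beta> B = 0" if j: "j \<in> J" for j B
  proof (cases "B \<subseteq> V")
    case True
    have "?i j x = (\<lambda>B. 0)" using xJ[OF j] by (simp add: fun_eq_iff)
    then show ?thesis unfolding \<beta>_def using acomm[of j B b x] j True by (simp add: contract_zero)
  next
    case False
    show ?thesis by (rule out[OF _ False]) (use \<beta>s in blast)
  qed
  have i\<alpha>: "?i j \<alpha> B = 0" if j: "j \<in> insert b J" for j B
  proof (cases "B \<subseteq> V")
    case True
    have e: "?i j \<alpha> B = ?i j x B - ?i j (?w \<beta>) B"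
      by (simp add: \<alpha>_def[abs_def] contract_diff)
    show ?thesis
    proof (cases "j = b")
      case b: True
      have "?i b \<beta> = (\<lambda>B. 0)" using i\<beta> by (simp add: fun_eq_iff)
      then show ?thesis using e w[OF True, of b \<beta>] y_b[OF A] by (simp add: b wedge_zero \<beta>_def[symmetric])
    next
      case False
      then have j': "j \<in> J" using j by simp
      have "?i j \<beta> = (\<lambda>B. 0)" using iJ\<beta>[OF j'] by (simp add: fun_eq_iff)
      then show ?thesis using e w[OF True, of j \<beta>] y_J[OF A j'] xJ[OF j'] by (simp add: wedge_zero)
    qed
  next
    case False
    show ?thesis by (rule out[OF _ False]) (use \<alpha>s in blast)
  qed
  have ia: "?i j a0 B = 0 \<and> ?i j a1 B = 0" if j: "j \<in> insert b J" for j B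
    by (rule \<xi>a[OF j i\<alpha>[OF j]]) (intro contract_in RM(1) RN RM_\<xi> RN_\<xi> j a)+
  have a0K: "a0 \<in> koszul RM \<xi> (insert b J) A p" using as a(1) ia by (auto simp: koszul_def)
  have a1K: "a1 \<in> koszul RN \<xi> J A p" using as a(2) ia by (auto simp: koszul_def)
  define z where "z = ?w a1"
  have zK: "z \<in> koszul RN \<xi> J A (Suc p)"
  proof -
    have s: "B \<subseteq> A \<and> card B = Suc p" if "z B \<noteq> 0" for B
      using wsupp[of a1 B p] that as unfolding z_def by blast
    have "?i j z B = 0" if j: "j \<in> J" for j B
    proof (cases "B \<subseteq> V")
      case True
      have "?i j a1 = (\<lambda>B. 0)" using ia j by (simp add: fun_eq_iff)
      then show ?thesis using w[OF True, of j a1] y_J[OF A j] by (simp add: z_def wedge_zero)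
    next
      case False
      show ?thesis by (rule out[OF _ False]) (use s in blast)
    qed
    moreover have "z B \<in> RN" for B unfolding z_def by (intro wedge_in[OF RN] RN_y a)
    ultimately show ?thesis using s by (auto simp: koszul_def)
  qed
  \<comment> \<open>What stands behind the wedge with \<open>y\<close> in \<open>x - ?d z\<close>:
    \<open>\<beta>\<close> comes from \<open>x\<close>, and \<open>?d a1\<close> from the homotopy
    formula for \<open>?d (?w a1)\<close>.\<close>
  define \<beta>' where "\<beta>' B = \<beta> B + ?d a1 B" for B
  have das: "B \<subseteq> A" if "?d a1 B \<noteq> 0" for B
    using csupp[of \<theta> a1 B p] that as by blast
  have \<beta>'s: "B \<subseteq> A" if "\<beta>' B \<noteq> 0" for B
  proof (cases "\<beta> B = 0")
    case True
    then have "?d a1 B \<noteq> 0" using that by (simp add: \<beta>'_def)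
    then show ?thesis by (rule das)
  next
    case False
    then show ?thesis using \<beta>s by blast
  qed
  have eq: "x B - ?d z B = a0 B + ?w \<beta>' B" for B
  proof (cases "B \<subseteq> V")
    case True
    have "?w \<beta>' B = ?w \<beta> B + ?w (?d a1) B"
      by (simp add: \<beta>'_def[abs_def] wedge_def distrib_left distrib_right sum.distrib)
    then show ?thesis using wd[OF True, of a1] a(3)[of B] by (simp add: z_def \<alpha>_def algebra_simps)
  next
    case False
    have "x B = 0" "?d z B = 0" "a0 B = 0"
      using xs[of B] Q[of B] False as[of B] out[of z B] zK by (auto simp: koszul_def)
    moreover have "?w \<beta>' B = 0"
    proof (rule ccontr)
      assume "?w \<beta>' B \<noteq> 0"
      from wedge_nonzero[OF this] obtain v where "v \<in> V \<inter> B" "\<beta>' (B - {v}) \<noteq> 0" by blast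
      then show False using \<beta>'s Q False by blast
    qed
    ultimately show ?thesis by simp
  qed
  have dd: "?d (?d f) B = 0" if "\<And>B. f B \<noteq> 0 \<Longrightarrow> B \<subseteq> A" "B \<subseteq> V" for f B
  proof (rule contract_square[OF finite_V pos that(2)])
    fix u v
    have "A \<in> X" using A YX by blast
    then show "f (insert u (insert v B)) * (\<theta> u * \<theta> v) = f (insert u (insert v B)) * (\<theta> v * \<theta> u)"
      using that(1)[of "insert u (insert v B)"] commute[of A u v]
      by (cases "f (insert u (insert v B)) = 0") auto
  qed
  have d\<beta>: "?d \<beta> B = 0" if "B \<subseteq> V" for B
  proof -
    have "?i b (?d x) B = - ?d \<beta> B" unfolding \<beta>_def by (rule acomm\<theta>) (use that in auto)
    then show ?thesis using dx_\<xi>[of B] by simp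
  qed
  have d\<beta>': "?d \<beta>' B = 0" if "B \<subseteq> V" for B
    using d\<beta>[OF that] dd[of a1 B] as that unfolding \<beta>'_def[abs_def] contract_add by auto
  \<comment> \<open>As \<open>\<beta>'\<close> is a cycle, applying the differential turns the wedge
    with \<open>y\<close> into a right multiple of \<open>?t\<close>. The other two terms lie in
    \<open>RM\<close>, so uniqueness of the division forces \<open>\<beta>' = 0\<close>.\<close>
  have dsub: "?d x B = ?d a0 B + \<beta>' B * ?t" if B: "B \<subseteq> V" for B
  proof -
    have "?d (\<lambda>B. x B - ?d z B) B = ?d x B"
      using dd[of z B] zK B by (simp add: contract_diff koszul_def)
    moreover have "?d (\<lambda>B. a0 B + ?w \<beta>' B) B = ?d a0 B + (\<beta>' B * ?t - ?w (?d \<beta>') B)"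
      by (simp add: contract_add wd[OF B])
    moreover have "?w (?d \<beta>') B = 0"
    proof -
      have "?d \<beta>' (B - {v}) = 0" for v by (rule d\<beta>') (use B in blast)
      then show ?thesis by (simp add: wedge_def)
    qed
    ultimately show ?thesis by (simp add: eq)
  qed
  have "\<beta>' B = 0" for B
  proof (cases "B \<subseteq> V")
    case True
    have "\<beta>' B \<in> RN" unfolding \<beta>'_def by (intro diff_closedD(4)[OF RN] \<beta>U d_RN[OF A a1K])
    moreover have "?d x B - ?d a0 B \<in> RM" by (intro diff_closedD(2)[OF RM(1)] dx_RM d_RM[OF A a0K])
    moreover have "?d x B - ?d a0 B = \<beta>' B * ?t" using dsub[OF True] by simp
    ultimately show ?thesis using unique[OF A] by blast
  next
    case False
    then show ?thesis using \<beta>'s[of B] Q[of B] by blast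
  qed
  then have \<beta>'0: "\<beta>' = (\<lambda>B. 0)" by (simp add: fun_eq_iff)
  have "x B - ?d z B = a0 B" for B unfolding eq by (simp only: \<beta>'0 wedge_zero add_0_right)
  then have "(\<lambda>B. x B - ?d z B) = a0" by (rule ext)
  then show ?thesis using zK a0K by (intro bexI[of _ z]) simp_all
qed

definition good :: "('v set \<times> 'v set list \<Rightarrow> 'r) \<Rightarrow> 'v set list \<Rightarrow> bool" where
  "good \<omega> \<sigma> \<longleftrightarrow> (\<forall>B. \<omega> (B, \<sigma>) \<in> RM \<and> contract V pos (\<xi> b) (\<lambda>B. \<omega> (B, \<sigma>)) B = 0)"

lemma good_zero: "(\<And>B. \<omega> (B, \<sigma>) = 0) \<Longrightarrow> good \<omega> \<sigma>"
  using diff_closedD(1)[OF RM(1)] by (simp add: good_def contract_zero)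

text \<open>One step of the filtration by the dimension of the simplices.\<close>

lemma quotient_acyclic_step:
  assumes \<omega>: "\<omega> \<in> chains RN \<xi> J (Suc i)" and d\<omega>: "dres \<omega> \<in> chains RM \<xi> (insert b J) i"
    and good: "\<And>\<sigma>. length \<sigma> > r \<Longrightarrow> good \<omega> \<sigma>" and r: "r \<le> Suc (Suc i)"
  shows "\<exists>z\<in>chains RN \<xi> J (Suc (Suc i)). \<forall>\<sigma>. length \<sigma> \<ge> r \<longrightarrow> good (\<lambda>s. \<omega> s - dres z s) \<sigma>"
proof -
  let ?p = "Suc (Suc i) - r"
  have s: "supp_in \<omega> (index (Suc i))" using \<omega> by (simp add: chains_def)
  have ex: "\<exists>z\<in>koszul RN \<xi> J (hd \<sigma>) (Suc ?p).
      (\<lambda>B. \<omega> (B, \<sigma>) - contract V pos \<theta> z B) \<in> koszul RM \<xi> (insert b J) (hd \<sigma>) ?p"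
    if \<sigma>: "\<sigma> \<in> realization Y" "length \<sigma> = r" for \<sigma>
  proof (rule koszul_quotient_acyclic)
    have ne: "\<sigma> \<noteq> []" using \<sigma> by (auto simp: realization_def)
    show "hd \<sigma> \<in> Y" "(\<lambda>B. \<omega> (B, \<sigma>)) \<in> koszul RN \<xi> J (hd \<sigma>) ?p"
      using slice_koszul[OF \<omega> \<sigma>(1)] \<sigma>(2) by auto
    \<comment> \<open>At length \<open>r\<close> the Koszul differential of the slice differs from
      \<open>dres \<omega>\<close> only by contributions of longer simplices, and these are in the
      smaller complex by assumption. So the slice is a cycle of the Koszul quotient.\<close>
    have e: "contract V pos \<theta> (\<lambda>B. \<omega> (B, \<sigma>)) B
        = dres \<omega> (B, \<sigma>) - (- 1) ^ card B * insum Y (\<lambda>\<sigma>. \<omega> (B, \<sigma>)) \<sigma>" for B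
      using ne by (simp add: dres_def dtot_def)
    show "contract V pos \<theta> (\<lambda>B. \<omega> (B, \<sigma>)) B \<in> RM" for B
      unfolding e using d\<omega> good \<sigma>(2)
      by (intro diff_closedD(2)[OF RM(1)] diff_closed_sign[OF RM(1)] insum_in[OF RM(1)])
        (auto simp: chains_def good_def)
    show "contract V pos (\<xi> b) (contract V pos \<theta> (\<lambda>B. \<omega> (B, \<sigma>))) B = 0" for B
    proof (cases "B \<subseteq> V")
      case True
      have fB: "finite B" using True finite_V by (rule finite_subset)
      have "insum Y (\<lambda>\<sigma>. contract V pos (\<xi> b) (\<lambda>B. \<omega> (B, \<sigma>)) B) \<sigma> = insum Y (\<lambda>\<sigma>. 0) \<sigma>"
        by (rule insum_cong_length) (use good \<sigma>(2) in \<open>auto simp: good_def\<close>)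
      then have "contract V pos (\<xi> b) (\<lambda>B. (- 1) ^ card B * insum Y (\<lambda>\<sigma>. \<omega> (B, \<sigma>)) \<sigma>) B = 0"
        using contract_sign_insum[OF fB, of "\<xi> b" \<omega> \<sigma>] by (simp add: insum_zero)
      moreover have "contract V pos (\<xi> b) (\<lambda>B. dres \<omega> (B, \<sigma>)) B = 0"
        using d\<omega> by (auto simp: chains_def)
      ultimately show ?thesis unfolding e[abs_def] by (simp add: contract_diff)
    next
      case False
      have "contract V pos \<theta> (\<lambda>B. \<omega> (B, \<sigma>)) (insert v B) = 0" for v
      proof (rule contract_outside)
        show "hd \<sigma> \<in> Y" by (rule slice_koszul(2)[OF \<omega> \<sigma>(1)])
        show "\<not> insert v B \<subseteq> V" using False by blast
        show "\<omega> (B, \<sigma>) \<noteq> 0 \<Longrightarrow> B \<subseteq> hd \<sigma>" for B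
          using slice_koszul(1)[OF \<omega> \<sigma>(1)] by (auto simp: koszul_def)
      qed
      then show ?thesis by (simp add: contract_def[of V pos "\<xi> b"])
    qed
  qed
  define zz where "zz \<sigma> = (SOME z. z \<in> koszul RN \<xi> J (hd \<sigma>) (Suc ?p) \<and>
      (\<lambda>B. \<omega> (B, \<sigma>) - contract V pos \<theta> z B) \<in> koszul RM \<xi> (insert b J) (hd \<sigma>) ?p)" for \<sigma>
  have zz: "zz \<sigma> \<in> koszul RN \<xi> J (hd \<sigma>) (Suc ?p)"
    "(\<lambda>B. \<omega> (B, \<sigma>) - contract V pos \<theta> (zz \<sigma>) B) \<in> koszul RM \<xi> (insert b J) (hd \<sigma>) ?p"
    if "\<sigma> \<in> realization Y" "length \<sigma> = r" for \<sigma>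
    using someI_ex[OF ex[OF that, unfolded Bex_def]] unfolding zz_def by blast+
  define z where "z = (\<lambda>(B, \<sigma>). if \<sigma> \<in> realization Y \<and> length \<sigma> = r then zz \<sigma> B else 0)"
  have zs: "z (B, \<sigma>) = (if \<sigma> \<in> realization Y \<and> length \<sigma> = r then zz \<sigma> B else 0)" for B \<sigma>
    by (simp add: z_def)
  have zC: "z \<in> chains RN \<xi> J (Suc (Suc i))"
  proof -
    have "s \<in> index (Suc (Suc i))" if nz: "z s \<noteq> 0" for s
    proof -
      obtain B \<sigma> where s: "s = (B, \<sigma>)" by (cases s)
      have \<sigma>: "\<sigma> \<in> realization Y" "length \<sigma> = r" and "zz \<sigma> B \<noteq> 0"
        using nz by (auto simp: s zs split: if_splits)
      then have B: "B \<subseteq> hd \<sigma>" "card B = Suc ?p" using zz(1)[OF \<sigma>] by (auto simp: koszul_def)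
      have "hd \<sigma> \<in> X" using slice_koszul(2)[OF \<omega> \<sigma>(1)] YX by blast
      then have "B \<in> X" using B(1) by (rule X_down)
      moreover have "\<sigma> \<noteq> []" using \<sigma>(1) by (auto simp: realization_def)
      ultimately show ?thesis using B \<sigma> r by (auto simp: s index_def ext_index_def)
    qed
    moreover have "z s \<in> RN" for s
      using zz(1) diff_closedD(1)[OF RN] by (cases s) (auto simp: zs koszul_def)
    moreover have "contract V pos (\<xi> j) (\<lambda>B. z (B, \<sigma>)) B = 0" if "j \<in> J" for j B \<sigma>
      using zz(1)[of \<sigma>] that by (cases "\<sigma> \<in> realization Y \<and> length \<sigma> = r") (auto simp: zs koszul_def contract_zero)
    ultimately show ?thesis by (auto simp: chains_def supp_in_def)
  qed
  \<comment> \<open>\<open>z\<close> lives on simplices with \<open>r\<close> vertices, so its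
    simplicial boundary affects only shorter ones, and nothing that has been achieved at length
    above \<open>r\<close> is spoilt.\<close>
  have ins: "insum Y (\<lambda>\<sigma>. z (B, \<sigma>)) \<sigma> = 0" if "length \<sigma> \<ge> r" for B \<sigma>
    using insum_cong_length[of \<sigma> "\<lambda>\<sigma>. z (B, \<sigma>)" "\<lambda>\<sigma>. 0" Y] that by (auto simp: zs insum_zero)
  have "good (\<lambda>s. \<omega> s - dres z s) \<sigma>" if len: "length \<sigma> \<ge> r" for \<sigma>
  proof (cases "\<sigma> \<in> realization Y \<and> length \<sigma> = r")
    case True
    then have \<sigma>: "\<sigma> \<in> realization Y" "length \<sigma> = r" by auto
    have "\<sigma> \<noteq> []" using \<sigma> by (auto simp: realization_def)
    then have "(\<lambda>B. \<omega> (B, \<sigma>) - dres z (B, \<sigma>)) = (\<lambda>B. \<omega> (B, \<sigma>) - contract V pos \<theta> (zz \<sigma>) B)"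
      using \<sigma> ins[OF len] by (simp add: dres_def dtot_def zs)
    then show ?thesis using zz(2)[OF \<sigma>] by (auto simp: good_def koszul_def fun_eq_iff)
  next
    case False
    show ?thesis
    proof (cases "\<sigma> \<in> realization Y")
      case True
      then have "length \<sigma> > r" using False len by auto
      moreover have "dres z (B, \<sigma>) = 0" for B
        using False ins[OF len] by (auto simp: dres_def dtot_def zs contract_zero)
      ultimately show ?thesis using good by (simp add: good_def)
    next
      case nr: False
      show ?thesis
      proof (rule good_zero)
        fix B
        have "supp_in (dres z) (index (Suc i))" using dres_chains[OF zC] by (simp add: chains_def)
        then show "\<omega> (B, \<sigma>) - dres z (B, \<sigma>) = 0"
          using s nr by (auto simp: supp_in_def index_def ext_index_def)
      qed
    qed
  qed
  then show ?thesis using zC by blast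
qed

text \<open>The slices are corrected from the longest simplices downwards, because the simplicial
  boundary only shortens. The start is vacuous: a chain of degree \<open>Suc i\<close> has at most
  \<open>Suc (Suc i)\<close> vertices in its simplices.\<close>

lemma quotient_acyclic:
  assumes \<omega>: "\<omega> \<in> chains RN \<xi> J (Suc i)" and d\<omega>: "dres \<omega> \<in> chains RM \<xi> (insert b J) i"
  shows "\<exists>z\<in>chains RN \<xi> J (Suc (Suc i)). (\<lambda>s. \<omega> s - dres z s) \<in> chains RM \<xi> (insert b J) (Suc i)"
proof -
  have "\<exists>z\<in>chains RN \<xi> J (Suc (Suc i)). \<forall>\<sigma>. length \<sigma> > r \<longrightarrow> good (\<lambda>s. \<omega> s - dres z s) \<sigma>"
    if "r \<le> Suc (Suc i)" for r
    using that
  proof (induction r rule: inc_induct)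
    case base
    have z: "(\<lambda>s. 0) \<in> chains RN \<xi> J (Suc (Suc i))"
      using diff_closedD(1)[OF RN] by (simp add: chains_def supp_in_def contract_zero)
    have "dres (\<lambda>s. 0) = (\<lambda>s. 0)" by (auto simp: dres_def dtot_def contract_zero insum_zero)
    moreover have "\<omega> (B, \<sigma>) = 0" if "length \<sigma> > Suc (Suc i)" for B \<sigma>
      using \<omega> that by (auto simp: chains_def supp_in_def index_def ext_index_def)
    ultimately show ?case by (intro bexI[OF _ z]) (auto intro!: good_zero)
  next
    case (step r)
    then obtain z where z: "z \<in> chains RN \<xi> J (Suc (Suc i))"
      "\<And>\<sigma>. length \<sigma> > Suc r \<Longrightarrow> good (\<lambda>s. \<omega> s - dres z s) \<sigma>" by blast
    have w: "(\<lambda>s. \<omega> s - dres z s) \<in> chains RN \<xi> J (Suc i)"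
      by (rule chains_diff[OF \<omega> dres_chains[OF z(1)]])
    have "supp_in z (index (Suc (Suc i)))" using z(1) by (simp add: chains_def)
    then have "dres (\<lambda>s. \<omega> s - dres z s) = dres \<omega>"
      using dres_dres[of z] by (simp add: dres_diff)
    then have "\<exists>z'\<in>chains RN \<xi> J (Suc (Suc i)). \<forall>\<sigma>. length \<sigma> \<ge> Suc r \<longrightarrow>
        good (\<lambda>s. (\<lambda>s. \<omega> s - dres z s) s - dres z' s) \<sigma>"
      using step.hyps by (intro quotient_acyclic_step[OF w _ z(2)]) (use d\<omega> in auto)
    then obtain z' where z': "z' \<in> chains RN \<xi> J (Suc (Suc i))"
      "\<And>\<sigma>. length \<sigma> \<ge> Suc r \<Longrightarrow> good (\<lambda>s. \<omega> s - dres z s - dres z' s) \<sigma>" by auto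
    show ?case
      by (rule bexI[OF _ chains_diff(2)[OF z(1) z'(1)]]) (use z'(2) in \<open>auto simp: dres_add diff_diff_add Suc_le_eq\<close>)
  qed
  from this[of 0] obtain z where z: "z \<in> chains RN \<xi> J (Suc (Suc i))"
    "\<And>\<sigma>. length \<sigma> > 0 \<Longrightarrow> good (\<lambda>s. \<omega> s - dres z s) \<sigma>" by auto
  have w: "(\<lambda>s. \<omega> s - dres z s) \<in> chains RN \<xi> J (Suc i)"
    by (rule chains_diff[OF \<omega> dres_chains[OF z(1)]])
  have "good (\<lambda>s. \<omega> s - dres z s) \<sigma>" for \<sigma>
  proof (cases "\<sigma> = []")
    case True
    show ?thesis
      by (rule good_zero) (use w True in \<open>auto simp: chains_def supp_in_def index_def\<close>)
  next
    case False
    then show ?thesis by (intro z(2)) simp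
  qed
  then have "(\<lambda>s. \<omega> s - dres z s) \<in> chains RM \<xi> (insert b J) (Suc i)"
    using w by (auto simp: chains_def good_def)
  then show ?thesis using z(1) by blast
qed

end


section \<open>Acyclicity over the full enveloping algebra\<close>

lemma lookup_mult_single:
  fixes p :: "'a projections \<Rightarrow>\<^sub>0 'k::comm_ring_1"
  shows "lookup (p * single s 1) (u + s) = lookup p u"
    and "(\<And>u. t \<noteq> u + s) \<Longrightarrow> lookup (p * single s 1) t = 0"
proof -
  show "lookup (p * single s 1) (u + s) = lookup p u"
    by (induction p rule: poly_mapping_induct)
      (auto simp: mult_single lookup_single when_def projections_add_cancel_right distrib_right lookup_add)
  show "(\<And>u. t \<noteq> u + s) \<Longrightarrow> lookup (p * single s 1) t = 0"
    by (induction p rule: poly_mapping_induct)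
      (auto simp: mult_single lookup_single when_def distrib_right lookup_add)
qed

lemma lookup_sg_mult:
  "lookup (sg pos v B * p) t = sg pos v B * lookup (p :: 'm::monoid_add \<Rightarrow>\<^sub>0 'k::comm_ring_1) t"
  by (cases "even (card {u \<in> B. pos u < pos v})") (auto simp: sg_def)

lemma lookup_insum: "lookup (insum Y z s) t = insum Y (\<lambda>l. lookup (z l) t) s"
  by (induction s arbitrary: z) (auto simp: lookup_sum lookup_minus)

locale raag_complex = raag_lie_algebra scale bracket G \<iota>
  for scale :: "'k::field \<Rightarrow> 'l::ab_group_add \<Rightarrow> 'l" and bracket
    and G :: "'v pair_pre_digraph" and \<iota> +
  fixes pos :: "'v \<Rightarrow> nat" and Y :: "'v set set" and n :: nat
  assumes pos: "inj_on pos (pverts G)"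
    and Y_cliques: "Y \<subseteq> complete_vertex_sets G"
    and acyclic: "\<And>Z. Z \<in> complete_vertex_sets G - Y \<Longrightarrow>
      acyclic_over TYPE('k) (int n - int (card Z) - 1) (lk Y Z)"
begin

abbreviation "X \<equiv> complete_vertex_sets G"

abbreviation gen :: "'v \<Rightarrow> ('v projections \<Rightarrow>\<^sub>0 'k)" where "gen v \<equiv> single (tr [v]) 1"

sublocale clique_complex "pverts G" pos X Y gen
proof
  show "finite (pverts G)" by (rule finite_verts)
  show "inj_on pos (pverts G)" by (rule pos)
  show "Y \<subseteq> X" by (rule Y_cliques)
  fix B B' u v assume B: "B \<in> X"
  show "B \<subseteq> pverts G" using B by (simp add: complete_vertex_sets_def)
  show "B' \<subseteq> B \<Longrightarrow> B' \<in> X" using B by (auto simp: complete_vertex_sets_def)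
  show "u \<in> B \<Longrightarrow> v \<in> B \<Longrightarrow> gen u * gen v = gen v * gen u"
    using B tr_commute[of u v] by (cases "u = v") (auto simp: complete_vertex_sets_def mult_single)
qed

section \<open>Exactness of the layers over single cliques\<close>

definition link_index :: "'v set \<Rightarrow> nat \<Rightarrow> 'v set list set" where
  "link_index B m = {\<sigma>. (\<sigma> = [] \<or> \<sigma> \<in> realization Y \<and> B \<subseteq> hd \<sigma>) \<and> length \<sigma> = m}"

lemma link_index_lists: "link_index B m \<subseteq> lists Y"
  by (auto simp: link_index_def realization_def)

lemma finite_link_index: "finite (link_index B m)"
  by (rule finite_subset[of _ "insert [] (realization Y)"]) (auto simp: link_index_def finite_realization)

text \<open>If \<open>B\<close> belongs to \<open>Y\<close>, the chains above \<open>B\<close> form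
  a cone with apex \<open>B\<close>. The filling \<open>c\<close> puts \<open>B\<close> in front of
  the part \<open>z'\<close> of the cycle away from the apex; that it also restores the part
  \<open>z''\<close> at the apex is the cycle condition.\<close>

lemma link_exact_cone:
  fixes z :: "'v set list \<Rightarrow> 'k"
  assumes B: "B \<in> Y" and supp: "\<And>\<sigma>. z \<sigma> \<noteq> 0 \<Longrightarrow> \<sigma> \<in> link_index B m" and cycle: "\<And>\<sigma>. insum Y z \<sigma> = 0"
  shows "\<exists>c. (\<forall>\<sigma>. c \<sigma> \<noteq> 0 \<longrightarrow> \<sigma> \<in> link_index B (Suc m)) \<and> (\<forall>\<sigma>. insum Y c \<sigma> = z \<sigma>)"
proof -
  define st where "st \<sigma> \<longleftrightarrow> \<sigma> \<noteq> [] \<and> hd \<sigma> = B" for \<sigma> :: "'v set list"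
  define z' where "z' \<sigma> = (if st \<sigma> then 0 else z \<sigma>)" for \<sigma>
  define z'' where "z'' \<sigma> = (if st \<sigma> then z \<sigma> else 0)" for \<sigma>
  define c where "c \<tau> = (case \<tau> of [] \<Rightarrow> 0 | A # \<sigma> \<Rightarrow> if A = B then z' \<sigma> else 0)" for \<tau>
  have c_B: "(\<lambda>l. c (A # l)) = (if A = B then z' else (\<lambda>l. 0))" for A by (auto simp: c_def)
  \<comment> \<open>In a chain above \<open>B\<close> the set \<open>B\<close> can only stand first.
    This rules out the spurious lists that \<open>insum\<close> produces by inserting in front of
    \<open>B\<close>.\<close>
  have tail: "z (A # B # l) = 0" for A l
  proof (rule ccontr)
    assume "z (A # B # l) \<noteq> 0"
    from supp[OF this] show False by (auto simp: link_index_def realization_def)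
  qed
  have "\<tau> \<in> link_index B (Suc m)" if nz: "c \<tau> \<noteq> 0" for \<tau>
  proof -
    obtain \<sigma> where \<tau>: "\<tau> = B # \<sigma>" "z' \<sigma> \<noteq> 0" using nz by (auto simp: c_def split: list.splits if_splits)
    then have "\<sigma> \<in> link_index B m" and n: "\<not> st \<sigma>" using supp by (auto simp: z'_def split: if_splits)
    then have \<sigma>: "\<sigma> = [] \<or> \<sigma> \<in> realization Y \<and> B \<subset> hd \<sigma>" "length \<sigma> = m"
      by (auto simp: link_index_def st_def)
    have "sorted_wrt (\<subset>) (B # \<sigma>)"
      using \<sigma>(1) by (cases \<sigma>) (auto simp: realization_def)
    then show ?thesis using \<sigma> B by (auto simp: \<tau> link_index_def realization_def)
  qed
  moreover have "insum Y c \<sigma> = z \<sigma>" for \<sigma>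
  proof -
    have S: "(\<Sum>A\<in>Y. c (A # \<sigma>)) = z' \<sigma>"
    proof -
      have "(\<Sum>A\<in>Y. c (A # \<sigma>)) = (\<Sum>A\<in>Y. if A = B then z' \<sigma> else 0)"
        by (rule sum.cong) (auto simp: c_def)
      then show ?thesis using B finite_Y by simp
    qed
    have zz: "insum Y z s = insum Y z' s + insum Y z'' s" for s
      unfolding insum_add[symmetric] by (rule arg_cong[of _ _ "\<lambda>f. insum Y f s"]) (auto simp: z'_def z''_def)
    have S'': "(\<Sum>A\<in>Y. z'' (A # s)) = z (B # s)" for s
    proof -
      have "(\<Sum>A\<in>Y. z'' (A # s)) = (\<Sum>A\<in>Y. if A = B then z (B # s) else 0)"
        by (rule sum.cong) (auto simp: z''_def st_def)
      then show ?thesis using B finite_Y by simp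
    qed
    show ?thesis
    proof (cases \<sigma>)
      case Nil
      then show ?thesis using S by (simp add: z'_def st_def)
    next
      case (Cons x xs)
      show ?thesis
      proof (cases "x = B")
        case False
        then show ?thesis using S by (simp add: Cons c_B insum_zero z'_def st_def)
      next
        case x: True
        have "insum Y c \<sigma> = - insum Y z' xs"
          using S by (simp add: Cons x c_B z'_def st_def)
        also have "\<dots> = insum Y z'' xs" by (rule minus_unique) (use cycle[of xs] zz[of xs] in simp)
        also have "\<dots> = z (B # xs)"
        proof (cases xs)
          case Nil
          then show ?thesis using S''[of "[]"] by simp
        next
          case c: (Cons u us)
          have "insum Y (\<lambda>l. z'' (u # l)) us = 0"
          proof (cases "u = B")
            case False
            then show ?thesis by (simp add: z''_def st_def insum_zero)
          next
            case True
            have "z (B # B # us) = 0" by (rule tail)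
            have 1: "insum Y z' xs = - insum Y z'' xs" using cycle[of xs] zz[of xs] by (simp add: eq_neg_iff_add_eq_0)
            have "insum Y z' xs = 0"
            proof -
              have "(\<Sum>A\<in>Y. z' (A # xs)) = 0"
                by (rule sum.neutral) (auto simp: z'_def c True tail)
              moreover have "(\<lambda>l. z' (B # l)) = (\<lambda>l. 0)" by (auto simp: z'_def st_def)
              ultimately show ?thesis by (simp add: c True insum_zero)
            qed
            then have "insum Y z'' xs = 0" using 1 by simp
            then show ?thesis using S''[of xs] tail[of B us] by (simp add: c True)
          qed
          then show ?thesis using S''[of xs] by (simp add: c)
        qed
        finally show ?thesis by (simp add: Cons x)
      qed
    qed
  qed
  ultimately show ?thesis by blast
qed

text \<open>For \<open>B\<close> outside \<open>Y\<close>, every simplex above \<open>B\<close> has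
  vertices strictly above it and belongs to the link. A list of length \<open>m\<close> is a simplex
  of dimension \<open>m - 1\<close>, and \<open>m + card B \<le> n\<close> puts that into the range
  of the assumed acyclicity.\<close>

lemma link_exact:
  fixes z :: "'v set list \<Rightarrow> 'k"
  assumes B: "B \<in> X" and supp: "\<And>\<sigma>. z \<sigma> \<noteq> 0 \<Longrightarrow> \<sigma> \<in> link_index B m" and cycle: "\<And>\<sigma>. insum Y z \<sigma> = 0"
    and m: "m + card B \<le> n"
  shows "\<exists>c. (\<forall>\<sigma>. c \<sigma> \<noteq> 0 \<longrightarrow> \<sigma> \<in> link_index B (Suc m)) \<and> (\<forall>\<sigma>. insum Y c \<sigma> = z \<sigma>)"
proof (cases "B \<in> Y")
  case True
  then show ?thesis using supp cycle by (rule link_exact_cone)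
next
  case False
  have idx: "{xs \<in> insert [] (lk Y B). int (length xs) = i + 1} = link_index B (nat (i + 1))" if "i \<ge> -1" for i
  proof -
    have "B \<subset> hd xs" if "xs \<in> realization Y" "B \<subseteq> hd xs" for xs
      using that False by (cases xs) (auto simp: realization_def)
    then show ?thesis using that by (auto simp: lk_def link_index_def)
  qed
  define p where "p = Abs_poly_mapping z"
  have "finite {\<sigma>. z \<sigma> \<noteq> 0}" by (rule finite_subset[OF _ finite_link_index[of B m]]) (use supp in auto)
  then have p: "lookup p = z" by (simp add: p_def)
  have keysp: "keys p \<subseteq> link_index B m" using supp by (auto simp: in_keys_iff p)
  have "boundary p = 0"
    by (rule poly_mapping_eqI)
      (use lookup_boundary[OF subset_trans[OF keysp link_index_lists] finite_Y] cycle in \<open>simp add: p\<close>)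
  moreover have "p \<in> reduced_chains (lk Y B) (int m - 1)"
    using keysp idx[of "int m - 1"] by (simp add: reduced_chains_def)
  moreover have "reduced_homology_vanishes TYPE('k) (lk Y B) (int m - 1)"
    using acyclic[of B] B False m by (auto simp: acyclic_over_def)
  ultimately have "p \<in> boundary ` reduced_chains (lk Y B) (int m - 1 + 1)"
    unfolding reduced_homology_vanishes_def by blast
  then obtain c where c: "p = boundary c" "c \<in> reduced_chains (lk Y B) (int m - 1 + 1)" by blast
  have keysc: "keys c \<subseteq> link_index B (Suc m)"
    using c(2) idx[of "int m"] by (simp add: reduced_chains_def nat_add_distrib)
  then have "\<sigma> \<in> link_index B (Suc m)" if "lookup c \<sigma> \<noteq> 0" for \<sigma>
    using that by (auto simp: in_keys_iff)
  moreover have "insum Y (lookup c) \<sigma> = z \<sigma>" for \<sigma>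
    using lookup_boundary[OF subset_trans[OF keysc link_index_lists] finite_Y, of \<sigma>] c(1) p by simp
  ultimately show ?thesis by blast
qed

text \<open>The boundary does not touch the values, so each trace \<open>t\<close> can be treated
  separately over the field. Choosing zero wherever the cycle has no coefficient at \<open>t\<close>
  keeps the result finitely supported.\<close>

lemma link_exact_coefficients:
  fixes z :: "'v set list \<Rightarrow> ('v projections \<Rightarrow>\<^sub>0 'k)"
  assumes B: "B \<in> X" and supp: "\<And>\<sigma>. z \<sigma> \<noteq> 0 \<Longrightarrow> \<sigma> \<in> link_index B m" and cycle: "\<And>\<sigma>. insum Y z \<sigma> = 0"
    and m: "m + card B \<le> n" and zT: "\<And>\<sigma>. z \<sigma> \<in> trace_algebra"
  shows "\<exists>c. (\<forall>\<sigma>. c \<sigma> \<noteq> 0 \<longrightarrow> \<sigma> \<in> link_index B (Suc m)) \<and> (\<forall>\<sigma>. insum Y c \<sigma> = z \<sigma>) \<and> (\<forall>\<sigma>. c \<sigma> \<in> trace_algebra)"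
proof -
  have "\<exists>c. (\<forall>\<sigma>. c \<sigma> \<noteq> 0 \<longrightarrow> \<sigma> \<in> link_index B (Suc m)) \<and> (\<forall>\<sigma>. insum Y c \<sigma> = lookup (z \<sigma>) t) \<and>
      ((\<forall>\<sigma>. lookup (z \<sigma>) t = 0) \<longrightarrow> c = (\<lambda>_. 0))" for t
  proof (cases "\<forall>\<sigma>. lookup (z \<sigma>) t = 0")
    case True
    then show ?thesis by (intro exI[of _ "\<lambda>_. 0"]) (simp add: insum_zero)
  next
    case False
    have "\<exists>c. (\<forall>\<sigma>. c \<sigma> \<noteq> 0 \<longrightarrow> \<sigma> \<in> link_index B (Suc m)) \<and> (\<forall>\<sigma>. insum Y c \<sigma> = lookup (z \<sigma>) t)"
    proof (rule link_exact[OF B _ _ m])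
      show "insum Y (\<lambda>\<sigma>. lookup (z \<sigma>) t) \<sigma> = 0" for \<sigma>
        using cycle[of \<sigma>] by (simp add: lookup_insum[symmetric])
      show "lookup (z \<sigma>) t \<noteq> 0 \<Longrightarrow> \<sigma> \<in> link_index B m" for \<sigma>
        using supp[of \<sigma>] by (cases "z \<sigma> = 0") auto
    qed
    then show ?thesis using False by blast
  qed
  then obtain c where c: "\<And>t \<sigma>. c t \<sigma> \<noteq> 0 \<Longrightarrow> \<sigma> \<in> link_index B (Suc m)"
    "\<And>t \<sigma>. insum Y (c t) \<sigma> = lookup (z \<sigma>) t" "\<And>t. (\<And>\<sigma>. lookup (z \<sigma>) t = 0) \<Longrightarrow> c t = (\<lambda>_. 0)"
    by metis
  define C where "C \<sigma> = Abs_poly_mapping (\<lambda>t. c t \<sigma>)" for \<sigma>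
  have ct: "\<exists>\<tau>\<in>link_index B m. t \<in> keys (z \<tau>)" if nz: "c t \<sigma> \<noteq> 0" for t \<sigma>
  proof (rule ccontr)
    assume n: "\<not> ?thesis"
    have "lookup (z \<tau>) t = 0" for \<tau>
    proof (cases "z \<tau> = 0")
      case False
      then show ?thesis using n supp[OF False] by (auto simp: in_keys_iff)
    qed simp
    from c(3)[OF this] show False using nz by simp
  qed
  have C: "lookup (C \<sigma>) t = c t \<sigma>" for \<sigma> t
  proof -
    have "finite {t. c t \<sigma> \<noteq> 0}"
      by (rule finite_subset[of _ "\<Union>\<tau>\<in>link_index B m. keys (z \<tau>)"]) (use ct finite_link_index in auto)
    then show ?thesis by (simp add: C_def)
  qed
  have "\<sigma> \<in> link_index B (Suc m)" if "C \<sigma> \<noteq> 0" for \<sigma>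
  proof -
    have "\<exists>t. c t \<sigma> \<noteq> 0"
    proof (rule ccontr)
      assume "\<nexists>t. c t \<sigma> \<noteq> 0"
      then have "C \<sigma> = 0" by (intro poly_mapping_eqI) (simp add: C)
      then show False using that by simp
    qed
    then show ?thesis using c(1) by blast
  qed
  moreover have "insum Y C \<sigma> = z \<sigma>" for \<sigma>
    by (rule poly_mapping_eqI) (simp add: lookup_insum C c(2))
  moreover have "C \<sigma> \<in> trace_algebra" for \<sigma>
  proof -
    have "t \<in> traces" if "c t \<sigma> \<noteq> 0" for t
      using ct[OF that] zT by (auto simp: trace_algebra_def)
    then show ?thesis by (auto simp: trace_algebra_def in_keys_iff C)
  qed
  ultimately show ?thesis by blast
qed

lemma diff_closed_trace_algebra: "diff_closed trace_algebra"
  by (auto simp: diff_closed_def trace_algebra_closed)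

lemma gen_trace_algebra: "v \<in> pverts G \<Longrightarrow> gen v \<in> trace_algebra"
  by (intro trace_algebra_closed traces_single)

lemma dtot_trace_algebra: "(\<And>s. \<omega> s \<in> trace_algebra) \<Longrightarrow> dtot \<omega> s \<in> trace_algebra"
proof -
  assume \<omega>: "\<And>s. \<omega> s \<in> trace_algebra"
  obtain B \<sigma> where s: "s = (B, \<sigma>)" by (cases s)
  have "contract (pverts G) pos gen (\<lambda>B. \<omega> (B, \<sigma>)) B \<in> trace_algebra"
    by (rule contract_in[OF diff_closed_trace_algebra]) (intro trace_algebra_closed(4) \<omega> gen_trace_algebra)
  moreover have "(- 1) ^ card B * insum Y (\<lambda>\<sigma>. \<omega> (B, \<sigma>)) \<sigma> \<in> trace_algebra"
    by (intro diff_closed_sign insum_in diff_closed_trace_algebra \<omega>)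
  ultimately show ?thesis by (simp add: s dtot_def trace_algebra_closed(2))
qed

text \<open>The filtration by \<open>|B|\<close> has the augmented chain complexes of the links as its quotients.\<close>

lemma ext_exact:
  assumes \<omega>: "supp_in \<omega> (ext_index i)" "\<And>s. \<omega> s \<in> trace_algebra" "\<And>s. dtot \<omega> s = 0" and i: "i < n"
  shows "\<exists>\<eta>. supp_in \<eta> (ext_index (Suc i)) \<and> (\<forall>s. \<eta> s \<in> trace_algebra) \<and> dtot \<eta> = \<omega>"
proof -
  have "\<exists>\<eta>. supp_in \<eta> (ext_index (Suc i)) \<and> (\<forall>s. \<eta> s \<in> trace_algebra) \<and>
      (\<forall>B \<sigma>. card B \<ge> b \<longrightarrow> \<omega> (B, \<sigma>) = dtot \<eta> (B, \<sigma>))" if "b \<le> Suc (Suc i)" for b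
    using that
  proof (induction b rule: inc_induct)
    case base
    have "\<omega> (B, \<sigma>) = 0" if "card B \<ge> Suc (Suc i)" for B \<sigma>
      using \<omega>(1) that by (auto simp: supp_in_def ext_index_def)
    moreover have "dtot (\<lambda>s. 0) = (\<lambda>s. 0)" by (auto simp: dtot_def contract_zero insum_zero)
    ultimately show ?case
      by (intro exI[of _ "\<lambda>s. 0"]) (auto simp: supp_in_def trace_algebra_closed)
  next
    case (step b)
    then obtain \<eta> where \<eta>: "supp_in \<eta> (ext_index (Suc i))" "\<And>s. \<eta> s \<in> trace_algebra"
      "\<And>B \<sigma>. card B \<ge> Suc b \<Longrightarrow> \<omega> (B, \<sigma>) = dtot \<eta> (B, \<sigma>)" by blast
    define \<omega>1 where "\<omega>1 s = \<omega> s - dtot \<eta> s" for s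
    have \<omega>1: "supp_in \<omega>1 (ext_index i)" "\<And>s. \<omega>1 s \<in> trace_algebra"
      using \<omega>(1,2) supp_dtot[OF \<eta>(1)] dtot_trace_algebra[of \<eta>] \<eta>(2)
      by (auto simp: supp_in_def \<omega>1_def trace_algebra_closed)
    have d\<omega>1: "dtot \<omega>1 s = 0" for s
      using \<omega>(3) dtot_dtot[OF \<eta>(1)] by (simp add: \<omega>1_def[abs_def] dtot_diff)
    have fX: "finite B" if "B \<in> X" for B using X_subset[OF that] finite_V by (rule finite_subset)
    have ex: "\<exists>c. (\<forall>\<sigma>. c \<sigma> \<noteq> 0 \<longrightarrow> \<sigma> \<in> link_index B (Suc (Suc i - b))) \<and>
        (\<forall>\<sigma>. insum Y c \<sigma> = \<omega>1 (B, \<sigma>)) \<and> (\<forall>\<sigma>. c \<sigma> \<in> trace_algebra)"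
      if B: "B \<in> X" "card B = b" for B
    proof (rule link_exact_coefficients[OF B(1)])
      show "\<omega>1 (B, \<sigma>) \<noteq> 0 \<Longrightarrow> \<sigma> \<in> link_index B (Suc i - b)" for \<sigma>
        using supp_inD[OF \<omega>1(1), of "(B, \<sigma>)"] B(2) by (auto simp: ext_index_def link_index_def)
      show "insum Y (\<lambda>\<sigma>. \<omega>1 (B, \<sigma>)) \<sigma> = 0" for \<sigma>
      proof -
        \<comment> \<open>The Koszul part at \<open>B\<close> reads only cliques with one more
          vertex, where \<open>\<omega>1\<close> has been cleared already. So the cycle condition at
          \<open>B\<close> concerns the simplicial boundary alone.\<close>
        have "\<omega>1 (insert v B, \<sigma>) = 0" if "v \<in> pverts G - B" for v
          using \<eta>(3)[of "insert v B" \<sigma>] that fX[OF B(1)] B(2) by (simp add: \<omega>1_def)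
        then have "contract (pverts G) pos gen (\<lambda>B. \<omega>1 (B, \<sigma>)) B = 0"
          by (simp add: contract_def)
        then show ?thesis using d\<omega>1[of "(B, \<sigma>)"] by (cases "even (card B)") (auto simp: dtot_def)
      qed
      \<comment> \<open>As \<open>|B| = b\<close>, this is \<open>i < n\<close>: the degree of the
        layer and the bound for the link shift together.\<close>
      show "Suc i - b + card B \<le> n" using B(2) i step.hyps by simp
      show "\<omega>1 (B, \<sigma>) \<in> trace_algebra" for \<sigma> by (rule \<omega>1(2))
    qed
    define cc where "cc B = (SOME c. (\<forall>\<sigma>. c \<sigma> \<noteq> 0 \<longrightarrow> \<sigma> \<in> link_index B (Suc (Suc i - b))) \<and>
        (\<forall>\<sigma>. insum Y c \<sigma> = \<omega>1 (B, \<sigma>)) \<and> (\<forall>\<sigma>. c \<sigma> \<in> trace_algebra))" for B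
    have cc: "(\<forall>\<sigma>. cc B \<sigma> \<noteq> 0 \<longrightarrow> \<sigma> \<in> link_index B (Suc (Suc i - b))) \<and>
        (\<forall>\<sigma>. insum Y (cc B) \<sigma> = \<omega>1 (B, \<sigma>)) \<and> (\<forall>\<sigma>. cc B \<sigma> \<in> trace_algebra)"
      if "B \<in> X" "card B = b" for B
      unfolding cc_def by (rule someI_ex[OF ex[OF that]])
    \<comment> \<open>The sign cancels the one in \<open>dtot\<close>.\<close>
    define \<eta>' where "\<eta>' = (\<lambda>(B, \<sigma>). if B \<in> X \<and> card B = b then (- 1) ^ b * cc B \<sigma> else 0)"
    have \<eta>'s: "\<eta>' (B, \<sigma>) = (if B \<in> X \<and> card B = b then (- 1) ^ b * cc B \<sigma> else 0)" for B \<sigma>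
      by (simp add: \<eta>'_def)
    have \<eta>'T: "\<eta>' s \<in> trace_algebra" for s
      using cc by (cases s) (auto simp: \<eta>'s trace_algebra_closed intro!: diff_closed_sign diff_closed_trace_algebra)
    have \<eta>'supp: "supp_in \<eta>' (ext_index (Suc i))"
      unfolding supp_in_def
    proof (intro allI impI, rule ccontr)
      fix s assume s: "s \<notin> ext_index (Suc i)" "\<eta>' s \<noteq> 0"
      obtain B \<sigma> where s': "s = (B, \<sigma>)" by (cases s)
      have B: "B \<in> X" "card B = b" "cc B \<sigma> \<noteq> 0" using s(2) by (auto simp: s' \<eta>'s split: if_splits)
      then have "\<sigma> \<in> link_index B (Suc (Suc i - b))" using cc by blast
      then show False using s(1) B step.hyps by (auto simp: s' ext_index_def link_index_def)
    qed
    have key: "dtot \<eta>' (B, \<sigma>) = \<omega>1 (B, \<sigma>)" if cb: "card B \<ge> b" for B \<sigma>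
    proof (cases "B \<in> X")
      case BX: True
      have "\<eta>' (insert v B, \<sigma>) = 0" if "v \<in> pverts G - B" for v
        using that fX[OF BX] cb by (simp add: \<eta>'s)
      then have con: "contract (pverts G) pos gen (\<lambda>B. \<eta>' (B, \<sigma>)) B = 0" by (simp add: contract_def)
      show ?thesis
      proof (cases "card B = b")
        case True
        have "insum Y (\<lambda>\<sigma>. \<eta>' (B, \<sigma>)) \<sigma> = (- 1) ^ b * \<omega>1 (B, \<sigma>)"
          using BX True cc[OF BX True] by (simp add: \<eta>'s insum_lmult)
        then show ?thesis using con True by (cases "even b") (auto simp: dtot_def)
      next
        case False
        then have "\<omega>1 (B, \<sigma>) = 0" using \<eta>(3)[of B \<sigma>] cb by (simp add: \<omega>1_def)
        then show ?thesis using con False by (simp add: dtot_def \<eta>'s insum_zero)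
      qed
    next
      case False
      then show ?thesis
        using \<omega>1(1) supp_dtot[OF \<eta>'supp] by (auto simp: supp_in_def ext_index_def)
    qed
    show ?case
    proof (intro exI[of _ "\<lambda>s. \<eta> s + \<eta>' s"] conjI allI impI)
      show "supp_in (\<lambda>s. \<eta> s + \<eta>' s) (ext_index (Suc i))"
        using \<eta>(1) \<eta>'supp by (auto simp: supp_in_def)
      show "\<eta> s + \<eta>' s \<in> trace_algebra" for s by (intro trace_algebra_closed \<eta> \<eta>'T)
      show "\<omega> (B, \<sigma>) = dtot (\<lambda>s. \<eta> s + \<eta>' s) (B, \<sigma>)" if "b \<le> card B" for B \<sigma>
        using key[OF that, of \<sigma>] by (simp add: dtot_add \<omega>1_def)
    qed
  qed
  from this[of 0] obtain \<eta> where "supp_in \<eta> (ext_index (Suc i))" "\<And>s. \<eta> s \<in> trace_algebra"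
    "\<And>B \<sigma>. \<omega> (B, \<sigma>) = dtot \<eta> (B, \<sigma>)" by auto
  then show ?thesis by (intro exI[of _ \<eta>]) auto
qed

section \<open>The Koszul complex of cliques over the trace algebra\<close>

text \<open>The element of the trace monoid that is the product of a clique.\<close>

definition clique_trace :: "'v set \<Rightarrow> 'v projections" where
  "clique_trace B = Projections (\<lambda>(u, w). if adj u w then [] else if u \<in> B then [u] else if w \<in> B then [w] else [])"

lemma clique_trace_empty: "clique_trace {} = 0"
  by (simp add: projections_eq_iff clique_trace_def)

lemma clique_adj: "B \<in> X \<Longrightarrow> u \<in> B \<Longrightarrow> v \<in> B \<Longrightarrow> u \<noteq> v \<Longrightarrow> adj u v"
  by (auto simp: complete_vertex_sets_def)

lemma clique_trace_insert:
  assumes "insert v B \<in> X" "v \<notin> B"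
  shows "clique_trace (insert v B) = tr [v] + clique_trace B"
  using clique_adj[OF assms(1)] assms(2)
  by (auto simp: projections_eq_iff clique_trace_def pair_proj_tr)

lemma clique_trace_list:
  assumes "B \<in> X"
  shows "\<exists>bs. set bs = B \<and> tr bs = clique_trace B"
proof -
  have "finite B" using X_subset[OF assms] finite_V by (rule finite_subset)
  then show ?thesis using assms
  proof (induction B rule: finite_induct)
    case empty
    then show ?case by (intro exI[of _ "[]"]) (simp add: tr_Nil clique_trace_empty)
  next
    case (insert v B)
    then obtain bs where "set bs = B" "tr bs = clique_trace B" using X_down[of "insert v B" B] by blast
    then show ?case
      using clique_trace_insert[OF insert.prems insert.hyps(2)] by (intro exI[of _ "v # bs"]) (simp add: tr_Cons[of v bs])
  qed
qed

lemma clique_trace_traces: "B \<in> X \<Longrightarrow> clique_trace B \<in> traces"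
  using clique_trace_list[of B] X_subset[of B] by (force simp: traces_def)

definition last_letters :: "'v projections \<Rightarrow> 'v set" where
  "last_letters w = {v \<in> pverts G. \<exists>t\<in>traces. w = t + tr [v]}"

lemma last_letters_nonempty: "w \<in> traces \<Longrightarrow> w \<noteq> 0 \<Longrightarrow> last_letters w \<noteq> {}"
proof -
  assume w: "w \<in> traces" "w \<noteq> 0"
  then obtain ws where ws: "ws \<in> lists (pverts G)" "w = tr ws" by (auto simp: traces_def)
  obtain us v where "ws = us @ [v]" using w(2) ws(2) by (cases ws rule: rev_cases) (auto simp: tr_Nil)
  then have "v \<in> last_letters w" using ws by (auto simp: last_letters_def traces_def tr_append)
  then show ?thesis by blast
qed

text \<open>Write \<open>w\<close> as a word for \<open>t\<close> followed by one for
  \<open>B\<close>. By \<open>tr_eq_snoc\<close> all letters after the last \<open>v\<close> are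
  adjacent to \<open>v\<close>; as \<open>v\<close> is not in \<open>B\<close>, that occurrence lies
  in the word for \<open>t\<close> and all of \<open>B\<close> comes after it. So \<open>v\<close>
  extends the clique and can be split off \<open>t\<close> at its end.\<close>

lemma last_letter_peel:
  assumes v: "v \<in> last_letters w" "v \<notin> B" and B: "B \<in> X" and w: "t \<in> traces" "w = t + clique_trace B"
  shows "insert v B \<in> X" "\<exists>u\<in>traces. t = u + tr [v]"
proof -
  obtain bs where bs: "set bs = B" "tr bs = clique_trace B" using clique_trace_list[OF B] by blast
  obtain ts where ts: "ts \<in> lists (pverts G)" "t = tr ts" using w(1) by (auto simp: traces_def)
  obtain us where us: "w = tr us + tr [v]" and vV: "v \<in> pverts G" using v(1) by (auto simp: last_letters_def traces_def)
  have "tr (ts @ bs) = tr us + tr [v]" using us w(2) bs(2) ts(2) by (simp add: tr_append)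
  then obtain w1 w2 where e: "ts @ bs = w1 @ v # w2" "\<And>x. x \<in> set w2 \<Longrightarrow> adj v x"
    by (rule tr_eq_snoc) blast
  have "\<exists>w2'. ts = w1 @ v # w2' \<and> w2 = w2' @ bs"
  proof -
    from e(1) obtain r where "ts = w1 @ r \<and> r @ bs = v # w2 \<or> ts @ r = w1 \<and> bs = r @ v # w2"
      by (auto simp: append_eq_append_conv2)
    then show ?thesis using bs(1) v(2) by (cases r) auto
  qed
  then obtain w2' where w2': "ts = w1 @ v # w2'" "w2 = w2' @ bs" by blast
  have ab: "adj v x" if "x \<in> B" for x using e(2) that w2'(2) bs(1) by auto
  then show "insert v B \<in> X"
    using B vV adj_sym by (auto simp: complete_vertex_sets_def)
  have "t = tr (w1 @ w2') + tr [v]"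
    using tr_commute_list[of w2' v] e(2) by (simp add: ts(2) w2' tr_append tr_Cons[of v w2'] add.assoc)
  moreover have "tr (w1 @ w2') \<in> traces" using ts(1) w2'(1) by (auto simp: traces_def)
  ultimately show "\<exists>u\<in>traces. t = u + tr [v]" by blast
qed

text \<open>The clique complex splits according to the product \<open>w = t \<cdot> \<Prod>B\<close> of the coefficient
  \<open>t\<close> and the clique \<open>B\<close>; the summand of \<open>w\<close> is the augmented chain complex of a full simplex on the
  letters that \<open>w\<close> can end with.\<close>

definition fiber :: "('v set \<Rightarrow> ('v projections \<Rightarrow>\<^sub>0 'k)) \<Rightarrow> 'v projections \<Rightarrow> 'v set \<Rightarrow> 'k" where
  "fiber \<phi> w B = (if B \<in> X \<and> (\<exists>t\<in>traces. w = t + clique_trace B)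
     then lookup (\<phi> B) (THE t. t \<in> traces \<and> w = t + clique_trace B) else 0)"

lemma fiber_eq:
  assumes "B \<in> X" "t \<in> traces"
  shows "fiber \<phi> (t + clique_trace B) B = lookup (\<phi> B) t"
proof -
  have "(THE t'. t' \<in> traces \<and> t + clique_trace B = t' + clique_trace B) = t"
    using assms by (intro the_equality) (auto simp: projections_add_cancel_right)
  then show ?thesis using assms by (auto simp: fiber_def)
qed

text \<open>The Koszul differential takes \<open>v\<close> out of the clique and appends it to the
  coefficient, which leaves the product \<open>w\<close> unchanged. Within the fiber only the signs
  survive, as weights equal to 1.\<close>

lemma fiber_contract:
  assumes X: "\<And>B. \<phi> B \<noteq> 0 \<Longrightarrow> B \<in> X" and T: "\<And>B. \<phi> B \<in> trace_algebra"
  shows "fiber (contract (pverts G) pos gen \<phi>) w B = contract (pverts G) pos (\<lambda>_. 1) (fiber \<phi> w) B"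
proof (cases "B \<in> X \<and> (\<exists>t\<in>traces. w = t + clique_trace B)")
  case True
  then obtain t where B: "B \<in> X" and t: "t \<in> traces" "w = t + clique_trace B" by blast
  have "lookup (\<phi> (insert v B) * gen v) t = fiber \<phi> w (insert v B)" if v: "v \<in> pverts G - B" for v
  proof (cases "insert v B \<in> X")
    case False
    then have "\<phi> (insert v B) = 0" using X by blast
    then show ?thesis using False by (simp add: fiber_def)
  next
    case iX: True
    have ct: "u + clique_trace (insert v B) = u + tr [v] + clique_trace B" for u
      using clique_trace_insert[OF iX] v by (simp add: add.assoc)
    show ?thesis
    proof (cases "\<exists>u. t = u + tr [v]")
      case True
      then obtain u where u: "t = u + tr [v]" by blast
      have w: "w = u + clique_trace (insert v B)" using t(2) by (simp add: u ct)
      have l: "lookup (\<phi> (insert v B) * gen v) t = lookup (\<phi> (insert v B)) u"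
        unfolding u by (rule lookup_mult_single)
      show ?thesis
      proof (cases "u \<in> traces")
        case True
        then show ?thesis unfolding l w by (rule fiber_eq[OF iX, symmetric])
      next
        case False
        then have "\<not> (\<exists>t'\<in>traces. w = t' + clique_trace (insert v B))"
          by (auto simp: w projections_add_cancel_right)
        moreover have "lookup (\<phi> (insert v B)) u = 0"
          using T[of "insert v B"] False by (auto simp: trace_algebra_def in_keys_iff)
        ultimately show ?thesis unfolding l by (simp add: fiber_def)
      qed
    next
      case False
      then have "lookup (\<phi> (insert v B) * gen v) t = 0" by (intro lookup_mult_single(2)) blast
      moreover have "w \<noteq> u + clique_trace (insert v B)" for u
        using False by (auto simp: t(2) ct projections_add_cancel_right)
      ultimately show ?thesis by (simp add: fiber_def)
    qed
  qed
  then show ?thesis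
    unfolding t(2) fiber_eq[OF B t(1)] by (simp add: contract_def lookup_sum lookup_sg_mult t(2)[symmetric])
next
  case False
  have "fiber \<phi> w (insert v B) = 0" if v: "v \<in> pverts G - B" for v
  proof (rule ccontr)
    assume "fiber \<phi> w (insert v B) \<noteq> 0"
    then obtain t where iX: "insert v B \<in> X" and t: "t \<in> traces" "w = t + clique_trace (insert v B)"
      by (auto simp: fiber_def split: if_splits)
    have "B \<in> X" using X_down[OF iX] by blast
    moreover have "w = (t + tr [v]) + clique_trace B"
      using t(2) clique_trace_insert[OF iX] v by (simp add: add.assoc)
    moreover have "t + tr [v] \<in> traces" using t(1) v by (intro traces_add traces_single) auto
    ultimately show False using False by blast
  qed
  then have "contract (pverts G) pos (\<lambda>_. 1) (fiber \<phi> w) B = 0" by (simp add: contract_def)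
  moreover have "fiber (contract (pverts G) pos gen \<phi>) w B = 0" by (simp only: fiber_def if_not_P[OF False])
  ultimately show ?thesis by simp
qed

text \<open>In the fiber of a nonempty trace \<open>w\<close>, wedging with a fixed letter
  \<open>v0 w\<close> with which \<open>w\<close> can end is a contracting homotopy; by
  \<open>last_letter_peel\<close> it does not leave the fiber. The fiber of the empty trace only has
  the empty clique, and \<open>\<phi>\<close> vanishes there by \<open>aug\<close> or for reasons of
  degree.\<close>

lemma clique_complex_exact:
  assumes supp: "\<And>B. \<phi> B \<noteq> 0 \<Longrightarrow> B \<in> X \<and> card B = i" and T: "\<And>B. \<phi> B \<in> trace_algebra"
    and cycle: "\<And>B. contract (pverts G) pos gen \<phi> B = 0" and aug: "i = 0 \<Longrightarrow> lookup (\<phi> {}) 0 = 0"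
  shows "\<exists>\<psi>. (\<forall>B. \<psi> B \<noteq> 0 \<longrightarrow> B \<in> X \<and> card B = Suc i) \<and> (\<forall>B. \<psi> B \<in> trace_algebra) \<and>
    (\<forall>B. contract (pverts G) pos gen \<psi> B = \<phi> B)"
proof -
  define v0 where "v0 w = (SOME v. v \<in> last_letters w)" for w
  have v0: "v0 w \<in> last_letters w" if "w \<in> traces" "w \<noteq> 0" for w
    using last_letters_nonempty[OF that] unfolding v0_def by (auto intro: someI)
  define \<delta> where "\<delta> w v = (if v = v0 w then 1 else 0 :: 'k)" for w v
  let ?W = "\<lambda>w. wedge (pverts G) pos (\<delta> w) (fiber \<phi> w)"
  define \<psi> where "\<psi> B = Abs_poly_mapping (\<lambda>t. if B \<in> X \<and> t \<in> traces then ?W (t + clique_trace B) B else 0)" for B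
  have fX: "finite B" if "B \<in> X" for B using X_subset[OF that] finite_V by (rule finite_subset)
  have W_nz: "v0 w \<in> B \<and> fiber \<phi> w (B - {v0 w}) \<noteq> 0" if "?W w B \<noteq> 0" for w B
    using wedge_nonzero[OF that] by (auto simp: \<delta>_def split: if_splits)
  have fiber_nz: "\<exists>t\<in>traces. B \<in> X \<and> w = t + clique_trace B \<and> lookup (\<phi> B) t \<noteq> 0" if "fiber \<phi> w B \<noteq> 0" for w B
  proof -
    have "B \<in> X \<and> (\<exists>t\<in>traces. w = t + clique_trace B)"
    proof (rule ccontr)
      assume n: "\<not> ?thesis"
      have "fiber \<phi> w B = 0" by (simp only: fiber_def if_not_P[OF n])
      then show False using that by simp
    qed
    then obtain t where t: "B \<in> X" "t \<in> traces" "w = t + clique_trace B" by blast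
    then show ?thesis using that fiber_eq[OF t(1,2), of \<phi>] by auto
  qed
  have fiber_0: "fiber \<phi> 0 B = 0" for B
  proof (rule ccontr)
    assume "fiber \<phi> 0 B \<noteq> 0"
    from fiber_nz[OF this] obtain t where t: "B \<in> X" "0 = t + clique_trace B" "lookup (\<phi> B) t \<noteq> 0" by blast
    then have "t = 0" "clique_trace B = 0" using projections_add_eq_0[of t "clique_trace B"] by auto
    moreover have "B = {}"
    proof (rule ccontr)
      assume "B \<noteq> {}"
      then obtain v where "v \<in> B" by blast
      then have "pair_proj (clique_trace B) (v, v) = [v]" using adj_irrefl by (simp add: clique_trace_def)
      then show False using \<open>clique_trace B = 0\<close> by simp
    qed
    moreover have "\<phi> B \<noteq> 0" using t(3) by auto
    ultimately show False using supp[of B] aug t(3) by auto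
  qed
  have fiber_traces: "w \<in> traces \<and> w \<noteq> 0" if "fiber \<phi> w B \<noteq> 0" for w B
    using fiber_nz[OF that] fiber_0 that traces_add clique_trace_traces by blast
  have \<psi>: "lookup (\<psi> B) t = (if B \<in> X \<and> t \<in> traces then ?W (t + clique_trace B) B else 0)" for B t
  proof -
    \<comment> \<open>A coefficient of the candidate at \<open>t\<close> comes from one of
      \<open>\<phi> (B - {v})\<close> at \<open>t + tr [v]\<close>. There are finitely many of
      those, and appending a letter is injective.\<close>
    have "finite {t. (if B \<in> X \<and> t \<in> traces then ?W (t + clique_trace B) B else 0) \<noteq> 0}"
    proof (cases "B \<in> X")
      case True
      have "{t. (if B \<in> X \<and> t \<in> traces then ?W (t + clique_trace B) B else 0) \<noteq> 0}
        \<subseteq> (\<Union>v\<in>B. (\<lambda>t. t + tr [v]) -` keys (\<phi> (B - {v})))"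
      proof clarify
        fix t assume "(if B \<in> X \<and> t \<in> traces then ?W (t + clique_trace B) B else 0) \<noteq> 0"
        then have nz: "?W (t + clique_trace B) B \<noteq> 0" by (auto split: if_splits)
        define v where "v = v0 (t + clique_trace B)"
        have v: "v \<in> B" "fiber \<phi> (t + clique_trace B) (B - {v}) \<noteq> 0" using W_nz[OF nz] by (auto simp: v_def)
        obtain t' where t': "t + clique_trace B = t' + clique_trace (B - {v})" "lookup (\<phi> (B - {v})) t' \<noteq> 0"
          using fiber_nz[OF v(2)] by blast
        have "clique_trace B = tr [v] + clique_trace (B - {v})"
          using clique_trace_insert[of v "B - {v}"] v(1) True by (simp add: insert_absorb)
        then have "t' = t + tr [v]" using t'(1) by (simp add: add.assoc[symmetric] projections_add_cancel_right)
        then show "t \<in> (\<Union>v\<in>B. (\<lambda>t. t + tr [v]) -` keys (\<phi> (B - {v})))"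
          using v(1) t'(2) by (auto simp: in_keys_iff)
      qed
      moreover have "finite (\<Union>v\<in>B. (\<lambda>t. t + tr [v]) -` keys (\<phi> (B - {v})))"
        using fX[OF True] by (intro finite_UN_I finite_vimageI) (auto simp: inj_def projections_add_cancel_right)
      ultimately show ?thesis by (rule finite_subset)
    qed simp
    then show ?thesis by (simp add: \<psi>_def)
  qed
  have \<psi>T: "\<psi> B \<in> trace_algebra" for B
    by (auto simp: trace_algebra_def in_keys_iff \<psi> split: if_splits)
  have \<psi>X: "B \<in> X" if "\<psi> B \<noteq> 0" for B
  proof (rule ccontr)
    assume "B \<notin> X"
    then have "\<psi> B = 0" by (intro poly_mapping_eqI) (simp add: \<psi>)
    then show False using that by simp
  qed
  have \<psi>card: "card B = Suc i" if nz: "\<psi> B \<noteq> 0" for B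
  proof -
    obtain t where "lookup (\<psi> B) t \<noteq> 0"
      using nz by (metis poly_mapping_eqI lookup_zero)
    then have "?W (t + clique_trace B) B \<noteq> 0" by (auto simp: \<psi> split: if_splits)
    from W_nz[OF this] obtain v where v: "v \<in> B" "fiber \<phi> (t + clique_trace B) (B - {v}) \<noteq> 0" by blast
    have "\<phi> (B - {v}) \<noteq> 0" using fiber_nz[OF v(2)] by auto
    then have "card (B - {v}) = i" using supp by blast
    then show ?thesis using v(1) fX[OF \<psi>X[OF nz]] by (metis card_Suc_Diff1)
  qed
  have fiber_\<psi>: "fiber \<psi> w B = ?W w B" for w B
  proof (cases "B \<in> X \<and> (\<exists>t\<in>traces. w = t + clique_trace B)")
    case True
    then obtain t where t: "B \<in> X" "t \<in> traces" "w = t + clique_trace B" by blast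
    then show ?thesis using fiber_eq[OF t(1,2), of \<psi>] by (simp add: \<psi>)
  next
    case False
    have "?W w B = 0"
    proof (rule ccontr)
      assume "?W w B \<noteq> 0"
      from W_nz[OF this] have v: "v0 w \<in> B" "fiber \<phi> w (B - {v0 w}) \<noteq> 0" by auto
      let ?B = "B - {v0 w}"
      \<comment> \<open>The wedge could be nonzero outside the fiber only if adding
        \<open>v0 w\<close> to a clique of the fiber led out of it, which peeling off that letter
        excludes.\<close>
      obtain t where t: "t \<in> traces" "?B \<in> X" "w = t + clique_trace ?B" using fiber_nz[OF v(2)] by blast
      have l: "v0 w \<in> last_letters w" using fiber_traces[OF v(2)] v0 by blast
      have nin: "v0 w \<notin> ?B" by simp
      have ins: "insert (v0 w) ?B = B" using v(1) by auto
      have "B \<in> X" using last_letter_peel(1)[OF l nin t(2,1,3)] ins by simp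
      moreover obtain u where u: "u \<in> traces" "t = u + tr [v0 w]"
        using last_letter_peel(2)[OF l nin t(2,1,3)] by blast
      moreover have "w = u + clique_trace B"
        using t(3) u(2) clique_trace_insert[of "v0 w" ?B] ins \<open>B \<in> X\<close> by (simp add: add.assoc)
      ultimately show False using False by blast
    qed
    moreover have "fiber \<psi> w B = 0" by (simp only: fiber_def if_not_P[OF False])
    ultimately show ?thesis by simp
  qed
  have "contract (pverts G) pos gen \<psi> B = \<phi> B" for B
  proof (cases "B \<in> X")
    case False
    then have "\<psi> (insert v B) = 0" for v using \<psi>X X_down[of "insert v B" B] by blast
    then show ?thesis using supp[of B] False by (auto simp: contract_def)
  next
    case B: True
    have BV: "B \<subseteq> pverts G" by (rule X_subset[OF B])
    have cT: "contract (pverts G) pos gen \<psi> B \<in> trace_algebra"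
      by (rule contract_in[OF diff_closed_trace_algebra]) (intro trace_algebra_closed(4) \<psi>T gen_trace_algebra)
    show ?thesis
    proof (rule poly_mapping_eqI)
      fix t
      show "lookup (contract (pverts G) pos gen \<psi> B) t = lookup (\<phi> B) t"
      proof (cases "t \<in> traces")
        case False
        then have "t \<notin> keys (contract (pverts G) pos gen \<psi> B)" "t \<notin> keys (\<phi> B)"
          using cT T[of B] by (auto simp: trace_algebra_def)
        then show ?thesis by (simp add: in_keys_iff)
      next
        case t: True
        let ?w = "t + clique_trace B"
        have "lookup (contract (pverts G) pos gen \<psi> B) t = fiber (contract (pverts G) pos gen \<psi>) ?w B"
          by (rule fiber_eq[OF B t, symmetric])
        also have "\<dots> = contract (pverts G) pos (\<lambda>_. 1) (fiber \<psi> ?w) B"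
          by (rule fiber_contract[OF \<psi>X \<psi>T])
        also have "\<dots> = contract (pverts G) pos (\<lambda>_. 1) (?W ?w) B"
          by (simp add: fiber_\<psi>[abs_def])
        also have "\<dots> = fiber \<phi> ?w B"
        proof (cases "?w = 0")
          case True
          have "fiber \<phi> 0 = (\<lambda>B. 0)" using fiber_0 by (simp add: fun_eq_iff)
          then show ?thesis using True by (simp add: wedge_zero[abs_def] contract_zero)
        next
          case False
          have "?w \<in> traces" using t clique_trace_traces[OF B] by (rule traces_add)
          then have "v0 ?w \<in> pverts G" using v0[OF _ False] by (auto simp: last_letters_def)
          then have s: "(\<Sum>v\<in>pverts G. \<delta> ?w v * 1) = 1" using finite_V by (simp add: \<delta>_def)
          have "fiber (contract (pverts G) pos gen \<phi>) ?w = (\<lambda>B. 0)"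
            using cycle by (simp add: fiber_def fun_eq_iff)
          then have "contract (pverts G) pos (\<lambda>_. 1) (fiber \<phi> ?w) = (\<lambda>B. 0)"
            using fiber_contract[where w = ?w, OF _ T] supp by (simp add: fun_eq_iff)
          then show ?thesis
            using contract_wedge[OF finite_V pos BV, of "\<delta> ?w" "\<lambda>_. 1" "fiber \<phi> ?w"] s
            by (simp add: wedge_zero mult.commute)
        qed
        also have "\<dots> = lookup (\<phi> B) t" by (rule fiber_eq[OF B t])
        finally show ?thesis .
      qed
    qed
  qed
  then show ?thesis using \<psi>X \<psi>card \<psi>T by blast
qed

text \<open>A cycle of the quotient complex fails to be one of the extended complex by its boundary
  \<open>\<phi>\<close> on the empty simplex. This is a Koszul cycle and, by the augmentation
  condition, bounds some \<open>\<psi>\<close>. Corrected by \<open>\<psi>\<close>, the cycle bounds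
  in the extended complex by \<open>ext_exact\<close>, and the empty simplex is forgotten
  again.\<close>

lemma base_exact:
  assumes \<omega>: "supp_in \<omega> (index i)" "\<And>s. \<omega> s \<in> trace_algebra" "dres \<omega> = (\<lambda>_. 0)" and i: "i < n"
    and aug: "i = 0 \<Longrightarrow> (\<Sum>A\<in>Y. lookup (\<omega> ({}, [A])) 0) = 0"
  shows "\<exists>\<eta>. supp_in \<eta> (index (Suc i)) \<and> (\<forall>s. \<eta> s \<in> trace_algebra) \<and> dres \<eta> = \<omega>"
proof -
  let ?c = "contract (pverts G) pos gen"
  have \<omega>e: "supp_in \<omega> (ext_index i)" by (rule supp_in_mono[OF \<omega>(1) index_ext])
  have \<omega>Nil: "\<omega> (B, []) = 0" for B using \<omega>(1) by (auto simp: supp_in_def index_def)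
  define \<phi> where "\<phi> B = dtot \<omega> (B, [])" for B
  have \<phi>: "\<phi> B = (- 1) ^ card B * (\<Sum>A\<in>Y. \<omega> (B, [A]))" for B
    by (simp add: \<phi>_def dtot_def \<omega>Nil contract_zero)
  have "\<exists>\<psi>. (\<forall>B. \<psi> B \<noteq> 0 \<longrightarrow> B \<in> X \<and> card B = Suc i) \<and> (\<forall>B. \<psi> B \<in> trace_algebra) \<and>
    (\<forall>B. ?c \<psi> B = \<phi> B)"
  proof (rule clique_complex_exact)
    show "B \<in> X \<and> card B = i" if "\<phi> B \<noteq> 0" for B
    proof -
      have "(\<Sum>A\<in>Y. \<omega> (B, [A])) \<noteq> 0" using that by (auto simp: \<phi>)
      then obtain A where "\<omega> (B, [A]) \<noteq> 0" by (auto elim: sum.not_neutral_contains_not_neutral)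
      then have "(B, [A]) \<in> ext_index i" using \<omega>e supp_inD by blast
      then show ?thesis by (auto simp: ext_index_def)
    qed
    show "\<phi> B \<in> trace_algebra" for B
      unfolding \<phi>_def by (rule dtot_trace_algebra[OF \<omega>(2)])
    show "?c \<phi> B = 0" for B
    proof -
      have "dtot \<omega> (B, [A]) = 0" for A using fun_cong[OF \<omega>(3), of "(B, [A])"] by (simp add: dres_def)
      then have "dtot (dtot \<omega>) (B, []) = ?c \<phi> B" by (simp add: dtot_def[of "dtot \<omega>"] \<phi>_def[abs_def])
      then show ?thesis using dtot_dtot[OF \<omega>e] by simp
    qed
    show "lookup (\<phi> {}) 0 = 0" if "i = 0" using aug[OF that] by (simp add: \<phi> lookup_sum)
  qed
  then obtain \<psi> where \<psi>: "\<And>B. \<psi> B \<noteq> 0 \<Longrightarrow> B \<in> X \<and> card B = Suc i" "\<And>B. \<psi> B \<in> trace_algebra" "\<And>B. ?c \<psi> B = \<phi> B"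
    by blast
  \<comment> \<open>A clique of \<open>i + 1\<close> vertices with the empty simplex has degree
    \<open>i\<close>, and the minus sign makes the Koszul part cancel \<open>\<phi>\<close>.\<close>
  define \<omega>' where "\<omega>' = (\<lambda>(B, \<sigma>). if \<sigma> = [] then 0 - \<psi> B else \<omega> (B, \<sigma>))"
  have \<omega>': "\<omega>' (B, \<sigma>) = (if \<sigma> = [] then 0 - \<psi> B else \<omega> (B, \<sigma>))" for B \<sigma> by (simp add: \<omega>'_def)
  have "\<exists>\<eta>. supp_in \<eta> (ext_index (Suc i)) \<and> (\<forall>s. \<eta> s \<in> trace_algebra) \<and> dtot \<eta> = \<omega>'"
  proof (rule ext_exact[OF _ _ _ i])
    show "supp_in \<omega>' (ext_index i)"
      using \<omega>e \<psi>(1) by (force simp: supp_in_def \<omega>' ext_index_def)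
    show "\<omega>' s \<in> trace_algebra" for s
      using \<omega>(2) \<psi>(2) by (cases s) (auto simp: \<omega>' intro: diff_closedD(3)[OF diff_closed_trace_algebra])
    show "dtot \<omega>' s = 0" for s
    proof -
      obtain B \<sigma> where s: "s = (B, \<sigma>)" by (cases s)
      have "insum Y (\<lambda>\<sigma>. \<omega>' (B, \<sigma>)) \<sigma> = insum Y (\<lambda>\<sigma>. \<omega> (B, \<sigma>)) \<sigma>"
        by (rule insum_cong_length) (auto simp: \<omega>')
      then have e: "dtot \<omega>' (B, \<sigma>) = ?c (\<lambda>B. \<omega>' (B, \<sigma>)) B + (- 1) ^ card B * insum Y (\<lambda>\<sigma>. \<omega> (B, \<sigma>)) \<sigma>"
        by (simp add: dtot_def)
      show ?thesis
      proof (cases "\<sigma> = []")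
        case True
        have "?c (\<lambda>B. 0 - \<psi> B) B = 0 - \<phi> B" unfolding contract_diff contract_zero \<psi>(3) ..
        then show ?thesis using e by (simp add: s True \<omega>' \<phi>)
      next
        case False
        then have "dtot \<omega>' (B, \<sigma>) = dtot \<omega> (B, \<sigma>)" using e by (simp add: \<omega>' dtot_def)
        then show ?thesis using fun_cong[OF \<omega>(3), of "(B, \<sigma>)"] False by (simp add: s dres_def)
      qed
    qed
  qed
  then obtain \<eta>' where \<eta>': "supp_in \<eta>' (ext_index (Suc i))" "\<And>s. \<eta>' s \<in> trace_algebra" "dtot \<eta>' = \<omega>'" by blast
  define \<eta> where "\<eta> = (\<lambda>(B, \<sigma>). if \<sigma> = [] then 0 else \<eta>' (B, \<sigma>))"
  have \<eta>: "\<eta> (B, \<sigma>) = (if \<sigma> = [] then 0 else \<eta>' (B, \<sigma>))" for B \<sigma> by (simp add: \<eta>_def)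
  have "dres \<eta> (B, \<sigma>) = \<omega> (B, \<sigma>)" for B \<sigma>
  proof (cases "\<sigma> = []")
    case False
    have "insum Y (\<lambda>\<sigma>. \<eta> (B, \<sigma>)) \<sigma> = insum Y (\<lambda>\<sigma>. \<eta>' (B, \<sigma>)) \<sigma>"
      by (rule insum_cong_length) (auto simp: \<eta>)
    then have "dres \<eta> (B, \<sigma>) = dtot \<eta>' (B, \<sigma>)" using False by (simp add: dres_def dtot_def \<eta>)
    then show ?thesis using False by (simp add: \<eta>'(3) \<omega>')
  qed (simp add: dres_def \<omega>Nil)
  moreover have "supp_in \<eta> (index (Suc i))" using \<eta>'(1) by (auto simp: supp_in_def \<eta> index_def)
  moreover have "\<eta> s \<in> trace_algebra" for s
    using \<eta>'(2) by (cases s) (auto simp: \<eta> trace_algebra_closed)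
  ultimately show ?thesis by (intro exI[of _ \<eta>]) auto
qed

end


section \<open>Descent to the ideal\<close>

lemma ex1_unique: "\<exists>!x. P x \<Longrightarrow> P a \<Longrightarrow> P b \<Longrightarrow> a = b"
  by blast

lemma cst_sum: "cst (\<Sum>i\<in>I. f i) = (\<Sum>i\<in>I. cst (f i) :: 'm::monoid_add \<Rightarrow>\<^sub>0 'k::comm_ring_1)"
  by (induction I rule: infinite_finite_induct) (simp_all add: single_add)

text \<open>Gaussian elimination over \<open>k\<close> for unknowns in a \<open>k\<close>-algebra; it shows that the modules of the
  complex are free of finite rank.\<close>

lemma linear_system_basis:
  fixes S :: "'i set" and E :: "('i \<Rightarrow> 'k::field) set"
  assumes "finite S"
  shows "\<exists>B c. B \<subseteq> S \<and> (\<forall>s\<in>B. \<forall>t\<in>B. c t s = (if s = t then 1 else 0)) \<and>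
    (\<forall>f :: 'i \<Rightarrow> ('m::monoid_add \<Rightarrow>\<^sub>0 'k). (\<forall>e\<in>E. (\<Sum>s\<in>S. cst (e s) * f s) = 0)
      \<longleftrightarrow> (\<forall>s\<in>S. f s = (\<Sum>t\<in>B. cst (c t s) * f t)))"
  using assms
proof (induction S arbitrary: E rule: finite_psubset_induct)
  case (psubset S)
  show ?case
  proof (cases "\<forall>e\<in>E. \<forall>s\<in>S. e s = 0")
    case True
    have "f s = (\<Sum>t\<in>S. cst (if s = t then 1 else 0) * f t)" if "s \<in> S" for f :: "'i \<Rightarrow> ('m \<Rightarrow>\<^sub>0 'k)" and s
    proof -
      have "(\<Sum>t\<in>S. cst (if s = t then 1 else 0) * f t) = (\<Sum>t\<in>S. if t = s then f t else 0)"
        by (rule sum.cong) auto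
      then show ?thesis using that psubset.hyps by simp
    qed
    moreover have "(\<Sum>s\<in>S. cst (e s) * f s) = 0" if "e \<in> E" for e and f :: "'i \<Rightarrow> ('m \<Rightarrow>\<^sub>0 'k)"
      using True that by (intro sum.neutral) auto
    ultimately show ?thesis
      by (intro exI[of _ S] exI[of _ "\<lambda>t s. if s = t then 1 else 0"]) auto
  next
    case False
    then obtain e0 s1 where e0: "e0 \<in> E" "s1 \<in> S" "e0 s1 \<noteq> 0" by blast
    let ?S = "S - {s1}"
    define E' where "E' = (\<lambda>e s. e s - e s1 / e0 s1 * e0 s) ` E"
    have "?S \<subset> S" using e0 by auto
    from psubset.IH[OF this, of E'] obtain B c where B: "B \<subseteq> ?S"
      and c: "\<forall>s\<in>B. \<forall>t\<in>B. c t s = (if s = t then 1 else 0)"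
      and eq: "\<And>f :: 'i \<Rightarrow> ('m \<Rightarrow>\<^sub>0 'k). (\<forall>e\<in>E'. (\<Sum>s\<in>?S. cst (e s) * f s) = 0)
        \<longleftrightarrow> (\<forall>s\<in>?S. f s = (\<Sum>t\<in>B. cst (c t s) * f t))" by blast
    \<comment> \<open>The pivot equation \<open>e0\<close> gives the unknown \<open>s1\<close> in
      terms of the others, for which the solution of the reduced system is inserted.\<close>
    define c' where "c' t s = (if s = s1 then - (\<Sum>r\<in>?S. e0 r / e0 s1 * c t r) else c t s)" for t s
    have finS: "finite ?S" using psubset.hyps by simp
    have "(\<forall>e\<in>E. (\<Sum>s\<in>S. cst (e s) * f s) = 0) \<longleftrightarrow> (\<forall>s\<in>S. f s = (\<Sum>t\<in>B. cst (c' t s) * f t))"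
      for f :: "'i \<Rightarrow> ('m \<Rightarrow>\<^sub>0 'k)"
    proof -
      have split: "(\<Sum>s\<in>S. cst (e s) * f s) = cst (e s1) * f s1 + (\<Sum>s\<in>?S. cst (e s) * f s)" for e
        using psubset.hyps e0(2) by (simp add: sum.remove)
      let ?sol = "f s1 = - (\<Sum>s\<in>?S. cst (e0 s / e0 s1) * f s)"
      have e0_iff: "(\<Sum>s\<in>S. cst (e0 s) * f s) = 0 \<longleftrightarrow> ?sol"
      proof -
        have 1: "cst (inverse (e0 s1)) * (\<Sum>s\<in>S. cst (e0 s) * f s) = f s1 + (\<Sum>s\<in>?S. cst (e0 s / e0 s1) * f s)"
          using e0(3) unfolding split
          by (simp add: distrib_left sum_distrib_left mult.assoc[symmetric] mult_single field_simps)
        have 2: "cst (e0 s1) * (cst (inverse (e0 s1)) * (\<Sum>s\<in>S. cst (e0 s) * f s)) = (\<Sum>s\<in>S. cst (e0 s) * f s)"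
          using e0(3) by (simp add: mult.assoc[symmetric] mult_single)
        show ?thesis
        proof
          assume "(\<Sum>s\<in>S. cst (e0 s) * f s) = 0"
          then show ?sol using 1 by (simp add: eq_neg_iff_add_eq_0)
        next
          assume ?sol
          then have "cst (inverse (e0 s1)) * (\<Sum>s\<in>S. cst (e0 s) * f s) = 0" using 1 by (metis add.left_inverse)
          then show "(\<Sum>s\<in>S. cst (e0 s) * f s) = 0" using 2 by (metis mult_zero_right)
        qed
      qed
      have e_iff: "(\<Sum>s\<in>?S. cst (e s - e s1 / e0 s1 * e0 s) * f s) = (\<Sum>s\<in>S. cst (e s) * f s)"
        if ?sol for e
      proof -
        have "(\<Sum>s\<in>?S. cst (e s - e s1 / e0 s1 * e0 s) * f s)
          = (\<Sum>s\<in>?S. cst (e s) * f s) - cst (e s1) * (\<Sum>s\<in>?S. cst (e0 s / e0 s1) * f s)"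
          unfolding sum_distrib_left sum_subtractf[symmetric]
        proof (rule sum.cong[OF refl])
          fix s
          have "cst (e s1) * (cst (e0 s / e0 s1) * f s) = cst (e s1 / e0 s1 * e0 s) * f s"
            by (simp add: mult.assoc[symmetric] mult_single)
          then show "cst (e s - e s1 / e0 s1 * e0 s) * f s = cst (e s) * f s - cst (e s1) * (cst (e0 s / e0 s1) * f s)"
            by (simp add: single_diff left_diff_distrib)
        qed
        then show ?thesis using split[of e] that by simp
      qed
      have par: "f s1 = (\<Sum>t\<in>B. cst (c' t s1) * f t) \<longleftrightarrow> ?sol" if sol: "\<forall>s\<in>?S. f s = (\<Sum>t\<in>B. cst (c t s) * f t)"
      proof -
        have "(\<Sum>s\<in>?S. cst (e0 s / e0 s1) * f s) = (\<Sum>s\<in>?S. \<Sum>t\<in>B. cst (e0 s / e0 s1 * c t s) * f t)"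
        proof (rule sum.cong[OF refl])
          fix s assume "s \<in> ?S"
          then have "cst (e0 s / e0 s1) * f s = cst (e0 s / e0 s1) * (\<Sum>t\<in>B. cst (c t s) * f t)" using sol by metis
          then show "cst (e0 s / e0 s1) * f s = (\<Sum>t\<in>B. cst (e0 s / e0 s1 * c t s) * f t)"
            by (simp add: sum_distrib_left mult.assoc[symmetric] mult_single)
        qed
        also have "\<dots> = (\<Sum>t\<in>B. \<Sum>s\<in>?S. cst (e0 s / e0 s1 * c t s) * f t)" by (rule sum.swap)
        also have "\<dots> = - (\<Sum>t\<in>B. cst (c' t s1) * f t)"
        proof -
          have "(\<Sum>s\<in>?S. cst (e0 s / e0 s1 * c t s) * f t) = - (cst (c' t s1) * f t)" for t
          proof -
            have "cst (\<Sum>s\<in>?S. e0 s / e0 s1 * c t s) = (\<Sum>s\<in>?S. cst (e0 s / e0 s1 * c t s) :: 'm \<Rightarrow>\<^sub>0 'k)"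
              by (rule cst_sum)
            then show ?thesis by (simp add: c'_def sum_distrib_right single_uminus)
          qed
          then show ?thesis by (simp add: sum_negf)
        qed
        finally show ?thesis by simp
      qed
      have rest: "(\<forall>s\<in>?S. f s = (\<Sum>t\<in>B. cst (c' t s) * f t)) \<longleftrightarrow> (\<forall>s\<in>?S. f s = (\<Sum>t\<in>B. cst (c t s) * f t))"
        by (auto simp: c'_def)
      have "(\<forall>e\<in>E. (\<Sum>s\<in>S. cst (e s) * f s) = 0)
        \<longleftrightarrow> ?sol \<and> (\<forall>e\<in>E'. (\<Sum>s\<in>?S. cst (e s) * f s) = 0)"
        using e0_iff e_iff e0(1) unfolding E'_def by auto
      also have "\<dots> \<longleftrightarrow> ?sol \<and> (\<forall>s\<in>?S. f s = (\<Sum>t\<in>B. cst (c t s) * f t))" unfolding eq ..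
      also have "\<dots> \<longleftrightarrow> f s1 = (\<Sum>t\<in>B. cst (c' t s1) * f t) \<and> (\<forall>s\<in>?S. f s = (\<Sum>t\<in>B. cst (c' t s) * f t))"
        unfolding rest using par by blast
      also have "\<dots> \<longleftrightarrow> (\<forall>s\<in>S. f s = (\<Sum>t\<in>B. cst (c' t s) * f t))" using e0(2) by auto
      finally show ?thesis .
    qed
    moreover have "\<forall>s\<in>B. \<forall>t\<in>B. c' t s = (if s = t then 1 else 0)" using B c by (auto simp: c'_def)
    ultimately show ?thesis using B by (intro exI[of _ B] exI[of _ c']) auto
  qed
qed

section \<open>Functionals that cut out the ideal, and dual vectors for them\<close>

context lie_algebra
begin

text \<open>The functionals are the coordinates modulo \<open>M\<close> in the basis
  \<open>B0\<close> that \<open>has_codim\<close> provides, so \<open>B0\<close> also indexes them.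
  Linearity follows from the uniqueness of coordinates, and brackets have coordinates zero because
  they lie in \<open>M\<close>.\<close>

lemma codim_functionals:
  assumes M: "lie_ideal M" and codim: "has_codim UNIV M k" and derived: "derived_subalgebra \<subseteq> M"
  obtains B0 and \<xi> :: "'l \<Rightarrow> 'l \<Rightarrow> 'k" where "finite B0" "card B0 = k"
    "\<And>b x z. b \<in> B0 \<Longrightarrow> \<xi> b (x + z) = \<xi> b x + \<xi> b z" "\<And>b c x. b \<in> B0 \<Longrightarrow> \<xi> b (scale c x) = c * \<xi> b x"
    "\<And>b x z. b \<in> B0 \<Longrightarrow> \<xi> b (bracket x z) = 0"
    "M = {x. \<forall>b\<in>B0. \<xi> b x = 0}"
    "\<And>b b'. b \<in> B0 \<Longrightarrow> b' \<in> B0 \<Longrightarrow> \<xi> b b' = (if b = b' then 1 else 0)"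
proof -
  obtain B0 where B0: "finite B0" "card B0 = k"
    and ex1: "\<And>x. \<exists>!c. c \<in> B0 \<rightarrow>\<^sub>E (UNIV :: 'k set) \<and> x - (\<Sum>b\<in>B0. scale (c b) b) \<in> M"
    using codim unfolding has_codim_def by auto
  have sub: "subspace M" using M by (simp add: lie_ideal_def)
  define c where "c x = (THE c. c \<in> B0 \<rightarrow>\<^sub>E (UNIV :: 'k set) \<and> x - (\<Sum>b\<in>B0. scale (c b) b) \<in> M)" for x
  have c: "c x \<in> B0 \<rightarrow>\<^sub>E UNIV \<and> x - (\<Sum>b\<in>B0. scale (c x b) b) \<in> M" for x
    unfolding c_def by (rule theI'[OF ex1])
  have uniq: "c x b = g b" if "x - (\<Sum>b\<in>B0. scale (g b) b) \<in> M" "b \<in> B0" for x g b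
  proof -
    have "(\<Sum>b\<in>B0. scale (restrict g B0 b) b) = (\<Sum>b\<in>B0. scale (g b) b)" by (rule sum.cong) auto
    then have "restrict g B0 \<in> B0 \<rightarrow>\<^sub>E UNIV \<and> x - (\<Sum>b\<in>B0. scale (restrict g B0 b) b) \<in> M" using that(1) by auto
    then have "c x = restrict g B0" using ex1[of x] c[of x] by blast
    then show ?thesis using that(2) by simp
  qed
  show thesis
  proof (rule that[of B0 "\<lambda>b x. c x b"])
    show "finite B0" "card B0 = k" by (fact B0)+
    show "c (x + z) b = c x b + c z b" if "b \<in> B0" for b x z
    proof (rule uniq[OF _ that])
      have "x + z - (\<Sum>b\<in>B0. scale (c x b + c z b) b)
        = (x - (\<Sum>b\<in>B0. scale (c x b) b)) + (z - (\<Sum>b\<in>B0. scale (c z b) b))"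
        by (simp add: scale_left_distrib sum.distrib)
      also have "\<dots> \<in> M" using c by (intro subspace_add[OF sub]) auto
      finally show "x + z - (\<Sum>b\<in>B0. scale (c x b + c z b) b) \<in> M" .
    qed
    show "c (scale a x) b = a * c x b" if "b \<in> B0" for b a x
    proof (rule uniq[OF _ that])
      have "scale a x - (\<Sum>b\<in>B0. scale (a * c x b) b) = scale a (x - (\<Sum>b\<in>B0. scale (c x b) b))"
        by (simp add: scale_right_diff_distrib scale_sum_right)
      also have "\<dots> \<in> M" using c by (intro subspace_scale[OF sub]) auto
      finally show "scale a x - (\<Sum>b\<in>B0. scale (a * c x b) b) \<in> M" .
    qed
    have c0: "c x b = 0" if "x \<in> M" "b \<in> B0" for x b
      using uniq[OF _ that(2), of x "\<lambda>_. 0"] that(1) by simp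
    show "c (bracket x z) b = 0" if "b \<in> B0" for b x z
    proof (rule c0[OF _ that])
      have "bracket x z \<in> span {bracket x y | x y. True}" by (rule span_base) auto
      then show "bracket x z \<in> M" using derived by (auto simp: derived_subalgebra_def)
    qed
    show "M = {x. \<forall>b\<in>B0. c x b = 0}"
    proof
      show "{x. \<forall>b\<in>B0. c x b = 0} \<subseteq> M"
      proof
        fix x assume "x \<in> {x. \<forall>b\<in>B0. c x b = 0}"
        then have "(\<Sum>b\<in>B0. scale (c x b) b) = 0" by (intro sum.neutral) auto
        then show "x \<in> M" using c[of x] by simp
      qed
    qed (use c0 in auto)
    show "c b' b = (if b = b' then 1 else 0)" if "b \<in> B0" "b' \<in> B0" for b b'
    proof (rule uniq[OF _ that(1)])
      have "(\<Sum>b\<in>B0. scale (if b = b' then 1 else 0) b) = (\<Sum>b\<in>B0. if b = b' then b else 0)"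
        by (rule sum.cong) auto
      then have "(\<Sum>b\<in>B0. scale (if b = b' then 1 else 0) b) = b'" using B0(1) that(2) by simp
      then show "b' - (\<Sum>b\<in>B0. scale (if b = b' then 1 else 0) b) \<in> M" using subspace_0[OF sub] by simp
    qed
  qed
qed

text \<open>The coordinate map \<open>p\<close> has its kernel inside \<open>M\<close>, so it sends
  the basis \<open>C\<close> of \<open>N\<close> modulo \<open>M \<inter> N\<close> to independent
  vectors in the span of \<open>B0\<close>. There are as many of them as elements of
  \<open>B0\<close>, so they span it, and each \<open>b\<close> is hit by an element of
  \<open>N\<close>.\<close>

lemma dual_elements:
  assumes N: "subspace N" and codim: "has_codim N (M \<inter> N) (card B0)" and B0: "finite B0"
    and add: "\<And>b x z. b \<in> B0 \<Longrightarrow> \<xi> b (x + z) = \<xi> b x + \<xi> b z"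
    and sc: "\<And>b c x. b \<in> B0 \<Longrightarrow> \<xi> b (scale c x) = c * (\<xi> b x :: 'k)"
    and M: "M = {x. \<forall>b\<in>B0. \<xi> b x = 0}"
    and dual: "\<And>b b'. b \<in> B0 \<Longrightarrow> b' \<in> B0 \<Longrightarrow> \<xi> b b' = (if b = b' then 1 else 0)"
    and b: "b \<in> B0"
  shows "\<exists>y\<in>N. \<forall>b'\<in>B0. \<xi> b' y = (if b' = b then 1 else 0)"
proof -
  obtain C where C: "finite C" "card C = card B0" "C \<subseteq> N"
    and ex1: "\<forall>x\<in>N. \<exists>!c. c \<in> C \<rightarrow>\<^sub>E (UNIV :: 'k set) \<and> x - (\<Sum>b\<in>C. scale (c b) b) \<in> M \<inter> N"
    using codim unfolding has_codim_def by (elim conjE exE) (rule that)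
  define p where "p x = (\<Sum>b\<in>B0. scale (\<xi> b x) b)" for x
  have \<xi>0: "\<xi> b 0 = 0" if "b \<in> B0" for b using sc[OF that, of 0 0] by simp
  have \<xi>sum: "\<xi> b (\<Sum>i\<in>I. scale (g i) (f i)) = (\<Sum>i\<in>I. g i * \<xi> b (f i))" if "b \<in> B0" for b and I :: "'l set" and f g
    by (induction I rule: infinite_finite_induct) (auto simp: \<xi>0 add sc that)
  have \<xi>p: "\<xi> b (p x) = \<xi> b x" if "b \<in> B0" for b x
  proof -
    have "\<xi> b (p x) = (\<Sum>b'\<in>B0. if b' = b then \<xi> b' x else 0)"
      unfolding p_def \<xi>sum[OF that] by (rule sum.cong) (use dual that in auto)
    then show ?thesis using that B0 by simp
  qed
  have p_sum: "p (\<Sum>i\<in>I. scale (g i) (f i)) = (\<Sum>i\<in>I. scale (g i) (p (f i)))" for I :: "'l set" and f g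
    unfolding p_def by (simp add: \<xi>sum scale_sum_left scale_sum_right sum.swap[of _ B0 I])
  have p0: "x \<in> M" if "p x = 0" for x using \<xi>p[of _ x] \<xi>0 that by (auto simp: M)
  have indep_C: "\<forall>b\<in>C. g b = 0" if z: "(\<Sum>i\<in>C. scale (g i) (p i)) = 0" for g
  proof
    fix a assume a: "a \<in> C"
    have "p (\<Sum>i\<in>C. scale (g i) i) = 0" using z by (simp add: p_sum[of g "\<lambda>i. i"])
    then have "(\<Sum>i\<in>C. scale (g i) i) \<in> M" by (rule p0)
    moreover have "(\<Sum>i\<in>C. scale (g i) i) \<in> N"
      using C(3) by (intro subspace_sum[OF N] subspace_scale[OF N]) auto
    ultimately have 1: "(\<Sum>i\<in>C. scale (g i) i) - (\<Sum>b\<in>C. scale (restrict (\<lambda>_. 0) C b) b) \<in> M \<inter> N"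
      by simp
    have e: "(\<Sum>b\<in>C. scale (restrict g C b) b) = (\<Sum>i\<in>C. scale (g i) i)" by (rule sum.cong) auto
    have "0 \<in> M \<inter> N" using subspace_0[OF N] \<xi>0 by (auto simp: M)
    then have 2: "(\<Sum>i\<in>C. scale (g i) i) - (\<Sum>b\<in>C. scale (restrict g C b) b) \<in> M \<inter> N" by (simp add: e)
    have "(\<Sum>i\<in>C. scale (g i) i) \<in> N" by fact
    have "restrict g C = restrict (\<lambda>_. 0) C"
      by (rule ex1_unique[OF bspec[OF ex1 \<open>(\<Sum>i\<in>C. scale (g i) i) \<in> N\<close>]]) (use 1 2 in auto)
    then have "restrict g C a = restrict (\<lambda>_. 0) C a" by simp
    then show "g a = 0" using a by simp
  qed
  have injC: "inj_on p C"
  proof (rule inj_onI, rule ccontr)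
    fix x z assume xz: "x \<in> C" "z \<in> C" "p x = p z" "x \<noteq> z"
    let ?g = "\<lambda>i. if i = x then 1 else if i = z then - 1 else (0 :: 'k)"
    have "(\<Sum>i\<in>C. scale (?g i) (p i)) = (\<Sum>i\<in>{x, z}. scale (?g i) (p i))"
      using C(1) xz by (intro sum.mono_neutral_right) auto
    also have "\<dots> = 0" using xz by simp
    finally have "\<forall>i\<in>C. ?g i = 0" by (rule indep_C)
    then have "?g x = 0" using xz(1) by (rule bspec)
    then show False by simp
  qed
  have ind: "independent (p ` C)"
  proof (rule independent_if_scalars_zero)
    fix u v assume z: "(\<Sum>v\<in>p ` C. scale (u v) v) = 0" and v: "v \<in> p ` C"
    have "(\<Sum>i\<in>C. scale (u (p i)) (p i)) = 0" using z by (simp add: sum.reindex[OF injC])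
    then have "\<forall>i\<in>C. u (p i) = 0" by (rule indep_C)
    then show "u v = 0" using v by blast
  qed (use C(1) in simp)
  have sp: "p ` C \<subseteq> span B0"
    unfolding p_def by (intro image_subsetI span_sum span_scale span_base)
  obtain t where t: "p ` C \<subseteq> t" "t \<subseteq> span B0" "independent t" "span B0 \<subseteq> span t"
    by (rule maximal_independent_subset_extend[OF sp ind])
  have "finite t" "card t \<le> card B0" using independent_span_bound[OF B0 t(3,2)] by simp_all
  then have "p ` C = t"
    using C(2) card_image[OF injC] t(1) by (intro card_seteq) simp_all
  then have "b \<in> span (p ` C)" using t(4) span_base[OF b] by (simp only: subset_iff)
  also have "span (p ` C) = range (\<lambda>u. \<Sum>v\<in>p ` C. scale (u v) v)"
    using C(1) by (intro span_finite finite_imageI)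
  finally obtain u where u: "b = (\<Sum>v\<in>p ` C. scale (u v) v)" by (rule rangeE)
  define y where "y = (\<Sum>i\<in>C. scale (u (p i)) i)"
  have "y \<in> N" unfolding y_def using C(3) by (intro subspace_sum[OF N] subspace_scale[OF N]) auto
  moreover have "p y = b"
  proof -
    have "p y = (\<Sum>i\<in>C. scale (u (p i)) (p i))" unfolding y_def by (rule p_sum)
    also have "\<dots> = (\<Sum>v\<in>p ` C. scale (u v) v)" by (simp add: sum.reindex[OF injC])
    finally show ?thesis by (rule trans[OF _ u[symmetric]])
  qed
  moreover from this have "\<xi> b' y = (if b' = b then 1 else 0)" if "b' \<in> B0" for b'
    using \<xi>p[OF that, of y] dual[OF that b] by (simp only:)
  ultimately show ?thesis by (intro bexI[of _ y] ballI)
qed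

end

section \<open>The complex over the enveloping algebra of a common kernel\<close>

locale codim_complex = raag_complex scale bracket G \<iota> pos Y n
  for scale :: "'k::field \<Rightarrow> 'l::ab_group_add \<Rightarrow> 'l" and bracket
    and G :: "'v pair_pre_digraph" and \<iota> pos Y n +
  fixes B0 :: "'j set" and \<xi> :: "'j \<Rightarrow> 'l \<Rightarrow> 'k" and y :: "'v set \<Rightarrow> 'j \<Rightarrow> 'v \<Rightarrow> 'k"
  assumes B0: "finite B0"
    and \<xi>_add: "b \<in> B0 \<Longrightarrow> \<xi> b (x + z) = \<xi> b x + \<xi> b z"
    and \<xi>_scale: "b \<in> B0 \<Longrightarrow> \<xi> b (scale c x) = c * \<xi> b x"
    and \<xi>_bracket: "b \<in> B0 \<Longrightarrow> \<xi> b (bracket x z) = 0"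
    and y_supp: "v \<notin> A \<Longrightarrow> y A b v = 0"
    and y_dual: "A \<in> Y \<Longrightarrow> b \<in> B0 \<Longrightarrow> b' \<in> B0 \<Longrightarrow>
      (\<Sum>v\<in>pverts G. y A b v * \<xi> b' (\<iota> v)) = (if b' = b then 1 else 0)"
begin

definition common_kernel :: "'j set \<Rightarrow> 'l set" where
  "common_kernel J = {x. \<forall>b\<in>J. \<xi> b x = 0}"

definition weight :: "'j \<Rightarrow> 'v \<Rightarrow> ('v projections \<Rightarrow>\<^sub>0 'k)" where
  "weight b v = cst (\<xi> b (\<iota> v))"

definition dual_element :: "'v set \<Rightarrow> 'j \<Rightarrow> 'l" where
  "dual_element A b = (\<Sum>v\<in>pverts G. scale (y A b v) (\<iota> v))"

lemma \<xi>_0: "b \<in> B0 \<Longrightarrow> \<xi> b 0 = 0"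
  using \<xi>_scale[of b 0 0] by simp

lemma \<xi>_sum: "b \<in> B0 \<Longrightarrow> \<xi> b (\<Sum>i\<in>I. scale (g i) (f i)) = (\<Sum>i\<in>I. g i * \<xi> b (f i))"
  by (induction I rule: infinite_finite_induct) (simp_all add: \<xi>_0 \<xi>_add \<xi>_scale)

lemma \<xi>_diff: "b \<in> B0 \<Longrightarrow> \<xi> b (x - z) = \<xi> b x - \<xi> b z"
  using \<xi>_add[of b "x - z" z] by simp

lemma \<xi>_dual_element: "A \<in> Y \<Longrightarrow> b \<in> B0 \<Longrightarrow> b' \<in> B0 \<Longrightarrow> \<xi> b' (dual_element A b) = (if b' = b then 1 else 0)"
  unfolding dual_element_def by (subst \<xi>_sum) (simp_all only: y_dual)

lemma \<theta>_sum: "\<theta> (\<Sum>i\<in>I. scale (g i) (f i)) = (\<Sum>i\<in>I. cst (g i) * \<theta> (f i))"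
proof -
  have "\<theta> 0 = 0" using \<theta>_scale[of 0 0] by simp
  then show ?thesis
    by (induction I rule: infinite_finite_induct) (simp_all only: \<theta>_add \<theta>_scale sum.empty sum.insert sum.infinite not_False_eq_True)
qed

lemma \<theta>_diff: "\<theta> (x - z) = \<theta> x - \<theta> z"
  using \<theta>_add[of "x - z" z] by simp

lemma \<theta>_dual_element: "\<theta> (dual_element A b) = (\<Sum>v\<in>pverts G. cst (y A b v) * gen v)"
  unfolding dual_element_def \<theta>_sum by (rule sum.cong) (simp_all only: \<theta>_generator)

lemma common_kernel_empty: "common_kernel {} = UNIV"
  by (simp add: common_kernel_def)

lemma common_kernel_insert: "common_kernel (insert b J) = {x \<in> common_kernel J. \<xi> b x = 0}"
  by (auto simp: common_kernel_def)

lemma lie_subalgebra_common_kernel: "J \<subseteq> B0 \<Longrightarrow> lie_subalgebra (common_kernel J)"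
  unfolding lie_subalgebra_def subspace_def common_kernel_def
  by (simp add: subset_iff \<xi>_0 \<xi>_add \<xi>_scale \<xi>_bracket)

lemma codim_one_subalgebra_common_kernel:
  assumes "A \<in> Y" "J \<subseteq> B0" "b \<in> B0 - J"
  shows "codim_one_subalgebra scale bracket (common_kernel J) (\<xi> b) (dual_element A b)"
proof
  show "lie_subalgebra (common_kernel J)" by (rule lie_subalgebra_common_kernel[OF assms(2)])
  show "dual_element A b \<in> common_kernel J"
    using assms \<xi>_dual_element[OF assms(1), of b] by (auto simp: common_kernel_def)
qed (use assms in \<open>simp_all add: \<xi>_add \<xi>_scale \<xi>_bracket \<xi>_dual_element\<close>)

text \<open>Starts from the whole Lie algebra and imposes the functionals one by one; a clique in
  \<open>Y\<close> supplies the vector outside the kernel that each step needs.\<close>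

lemma faithful_common_kernel:
  assumes "Y \<noteq> {}" "J \<subseteq> B0"
  shows "faithful_on (common_kernel J)"
  using finite_subset[OF assms(2) B0] assms(2)
proof (induction J rule: finite_induct)
  case empty
  then show ?case by (simp add: common_kernel_empty faithful_UNIV)
next
  case (insert b J)
  obtain A where "A \<in> Y" using assms(1) by blast
  then interpret s: codim_one_subalgebra scale bracket "common_kernel J" "\<xi> b" "dual_element A b"
    using insert by (intro codim_one_subalgebra_common_kernel) auto
  interpret codim_one_rep scale bracket \<theta> "common_kernel J" "\<xi> b" "dual_element A b"
    by unfold_locales (use insert in simp)
  show ?case using faithful_ker by (simp add: common_kernel_insert)
qed

lemma diff_closed_U: "diff_closed (U N)"
  by (simp add: diff_closed_def U_closed)

lemma U_cst_right: "u \<in> U N \<Longrightarrow> u * cst c \<in> U N"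
  using U_closed(7)[of u N c] by (simp add: cst_central)

text \<open>Each generator is moved into the common kernel by subtracting multiples of the dual
  elements, which gives \<open>?h v\<close>. On a form killed by the contractions with the
  functionals this change does not alter the Koszul differential, whose values are therefore in the
  smaller algebra.\<close>

lemma contract_common_kernel:
  assumes A: "A \<in> Y" and J: "J \<subseteq> B0" and f: "f \<in> koszul (U (common_kernel J)) weight J A p"
  shows "contract (pverts G) pos gen f B \<in> U (common_kernel J)"
proof -
  let ?N = "common_kernel J"
  let ?h = "\<lambda>v. \<iota> v - (\<Sum>b\<in>J. scale (\<xi> b (\<iota> v)) (dual_element A b))"
  have fJ: "finite J" using J B0 by (rule finite_subset)
  have h: "?h v \<in> ?N" for v
  proof -
    have "\<xi> b (?h v) = 0" if b: "b \<in> J" for b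
    proof -
      have bB: "b \<in> B0" using b J by auto
      have "(\<Sum>b'\<in>J. \<xi> b' (\<iota> v) * \<xi> b (dual_element A b')) = (\<Sum>b'\<in>J. if b' = b then \<xi> b' (\<iota> v) else 0)"
        by (rule sum.cong) (use J bB A in \<open>auto simp: \<xi>_dual_element\<close>)
      then show ?thesis using b fJ by (simp add: \<xi>_diff[OF bB] \<xi>_sum[OF bB])
    qed
    then show ?thesis by (simp add: common_kernel_def)
  qed
  have "contract (pverts G) pos (\<lambda>v. \<theta> (?h v)) f B
    = contract (pverts G) pos (\<lambda>v. gen v - (\<Sum>b\<in>J. weight b v * \<theta> (dual_element A b))) f B"
    unfolding contract_def
    by (rule sum.cong[OF refl]) (simp only: DiffE \<theta>_diff \<theta>_sum \<theta>_generator weight_def Diff_iff)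
  also have "\<dots> = contract (pverts G) pos gen f B
    - (\<Sum>b\<in>J. contract (pverts G) pos (weight b) f B * \<theta> (dual_element A b))"
    unfolding contract_weight_diff contract_weight_sum contract_rmult_sum ..
  also have "(\<Sum>b\<in>J. contract (pverts G) pos (weight b) f B * \<theta> (dual_element A b)) = 0"
    by (rule sum.neutral) (use f in \<open>auto simp: koszul_def\<close>)
  finally have "contract (pverts G) pos gen f B = contract (pverts G) pos (\<lambda>v. \<theta> (?h v)) f B" by simp
  also have "\<dots> \<in> U ?N"
    by (rule contract_in[OF diff_closed_U]) (use f h in \<open>auto simp: koszul_def intro!: U_closed(6) U_closed(8)\<close>)
  finally show ?thesis .
qed

lemma stable_chains_common_kernel:
  assumes "J \<subseteq> B0"
  shows "stable_chains (pverts G) pos X Y gen (U (common_kernel J)) weight J"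
  by unfold_locales
    (use assms in \<open>auto simp: weight_def cst_central intro: diff_closed_U contract_common_kernel\<close>)

lemma codim_one_step_common_kernel:
  assumes J: "J \<subseteq> B0" and b: "b \<in> B0 - J"
  shows "codim_one_step (pverts G) pos X Y gen (U (common_kernel J)) weight J
    (U (common_kernel (insert b J))) b (\<lambda>A v. cst (y A b v))"
proof -
  let ?N = "common_kernel J" and ?M = "common_kernel (insert b J)"
  interpret S: stable_chains "pverts G" pos X Y gen "U ?N" weight J
    by (rule stable_chains_common_kernel[OF J])
  have sums: "(\<Sum>v\<in>pverts G. cst (y A b v) * weight j v) = cst (\<Sum>v\<in>pverts G. y A b v * \<xi> j (\<iota> v))" for A j
    unfolding weight_def cst_sum by (rule sum.cong) (simp_all only: cst_mult)
  have rep: "codim_one_rep scale bracket \<theta> ?N (\<xi> b) (dual_element A b)" if A: "A \<in> Y" for A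
  proof -
    interpret s: codim_one_subalgebra scale bracket ?N "\<xi> b" "dual_element A b"
      using A J b by (rule codim_one_subalgebra_common_kernel)
    show ?thesis by unfold_locales (use A J in \<open>auto intro: faithful_common_kernel\<close>)
  qed
  have sy: "(\<Sum>v\<in>pverts G. cst (y A b v) * gen v) = \<theta> (dual_element A b)" for A
    by (rule \<theta>_dual_element[symmetric])
  show ?thesis
  proof
    show "U ?M \<subseteq> U ?N" by (rule U_mono) (auto simp: common_kernel_insert)
    show "cst (y A b v) = 0" if "v \<notin> A" for A v using y_supp[OF that] by simp
    show "(\<Sum>v\<in>pverts G. cst (y A b v) * weight b v) = 1" if "A \<in> Y" for A
      using y_dual[OF that, of b b] b by (simp add: sums)
    show "(\<Sum>v\<in>pverts G. cst (y A b v) * weight j v) = 0" if "A \<in> Y" "j \<in> J" for A j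
    proof -
      have "(\<Sum>v\<in>pverts G. y A b v * \<xi> j (\<iota> v)) = 0" using y_dual[OF that(1), of b j] that(2) b J by auto
      then show ?thesis by (simp add: sums)
    qed
    show "\<exists>a0\<in>U ?M. \<exists>a1\<in>U ?N. u = a0 + a1 * (\<Sum>v\<in>pverts G. cst (y A b v) * gen v)"
      if "A \<in> Y" "u \<in> U ?N" for A u
      unfolding sy common_kernel_insert by (rule codim_one_rep.U_decompose[OF rep[OF that(1)] that(2)])
    show "a0 = 0 \<and> a1 = 0" if "A \<in> Y" "a0 \<in> U ?M" "a1 \<in> U ?N"
      "a0 = a1 * (\<Sum>v\<in>pverts G. cst (y A b v) * gen v)" for A a0 a1
      using codim_one_rep.U_unique[OF rep[OF that(1)], of a0 a1] that(2-4)
      unfolding sy common_kernel_insert by blast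
    show "contract (pverts G) pos gen f B \<in> U ?M"
      if "A \<in> Y" "f \<in> koszul (U ?M) weight (insert b J) A p" for A f p B
      using contract_common_kernel[OF that(1) _ that(2)] J b by auto
  qed (auto simp: cst_central weight_def intro: diff_closed_U U_cst_right U_closed(7))
qed

abbreviation complex :: "'j set \<Rightarrow> nat \<Rightarrow> ('v set \<times> 'v set list \<Rightarrow> ('v projections \<Rightarrow>\<^sub>0 'k)) set" where
  "complex J \<equiv> chains (U (common_kernel J)) weight J"

definition aug :: "('v set \<times> 'v set list \<Rightarrow> ('v projections \<Rightarrow>\<^sub>0 'k)) \<Rightarrow> 'k" where
  "aug \<omega> = (\<Sum>A\<in>Y. lookup (\<omega> ({}, [A])) 0)"

text \<open>Induction on the functionals imposed, from \<open>base_exact\<close>. A cycle of the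
  smaller complex bounds some \<open>\<eta>\<close> of the larger one; \<open>\<eta>\<close> is a
  cycle modulo the smaller complex, and acyclicity of the quotient moves it into the smaller one
  without changing its boundary.\<close>

lemma complex_exact:
  assumes "J \<subseteq> B0" "\<omega> \<in> complex J i" "i < n" "dres \<omega> = (\<lambda>_. 0)" "i = 0 \<Longrightarrow> aug \<omega> = 0"
  shows "\<exists>\<eta>\<in>complex J (Suc i). dres \<eta> = \<omega>"
  using finite_subset[OF assms(1) B0] assms(1,2)
proof (induction J rule: finite_induct)
  case empty
  then have "supp_in \<omega> (index i)" "\<And>s. \<omega> s \<in> trace_algebra"
    by (auto simp: chains_def common_kernel_empty U_UNIV)
  from base_exact[OF this assms(4,3)] assms(5) show ?case
    by (auto simp: chains_def common_kernel_empty U_UNIV aug_def)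
next
  case (insert b J)
  interpret codim_one_step "pverts G" pos X Y gen "U (common_kernel J)" weight J
    "U (common_kernel (insert b J))" b "\<lambda>A v. cst (y A b v)"
    by (rule codim_one_step_common_kernel) (use insert in auto)
  have "\<omega> \<in> complex J i" using insert.prems(2) RM(2) by (auto simp: chains_def)
  then obtain \<eta> where \<eta>: "\<eta> \<in> complex J (Suc i)" "dres \<eta> = \<omega>" using insert by auto
  then obtain z where z: "z \<in> complex J (Suc (Suc i))" "(\<lambda>s. \<eta> s - dres z s) \<in> complex (insert b J) (Suc i)"
    using quotient_acyclic[of \<eta> i] insert.prems(2) by auto
  have "supp_in z (index (Suc (Suc i)))" using z(1) by (simp add: chains_def)
  then have "dres (\<lambda>s. \<eta> s - dres z s) = \<omega>" using \<eta>(2) by (simp add: dres_diff dres_dres)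
  then show ?case using z(2) by blast
qed

lemma cst_sg: "cst (sg pos v B * a) = (sg pos v B * cst a :: 'm::monoid_add \<Rightarrow>\<^sub>0 'k)"
  by (cases "even (card {u \<in> B. pos u < pos v})") (auto simp: sg_def single_uminus)

text \<open>Vanishing of the contractions is a system of linear equations with coefficients in the
  field. So its solutions are given by scalar coefficients as well, and the condition that values
  lie in \<open>U (common_kernel J)\<close> has to be imposed only on \<open>B\<close>.\<close>

lemma complex_basis:
  "\<exists>B c. finite B \<and> (\<forall>s\<in>B. \<forall>t\<in>B. c t s = (if s = t then 1 else 0)) \<and>
     (\<forall>f. f \<in> complex J i \<longleftrightarrow> (\<exists>g. (\<forall>t\<in>B. g t \<in> U (common_kernel J)) \<and> f = (\<lambda>s. \<Sum>t\<in>B. cst (c t s) * g t)))"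
proof -
  \<comment> \<open>The equation for the contraction with \<open>\<xi> b\<close> at
    \<open>(B, \<sigma>)\<close>, as a coefficient function in the unknowns.\<close>
  define e where "e b B \<sigma> s = (\<Sum>v\<in>pverts G - B. if s = (insert v B, \<sigma>) then sg pos v B * \<xi> b (\<iota> v) else 0)"
    for b B \<sigma> and s :: "'v set \<times> 'v set list"
  have eq: "(\<Sum>s\<in>index i. cst (e b B \<sigma> s) * f s) = contract (pverts G) pos (weight b) (\<lambda>B. f (B, \<sigma>)) B"
    if f: "supp_in f (index i)" for f b B \<sigma>
  proof -
    let ?a = "\<lambda>v. cst (sg pos v B * \<xi> b (\<iota> v)) :: 'v projections \<Rightarrow>\<^sub>0 'k"
    have "(\<Sum>s\<in>index i. cst (e b B \<sigma> s) * f s)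
      = (\<Sum>s\<in>index i. \<Sum>v\<in>pverts G - B. if s = (insert v B, \<sigma>) then ?a v * f s else 0)"
      unfolding e_def cst_sum sum_distrib_right by (intro sum.cong) auto
    also have "\<dots> = (\<Sum>v\<in>pverts G - B. \<Sum>s\<in>index i. if s = (insert v B, \<sigma>) then ?a v * f s else 0)"
      by (rule sum.swap)
    also have "\<dots> = (\<Sum>v\<in>pverts G - B. ?a v * f (insert v B, \<sigma>))"
      using f finite_index[of i] by (intro sum.cong) (auto simp: supp_in_def)
    also have "\<dots> = contract (pverts G) pos (weight b) (\<lambda>B. f (B, \<sigma>)) B"
      unfolding contract_def cst_sg weight_def
      by (intro sum.cong refl) (simp only: mult.assoc cst_central[of "f x" for x])
    finally show ?thesis .
  qed
  obtain B c where B: "B \<subseteq> index i" and c: "\<forall>s\<in>B. \<forall>t\<in>B. c t s = (if s = t then 1 else 0)"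
    and sol: "\<And>f :: _ \<Rightarrow> ('v projections \<Rightarrow>\<^sub>0 'k). (\<forall>e\<in>{e b B \<sigma> | b B \<sigma>. b \<in> J}. (\<Sum>s\<in>index i. cst (e s) * f s) = 0)
      \<longleftrightarrow> (\<forall>s\<in>index i. f s = (\<Sum>t\<in>B. cst (c t s) * f t))"
    using linear_system_basis[OF finite_index, of i "{e b B \<sigma> | b B \<sigma>. b \<in> J}"] by blast
  have fB: "finite B" using B finite_index by (rule finite_subset)
  define c' where "c' t s = (if s \<in> index i then c t s else 0)" for t s
  have in_complex: "f \<in> complex J i \<longleftrightarrow> supp_in f (index i) \<and> (\<forall>s. f s \<in> U (common_kernel J)) \<and>
      (\<forall>s\<in>index i. f s = (\<Sum>t\<in>B. cst (c t s) * f t))" for f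
  proof (cases "supp_in f (index i)")
    case True
    have "(\<forall>e\<in>{e b B \<sigma> | b B \<sigma>. b \<in> J}. (\<Sum>s\<in>index i. cst (e s) * f s) = 0)
      \<longleftrightarrow> (\<forall>b\<in>J. \<forall>B \<sigma>. contract (pverts G) pos (weight b) (\<lambda>B. f (B, \<sigma>)) B = 0)"
      unfolding eq[OF True, symmetric] by blast
    then show ?thesis unfolding chains_def mem_Collect_eq sol[symmetric] by blast
  qed (simp add: chains_def)
  have "f \<in> complex J i \<longleftrightarrow> (\<exists>g. (\<forall>t\<in>B. g t \<in> U (common_kernel J)) \<and> f = (\<lambda>s. \<Sum>t\<in>B. cst (c' t s) * g t))" for f
  proof
    assume f: "f \<in> complex J i"
    have "f = (\<lambda>s. \<Sum>t\<in>B. cst (c' t s) * f t)"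
    proof
      fix s show "f s = (\<Sum>t\<in>B. cst (c' t s) * f t)"
        using f[unfolded in_complex] by (cases "s \<in> index i") (simp_all add: c'_def supp_in_def del: split_paired_All)
    qed
    moreover have "\<forall>t\<in>B. f t \<in> U (common_kernel J)" using f[unfolded in_complex] by blast
    ultimately show "\<exists>g. (\<forall>t\<in>B. g t \<in> U (common_kernel J)) \<and> f = (\<lambda>s. \<Sum>t\<in>B. cst (c' t s) * g t)" by blast
  next
    assume "\<exists>g. (\<forall>t\<in>B. g t \<in> U (common_kernel J)) \<and> f = (\<lambda>s. \<Sum>t\<in>B. cst (c' t s) * g t)"
    then obtain g where g: "\<forall>t\<in>B. g t \<in> U (common_kernel J)" and f: "f = (\<lambda>s. \<Sum>t\<in>B. cst (c' t s) * g t)" by blast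
    have fg: "f s = g s" if "s \<in> B" for s
    proof -
      have "f s = (\<Sum>t\<in>B. if t = s then g t else 0)"
        unfolding f by (rule sum.cong) (use c that B in \<open>auto simp: c'_def\<close>)
      then show ?thesis using that fB by simp
    qed
    have "f s = (\<Sum>t\<in>B. cst (c t s) * f t)" if "s \<in> index i" for s
    proof -
      have "f s = (\<Sum>t\<in>B. cst (c t s) * g t)" unfolding f using that by (simp add: c'_def)
      also have "\<dots> = (\<Sum>t\<in>B. cst (c t s) * f t)" by (rule sum.cong) (simp_all add: fg)
      finally show ?thesis .
    qed
    moreover have "supp_in f (index i)" by (simp add: supp_in_def f c'_def)
    moreover have "f s \<in> U (common_kernel J)" for s
      unfolding f using g by (intro U_sum U_closed(7)) simp
    ultimately show "f \<in> complex J i" by (simp add: in_complex)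
  qed
  moreover have "\<forall>s\<in>B. \<forall>t\<in>B. c' t s = (if s = t then 1 else 0)" using B c by (auto simp: c'_def)
  ultimately show ?thesis using fB by blast
qed

text \<open>The empty set is a clique. If it is not in \<open>Y\<close>, its link is acyclic up to
  degree \<open>n - 1\<close>, hence at least in degree -1, and so it has a vertex.\<close>

lemma Y_nonempty: "Y \<noteq> {}"
proof (cases "{} \<in> Y")
  case False
  have "{} \<in> X" by (simp add: complete_vertex_sets_def)
  then have "acyclic_over TYPE('k) (int n - int (card ({} :: 'v set)) - 1) (lk Y {})" using False by (intro acyclic) simp
  then have "reduced_homology_vanishes TYPE('k) (lk Y {}) (- 1)" by (simp add: acyclic_over_def)
  then have h: "{c \<in> reduced_chains (lk Y {}) (- 1). boundary c = 0} = boundary ` (reduced_chains (lk Y {}) 0 :: ('v set list \<Rightarrow>\<^sub>0 'k) set)"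
    by (simp add: reduced_homology_vanishes_def)
  have "single [] 1 \<in> {c \<in> reduced_chains (lk Y {}) (- 1). boundary c = (0 :: 'v set list \<Rightarrow>\<^sub>0 'k)}"
    by (simp add: reduced_chains_def boundary_def)
  then obtain c :: "'v set list \<Rightarrow>\<^sub>0 'k" where c: "c \<in> reduced_chains (lk Y {}) 0" "boundary c = single [] 1"
    unfolding h by (metis imageE)
  have "keys c \<noteq> {}"
  proof
    assume "keys c = {}"
    then have "boundary c = 0" by (simp add: boundary_def)
    then have "lookup (single [] 1 :: 'v set list \<Rightarrow>\<^sub>0 'k) [] = lookup (0 :: 'v set list \<Rightarrow>\<^sub>0 'k) []" using c(2) by metis
    then show False by (simp only: lookup_single_eq lookup_zero one_neq_zero)
  qed
  then obtain xs where "xs \<in> keys c" by blast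
  then have "xs \<in> insert [] (lk Y {})" "length xs = 1" using c(1) by (auto simp: reduced_chains_def)
  then have "set xs \<subseteq> Y" "xs \<noteq> []" by (auto simp: lk_def realization_def)
  then show ?thesis by (cases xs) auto
qed auto

theorem lie_type_FP_common_kernel: "lie_type_FP scale bracket (common_kernel B0) n"
proof -
  interpret S: stable_chains "pverts G" pos X Y gen "U (common_kernel B0)" weight B0
    by (rule stable_chains_common_kernel) simp
  interpret augmented_lie_rep scale bracket \<theta> "common_kernel B0"
    by unfold_locales (simp_all add: lie_subalgebra_common_kernel faithful_common_kernel Y_nonempty
        lookup_mult_0_projections \<theta>_trace_algebra)
  obtain B :: "nat \<Rightarrow> ('v set \<times> 'v set list) set" and c :: "nat \<Rightarrow> 'v set \<times> 'v set list \<Rightarrow> 'v set \<times> 'v set list \<Rightarrow> 'k"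
    where B: "\<And>i. finite (B i)" "\<And>i s t. s \<in> B i \<Longrightarrow> t \<in> B i \<Longrightarrow> c i t s = (if s = t then 1 else 0)"
      "\<And>i f. f \<in> complex B0 i \<longleftrightarrow>
        (\<exists>g. (\<forall>t\<in>B i. g t \<in> U (common_kernel B0)) \<and> f = (\<lambda>s. \<Sum>t\<in>B i. cst (c i t s) * g t))"
  proof -
    have "\<forall>i. \<exists>Bc. finite (fst Bc) \<and> (\<forall>s\<in>fst Bc. \<forall>t\<in>fst Bc. snd Bc t s = (if s = t then 1 else 0)) \<and>
     (\<forall>f. f \<in> complex B0 i \<longleftrightarrow> (\<exists>g. (\<forall>t\<in>fst Bc. g t \<in> U (common_kernel B0)) \<and>
       f = (\<lambda>s. \<Sum>t\<in>fst Bc. cst (snd Bc t s) * g t)))"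
      using complex_basis[of B0] by simp
    from choice[OF this] obtain Bc where "\<forall>i. finite (fst (Bc i)) \<and>
      (\<forall>s\<in>fst (Bc i). \<forall>t\<in>fst (Bc i). snd (Bc i) t s = (if s = t then 1 else 0)) \<and>
      (\<forall>f. f \<in> complex B0 i \<longleftrightarrow> (\<exists>g. (\<forall>t\<in>fst (Bc i). g t \<in> U (common_kernel B0)) \<and>
       f = (\<lambda>s. \<Sum>t\<in>fst (Bc i). cst (snd (Bc i) t s) * g t)))" ..
    then show thesis by (intro that[of "\<lambda>i. fst (Bc i)" "\<lambda>i. snd (Bc i)"]) auto
  qed
  obtain A where A: "A \<in> Y" using Y_nonempty by blast
  \<comment> \<open>A vertex of the realization with coefficient 1, on which the augmentation is
    1.\<close>
  define f1 :: "'v set \<times> 'v set list \<Rightarrow> ('v projections \<Rightarrow>\<^sub>0 'k)" where "f1 s = (if s = ({}, [A]) then 1 else 0)" for s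
  have chain: "supp_in f (index i)" if "f \<in> complex B0 i" for f i
    using that by (simp add: chains_def)
  show ?thesis
  proof (rule lie_type_FP_criterion[where C = "complex B0" and B = B and c = c and D = "\<lambda>_. dres" and \<epsilon> = aug])
    show "f \<in> complex B0 i \<longleftrightarrow> (\<exists>g. (\<forall>t\<in>B i. g t \<in> U (common_kernel B0)) \<and> f = (\<lambda>s. \<Sum>t\<in>B i. cst (c i t s) * g t))" for f i
      by (rule B(3))
    show "dres f \<in> complex B0 i" if "f \<in> complex B0 (Suc i)" for f i using that by (rule S.dres_chains)
    show "aug (\<lambda>s. f s + g s) = aug f + aug g" for f g by (simp add: aug_def lookup_add sum.distrib)
    show "aug (\<lambda>s. a * f s) = lookup a 0 * aug f" for a f
      by (simp add: aug_def lookup_mult_0_projections sum_distrib_left)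
    have "{} \<in> X" by (simp add: complete_vertex_sets_def)
    then show "f1 \<in> complex B0 0"
      using A by (auto simp: chains_def f1_def supp_in_def index_def ext_index_def realization_def
          contract_def U_closed)
    have "aug f1 = (\<Sum>A'\<in>Y. if A' = A then 1 else 0)"
      unfolding aug_def by (rule sum.cong) (auto simp: f1_def lookup_one)
    then show "aug f1 = 1" using A finite_Y by simp
    show "aug (dres f) = 0" if "f \<in> complex B0 1" for f
      unfolding aug_def
    proof (rule augmentation_dres)
      show "supp_in f (index (Suc 0))" using chain[OF that] by simp
      show "lookup (a * gen v) 0 = 0" if "v \<in> pverts G" for a v
        using \<theta>_trace_algebra[of "\<iota> v"] that by (simp add: lookup_mult_0_projections \<theta>_generator)
    qed (simp add: lookup_add)
    show "\<exists>h\<in>complex B0 1. dres h = f" if "0 < n" "f \<in> complex B0 0" "aug f = 0" for f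
    proof -
      \<comment> \<open>Chains of degree 0 live on the empty clique and single vertices, below which
        there is nothing; so the cycle condition of \<open>complex_exact\<close> holds automatically
        in this degree.\<close>
      have "dres f = (\<lambda>_. 0)"
      proof
        fix s
        have fz: "f (B, \<sigma>) = 0" if "\<not> (B = {} \<and> length \<sigma> = 1)" for B \<sigma>
        proof (rule ccontr)
          assume "f (B, \<sigma>) \<noteq> 0"
          then have "(B, \<sigma>) \<in> index 0" using chain[OF \<open>f \<in> complex B0 0\<close>] supp_inD by blast
          then have B: "B \<in> X" "card B + length \<sigma> = 1" "\<sigma> \<noteq> []" by (auto simp: index_def ext_index_def)
          then have "finite B" using finite_subset[OF X_subset finite_V] by blast
          then show False using B(2,3) that by (cases \<sigma>) auto
        qed
        show "dres f s = 0"
        proof (cases s)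
          case (Pair B \<sigma>)
          have "insum Y (\<lambda>\<sigma>. f (B, \<sigma>)) \<sigma> = insum Y (\<lambda>\<sigma>. 0) \<sigma>" if "\<sigma> \<noteq> []"
            by (rule insum_cong_length) (use that fz in auto)
          moreover have "contract (pverts G) pos gen (\<lambda>B. f (B, \<sigma>)) B = 0"
            unfolding contract_def by (rule sum.neutral) (simp add: fz)
          ultimately show ?thesis by (simp add: Pair dres_def dtot_def insum_zero)
        qed
      qed
      then show ?thesis using complex_exact[of B0 f 0] that by simp
    qed
    show "\<exists>h\<in>complex B0 (Suc (Suc i)). dres h = f"
      if "Suc i < n" "f \<in> complex B0 (Suc i)" "dres f = (\<lambda>_. 0)" for i f
      using complex_exact[of B0 f "Suc i"] that by simp
    show "dres (dres f) = (\<lambda>_. 0)" if "f \<in> complex B0 (Suc (Suc i))" for i f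
      by (rule dres_dres[OF chain[OF that]])
  qed (auto simp: B(1,2) dres_add dres_lmult)
qed

end

theorem theoremG:
  fixes scale :: "'k::field \<Rightarrow> 'l::ab_group_add \<Rightarrow> 'l"
    and bracket :: "'l \<Rightarrow> 'l \<Rightarrow> 'l"
    and G :: "'v pair_pre_digraph"
    and \<iota> :: "'v \<Rightarrow> 'l"
    and M :: "'l set"
    and X Y :: "'v set set"
    and n k :: nat
  assumes "raag_lie_algebra scale bracket G \<iota>"
    and "lie_algebra.lie_ideal scale bracket M"
    and "lie_algebra.has_codim scale UNIV M k"
    and "lie_algebra.derived_subalgebra scale bracket \<subseteq> M"
    and "X = complete_vertex_sets G"
    and "Y = raag_lie_algebra.codim_preserving_sets scale bracket G \<iota> M k"
    and "\<And>Z. Z \<in> X - Y \<Longrightarrow> acyclic_over TYPE('k) (int n - int (card Z) - 1) (lk Y Z)"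
  shows "lie_type_FP scale bracket M n"
proof -
  interpret raag_lie_algebra scale bracket G \<iota> by (fact assms(1))
  obtain B0 and \<xi> :: "'l \<Rightarrow> 'l \<Rightarrow> 'k" where B0: "finite B0" "card B0 = k"
    and \<xi>: "\<And>b x z. b \<in> B0 \<Longrightarrow> \<xi> b (x + z) = \<xi> b x + \<xi> b z" "\<And>b c x. b \<in> B0 \<Longrightarrow> \<xi> b (scale c x) = c * \<xi> b x"
      "\<And>b x z. b \<in> B0 \<Longrightarrow> \<xi> b (bracket x z) = 0"
    and M: "M = {x. \<forall>b\<in>B0. \<xi> b x = 0}"
    and dual: "\<And>b b'. b \<in> B0 \<Longrightarrow> b' \<in> B0 \<Longrightarrow> \<xi> b b' = (if b = b' then 1 else 0)"
    by (rule codim_functionals[OF assms(2-4)]) blast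
  have Y: "A \<in> X" "has_codim (L_on A) (M \<inter> L_on A) (card B0)" if "A \<in> Y" for A
    using that by (simp_all add: assms(5,6) codim_preserving_sets_def B0(2))
  have \<xi>_sum: "\<xi> b (\<Sum>v\<in>A. scale (g v) (\<iota> v)) = (\<Sum>v\<in>A. g v * \<xi> b (\<iota> v))" if "b \<in> B0" for b A g
  proof -
    have "\<xi> b 0 = 0" using \<xi>(2)[OF that, of 0 0] by simp
    then show ?thesis by (induction A rule: infinite_finite_induct) (simp_all add: \<xi> that)
  qed
  have "\<exists>g. (\<forall>v. v \<notin> A \<longrightarrow> g v = 0) \<and>
      (\<forall>b'\<in>B0. (\<Sum>v\<in>pverts G. g v * \<xi> b' (\<iota> v)) = (if b' = b then 1 else 0))"
    if A: "A \<in> Y" and b: "b \<in> B0" for A b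
  proof -
    have "subspace (L_on A)"
      unfolding L_on_def generated_subalgebra_def by (intro subspace_Inter) (auto simp: lie_subalgebra_def)
    from dual_elements[OF this Y(2)[OF A] B0(1) \<xi>(1,2) M dual b] obtain e where e: "e \<in> L_on A"
      "\<forall>b'\<in>B0. \<xi> b' e = (if b' = b then 1 else 0)" by blast
    obtain a where a: "e = (\<Sum>v\<in>A. scale (a v) (\<iota> v))"
      using L_on_complete[of A] Y(1)[OF A] e(1) assms(5) by blast
    have AV: "A \<subseteq> pverts G" using Y(1)[OF A] assms(5) by (simp add: complete_vertex_sets_def)
    \<comment> \<open>The coefficients are extended by zero because the pairings in the complex run
      over all vertices.\<close>
    let ?g = "\<lambda>v. if v \<in> A then a v else 0"
    have "(\<Sum>v\<in>pverts G. ?g v * \<xi> b' (\<iota> v)) = \<xi> b' e" if "b' \<in> B0" for b'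
      unfolding a \<xi>_sum[OF that] using AV by (intro sum.mono_neutral_cong_right finite_verts) auto
    then show ?thesis using e(2) by (intro exI[of _ ?g]) simp
  qed
  then obtain g where g: "\<And>A b v. A \<in> Y \<Longrightarrow> b \<in> B0 \<Longrightarrow> v \<notin> A \<Longrightarrow> g A b v = 0"
    "\<And>A b b'. A \<in> Y \<Longrightarrow> b \<in> B0 \<Longrightarrow> b' \<in> B0 \<Longrightarrow>
      (\<Sum>v\<in>pverts G. g A b v * \<xi> b' (\<iota> v)) = (if b' = b then 1 else 0)"
    by metis
  obtain pos :: "'v \<Rightarrow> nat" where pos: "inj_on pos (pverts G)"
    using finite_imp_inj_to_nat_seg[OF finite_verts] by blast
  \<comment> \<open>The locale wants coordinates supported in \<open>A\<close> for all
    \<open>A\<close> and \<open>b\<close>, while \<open>g\<close> is controlled only for those in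
    \<open>Y\<close> and \<open>B0\<close>; hence the default value 0.\<close>
  interpret codim_complex scale bracket G \<iota> pos Y n B0 \<xi> "\<lambda>A b v. if A \<in> Y \<and> b \<in> B0 then g A b v else 0"
  proof
    show "Y \<subseteq> complete_vertex_sets G" using Y(1) assms(5) by blast
  qed (use pos assms(5,7) B0(1) \<xi> g in auto)
  show ?thesis using lie_type_FP_common_kernel by (simp add: common_kernel_def M)
qed

end
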